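(* Let $\mathbf{K}$ be any symbol from $\{\mathbf{S},\mathbf{O},\mathbf{C},\mathbf{G}_{\gamma}\}$ (with $\gamma>0$ in the last case). The following holds both in continuous time and in discrete time. (1) If the LSS $\Sigma$ is such that $\mathbf{K}(\Sigma)\neq\emptyset$, then for any minimal LSS $\Sigma_{m}$ which is equivalent to $\Sigma$, $\mathbf{K}(\Sigma_{m})\neq\emptyset$. (2) Let $\Sigma$ be an LSS of dimension $n$. If $\mathcal{P}\in\mathbf{C}(\Sigma)$ and $\mathcal{R}\in\mathbf{O}(\Sigma)$, then for any minimal LSS $\Sigma_m$ which is equivalent to $\Sigma$ there exist $\mathcal{P}_m\in\mathbf{C}(\Sigma_m)$ and $\mathcal{R}_m\in\mathbf{O}(\Sigma_m)$ such that the following holds: if $\sigma_1\ge\cdots\ge\sigma_n$ are the singular values of $(\mathcal{P},\mathcal{R})$ and $\lambda_1\ge\cdots\ge\lambda_k$ are the singular values of $(\mathcal{P}_m,\mathcal{R}_m)$, where $k=\dim\Sigma_m$, then $\sigma_{n-k+i}\le\lambda_i\le\sigma_i$ for $i=1,\ldots,k$. (3) Let $\Sigma_1$ and $\Sigma_2$ be two LSSs of dimension $n$ and let $\mathcal{S}:\Sigma_1\to\Sigma_2$ be an isomorphism between them. If $\mathbf{K}\in\{\mathbf{S},\mathbf{O},\mathbf{G}_\gamma\}$, define $M=\mathcal{S}^{-1}\in\mathbb{R}^{n\times n}$; if $\mathbf{K}=\mathbf{C}$, define $M=\mathcal{S}^{T}$. Then for every positive definite $P\in\mathbb{R}^{n\times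 n}$, $$P\in\mathbf{K}(\Sigma_1)\iff M^TPM\in\mathbf{K}(\Sigma_2).$$ In particular, for any two minimal and equivalent LSSs $\Sigma_1$ and $\Sigma_2$ there exists a nonsingular matrix $M$ such that this equivalence holds.
   Context: Linear switched systems. Let $Q=\{1,\ldots,D\}$, $D\ge1$. A linear switched system (LSS) is a tuple $\Sigma=(n,Q,\{(A_q,B_q,C_q)\mid q\in Q\})$ with $A_q\in\mathbb{R}^{n\times n}$, $B_q\in\mathbb{R}^{n\times m}$, $C_q\in\mathbb{R}^{p\times n}$; $n=\dim\Sigma$ is its dimension. In continuous time, with $T=[0,\infty)$, inputs are $u\in\mathcal{U}=L_2(T,\mathbb{R}^m)$, switching signals are $q\in\mathcal{Q}=PC(T,Q)$ (piecewise continuous: finitely many discontinuities on each compact interval, with one-sided limits), states are absolutely continuous functions and outputs are piecewise continuous. In discrete time, $\mathcal{U}=l_2(\mathbb{N},\mathbb{R}^m)$, $\mathcal{Q}$ is the set of infinite sequences in $Q$, and states and outputs are sequences in $\mathbb{R}^n$, $\mathbb{R}^p$. For initial state $x_0\in\mathbb{R}^n$ and $(u,q)\in\mathcal{U}\times\mathcal{Q}$ the solution $(x,y)$ satisfies $\delta x(t)=A_{q(t)}x(t)+B_{q(t)}u(t)$ (a.e. in continuous time), $x(0)=x_0$, $y(t)=C_{q(t)}x(t)$, where $\delta x=\dot x$ in continuous time and $\delta x(t)=x(t+1)$ in discrete time. Write $Y^\Sigma_{x_0}(u,q)=y$ and $Y^\Sigma=Y^\Sigma_0$ (the input-output map). Two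 LSSs (with the same $Q,m,p$) are equivalent if they have the same input-output map $Y^{\Sigma}$. $\Sigma$ is minimal if $\dim\Sigma\le\dim\Sigma'$ for every LSS $\Sigma'$ equivalent to $\Sigma$. An isomorphism $\mathcal{S}:\Sigma_1\to\Sigma_2$ between $\Sigma_1=(n,Q,\{(A_q,B_q,C_q)\})$ and $\Sigma_2=(n,Q,\{(A^a_q,B^a_q,C^a_q)\})$ is a nonsingular $\mathcal{S}\in\mathbb{R}^{n\times n}$ with $A^a_q\mathcal{S}=\mathcal{S}A_q$, $B_q^a=\mathcal{S}B_q$, $C_q^a\mathcal{S}=C_q$ for all $q\in Q$. Sets. All matrices below are symmetric $n\times n$; $>0$ etc. refer to definiteness. - $\mathbf{S}(\Sigma)$: all $P>0$ such that for all $q\in Q$, $A_q^TP+PA_q<0$ (continuous time), resp. $A_q^TPA_q-P<0$ (discrete time). - $\mathbf{O}(\Sigma)$ (observability grammians): all $\mathcal{R}>0$ such that for all $q$, $A_q^T\mathcal{R}+\mathcal{R}A_q+C_q^TC_q\le0$ (cont.), resp. $A_q^T\mathcal{R}A_q+C_q^TC_q-\mathcal{R}\le0$ (disc.). - $\mathbf{C}(\Sigma)$ (controllability grammians): all $\mathcal{P}>0$ such that for all $q$, $A_q\mathcal{P}+\mathcal{P}A_q^T+B_qB_q^T\le0$ (cont.), resp. $A_q\mathcal{P}A_q^T+B_qB_q^T-\mathcal{P}\le0$ (disc.). - $\mathbf{G}_\gamma(\Sigma)$, $\gamma>0$: all $P>0$ such that for all $q$, $$\begin{bmatrix} A_q^TP+PA_q+C_q^TC_q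 & PB_q \\ B_q^TP & -\gamma^2I \end{bmatrix}<0\ \text{(cont.)},\qquad \begin{bmatrix} A_q^TPA_q+C_q^TC_q-P & A_q^TPB_q \\ B_q^TPA_q & B_q^TPB_q-\gamma^2I \end{bmatrix}<0\ \text{(disc.)}.$$ The singular values of a pair of grammians $(\mathcal{P},\mathcal{R})$ are the eigenvalues of $\mathcal{P}\mathcal{R}$, counted with multiplicity. *)

theory Defs
  imports
    "HOL-Analysis.Analysis"
    "Jordan_Normal_Form.Char_Poly"
    "Jordan_Normal_Form.Gauss_Jordan_Elimination"
begin

no_notation inner (infix "\<bullet>" 70)
no_notation vec_nth (infixl "$" 90)

section \<open>Linear switched systems\<close>

text \<open>
  Dimensions are natural numbers, not types, because minimality compares systems of
  different dimensions.  State dimension \<open>0\<close> is allowed: it is the dimension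
  of the minimal realisations of the zero input-output map.
\<close>

record lss =
  state_dim :: nat
  num_modes :: nat
  input_dim :: nat
  output_dim :: nat
  Amat :: "nat \<Rightarrow> real mat"
  Bmat :: "nat \<Rightarrow> real mat"
  Cmat :: "nat \<Rightarrow> real mat"

definition modes :: "lss \<Rightarrow> nat set" where
  "modes \<Sigma> = {1..num_modes \<Sigma>}"

definition is_lss :: "lss \<Rightarrow> bool" where
  "is_lss \<Sigma> \<longleftrightarrow> 1 \<le> num_modes \<Sigma> \<and>
     (\<forall>q\<in>modes \<Sigma>.
        Amat \<Sigma> q \<in> carrier_mat (state_dim \<Sigma>) (state_dim \<Sigma>) \<and>
        Bmat \<Sigma> q \<in> carrier_mat (state_dim \<Sigma>) (input_dim \<Sigma>) \<and>
        Cmat \<Sigma> q \<in> carrier_mat (output_dim \<Sigma>) (state_dim \<Sigma>))"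


section \<open>Trajectories and input-output maps\<close>

text \<open>
  \<open>real vec\<close> carries no topology or measurable structure, so the analytic
  conditions on vector-valued signals are imposed componentwise.
\<close>

datatype time_axis = Continuous_Time | Discrete_Time

subsection \<open>Continuous time\<close>

definition piecewise_continuous :: "(real \<Rightarrow> 'a::t2_space) \<Rightarrow> bool" where
  "piecewise_continuous f \<longleftrightarrow>
     (\<forall>b\<ge>0. finite {t \<in> {0..b}. \<not> continuous (at t within {0..}) f}) \<and>
     (\<forall>t\<ge>0. \<exists>l. (f \<longlongrightarrow> l) (at_right t)) \<and>
     (\<forall>t>0. \<exists>l. (f \<longlongrightarrow> l) (at_left t))"

text \<open>
  The usual epsilon-delta definition; the members of a division are non-overlapping
  compact intervals.
\<close>

definition absolutely_continuous_on_interval :: "real \<Rightarrow> real \<Rightarrow> (real \<Rightarrow> real) \<Rightarrow> bool" where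
  "absolutely_continuous_on_interval a b f \<longleftrightarrow>
     (\<forall>\<epsilon>>0. \<exists>\<delta>>0. \<forall>\<D> T.
        \<D> division_of T \<and> T \<subseteq> {a..b} \<and> (\<Sum>I\<in>\<D>. Sup I - Inf I) < \<delta> \<longrightarrow>
        (\<Sum>I\<in>\<D>. \<bar>f (Sup I) - f (Inf I)\<bar>) < \<epsilon>)"

text \<open>
  Absolute continuity on the half-line means absolute continuity on each compact
  subinterval: states of unstable systems grow exponentially.
\<close>

definition absolutely_continuous_signal :: "(real \<Rightarrow> real) \<Rightarrow> bool" where
  "absolutely_continuous_signal f \<longleftrightarrow> (\<forall>b\<ge>0. absolutely_continuous_on_interval 0 b f)"

definition ct_inputs :: "nat \<Rightarrow> (real \<Rightarrow> real vec) set" where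
  "ct_inputs m = {u. (\<forall>t\<ge>0. u t \<in> carrier_vec m) \<and>
     (\<forall>i<m. (\<lambda>t. u t $ i) \<in> borel_measurable (lebesgue_on {0..})) \<and>
     integrable (lebesgue_on {0..}) (\<lambda>t. u t \<bullet> u t)}"

definition ct_switchings :: "nat set \<Rightarrow> (real \<Rightarrow> nat) set" where
  "ct_switchings Q = {q. (\<forall>t\<ge>0. q t \<in> Q) \<and> piecewise_continuous q}"

definition ct_solution ::
    "lss \<Rightarrow> real vec \<Rightarrow> (real \<Rightarrow> real vec) \<Rightarrow> (real \<Rightarrow> nat) \<Rightarrow>
     (real \<Rightarrow> real vec) \<Rightarrow> (real \<Rightarrow> real vec) \<Rightarrow> bool" where
  "ct_solution \<Sigma> x0 u q x y \<longleftrightarrow>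
     (\<forall>t\<ge>0. x t \<in> carrier_vec (state_dim \<Sigma>)) \<and>
     (\<forall>i<state_dim \<Sigma>. absolutely_continuous_signal (\<lambda>t. x t $ i)) \<and>
     y \<in> {0..} \<rightarrow>\<^sub>E carrier_vec (output_dim \<Sigma>) \<and>
     (\<forall>i<output_dim \<Sigma>. piecewise_continuous (\<lambda>t. y t $ i)) \<and>
     x 0 = x0 \<and>
     (AE t in lebesgue_on {0..}. \<forall>i<state_dim \<Sigma>.
        ((\<lambda>s. x s $ i) has_real_derivative
           (Amat \<Sigma> (q t) *\<^sub>v x t + Bmat \<Sigma> (q t) *\<^sub>v u t) $ i) (at t within {0..})) \<and>
     (\<forall>t\<ge>0. y t = Cmat \<Sigma> (q t) *\<^sub>v x t)"

definition ct_output ::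
    "lss \<Rightarrow> real vec \<Rightarrow> (real \<Rightarrow> real vec) \<Rightarrow> (real \<Rightarrow> nat) \<Rightarrow> (real \<Rightarrow> real vec)" where
  "ct_output \<Sigma> x0 u q = (THE y. \<exists>x. ct_solution \<Sigma> x0 u q x y)"

subsection \<open>Discrete time\<close>

definition dt_inputs :: "nat \<Rightarrow> (nat \<Rightarrow> real vec) set" where
  "dt_inputs m = {u. (\<forall>t. u t \<in> carrier_vec m) \<and> summable (\<lambda>t. u t \<bullet> u t)}"

definition dt_switchings :: "nat set \<Rightarrow> (nat \<Rightarrow> nat) set" where
  "dt_switchings Q = {q. \<forall>t. q t \<in> Q}"

definition dt_solution ::
    "lss \<Rightarrow> real vec \<Rightarrow> (nat \<Rightarrow> real vec) \<Rightarrow> (nat \<Rightarrow> nat) \<Rightarrow>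
     (nat \<Rightarrow> real vec) \<Rightarrow> (nat \<Rightarrow> real vec) \<Rightarrow> bool" where
  "dt_solution \<Sigma> x0 u q x y \<longleftrightarrow>
     (\<forall>t. x t \<in> carrier_vec (state_dim \<Sigma>)) \<and>
     (\<forall>t. y t \<in> carrier_vec (output_dim \<Sigma>)) \<and>
     x 0 = x0 \<and>
     (\<forall>t. x (Suc t) = Amat \<Sigma> (q t) *\<^sub>v x t + Bmat \<Sigma> (q t) *\<^sub>v u t) \<and>
     (\<forall>t. y t = Cmat \<Sigma> (q t) *\<^sub>v x t)"

definition dt_output ::
    "lss \<Rightarrow> real vec \<Rightarrow> (nat \<Rightarrow> real vec) \<Rightarrow> (nat \<Rightarrow> nat) \<Rightarrow> (nat \<Rightarrow> real vec)" where
  "dt_output \<Sigma> x0 u q = (THE y. \<exists>x. dt_solution \<Sigma> x0 u q x y)"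

subsection \<open>Equivalence, minimality, isomorphism\<close>

definition same_io_map :: "time_axis \<Rightarrow> lss \<Rightarrow> lss \<Rightarrow> bool" where
  "same_io_map \<tau> \<Sigma> \<Sigma>' \<longleftrightarrow>
     (case \<tau> of
        Continuous_Time \<Rightarrow>
          \<forall>u\<in>ct_inputs (input_dim \<Sigma>). \<forall>q\<in>ct_switchings (modes \<Sigma>).
            ct_output \<Sigma> (0\<^sub>v (state_dim \<Sigma>)) u q = ct_output \<Sigma>' (0\<^sub>v (state_dim \<Sigma>')) u q
      | Discrete_Time \<Rightarrow>
          \<forall>u\<in>dt_inputs (input_dim \<Sigma>). \<forall>q\<in>dt_switchings (modes \<Sigma>).
            dt_output \<Sigma> (0\<^sub>v (state_dim \<Sigma>)) u q = dt_output \<Sigma>' (0\<^sub>v (state_dim \<Sigma>')) u q)"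

definition same_type :: "lss \<Rightarrow> lss \<Rightarrow> bool" where
  "same_type \<Sigma> \<Sigma>' \<longleftrightarrow> num_modes \<Sigma> = num_modes \<Sigma>' \<and>
     input_dim \<Sigma> = input_dim \<Sigma>' \<and> output_dim \<Sigma> = output_dim \<Sigma>'"

definition lss_equivalent :: "time_axis \<Rightarrow> lss \<Rightarrow> lss \<Rightarrow> bool" where
  "lss_equivalent \<tau> \<Sigma> \<Sigma>' \<longleftrightarrow> same_type \<Sigma> \<Sigma>' \<and> same_io_map \<tau> \<Sigma> \<Sigma>'"

definition lss_minimal :: "time_axis \<Rightarrow> lss \<Rightarrow> bool" where
  "lss_minimal \<tau> \<Sigma> \<longleftrightarrow>
     (\<forall>\<Sigma>'. is_lss \<Sigma>' \<and> lss_equivalent \<tau> \<Sigma>' \<Sigma> \<longrightarrow> state_dim \<Sigma> \<le> state_dim \<Sigma>')"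

definition lss_isomorphism :: "real mat \<Rightarrow> lss \<Rightarrow> lss \<Rightarrow> bool" where
  "lss_isomorphism S \<Sigma> \<Sigma>' \<longleftrightarrow>
     same_type \<Sigma> \<Sigma>' \<and> state_dim \<Sigma> = state_dim \<Sigma>' \<and>
     S \<in> carrier_mat (state_dim \<Sigma>) (state_dim \<Sigma>) \<and> invertible_mat S \<and>
     (\<forall>q\<in>modes \<Sigma>.
        Amat \<Sigma>' q * S = S * Amat \<Sigma> q \<and>
        Bmat \<Sigma>' q = S * Bmat \<Sigma> q \<and>
        Cmat \<Sigma>' q * S = Cmat \<Sigma> q)"


section \<open>Definiteness and the sets of matrices\<close>

definition pos_def :: "nat \<Rightarrow> real mat \<Rightarrow> bool" where
  "pos_def n P \<longleftrightarrow> P \<in> carrier_mat n n \<and> P\<^sup>T = P \<and>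
     (\<forall>v\<in>carrier_vec n. v \<noteq> 0\<^sub>v n \<longrightarrow> v \<bullet> (P *\<^sub>v v) > 0)"

definition neg_def :: "nat \<Rightarrow> real mat \<Rightarrow> bool" where
  "neg_def n P \<longleftrightarrow> P \<in> carrier_mat n n \<and> P\<^sup>T = P \<and>
     (\<forall>v\<in>carrier_vec n. v \<noteq> 0\<^sub>v n \<longrightarrow> v \<bullet> (P *\<^sub>v v) < 0)"

definition neg_semidef :: "nat \<Rightarrow> real mat \<Rightarrow> bool" where
  "neg_semidef n P \<longleftrightarrow> P \<in> carrier_mat n n \<and> P\<^sup>T = P \<and>
     (\<forall>v\<in>carrier_vec n. v \<bullet> (P *\<^sub>v v) \<le> 0)"

definition stability_set :: "time_axis \<Rightarrow> lss \<Rightarrow> real mat set" where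
  "stability_set \<tau> \<Sigma> = {P. pos_def (state_dim \<Sigma>) P \<and>
     (\<forall>q\<in>modes \<Sigma>. let A = Amat \<Sigma> q in
        neg_def (state_dim \<Sigma>)
          (case \<tau> of Continuous_Time \<Rightarrow> A\<^sup>T * P + P * A
                    | Discrete_Time \<Rightarrow> A\<^sup>T * P * A - P))}"

definition obs_grammians :: "time_axis \<Rightarrow> lss \<Rightarrow> real mat set" where
  "obs_grammians \<tau> \<Sigma> = {R. pos_def (state_dim \<Sigma>) R \<and>
     (\<forall>q\<in>modes \<Sigma>. let A = Amat \<Sigma> q; C = Cmat \<Sigma> q in
        neg_semidef (state_dim \<Sigma>)
          (case \<tau> of Continuous_Time \<Rightarrow> A\<^sup>T * R + R * A + C\<^sup>T * C
                    | Discrete_Time \<Rightarrow> A\<^sup>T * R * A + C\<^sup>T * C - R))}"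

definition ctrl_grammians :: "time_axis \<Rightarrow> lss \<Rightarrow> real mat set" where
  "ctrl_grammians \<tau> \<Sigma> = {P. pos_def (state_dim \<Sigma>) P \<and>
     (\<forall>q\<in>modes \<Sigma>. let A = Amat \<Sigma> q; B = Bmat \<Sigma> q in
        neg_semidef (state_dim \<Sigma>)
          (case \<tau> of Continuous_Time \<Rightarrow> A * P + P * A\<^sup>T + B * B\<^sup>T
                    | Discrete_Time \<Rightarrow> A * P * A\<^sup>T + B * B\<^sup>T - P))}"

definition gain_set :: "time_axis \<Rightarrow> real \<Rightarrow> lss \<Rightarrow> real mat set" where
  "gain_set \<tau> \<gamma> \<Sigma> = {P. pos_def (state_dim \<Sigma>) P \<and>
     (\<forall>q\<in>modes \<Sigma>. let A = Amat \<Sigma> q; B = Bmat \<Sigma> q; C = Cmat \<Sigma> q;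
                        G = \<gamma>\<^sup>2 \<cdot>\<^sub>m 1\<^sub>m (input_dim \<Sigma>) in
        neg_def (state_dim \<Sigma> + input_dim \<Sigma>)
          (case \<tau> of
             Continuous_Time \<Rightarrow>
               four_block_mat (A\<^sup>T * P + P * A + C\<^sup>T * C) (P * B)
                              (B\<^sup>T * P)                     (- G)
           | Discrete_Time \<Rightarrow>
               four_block_mat (A\<^sup>T * P * A + C\<^sup>T * C - P) (A\<^sup>T * P * B)
                              (B\<^sup>T * P * A)               (B\<^sup>T * P * B - G)))}"

datatype set_symbol = Sym_S | Sym_O | Sym_C | Sym_G real

definition valid_symbol :: "set_symbol \<Rightarrow> bool" where
  "valid_symbol K \<longleftrightarrow> (\<forall>\<gamma>. K = Sym_G \<gamma> \<longrightarrow> \<gamma> > 0)"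

fun symbol_set :: "time_axis \<Rightarrow> set_symbol \<Rightarrow> lss \<Rightarrow> real mat set" where
  "symbol_set \<tau> Sym_S \<Sigma> = stability_set \<tau> \<Sigma>"
| "symbol_set \<tau> Sym_O \<Sigma> = obs_grammians \<tau> \<Sigma>"
| "symbol_set \<tau> Sym_C \<Sigma> = ctrl_grammians \<tau> \<Sigma>"
| "symbol_set \<tau> (Sym_G \<gamma>) \<Sigma> = gain_set \<tau> \<gamma> \<Sigma>"

fun congruence_factor :: "set_symbol \<Rightarrow> real mat \<Rightarrow> real mat" where
  "congruence_factor Sym_C S = S\<^sup>T"
| "congruence_factor _ S = the (mat_inverse S)"

text \<open>
  The \<open>i\<close>-th largest (\<open>i \<ge> 1\<close>) eigenvalue of \<open>P * R\<close>,
  counted with algebraic multiplicity.  For positive definite \<open>P\<close> and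
  \<open>R\<close> of size \<open>n\<close> the product is similar to a symmetric matrix,
  so its characteristic polynomial has \<open>n\<close> real roots with multiplicity.
\<close>

definition singular_value :: "real mat \<Rightarrow> real mat \<Rightarrow> nat \<Rightarrow> real" where
  "singular_value P R i = rev (sorted_list_of_multiset (proots (char_poly (P * R)))) ! (i - 1)"

end

theory Submission
  imports Defs
begin

text \<open>Input-output equivalence is equality of all Markov parameters \<open>C\<^sub>q A\<^sub>w B\<^sub>r\<close>, in either time axis.
  So \<open>\<Sigma>\<close> can be cut down purely algebraically: restrict it to the reachable space (inclusion \<open>V\<close>),
  then map that space onto the state space of the minimal system (surjection \<open>T\<close>).
  All the sets except the controllability grammians consist of quadratic forms \<open>R\<close> subject to a dissipation
  inequality for \<open>R(Ax + Bu)\<close> or its continuous analogue. Restricting the form along \<open>V\<close> keeps the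
  inequality, and so does the form \<open>z \<mapsto> min {R(x) | x reachable, T x = z}\<close>. Controllability
  grammians are observability grammians of the dual system.
  The singular values are the generalised eigenvalues of the pencil formed by one grammian and the inverse of
  the other. The minimal system's pencil is compared with the original one along linear maps under which
  one form does not increase and the other does not decrease, and a Courant--Fischer dimension count gives
  the interlacing.\<close>

section \<open>Differentiation of indefinite integrals\<close>

text \<open>In continuous time the passage to Markov parameters is where the analysis lies.
  \<open>ct_output\<close> is a definite description, so existence and uniqueness of the output have
  to be proved for merely square-integrable inputs, with absolutely continuous states that obey the
  equation almost everywhere. This calls for both halves of the Lebesgue fundamental theorem of
  calculus: an indefinite integral is differentiable almost everywhere, and an absolutely continuous
  function with derivative zero almost everywhere is constant. The differential equation then
  becomes an integral equation with a Picard series as its solution, and the k-th term of the output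
  involves only Markov parameters whose words have length k. Subspaces and quotients are represented
  by rectangular matrices with a one-sided inverse, which act as a basis and its coordinates. The
  two interlacing bounds need two different maps: the lower one compares the pencils of a
  controllability form and an inverse observability form, the upper one those of an observability
  form and an inverse controllability form.\<close>

text \<open>A bad point is the end of arbitrarily short intervals on which the integral misses
  \<open>f x\<close> times the length by more than \<open>e\<close> times the length. Vitali's lemma
  selects disjoint ones among them, and Henstock's lemma bounds the sum of such defects over
  disjoint intervals that are fine for a gauge.\<close>

lemma integral_derivative_bad_set_negligible:
  fixes f :: "real \<Rightarrow> real" and F :: "real \<Rightarrow> real"
  assumes f: "f integrable_on {a..b}" and e: "e > 0"
    and F: "\<And>t. F t = integral {a..t} f"
  shows "negligible {x \<in> {a<..<b}. \<forall>d>0. \<exists>y. y \<in> {a..b} \<and> y \<noteq> x \<and> \<bar>y - x\<bar> < d \<and>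
            e * \<bar>y - x\<bar> < \<bar>F y - F x - f x * (y - x)\<bar>}" (is "negligible ?S")
  unfolding negligible_outer_le
proof (intro allI impI)
  fix \<eta> :: real assume "\<eta> > 0"
  \<comment> \<open>A selected interval has length \<open>2 * r\<close> and a defect above
    \<open>e\<close> times that; its fivefold enlargement has length \<open>10 * r\<close>. The
    bound \<open>e * \<eta> / 10\<close> thus keeps the enlargements below \<open>\<eta> / 2\<close>
    in total.\<close>
  then have "e * \<eta> / 10 > 0" using e by simp
  then obtain \<gamma> where \<gamma>: "gauge \<gamma>"
    "\<And>p. \<lbrakk>p tagged_partial_division_of (cbox a b); \<gamma> fine p\<rbrakk> \<Longrightarrow>
             sum (\<lambda>(x,k). norm(measure lborel k *\<^sub>R f x - integral k f)) p < e * \<eta> / 10"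
    using Henstock_lemma[of f a b "e * \<eta> / 10"] f by auto
  \<comment> \<open>The bound 2 on the length supplies the bounded radii that Vitali's lemma asks
    for; containment in \<open>\<gamma> x\<close> will make the intervals fine.\<close>
  have "\<exists>y. y \<in> {a..b} \<and> y \<noteq> x \<and> \<bar>y - x\<bar> < 2 \<and> {min x y..max x y} \<subseteq> \<gamma> x \<and>
            e * \<bar>y - x\<bar> < \<bar>F y - F x - f x * (y - x)\<bar>" if x: "x \<in> ?S" for x
  proof -
    obtain d where d: "d > 0" "ball x d \<subseteq> \<gamma> x"
      using \<gamma>(1) unfolding gauge_def by (meson open_contains_ball)
    have "min d 2 > 0" using d by auto
    then obtain y where y: "y \<in> {a..b}" "y \<noteq> x" "\<bar>y - x\<bar> < min d 2"
            "e * \<bar>y - x\<bar> < \<bar>F y - F x - f x * (y - x)\<bar>" using x by blast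
    have "{min x y..max x y} \<subseteq> ball x d" using y d by (auto simp: dist_real_def)
    then show ?thesis using y d by (intro exI[of _ y]) auto
  qed
  then have "\<forall>x\<in>?S. \<exists>y. y \<in> {a..b} \<and> y \<noteq> x \<and> \<bar>y - x\<bar> < 2 \<and> {min x y..max x y} \<subseteq> \<gamma> x \<and>
            e * \<bar>y - x\<bar> < \<bar>F y - F x - f x * (y - x)\<bar>" by (intro ballI)
  from bchoice[OF this] obtain y where "\<forall>x\<in>?S. y x \<in> {a..b} \<and> y x \<noteq> x \<and> \<bar>y x - x\<bar> < 2 \<and>
        {min x (y x)..max x (y x)} \<subseteq> \<gamma> x \<and>
            e * \<bar>y x - x\<bar> < \<bar>F (y x) - F x - f x * (y x - x)\<bar>" by (elim exE)
  note y = bspec[OF this]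
  \<comment> \<open>The interval between \<open>x\<close> and \<open>y x\<close> is rewritten as a
    ball for the covering lemma. Its tag \<open>x\<close> is an endpoint, not the centre.\<close>
  define c where "c = (\<lambda>x. (x + y x) / 2)"
  define r where "r = (\<lambda>x. \<bar>y x - x\<bar> / 2)"
  have cb: "cball (c x) (r x) = {min x (y x)..max x (y x)}" for x
    unfolding c_def r_def by (auto simp: cball_eq_atLeastAtMost min_def max_def field_simps abs_if)
  have r: "0 < r x \<and> r x \<le> 1" if "x \<in> ?S" for x using y[OF that] by (auto simp: r_def)
  have cov: "?S \<subseteq> (\<Union>i\<in>?S. cball (c i) (r i))"
  proof
    fix x assume "x \<in> ?S"
    moreover have "x \<in> cball (c x) (r x)" unfolding cb by simp
    ultimately show "x \<in> (\<Union>i\<in>?S. cball (c i) (r i))" by (rule UN_I)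
  qed
  obtain C where C: "countable C" "C \<subseteq> ?S"
     "pairwise (\<lambda>i j. disjnt (cball (c i) (r i)) (cball (c j) (r j))) C"
     "?S \<subseteq> (\<Union>i\<in>C. cball (c i) (5 * r i))"
    using Vitali_covering_lemma_cballs[OF cov r] by blast
  \<comment> \<open>Henstock's lemma speaks of finite families. The bound obtained is the same for
    all of them, so it passes to the countable union.\<close>
  have fin: "measure lebesgue (\<Union>i\<in>C'. cball (c i) (5 * r i)) \<le> \<eta>" if C': "C' \<subseteq> C" "finite C'" for C'
  proof -
    define p where "p = (\<lambda>x. (x, cball (c x) (r x))) ` C'"
    have pp: "p tagged_partial_division_of (cbox a b)"
      unfolding tagged_partial_division_of_def
    proof (intro conjI allI impI)
      show "finite p" using C' p_def by auto
      fix x K assume "(x, K) \<in> p"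
      then have x: "x \<in> C'" "K = cball (c x) (r x)" by (auto simp: p_def)
      with C' C have xS: "x \<in> ?S" by auto
      show "x \<in> K" using x cb by auto
      show "K \<subseteq> cbox a b" using x cb[of x] y[OF xS] xS by auto
      show "\<exists>a b. K = cbox a b" using x cb by auto
    next
      fix x1 K1 x2 K2 assume "(x1, K1) \<in> p \<and> (x2, K2) \<in> p \<and> (x1, K1) \<noteq> (x2, K2)"
      then have "x1 \<in> C" "x2 \<in> C" "x1 \<noteq> x2" "K1 = cball (c x1) (r x1)" "K2 = cball (c x2) (r x2)"
        using C' by (auto simp: p_def)
      then have "disjnt K1 K2" using C(3) by (auto simp: pairwise_def)
      then show "interior K1 \<inter> interior K2 = {}"
        using interior_subset unfolding disjnt_def by blast
    qed
    have "\<gamma> fine p"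
    proof (rule fineI)
      fix x K assume "(x, K) \<in> p"
      then have "x \<in> ?S" "K = cball (c x) (r x)" using C' C by (auto simp: p_def)
      then show "K \<subseteq> \<gamma> x" using y[of x] cb[of x] by metis
    qed
    from \<gamma>(2)[OF pp this]
    have lt: "sum (\<lambda>(x,k). norm(measure lborel k *\<^sub>R f x - integral k f)) p < e * \<eta> / 10" .
    have "sum (\<lambda>(x,k). norm(measure lborel k *\<^sub>R f x - integral k f)) p
       = (\<Sum>x\<in>C'. norm(measure lborel (cball (c x) (r x)) *\<^sub>R f x - integral (cball (c x) (r x)) f))"
      unfolding p_def by (subst sum.reindex) (auto simp: inj_on_def)
    moreover have "e * (2 * r x) \<le> norm(measure lborel (cball (c x) (r x)) *\<^sub>R f x - integral (cball (c x) (r x)) f)"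
      if "x \<in> C'" for x
    proof -
      have xS: "x \<in> ?S" using that C' C by auto
      have ab: "a < x" "x < b" "y x \<in> {a..b}" using xS y by auto
      have main: "e * \<bar>y x - x\<bar> < \<bar>F (y x) - F x - f x * (y x - x)\<bar>" using y[OF xS] by auto
      have int: "f integrable_on {a..t}" if "t \<le> b" for t
        using f integrable_subinterval_real[of f a b a t] that by auto
      show ?thesis
      proof (cases "x < y x")
        case True
        have "integral {a..x} f + integral {x..y x} f = integral {a..y x} f"
          by (rule Henstock_Kurzweil_Integration.integral_combine) (use ab True int in auto)
        then have "integral (cball (c x) (r x)) f = F (y x) - F x" using True by (simp add: cb F)
        moreover have "measure lborel (cball (c x) (r x)) = y x - x" using True by (simp add: cb)
        moreover have "(y x - x) * f x - (F (y x) - F x) = - (F (y x) - F x - f x * (y x - x))"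
          by (simp add: algebra_simps)
        ultimately show ?thesis using main True unfolding real_scaleR_def real_norm_def
          by (smt (verit) r_def field_sum_of_halves)
      next
        case False
        have "integral {a..y x} f + integral {y x..x} f = integral {a..x} f"
          by (rule Henstock_Kurzweil_Integration.integral_combine) (use ab False int in auto)
        then have "integral (cball (c x) (r x)) f = F x - F (y x)" using False by (simp add: cb F)
        moreover have "measure lborel (cball (c x) (r x)) = x - y x" using False by (simp add: cb)
        moreover have "(x - y x) * f x - (F x - F (y x)) = F (y x) - F x - f x * (y x - x)"
          by (simp add: algebra_simps)
        ultimately show ?thesis using main False unfolding real_scaleR_def real_norm_def
          by (smt (verit) r_def field_sum_of_halves)
      qed
    qed
    ultimately have "(\<Sum>x\<in>C'. e * (2 * r x)) < e * \<eta> / 10"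
      using lt sum_mono[of C' "\<lambda>x. e * (2 * r x)" "\<lambda>x. norm(measure lborel (cball (c x) (r x)) *\<^sub>R f x - integral (cball (c x) (r x)) f)"]
      by (metis (no_types, lifting) order_le_less_trans)
    moreover have "(\<Sum>x\<in>C'. e * (2 * r x)) = e * (\<Sum>x\<in>C'. 10 * r x) / 5"
      by (simp add: sum_distrib_left[symmetric])
    ultimately have "e * (\<Sum>x\<in>C'. 10 * r x) < e * \<eta>" using mult_pos_pos[OF \<open>e > 0\<close> \<open>\<eta> > 0\<close>] by linarith
    then have *: "(\<Sum>x\<in>C'. 10 * r x) < \<eta>" using e by simp
    have "measure lebesgue (\<Union>i\<in>C'. cball (c i) (5 * r i)) \<le> (\<Sum>i\<in>C'. measure lebesgue (cball (c i) (5 * r i)))"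
      by (rule measure_UNION_le) (use C' in auto)
    also have "\<dots> = (\<Sum>x\<in>C'. 10 * r x)"
      by (rule sum.cong) (auto simp: cball_eq_atLeastAtMost r_def)
    finally show ?thesis using * by linarith
  qed
  show "\<exists>T. ?S \<subseteq> T \<and> T \<in> lmeasurable \<and> measure lebesgue T \<le> \<eta>"
  proof (intro exI conjI)
    show "?S \<subseteq> (\<Union>i\<in>C. cball (c i) (5 * r i))" by fact
    show "(\<Union>i\<in>C. cball (c i) (5 * r i)) \<in> lmeasurable"
      by (rule fmeasurable_UN_bound[OF C(1) _ fin]) auto
    show "measure lebesgue (\<Union>i\<in>C. cball (c i) (5 * r i)) \<le> \<eta>"
      by (rule measure_UN_bound[OF C(1) _ fin]) auto
  qed
qed

text \<open>Differentiability at \<open>x\<close> fails only if a deviation of some size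
  \<open>inverse (Suc n)\<close> persists arbitrarily close to \<open>x\<close>, so countably many
  null sets cover the exceptional set.\<close>

lemma indefinite_integral_derivative_ae:
  fixes f :: "real \<Rightarrow> real"
  assumes f: "f integrable_on {a..b}"
  shows "negligible {x \<in> {a<..<b}. \<not> ((\<lambda>t. integral {a..t} f) has_real_derivative f x) (at x)}"
proof -
  define F where "F = (\<lambda>t. integral {a..t} f)"
  define S where "S = (\<lambda>e. {x \<in> {a<..<b}. \<forall>d>0. \<exists>y. y \<in> {a..b} \<and> y \<noteq> x \<and> \<bar>y - x\<bar> < d \<and>
            e * \<bar>y - x\<bar> < \<bar>F y - F x - f x * (y - x)\<bar>})"
  have "negligible (\<Union>n. S (inverse (real (Suc n))))"
    unfolding S_def by (intro negligible_Union_nat integral_derivative_bad_set_negligible[OF f]) (auto simp: F_def)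
  moreover have "{x \<in> {a<..<b}. \<not> (F has_real_derivative f x) (at x)} \<subseteq> (\<Union>n. S (inverse (real (Suc n))))"
  proof (rule ccontr)
    assume "\<not> ?thesis"
    then obtain x where x: "x \<in> {a<..<b}" "\<not> (F has_real_derivative f x) (at x)"
      and nS: "\<And>n. x \<notin> S (inverse (real (Suc n)))" by blast
    have "(F has_real_derivative f x) (at x)"
      unfolding has_field_derivative_def has_derivative_at_alt
    proof (intro conjI allI impI)
      show "bounded_linear ((*) (f x))" by (rule bounded_linear_mult_right)
      fix e :: real assume "e > 0"
      then obtain n where n: "inverse (real (Suc n)) < e" using reals_Archimedean by blast
      obtain d where d: "d > 0" "\<And>y. y \<in> {a..b} \<Longrightarrow> y \<noteq> x \<Longrightarrow> \<bar>y - x\<bar> < d \<Longrightarrow>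
            \<bar>F y - F x - f x * (y - x)\<bar> \<le> inverse (real (Suc n)) * \<bar>y - x\<bar>"
        using nS[of n] x(1) unfolding S_def mem_Collect_eq not_less[symmetric] by blast
      show "\<exists>d>0. \<forall>y. norm (y - x) < d \<longrightarrow> norm (F y - F x - f x * (y - x)) \<le> e * norm (y - x)"
      proof (intro exI[of _ "min d (min (x - a) (b - x))"] conjI allI impI)
        show "min d (min (x - a) (b - x)) > 0" using d x by auto
        fix y assume y: "norm (y - x) < min d (min (x - a) (b - x))"
        show "norm (F y - F x - f x * (y - x)) \<le> e * norm (y - x)"
        proof (cases "y = x")
          case False
          have "\<bar>F y - F x - f x * (y - x)\<bar> \<le> inverse (real (Suc n)) * \<bar>y - x\<bar>"
            using d(2)[of y] y False by (simp add: abs_less_iff)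
          also have "\<dots> \<le> e * \<bar>y - x\<bar>" by (rule mult_right_mono) (use n in auto)
          finally show ?thesis by simp
        qed auto
      qed
    qed
    with x show False by blast
  qed
  ultimately show ?thesis unfolding F_def by (rule negligible_subset)
qed

section \<open>Absolutely continuous functions\<close>

lemma absolutely_continuous_on_intervalE:
  assumes "absolutely_continuous_on_interval a b f" "\<epsilon> > 0"
  obtains \<delta> where "\<delta> > 0" "\<And>\<D> T. \<D> division_of T \<Longrightarrow> T \<subseteq> {a..b} \<Longrightarrow> (\<Sum>I\<in>\<D>. Sup I - Inf I) < \<delta> \<Longrightarrow>
        (\<Sum>I\<in>\<D>. \<bar>f (Sup I) - f (Inf I)\<bar>) < \<epsilon>"
proof -
  have "\<exists>\<delta>>0. \<forall>\<D> T. \<D> division_of T \<and> T \<subseteq> {a..b} \<and> (\<Sum>I\<in>\<D>. Sup I - Inf I) < \<delta> \<longrightarrow>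
        (\<Sum>I\<in>\<D>. \<bar>f (Sup I) - f (Inf I)\<bar>) < \<epsilon>"
    using assms unfolding absolutely_continuous_on_interval_def by simp
  then obtain \<delta> where "\<delta> > 0" and H: "\<forall>\<D> T. \<D> division_of T \<and> T \<subseteq> {a..b} \<and> (\<Sum>I\<in>\<D>. Sup I - Inf I) < \<delta> \<longrightarrow>
        (\<Sum>I\<in>\<D>. \<bar>f (Sup I) - f (Inf I)\<bar>) < \<epsilon>" by (elim exE conjE) (rule that)
  show thesis by (rule that[OF \<open>\<delta> > 0\<close>]) (rule H[rule_format], intro conjI)
qed

text \<open>Two tagged pairs can share an interval only if its interior is empty, so that it is a
  point with increment zero. Hence a sum over pairs equals the sum over intervals, to which absolute
  continuity applies. \<open>d\<close> is set to 0 on the empty set, where \<open>Sup\<close> and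
  \<open>Inf\<close> carry no meaning.\<close>

lemma tagged_partial_division_increment_sum:
  fixes f :: "real \<Rightarrow> real"
  assumes p: "p tagged_partial_division_of cbox a b"
  shows "snd ` p division_of \<Union>(snd ` p)"
    and "(\<Sum>(x, K)\<in>p. \<bar>f (Sup K) - f (Inf K)\<bar>) = (\<Sum>K\<in>snd ` p. \<bar>f (Sup K) - f (Inf K)\<bar>)"
proof -
  have t: "p tagged_division_of \<Union>(snd ` p)"
    by (rule tagged_partial_division_of_Union_self[OF p])
  show "snd ` p division_of \<Union>(snd ` p)" by (rule division_of_tagged_division[OF t])
  define d where "d = (\<lambda>K. if K = {} then 0 else \<bar>f (Sup K) - f (Inf K)\<bar>)"
  have ne: "K \<noteq> {}" if "(x, K) \<in> p" for x K
    using tagged_partial_division_ofD(2)[OF p that] by auto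
  have "(\<Sum>(_, K)\<in>p. d K) = sum d (snd ` p)"
  proof (rule sum.over_tagged_division_lemma[OF t])
    fix u v :: real assume "box u v = {}"
    then have "v \<le> u" by simp
    then show "d (cbox u v) = 0" unfolding d_def by (cases "u = v") auto
  qed
  moreover have "(\<Sum>(_, K)\<in>p. d K) = (\<Sum>(x, K)\<in>p. \<bar>f (Sup K) - f (Inf K)\<bar>)"
    by (rule sum.cong) (auto simp: d_def dest: ne)
  moreover have "sum d (snd ` p) = (\<Sum>K\<in>snd ` p. \<bar>f (Sup K) - f (Inf K)\<bar>)"
    by (rule sum.cong) (auto simp: d_def dest: ne)
  ultimately show "(\<Sum>(x, K)\<in>p. \<bar>f (Sup K) - f (Inf K)\<bar>) = (\<Sum>K\<in>snd ` p. \<bar>f (Sup K) - f (Inf K)\<bar>)"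
    by simp
qed

lemma sum_length_division:
  assumes "\<D> division_of T"
  shows "(\<Sum>I\<in>\<D>. Sup I - Inf I) = measure lebesgue (T :: real set)"
proof -
  have "(\<Sum>I\<in>\<D>. Sup I - Inf I) = (\<Sum>I\<in>\<D>. measure lebesgue I)"
  proof (rule sum.cong)
    fix K assume K: "K \<in> \<D>"
    then obtain u v where "K = cbox u v" "K \<noteq> {}" using division_ofD(3,4)[OF assms] by metis
    then show "Sup K - Inf K = measure lebesgue K" by auto
  qed simp
  also have "\<dots> = measure lebesgue T"
    using content_division[OF assms] by simp
  finally show ?thesis .
qed

text \<open>The gauge treats two kinds of tags. Near a tag outside \<open>N\<close> the zero
  derivative bounds the increment by \<open>\<epsilon>\<close> times the length. Intervals tagged in
  \<open>N\<close> stay inside an open set of measure below \<open>\<delta>\<close>, so absolute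
  continuity bounds all their increments together by \<open>\<epsilon>\<close>. Telescoping over a
  fine division gives \<open>\<epsilon> * (b + 1)\<close>.\<close>

lemma absolutely_continuous_zero_derivative_const:
  assumes ac: "absolutely_continuous_on_interval 0 b f" and b: "0 \<le> b"
    and N: "negligible N"
    and d: "\<And>t. t \<in> {0..b} - N \<Longrightarrow> (f has_real_derivative 0) (at t within {0..})"
  shows "f b = f 0"
proof -
  have small: "\<bar>f b - f 0\<bar> \<le> \<epsilon> * (b + 1)" if e: "\<epsilon> > 0" for \<epsilon>
  proof -
    obtain \<delta> where \<delta>: "\<delta> > 0" "\<And>\<D> T. \<D> division_of T \<Longrightarrow> T \<subseteq> {0..b} \<Longrightarrow> (\<Sum>I\<in>\<D>. Sup I - Inf I) < \<delta> \<Longrightarrow>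
        (\<Sum>I\<in>\<D>. \<bar>f (Sup I) - f (Inf I)\<bar>) < \<epsilon>"
      by (rule absolutely_continuous_on_intervalE[OF ac e]) (rule that)
    have Nm: "N \<in> lmeasurable" "measure lebesgue N = 0"
      using N negligible_iff_measure by blast+
    obtain U where U: "open U" "N \<subseteq> U" "U \<in> lmeasurable" "measure lebesgue U < \<delta>"
    proof -
      obtain U where U: "open U" "N \<subseteq> U" "U - N \<in> lmeasurable" "emeasure lebesgue (U - N) < ennreal \<delta>"
        using sets_lebesgue_outer_open[of N \<delta>] Nm(1) \<delta>(1) by (auto simp: fmeasurableD)
      have eq: "U = (U - N) \<union> N" using U(2) by blast
      have m: "U \<in> lmeasurable" by (subst eq, rule fmeasurable.Un[OF U(3) Nm(1)])
      have "measure lebesgue U \<le> measure lebesgue (U - N) + measure lebesgue N"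
        by (subst eq, rule measure_Un_le) (use U(3) Nm(1) in \<open>auto simp: fmeasurableD\<close>)
      moreover have "measure lebesgue (U - N) < \<delta>"
        using U(4) \<delta>(1) emeasure_eq_measure2[OF U(3)] by (simp add: ennreal_less_iff)
      ultimately show thesis using that U(1,2) m Nm(2) by simp
    qed
    have "\<exists>r>0. \<forall>y\<in>{0..b}. \<bar>y - x\<bar> < r \<longrightarrow> \<bar>f y - f x\<bar> \<le> \<epsilon> * \<bar>y - x\<bar>" if "x \<in> {0..b} - N" for x
    proof -
      from d[OF that] obtain r where "r > 0" "\<forall>y\<in>{0..}. norm (y - x) < r \<longrightarrow> norm (f y - f x - 0 * (y - x)) \<le> \<epsilon> * norm (y - x)"
        unfolding has_field_derivative_def has_derivative_within_alt using e by blast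
      then show ?thesis by (intro exI[of _ r]) auto
    qed
    then obtain r where r: "\<And>x. x \<in> {0..b} - N \<Longrightarrow> r x > 0 \<and> (\<forall>y\<in>{0..b}. \<bar>y - x\<bar> < r x \<longrightarrow> \<bar>f y - f x\<bar> \<le> \<epsilon> * \<bar>y - x\<bar>)"
      by metis
    define \<gamma> where "\<gamma> = (\<lambda>x. if x \<in> N then U else if x \<in> {0..b} then ball x (r x) else UNIV)"
    have "gauge \<gamma>" unfolding \<gamma>_def by (rule gaugeI) (use U r in auto)
    then obtain p where p: "p tagged_division_of {0..b}" "\<gamma> fine p"
      using fine_division_exists_real by blast
    note pD = tagged_division_ofD[OF p(1)]
    define pN where "pN = {z \<in> p. fst z \<in> N}"
    have pN: "pN tagged_partial_division_of cbox 0 b"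
    proof (rule tagged_partial_division_subset)
      show "p tagged_partial_division_of cbox 0 b" using p(1) by (simp add: tagged_division_of_def)
    qed (auto simp: pN_def)
    note dv1 = tagged_partial_division_increment_sum(1)[OF pN]
    note dv2 = tagged_partial_division_increment_sum(2)[OF pN, of f]
    have sub: "\<Union>(snd ` pN) \<subseteq> U"
      using p(2) unfolding fine_def pN_def \<gamma>_def by fastforce
    have "(\<Sum>I\<in>snd ` pN. Sup I - Inf I) = measure lebesgue (\<Union>(snd ` pN))"
      by (rule sum_length_division[OF dv1])
    also have "\<dots> \<le> measure lebesgue U"
      by (rule measure_mono_fmeasurable[OF sub]) (use U lmeasurable_division[OF dv1] in \<open>auto simp: fmeasurableD\<close>)
    also have "\<dots> < \<delta>" by fact
    finally have "(\<Sum>I\<in>snd ` pN. Sup I - Inf I) < \<delta>" .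
    moreover have "\<Union>(snd ` pN) \<subseteq> {0..b}" using pD(3) unfolding pN_def by fastforce
    ultimately have bad: "(\<Sum>(x,K)\<in>pN. \<bar>f (Sup K) - f (Inf K)\<bar>) < \<epsilon>"
      using \<delta>(2)[OF dv1] dv2 by simp
    have fin: "finite p" using pD(1) .
    \<comment> \<open>The derivative estimate is applied from the tag to each endpoint; the tag lies
      between them, so the two lengths add up to that of \<open>K\<close>.\<close>
    have good: "\<bar>f (Sup K) - f (Inf K)\<bar> \<le> \<epsilon> * measure lborel K" if "(x, K) \<in> p - pN" for x K
    proof -
      have xN: "x \<notin> N" and xp: "(x, K) \<in> p" using that by (auto simp: pN_def)
      obtain u v where K: "K = {u..v}" using pD(4)[OF xp] by auto
      have x: "u \<le> x" "x \<le> v" using pD(2)[OF xp] K by auto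
      have Ks: "{u..v} \<subseteq> {0..b}" using pD(3)[OF xp] K by auto
      have xb: "x \<in> {0..b}" using Ks x by auto
      have "K \<subseteq> \<gamma> x" using fineD[OF p(2) xp] .
      then have "K \<subseteq> ball x (r x)" using xN xb unfolding \<gamma>_def by simp
      moreover have "u \<in> K" "v \<in> K" using K x by auto
      ultimately have "u \<in> ball x (r x)" "v \<in> ball x (r x)" by auto
      then have "\<bar>u - x\<bar> < r x" "\<bar>v - x\<bar> < r x" by (auto simp: dist_real_def)
      moreover have "u \<in> {0..b}" "v \<in> {0..b}" using Ks x by auto
      ultimately have "\<bar>f u - f x\<bar> \<le> \<epsilon> * \<bar>u - x\<bar>" "\<bar>f v - f x\<bar> \<le> \<epsilon> * \<bar>v - x\<bar>"
        using r[of x] xb xN by auto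
      then have "\<bar>f v - f u\<bar> \<le> \<epsilon> * (x - u) + \<epsilon> * (v - x)" using x by auto
      then show ?thesis using K x by (simp add: algebra_simps)
    qed
    have "f b - f 0 = (\<Sum>(x,K)\<in>p. f (Sup K) - f (Inf K))"
      using additive_tagged_division_1[OF b p(1), of f] by simp
    also have "\<bar>\<dots>\<bar> \<le> (\<Sum>(x,K)\<in>p. \<bar>f (Sup K) - f (Inf K)\<bar>)"
      by (rule order_trans[OF sum_abs]) (auto intro!: sum_mono)
    also have "\<dots> = (\<Sum>(x,K)\<in>p - pN. \<bar>f (Sup K) - f (Inf K)\<bar>) + (\<Sum>(x,K)\<in>pN. \<bar>f (Sup K) - f (Inf K)\<bar>)"
      by (rule sum.subset_diff) (use fin in \<open>auto simp: pN_def\<close>)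
    also have "\<dots> \<le> (\<Sum>(x,K)\<in>p - pN. \<epsilon> * measure lborel K) + \<epsilon>"
      by (rule add_mono[OF sum_mono]) (use good bad in auto)
    also have "(\<Sum>(x,K)\<in>p - pN. \<epsilon> * measure lborel K) \<le> (\<Sum>(x,K)\<in>p. \<epsilon> * measure lborel K)"
      by (rule sum_mono2) (use fin e in auto)
    also have "(\<Sum>(x,K)\<in>p. \<epsilon> * measure lborel K) = \<epsilon> * (\<Sum>(x,K)\<in>p. measure lborel K)"
      by (simp add: sum_distrib_left case_prod_unfold)
    also have "(\<Sum>(x,K)\<in>p. measure lborel K) = b"
      using additive_content_tagged_division[of p 0 b] p(1) b by simp
    finally show ?thesis by (simp add: algebra_simps)
  qed
  show ?thesis
  proof (rule ccontr)
    assume "f b \<noteq> f 0"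
    then have "\<bar>f b - f 0\<bar> / (2 * (b + 1)) > 0" using b by simp
    from small[OF this] have "\<bar>f b - f 0\<bar> \<le> \<bar>f b - f 0\<bar> / (2 * (b + 1)) * (b + 1)" .
    also have "\<dots> = \<bar>f b - f 0\<bar> / 2" using b by (simp add: field_simps)
    finally have "\<bar>f b - f 0\<bar> \<le> \<bar>f b - f 0\<bar> / 2" .
    with \<open>f b \<noteq> f 0\<close> show False by simp
  qed
qed

lemma absolutely_continuous_on_interval_diff:
  assumes "absolutely_continuous_on_interval a b f" "absolutely_continuous_on_interval a b g"
  shows "absolutely_continuous_on_interval a b (\<lambda>t. f t - g t)"
  unfolding absolutely_continuous_on_interval_def
proof (intro allI impI)
  fix \<epsilon> :: real assume "\<epsilon> > 0"
  then have "\<epsilon> / 2 > 0" by simp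
  obtain d1 where d1: "d1 > 0" "\<And>\<D> T. \<D> division_of T \<Longrightarrow> T \<subseteq> {a..b} \<Longrightarrow> (\<Sum>I\<in>\<D>. Sup I - Inf I) < d1 \<Longrightarrow>
        (\<Sum>I\<in>\<D>. \<bar>f (Sup I) - f (Inf I)\<bar>) < \<epsilon> / 2"
    by (rule absolutely_continuous_on_intervalE[OF assms(1) \<open>\<epsilon> / 2 > 0\<close>]) (rule that)
  obtain d2 where d2: "d2 > 0" "\<And>\<D> T. \<D> division_of T \<Longrightarrow> T \<subseteq> {a..b} \<Longrightarrow> (\<Sum>I\<in>\<D>. Sup I - Inf I) < d2 \<Longrightarrow>
        (\<Sum>I\<in>\<D>. \<bar>g (Sup I) - g (Inf I)\<bar>) < \<epsilon> / 2"
    by (rule absolutely_continuous_on_intervalE[OF assms(2) \<open>\<epsilon> / 2 > 0\<close>]) (rule that)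
  show "\<exists>\<delta>>0. \<forall>\<D> T. \<D> division_of T \<and> T \<subseteq> {a..b} \<and> (\<Sum>I\<in>\<D>. Sup I - Inf I) < \<delta> \<longrightarrow>
        (\<Sum>I\<in>\<D>. \<bar>f (Sup I) - g (Sup I) - (f (Inf I) - g (Inf I))\<bar>) < \<epsilon>"
  proof (intro exI[of _ "min d1 d2"] conjI allI impI)
    show "min d1 d2 > 0" using d1 d2 by simp
    fix \<D> T assume H: "\<D> division_of T \<and> T \<subseteq> {a..b} \<and> (\<Sum>I\<in>\<D>. Sup I - Inf I) < min d1 d2"
    have "(\<Sum>I\<in>\<D>. \<bar>f (Sup I) - g (Sup I) - (f (Inf I) - g (Inf I))\<bar>)
      \<le> (\<Sum>I\<in>\<D>. \<bar>f (Sup I) - f (Inf I)\<bar> + \<bar>g (Sup I) - g (Inf I)\<bar>)"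
      by (rule sum_mono) linarith
    also have "\<dots> < \<epsilon>" using d1(2)[of \<D> T] d2(2)[of \<D> T] H by (simp add: sum.distrib)
    finally show "(\<Sum>I\<in>\<D>. \<bar>f (Sup I) - g (Sup I) - (f (Inf I) - g (Inf I))\<bar>) < \<epsilon>" .
  qed
qed

lemma absolutely_continuous_imp_continuous_on:
  assumes ac: "absolutely_continuous_on_interval a b f"
  shows "continuous_on {a..b} f"
  unfolding continuous_on_iff
proof (intro ballI allI impI)
  fix x e assume x: "x \<in> {a..b}" and e: "(e::real) > 0"
  obtain d where d: "d > 0" "\<And>\<D> T. \<D> division_of T \<Longrightarrow> T \<subseteq> {a..b} \<Longrightarrow> (\<Sum>I\<in>\<D>. Sup I - Inf I) < d \<Longrightarrow>
        (\<Sum>I\<in>\<D>. \<bar>f (Sup I) - f (Inf I)\<bar>) < e"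
    by (rule absolutely_continuous_on_intervalE[OF ac e]) (rule that)
  show "\<exists>d>0. \<forall>x'\<in>{a..b}. dist x' x < d \<longrightarrow> dist (f x') (f x) < e"
  proof (intro exI[of _ d] conjI ballI impI)
    fix y assume y: "y \<in> {a..b}" "dist y x < d"
    define I where "I = {min x y..max x y}"
    have I: "I = cbox (min x y) (max x y)" "I \<noteq> {}" "Sup I = max x y" "Inf I = min x y" by (auto simp: I_def)
    have "{I} division_of I" using division_of_self[of "min x y" "max x y"] I by auto
    from d(2)[of "{I}" I] this have "\<bar>f (Sup I) - f (Inf I)\<bar> < e"
      using x y I by (auto simp: dist_real_def I_def)
    then show "dist (f y) (f x) < e" using I by (auto simp: dist_real_def min_def max_def split: if_splits)
  qed (use d in auto)
qed

section \<open>Locally square-integrable functions and their integrals\<close>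

text \<open>The class of right-hand sides that occur: input components times bounded measurable
  coefficients. Measurability is demanded separately, as that of the square does not give that of
  the function.\<close>

definition l2_loc :: "(real \<Rightarrow> real) \<Rightarrow> bool" where
  "l2_loc h \<longleftrightarrow> (\<forall>b\<ge>0. h \<in> borel_measurable (lebesgue_on {0..b}) \<and> (\<lambda>t. (h t)\<^sup>2) integrable_on {0..b})"

text \<open>A weighted inequality between arithmetic and geometric mean. With \<open>c = 1\<close>
  it makes a function integrable once its square is; a large \<open>c\<close> makes the square term
  small in the proof of absolute continuity.\<close>

lemma abs_le_weighted_square:
  fixes x c :: real
  assumes "c > 0"
  shows "\<bar>x\<bar> \<le> c + x\<^sup>2 / c"
proof -
  have "2 * (c * \<bar>x\<bar>) \<le> c * c + x\<^sup>2"
    using sum_squares_bound[of c "\<bar>x\<bar>"] by (simp add: power2_eq_square mult.assoc)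
  moreover have "0 \<le> c * \<bar>x\<bar>" using assms by simp
  ultimately have "c * \<bar>x\<bar> \<le> c * c + x\<^sup>2" by linarith
  then show ?thesis using assms by (simp add: field_simps)
qed

lemma l2_loc_bound:
  assumes m: "\<And>b. b \<ge> 0 \<Longrightarrow> h \<in> borel_measurable (lebesgue_on {0..b})"
    and g: "\<And>b. b \<ge> 0 \<Longrightarrow> g integrable_on {0..b}"
    and hg: "\<And>t. t \<ge> 0 \<Longrightarrow> (h t)\<^sup>2 \<le> g t"
  shows "l2_loc h"
  unfolding l2_loc_def
proof (intro allI impI conjI)
  fix b :: real assume b: "0 \<le> b"
  show "h \<in> borel_measurable (lebesgue_on {0..b})" using m b by auto
  then have "(\<lambda>t. (h t)\<^sup>2) \<in> borel_measurable (lebesgue_on {0..b})" by measurable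
  then show "(\<lambda>t. (h t)\<^sup>2) integrable_on {0..b}"
    by (rule measurable_bounded_by_integrable_imp_integrable[OF _ g[OF b]]) (use hg in auto)
qed

lemma l2_loc_absolutely_integrable:
  assumes "l2_loc h"
  shows "h absolutely_integrable_on {0..b}"
proof (cases "b \<ge> 0")
  case True
  show ?thesis
  proof (rule measurable_bounded_by_integrable_imp_absolutely_integrable)
    show "h \<in> borel_measurable (lebesgue_on {0..b})" using assms True by (auto simp: l2_loc_def)
    show "(\<lambda>t. 1 + (h t)\<^sup>2 / 1) integrable_on {0..b}"
      using assms True by (intro integrable_add) (auto simp: l2_loc_def)
    show "\<And>t. t \<in> {0..b} \<Longrightarrow> norm (h t) \<le> 1 + (h t)\<^sup>2 / 1"
      using abs_le_weighted_square[of 1] by auto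
  qed auto
qed auto

lemma l2_loc_integrable: "l2_loc h \<Longrightarrow> h integrable_on {0..b}"
  using l2_loc_absolutely_integrable set_lebesgue_integral_eq_integral(1) by blast

lemma l2_loc_integrable_sub: "l2_loc h \<Longrightarrow> a \<ge> 0 \<Longrightarrow> h integrable_on {a..b}"
  using integrable_subinterval_real[OF l2_loc_integrable[of h b], of a b] by auto

lemma l2_loc_add:
  assumes "l2_loc f" "l2_loc g"
  shows "l2_loc (\<lambda>t. f t + g t)"
proof (rule l2_loc_bound)
  fix b :: real assume b: "b \<ge> 0"
  show "(\<lambda>t. f t + g t) \<in> borel_measurable (lebesgue_on {0..b})"
    using assms b unfolding l2_loc_def by (intro borel_measurable_add) auto
  show "(\<lambda>t. 2 * (f t)\<^sup>2 + 2 * (g t)\<^sup>2) integrable_on {0..b}"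
    using assms b unfolding l2_loc_def by (intro integrable_add integrable_on_mult_right) auto
next
  fix t show "(f t + g t)\<^sup>2 \<le> 2 * (f t)\<^sup>2 + 2 * (g t)\<^sup>2"
    using sum_squares_bound[of "f t" "g t"] by (simp add: power2_sum)
qed

lemma l2_loc_bounded_mult:
  assumes "l2_loc f" and m: "\<And>b. b \<ge> 0 \<Longrightarrow> a \<in> borel_measurable (lebesgue_on {0..b})"
    and K: "\<And>t. t \<ge> 0 \<Longrightarrow> \<bar>a t\<bar> \<le> (K :: real)"
  shows "l2_loc (\<lambda>t. a t * f t)"
proof (rule l2_loc_bound)
  fix b :: real assume b: "b \<ge> 0"
  show "(\<lambda>t. a t * f t) \<in> borel_measurable (lebesgue_on {0..b})"
    using assms(1) m[OF b] b unfolding l2_loc_def by (intro borel_measurable_times) auto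
  show "(\<lambda>t. K\<^sup>2 * (f t)\<^sup>2) integrable_on {0..b}"
    using assms(1) b unfolding l2_loc_def by (intro integrable_on_mult_right) auto
next
  fix t :: real assume "t \<ge> 0"
  then have "\<bar>a t\<bar>\<^sup>2 \<le> K\<^sup>2" using K by (intro power_mono) auto
  then show "(a t * f t)\<^sup>2 \<le> K\<^sup>2 * (f t)\<^sup>2"
    by (simp add: power_mult_distrib mult_right_mono)
qed

lemma l2_loc_continuous:
  assumes "\<And>b. b \<ge> 0 \<Longrightarrow> continuous_on {0..b} f"
  shows "l2_loc f"
  unfolding l2_loc_def
  by (auto intro!: continuous_imp_measurable_on_sets_lebesgue integrable_continuous_real continuous_intros assms)

lemma l2_loc_sum:
  assumes "finite I" "\<And>i. i \<in> I \<Longrightarrow> l2_loc (f i)"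
  shows "l2_loc (\<lambda>t. \<Sum>i\<in>I. f i t)"
  using assms
proof (induction I rule: finite_induct)
  case empty
  then show ?case by (auto intro!: l2_loc_continuous)
next
  case (insert x F)
  then show ?case by (simp add: l2_loc_add)
qed

lemma integral_Ioc_diff:
  fixes h :: "real \<Rightarrow> real"
  assumes "l2_loc h" "0 \<le> u" "u \<le> v"
  shows "integral {0..v} h - integral {0..u} h = integral {u..v} h"
  using Henstock_Kurzweil_Integration.integral_combine[of 0 u v h] l2_loc_integrable[OF assms(1)] assms by auto

text \<open>Over intervals of total length \<open>\<delta>\<close> the weighted estimate bounds the
  increments by \<open>c * \<delta> + I / c\<close>, with \<open>I\<close> the integral of the
  square over \<open>{0..b}\<close>. The weight \<open>c\<close> is fixed by the second summand, and
  \<open>\<delta>\<close> by the other one for that \<open>c\<close>.\<close>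

lemma l2_loc_integral_absolutely_continuous:
  assumes h: "l2_loc h"
  shows "absolutely_continuous_signal (\<lambda>t. integral {0..t} h)"
  unfolding absolutely_continuous_signal_def absolutely_continuous_on_interval_def
proof (intro allI impI)
  fix b \<epsilon> :: real assume b: "0 \<le> b" and e: "0 < \<epsilon>"
  define I where "I = integral {0..b} (\<lambda>t. (h t)\<^sup>2)"
  have h2: "(\<lambda>t. (h t)\<^sup>2) integrable_on {0..b}" using h b by (auto simp: l2_loc_def)
  have I0: "I \<ge> 0" unfolding I_def by (rule integral_nonneg[OF h2]) auto
  \<comment> \<open>The summand 1 keeps \<open>c\<close> positive when \<open>I = 0\<close> and
    makes \<open>I / c\<close> strictly smaller than \<open>\<epsilon> / 2\<close>.\<close>
  define c where "c = 2 * I / \<epsilon> + 1"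
  have c: "c > 0" using I0 e by (auto simp: c_def intro: add_nonneg_pos)
  have Ic: "I / c < \<epsilon> / 2" using I0 e c by (simp add: c_def field_simps)
  show "\<exists>\<delta>>0. \<forall>\<D> T. \<D> division_of T \<and> T \<subseteq> {0..b} \<and> (\<Sum>I\<in>\<D>. Sup I - Inf I) < \<delta> \<longrightarrow>
         (\<Sum>I\<in>\<D>. \<bar>integral {0..Sup I} h - integral {0..Inf I} h\<bar>) < \<epsilon>"
  proof (intro exI[of _ "\<epsilon> / (2 * c)"] conjI allI impI)
    show "\<epsilon> / (2 * c) > 0" using e c by simp
    fix \<D> T assume H: "\<D> division_of T \<and> T \<subseteq> {0..b} \<and> (\<Sum>I\<in>\<D>. Sup I - Inf I) < \<epsilon> / (2 * c)"
    then have dv: "\<D> division_of T" and T: "T \<subseteq> {0..b}" by auto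
    note D = division_ofD[OF dv]
    have h2T: "(\<lambda>t. (h t)\<^sup>2) integrable_on T"
      using integrable_on_subdivision[OF dv h2 T] .
    have one: "\<bar>integral {0..Sup K} h - integral {0..Inf K} h\<bar> \<le> c * (Sup K - Inf K) + integral K (\<lambda>t. (h t)\<^sup>2) / c"
      if K: "K \<in> \<D>" for K
    proof -
      obtain u v where uv: "K = {u..v}" "u \<le> v"
        using D(3,4)[OF K] by (metis atLeastatMost_empty_iff box_real(2))
      have Kb: "{u..v} \<subseteq> {0..b}" using D(2)[OF K] T unfolding uv(1) by (rule order_trans)
      then have u0: "0 \<le> u" using uv by auto
      have hK: "h integrable_on {u..v}" by (rule l2_loc_integrable_sub[OF h u0])
      have h2K: "(\<lambda>t. (h t)\<^sup>2) integrable_on {u..v}" using integrable_subinterval_real[OF h2 Kb] .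
      have eq: "integral {0..v} h - integral {0..u} h = integral {u..v} h"
        by (rule integral_Ioc_diff[OF h u0 uv(2)])
      have "norm (integral {u..v} h) \<le> integral {u..v} (\<lambda>t. c + (h t)\<^sup>2 / c)"
        by (rule integral_norm_bound_integral[OF hK])
          (use h2K abs_le_weighted_square[OF c] in \<open>auto intro!: integrable_add integrable_on_divide\<close>)
      also have "\<dots> = c * (v - u) + integral {u..v} (\<lambda>t. (h t)\<^sup>2) / c"
        using h2K uv by (subst Henstock_Kurzweil_Integration.integral_add) (auto intro: integrable_on_divide)
      finally show ?thesis using eq uv by simp
    qed
    have "(\<Sum>K\<in>\<D>. \<bar>integral {0..Sup K} h - integral {0..Inf K} h\<bar>)
      \<le> (\<Sum>K\<in>\<D>. c * (Sup K - Inf K) + integral K (\<lambda>t. (h t)\<^sup>2) / c)"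
      by (rule sum_mono[OF one])
    also have "\<dots> = c * (\<Sum>K\<in>\<D>. Sup K - Inf K) + (\<Sum>K\<in>\<D>. integral K (\<lambda>t. (h t)\<^sup>2)) / c"
      by (simp add: sum.distrib sum_distrib_left sum_divide_distrib)
    also have "(\<Sum>K\<in>\<D>. integral K (\<lambda>t. (h t)\<^sup>2)) = integral T (\<lambda>t. (h t)\<^sup>2)"
      using integral_combine_division_topdown[OF h2T dv] by simp
    also have "\<dots> \<le> I" unfolding I_def
      by (rule integral_subset_le[OF T h2T h2]) auto
    finally have "(\<Sum>K\<in>\<D>. \<bar>integral {0..Sup K} h - integral {0..Inf K} h\<bar>)
      \<le> c * (\<Sum>K\<in>\<D>. Sup K - Inf K) + I / c" using c by (simp add: divide_right_mono)
    also have "c * (\<Sum>K\<in>\<D>. Sup K - Inf K) < \<epsilon> / 2"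
      using H c by (simp add: field_simps)
    finally show "(\<Sum>I\<in>\<D>. \<bar>integral {0..Sup I} h - integral {0..Inf I} h\<bar>) < \<epsilon>" using Ic by linarith
  qed
qed

text \<open>The null sets belonging to the intervals \<open>{0<..<real n}\<close> are united, and
  the endpoint 0 is added to them.\<close>

lemma l2_loc_integral_derivative_ae:
  assumes h: "l2_loc h"
  shows "\<exists>N. negligible N \<and> (\<forall>t\<in>{0..} - N. ((\<lambda>t. integral {0..t} h) has_real_derivative h t) (at t within {0..}))"
proof -
  define B where "B = (\<lambda>n::nat. {x \<in> {0<..<real n}. \<not> ((\<lambda>t. integral {0..t} h) has_real_derivative h x) (at x)})"
  have "negligible (B n)" for n
    unfolding B_def using indefinite_integral_derivative_ae[OF l2_loc_integrable[OF h, of "real n"]] .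
  then have "negligible (\<Union>n. B n)" by (rule negligible_Union_nat)
  then have "negligible ({0} \<union> (\<Union>n. B n))"
    using negligible_sing[of 0] by (rule negligible_Un[rotated])
  moreover have "((\<lambda>t. integral {0..t} h) has_real_derivative h t) (at t within {0..})"
    if t: "t \<in> {0..} - ({0} \<union> (\<Union>n. B n))" for t
  proof -
    obtain n where n: "t < real n" using reals_Archimedean2[of t] by (elim exE)
    have "t \<notin> B n" "0 < t" using t by auto
    with n have "((\<lambda>t. integral {0..t} h) has_real_derivative h t) (at t)"
      unfolding B_def by simp
    then show ?thesis by (rule has_field_derivative_at_within)
  qed
  ultimately show ?thesis by (intro exI[of _ "{0} \<union> (\<Union>n. B n)"] conjI ballI)
qed

text \<open>The difference of \<open>f\<close> and the integral of \<open>h\<close> is absolutely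
  continuous with derivative zero off a null set, hence constant. This is what turns an equation
  holding almost everywhere into an integral equation.\<close>

lemma absolutely_continuous_eq_integral:
  assumes ac: "absolutely_continuous_signal f" and h: "l2_loc h" and N: "negligible N"
    and d: "\<And>t. t \<in> {0..} - N \<Longrightarrow> (f has_real_derivative h t) (at t within {0..})"
    and b: "0 \<le> b"
  shows "f b = f 0 + integral {0..b} h"
proof -
  obtain N' where N': "negligible N'" "\<And>t. t \<in> {0..} - N' \<Longrightarrow> ((\<lambda>t. integral {0..t} h) has_real_derivative h t) (at t within {0..})"
    using l2_loc_integral_derivative_ae[OF h] by (elim exE conjE) simp
  have "f b - integral {0..b} h = f 0 - integral {0..0} h"
  proof (rule absolutely_continuous_zero_derivative_const[OF _ b])
    show "absolutely_continuous_on_interval 0 b (\<lambda>t. f t - integral {0..t} h)"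
      using ac l2_loc_integral_absolutely_continuous[OF h] b
      by (intro absolutely_continuous_on_interval_diff) (auto simp: absolutely_continuous_signal_def)
    show "negligible (N \<union> N')" using N N' by simp
    fix t assume "t \<in> {0..b} - (N \<union> N')"
    then have "((\<lambda>t. f t - integral {0..t} h) has_real_derivative h t - h t) (at t within {0..})"
      by (intro DERIV_diff d N'(2)) auto
    then show "((\<lambda>t. f t - integral {0..t} h) has_real_derivative 0) (at t within {0..})" by simp
  qed
  then show ?thesis by simp
qed

section \<open>Linear integral equations\<close>

text \<open>The terms of the Neumann series of the Volterra equation; the successive Picard
  approximations are its partial sums. In the term with index \<open>k\<close> exactly
  \<open>k\<close> coefficient matrices stand before \<open>g\<close>, so each term will see words
  of a single length.\<close>

primrec picard_term :: "nat \<Rightarrow> (nat \<Rightarrow> nat \<Rightarrow> real \<Rightarrow> real) \<Rightarrow> (nat \<Rightarrow> real \<Rightarrow> real) \<Rightarrow> nat \<Rightarrow> nat \<Rightarrow> real \<Rightarrow> real" where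
  "picard_term n a g 0 i t = integral {0..t} (g i)"
| "picard_term n a g (Suc k) i t = integral {0..t} (\<lambda>s. \<Sum>j<n. a i j s * picard_term n a g k j s)"

definition picard_sol :: "nat \<Rightarrow> (nat \<Rightarrow> nat \<Rightarrow> real \<Rightarrow> real) \<Rightarrow> (nat \<Rightarrow> real \<Rightarrow> real) \<Rightarrow> nat \<Rightarrow> real \<Rightarrow> real" where
  "picard_sol n a g i t = (\<Sum>k. picard_term n a g k i t)"

definition solves_integral_eq :: "nat \<Rightarrow> (nat \<Rightarrow> nat \<Rightarrow> real \<Rightarrow> real) \<Rightarrow> (nat \<Rightarrow> real \<Rightarrow> real) \<Rightarrow> real \<Rightarrow> (nat \<Rightarrow> real \<Rightarrow> real) \<Rightarrow> bool" where
  "solves_integral_eq n a g b x \<longleftrightarrow> (\<forall>i<n. continuous_on {0..b} (x i) \<and>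
     (\<forall>t\<in>{0..b}. x i t = integral {0..t} (\<lambda>s. g i s + (\<Sum>j<n. a i j s * x j s))))"

text \<open>Integrals ignore null sets. This is applied to data that agree before a time
  \<open>t\<close> but may differ at \<open>t\<close> itself.\<close>

lemma solves_integral_eq_spike:
  assumes x: "solves_integral_eq n a' g' b x" and N: "negligible N"
    and a: "\<And>s i j. s \<in> {0..b} - N \<Longrightarrow> i < n \<Longrightarrow> j < n \<Longrightarrow> a i j s = a' i j s"
    and g: "\<And>s i. s \<in> {0..b} - N \<Longrightarrow> i < n \<Longrightarrow> g i s = g' i s"
  shows "solves_integral_eq n a g b x"
  unfolding solves_integral_eq_def
proof (intro allI impI conjI ballI)
  fix i assume i: "i < n"
  show "continuous_on {0..b} (x i)" using x i unfolding solves_integral_eq_def by simp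
  fix t assume t: "t \<in> {0..b}"
  have "x i t = integral {0..t} (\<lambda>s. g' i s + (\<Sum>j<n. a' i j s * x j s))"
    using x i t unfolding solves_integral_eq_def by simp
  also have "\<dots> = integral {0..t} (\<lambda>s. g i s + (\<Sum>j<n. a i j s * x j s))"
  proof (rule integral_spike[OF N])
    fix s assume "s \<in> {0..t} - N"
    then have "s \<in> {0..b} - N" using t by auto
    then show "g i s + (\<Sum>j<n. a i j s * x j s) = g' i s + (\<Sum>j<n. a' i j s * x j s)"
      using a g i by simp
  qed
  finally show "x i t = integral {0..t} (\<lambda>s. g i s + (\<Sum>j<n. a i j s * x j s))" .
qed

lemma continuous_on_interval_bounded:
  fixes f :: "nat \<Rightarrow> real \<Rightarrow> real"
  assumes "\<And>j. j < n \<Longrightarrow> continuous_on {0..b} (f j)"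
  shows "\<exists>M\<ge>0. \<forall>j<n. \<forall>t\<in>{0..b}. \<bar>f j t\<bar> \<le> M"
proof -
  have "\<exists>M. \<forall>t\<in>{0..b}. \<bar>f j t\<bar> \<le> M" if "j < n" for j
  proof -
    have "bounded (f j ` {0..b})"
      by (rule compact_imp_bounded[OF compact_continuous_image[OF assms[OF that] compact_Icc]])
    then show ?thesis unfolding bounded_iff by auto
  qed
  then obtain M where M: "\<And>j. j < n \<Longrightarrow> \<forall>t\<in>{0..b}. \<bar>f j t\<bar> \<le> M j" by metis
  have "\<bar>f j t\<bar> \<le> (\<Sum>j<n. \<bar>M j\<bar>)" if "j < n" "t \<in> {0..b}" for j t
  proof -
    have "\<bar>f j t\<bar> \<le> \<bar>M j\<bar>" using M[OF that(1)] that(2) by fastforce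
    also have "\<dots> \<le> (\<Sum>j<n. \<bar>M j\<bar>)" using that(1) by (intro member_le_sum) auto
    finally show ?thesis .
  qed
  then show ?thesis by (intro exI[of _ "\<Sum>j<n. \<bar>M j\<bar>"]) (auto intro: sum_nonneg)
qed

text \<open>Bounded measurable coefficients and a locally square-integrable inhomogeneity: what
  switching among finitely many matrices and a square-integrable input provide.\<close>

locale linear_integral_equation =
  fixes n :: nat and a :: "nat \<Rightarrow> nat \<Rightarrow> real \<Rightarrow> real" and g :: "nat \<Rightarrow> real \<Rightarrow> real" and K :: real
  assumes K0: "K \<ge> 0"
    and a_meas: "\<And>i j b. i < n \<Longrightarrow> j < n \<Longrightarrow> b \<ge> 0 \<Longrightarrow> a i j \<in> borel_measurable (lebesgue_on {0..b})"
    and a_bound: "\<And>i j t. i < n \<Longrightarrow> j < n \<Longrightarrow> t \<ge> 0 \<Longrightarrow> \<bar>a i j t\<bar> \<le> K"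
    and g_l2: "\<And>i. i < n \<Longrightarrow> l2_loc (g i)"
begin

lemma integrand_bound:
  assumes i: "i < n" and s: "s \<ge> 0" and f: "\<And>j. j < n \<Longrightarrow> \<bar>f j\<bar> \<le> M"
  shows "\<bar>\<Sum>j<n. a i j s * f j\<bar> \<le> real n * K * M"
proof -
  have "\<bar>\<Sum>j<n. a i j s * f j\<bar> \<le> (\<Sum>j<n. \<bar>a i j s * f j\<bar>)" by (rule sum_abs)
  also have "\<dots> \<le> (\<Sum>j<n. K * M)"
    by (rule sum_mono) (use a_bound[OF i _ s] f K0 in \<open>auto simp: abs_mult intro!: mult_mono\<close>)
  finally show ?thesis by (simp add: mult.assoc)
qed

lemma integrand_l2:
  assumes i: "i < n" and f: "\<And>j b. j < n \<Longrightarrow> continuous_on {0..b} (f j)"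
  shows "l2_loc (\<lambda>s. \<Sum>j<n. a i j s * f j s)"
  by (intro l2_loc_sum l2_loc_bounded_mult[where K = K] l2_loc_continuous)
    (use a_meas[OF i] a_bound[OF i] f in auto)

lemma integrand_integrable:
  assumes i: "i < n" and t: "t \<le> b" and f: "\<And>j. j < n \<Longrightarrow> continuous_on {0..b} (f j)"
  shows "(\<lambda>s. \<Sum>j<n. a i j s * f j s) integrable_on {0..t}"
proof (cases "t \<ge> 0")
  case True
  obtain M where M: "\<And>j t. j < n \<Longrightarrow> t \<in> {0..b} \<Longrightarrow> \<bar>f j t\<bar> \<le> M"
    using continuous_on_interval_bounded[of n b f, OF f] by blast
  show ?thesis
  proof (rule measurable_bounded_by_integrable_imp_integrable)
    have "f j \<in> borel_measurable (lebesgue_on {0..t})" if "j < n" for j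
      by (rule continuous_imp_measurable_on_sets_lebesgue[OF continuous_on_subset[OF f[OF that]]]) (use t in auto)
    then show "(\<lambda>s. \<Sum>j<n. a i j s * f j s) \<in> borel_measurable (lebesgue_on {0..t})"
      using a_meas[OF i _ True] by (intro borel_measurable_sum borel_measurable_times) auto
    show "(\<lambda>s. real n * K * M) integrable_on {0..t}" by (rule integrable_const_ivl)
    fix s assume "s \<in> {0..t}"
    then show "norm (\<Sum>j<n. a i j s * f j s) \<le> real n * K * M"
      using integrand_bound[OF i, of s "\<lambda>j. f j s" M] M t by auto
  qed auto
qed auto

text \<open>One integration turns a term of the exponential series into the next:
  \<open>real n * K\<close> times the bound of order \<open>k\<close> integrates to the bound of
  order \<open>Suc k\<close>. Uniqueness and convergence both iterate this step.\<close>

lemma picard_step_bound: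
  assumes i: "i < n" and t: "t \<in> {0..b}" and f: "\<And>j. j < n \<Longrightarrow> continuous_on {0..b} (f j)"
    and bd: "\<And>j s. j < n \<Longrightarrow> s \<in> {0..b} \<Longrightarrow> \<bar>f j s\<bar> \<le> M * (real n * K * s) ^ k / fact k"
  shows "\<bar>integral {0..t} (\<lambda>s. \<Sum>j<n. a i j s * f j s)\<bar> \<le> M * (real n * K * t) ^ Suc k / fact (Suc k)"
proof -
  define G where "G = (\<lambda>s. M * (real n * K * s) ^ Suc k / fact (Suc k))"
  have "((\<lambda>s. real n * K * (M * (real n * K * s) ^ k / fact k)) has_integral (G t - G 0)) {0..t}"
  proof (rule fundamental_theorem_of_calculus)
    show "0 \<le> t" using t by simp
    fix s :: real
    have "(G has_real_derivative (M * (real (Suc k) * (real n * K * s) ^ k * (real n * K)) / fact (Suc k))) (at s within {0..t})"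
      unfolding G_def by (auto intro!: derivative_eq_intros simp del: fact_Suc power_Suc)
    also have "M * (real (Suc k) * (real n * K * s) ^ k * (real n * K)) / fact (Suc k) = real n * K * (M * (real n * K * s) ^ k / fact k)"
      by (simp del: of_nat_Suc add: field_simps)
    finally show "(G has_vector_derivative real n * K * (M * (real n * K * s) ^ k / fact k)) (at s within {0..t})"
      by (simp add: has_real_derivative_iff_has_vector_derivative)
  qed
  then have hi: "((\<lambda>s. real n * K * (M * (real n * K * s) ^ k / fact k)) has_integral G t) {0..t}"
    by (simp add: G_def)
  have "norm (integral {0..t} (\<lambda>s. \<Sum>j<n. a i j s * f j s)) \<le> integral {0..t} (\<lambda>s. real n * K * (M * (real n * K * s) ^ k / fact k))"
  proof (rule integral_norm_bound_integral)
    show "(\<lambda>s. \<Sum>j<n. a i j s * f j s) integrable_on {0..t}"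
      by (rule integrand_integrable[OF i _ f]) (use t in auto)
    show "(\<lambda>s. real n * K * (M * (real n * K * s) ^ k / fact k)) integrable_on {0..t}"
      using hi by blast
    fix s assume "s \<in> {0..t}"
    then show "norm (\<Sum>j<n. a i j s * f j s) \<le> real n * K * (M * (real n * K * s) ^ k / fact k)"
      using integrand_bound[OF i, of s "\<lambda>j. f j s" "M * (real n * K * s) ^ k / fact k"] bd t by auto
  qed
  also have "\<dots> = G t" using hi by (rule integral_unique)
  finally show ?thesis by (simp add: G_def)
qed

text \<open>The difference of two solutions solves the homogeneous equation, so it obeys the step
  bound of every order, and these bounds tend to 0 like the terms of an exponential series.\<close>

lemma integral_eq_unique:
  assumes x: "solves_integral_eq n a g b x" and y: "solves_integral_eq n a g b y"
    and i: "i < n" and t: "t \<in> {0..b}"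
  shows "x i t = y i t"
proof -
  define z where "z = (\<lambda>i t. x i t - y i t)"
  have xc: "continuous_on {0..b} (x j)" and yc: "continuous_on {0..b} (y j)" if "j < n" for j
    using x y that unfolding solves_integral_eq_def by auto
  then have zc: "continuous_on {0..b} (z j)" if "j < n" for j
    unfolding z_def using that by (intro continuous_intros) auto
  have zi: "z i t = integral {0..t} (\<lambda>s. \<Sum>j<n. a i j s * z j s)" if i: "i < n" and t: "t \<in> {0..b}" for i t
  proof -
    have I: "(\<lambda>s. g i s + (\<Sum>j<n. a i j s * x j s)) integrable_on {0..t}"
      "(\<lambda>s. g i s + (\<Sum>j<n. a i j s * y j s)) integrable_on {0..t}"
      using integrand_integrable[OF i _ xc, of t] integrand_integrable[OF i _ yc, of t]
        l2_loc_integrable[OF g_l2[OF i]] t by (auto intro!: integrable_add)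
    have "z i t = integral {0..t} (\<lambda>s. g i s + (\<Sum>j<n. a i j s * x j s)) - integral {0..t} (\<lambda>s. g i s + (\<Sum>j<n. a i j s * y j s))"
      using x y i t unfolding z_def solves_integral_eq_def by simp
    also have "\<dots> = integral {0..t} (\<lambda>s. (g i s + (\<Sum>j<n. a i j s * x j s)) - (g i s + (\<Sum>j<n. a i j s * y j s)))"
      by (rule Henstock_Kurzweil_Integration.integral_diff[OF I, symmetric])
    also have "(\<lambda>s. (g i s + (\<Sum>j<n. a i j s * x j s)) - (g i s + (\<Sum>j<n. a i j s * y j s))) = (\<lambda>s. \<Sum>j<n. a i j s * z j s)"
      by (simp add: z_def sum_subtractf right_diff_distrib)
    finally show ?thesis .
  qed
  obtain M where M: "\<And>j t. j < n \<Longrightarrow> t \<in> {0..b} \<Longrightarrow> \<bar>z j t\<bar> \<le> M"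
    using continuous_on_interval_bounded[of n b z, OF zc] by blast
  have bd: "\<bar>z i t\<bar> \<le> M * (real n * K * t) ^ k / fact k" if "i < n" "t \<in> {0..b}" for k i t
    using that
  proof (induction k arbitrary: i t)
    case 0
    then show ?case using M by simp
  next
    case (Suc k)
    show ?case using picard_step_bound[OF Suc.prems zc Suc.IH] zi[OF Suc.prems] by simp
  qed
  have "(\<lambda>k. (real n * K * t) ^ k / fact k) \<longlonglongrightarrow> 0"
    using summable_LIMSEQ_zero[OF summable_exp[of "real n * K * t"]] by (simp add: field_simps)
  then have "(\<lambda>k. M * ((real n * K * t) ^ k / fact k)) \<longlonglongrightarrow> M * 0"
    by (intro tendsto_mult tendsto_const)
  then have "\<bar>z i t\<bar> \<le> M * 0"
    by (rule tendsto_lowerbound) (use bd[OF i t] in auto)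
  then show ?thesis by (simp add: z_def)
qed

abbreviation "pt \<equiv> picard_term n a g"
abbreviation "ps \<equiv> picard_sol n a g"

lemma picard_term_continuous: "i < n \<Longrightarrow> continuous_on {0..b} (pt k i)"
proof (induction k arbitrary: i b)
  case 0
  have "continuous_on {0..b} (\<lambda>t. integral {0..t} (g i))"
    by (rule indefinite_integral_continuous_1[OF l2_loc_integrable[OF g_l2[OF 0]]])
  then show ?case by simp
next
  case (Suc k)
  have "continuous_on {0..b} (\<lambda>t. integral {0..t} (\<lambda>s. \<Sum>j<n. a i j s * pt k j s))"
    by (rule indefinite_integral_continuous_1[OF integrand_integrable[OF Suc.prems order_refl Suc.IH]])
  then show ?case by simp
qed

lemma picard_term_bound:
  "\<exists>M\<ge>0. \<forall>k. \<forall>i<n. \<forall>t\<in>{0..b}. \<bar>pt k i t\<bar> \<le> M * (real n * K * t) ^ k / fact k"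
proof -
  obtain M where M0: "M \<ge> 0" and M: "\<And>j t. j < n \<Longrightarrow> t \<in> {0..b} \<Longrightarrow> \<bar>pt 0 j t\<bar> \<le> M"
    using continuous_on_interval_bounded[of n b "pt 0", OF picard_term_continuous] by blast
  have "\<bar>pt k i t\<bar> \<le> M * (real n * K * t) ^ k / fact k" if "i < n" "t \<in> {0..b}" for k i t
    using that
  proof (induction k arbitrary: i t)
    case 0
    then show ?case using M by simp
  next
    case (Suc k)
    show ?case using picard_step_bound[OF Suc.prems picard_term_continuous Suc.IH] by simp
  qed
  then show ?thesis using M0 by blast
qed

text \<open>The terms are dominated by an exponential series. Uniform convergence gives continuity
  of the sum; the uniform bound on partial sums is the majorant for dominated convergence.\<close>

lemma picard_sol_limit:
  shows "i < n \<Longrightarrow> uniform_limit {0..b} (\<lambda>m t. \<Sum>k<m. pt k i t) (ps i) sequentially"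
    and "\<exists>B. \<forall>m. \<forall>i<n. \<forall>t\<in>{0..b}. \<bar>\<Sum>k<m. pt k i t\<bar> \<le> B"
proof -
  obtain M where M0: "M \<ge> 0" and M: "\<And>k i t. i < n \<Longrightarrow> t \<in> {0..b} \<Longrightarrow> \<bar>pt k i t\<bar> \<le> M * (real n * K * t) ^ k / fact k"
    using picard_term_bound[of b] by blast
  define c where "c = (\<lambda>k. M * ((real n * K * b) ^ k / fact k))"
  have c: "\<bar>pt k i t\<bar> \<le> c k" if "i < n" "t \<in> {0..b}" for k i t
  proof -
    have "M * (real n * K * t) ^ k / fact k \<le> M * (real n * K * b) ^ k / fact k"
      using that M0 K0 by (intro divide_right_mono mult_left_mono power_mono mult_nonneg_nonneg) auto
    then show ?thesis using M[OF that, of k] by (simp add: c_def)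
  qed
  have sc: "summable c" unfolding c_def
    using summable_exp[of "real n * K * b"] by (intro summable_mult) (simp add: field_simps)
  show "uniform_limit {0..b} (\<lambda>m t. \<Sum>k<m. pt k i t) (ps i) sequentially" if i: "i < n"
    unfolding picard_sol_def by (rule Weierstrass_m_test[OF _ sc]) (use c[OF i] in auto)
  have "\<bar>\<Sum>k<m. pt k i t\<bar> \<le> suminf c" if "i < n" "t \<in> {0..b}" for m i t
  proof -
    have c0: "c k \<ge> 0" for k using c[OF that, of k] by linarith
    have "\<bar>\<Sum>k<m. pt k i t\<bar> \<le> (\<Sum>k<m. \<bar>pt k i t\<bar>)" by (rule sum_abs)
    also have "\<dots> \<le> (\<Sum>k<m. c k)" by (rule sum_mono) (use c that in auto)
    also have "\<dots> \<le> suminf c" by (rule sum_le_suminf[OF sc]) (use c0 in auto)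
    finally show ?thesis .
  qed
  then show "\<exists>B. \<forall>m. \<forall>i<n. \<forall>t\<in>{0..b}. \<bar>\<Sum>k<m. pt k i t\<bar> \<le> B" by blast
qed

lemma picard_sol_pointwise: "i < n \<Longrightarrow> t \<ge> 0 \<Longrightarrow> (\<lambda>m. \<Sum>k<m. pt k i t) \<longlonglongrightarrow> ps i t"
  by (rule tendsto_uniform_limitI[OF picard_sol_limit(1)[of i t]]) auto

lemma picard_sol_continuous: "i < n \<Longrightarrow> continuous_on {0..b} (ps i)"
  by (rule uniform_limit_theorem[OF _ picard_sol_limit(1)])
    (auto intro!: always_eventually continuous_on_sum picard_term_continuous)

lemma picard_sol_solves: "solves_integral_eq n a g b ps"
  unfolding solves_integral_eq_def
proof (intro allI impI conjI ballI)
  fix i assume i: "i < n"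
  show "continuous_on {0..b} (ps i)" by (rule picard_sol_continuous[OF i])
  fix t assume t: "t \<in> {0..b}"
  obtain B where B: "\<And>m i t. i < n \<Longrightarrow> t \<in> {0..b} \<Longrightarrow> \<bar>\<Sum>k<m. pt k i t\<bar> \<le> B"
    using picard_sol_limit(2)[of b] by blast
  define f where "f = (\<lambda>m s. \<Sum>j<n. a i j s * (\<Sum>k<m. pt k j s))"
  have fi: "f m integrable_on {0..t}" for m
    unfolding f_def by (rule integrand_integrable[OF i order_refl])
      (auto intro!: continuous_on_sum picard_term_continuous)
  have lim: "(\<lambda>m. integral {0..t} (f m)) \<longlonglongrightarrow> integral {0..t} (\<lambda>s. \<Sum>j<n. a i j s * ps j s)"
  proof (rule dominated_convergence(2))
    show "f m integrable_on {0..t}" for m by (rule fi)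
    show "(\<lambda>s. real n * K * B) integrable_on {0..t}" by (rule integrable_const_ivl)
    show "norm (f m s) \<le> real n * K * B" if "s \<in> {0..t}" for m s
      using integrand_bound[OF i, of s "\<lambda>j. \<Sum>k<m. pt k j s" B] B that t unfolding f_def by auto
    show "(\<lambda>m. f m s) \<longlonglongrightarrow> (\<Sum>j<n. a i j s * ps j s)" if "s \<in> {0..t}" for s
      unfolding f_def by (intro tendsto_sum tendsto_mult tendsto_const picard_sol_pointwise) (use that in auto)
  qed
  \<comment> \<open>\<open>f m\<close> is the coefficient matrix applied to a partial sum, so
    passing to the next partial sum is one step of the integral equation, and both sides have
    limits.\<close>
  have S: "(\<Sum>k<Suc m. pt k i t) = integral {0..t} (g i) + integral {0..t} (f m)" for m
  proof -
    have "(\<Sum>k<Suc m. pt k i t) = pt 0 i t + (\<Sum>k<m. pt (Suc k) i t)"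
      by (rule sum.lessThan_Suc_shift)
    also have "(\<Sum>k<m. pt (Suc k) i t) = integral {0..t} (\<lambda>s. \<Sum>k<m. \<Sum>j<n. a i j s * pt k j s)"
      by (subst Henstock_Kurzweil_Integration.integral_sum)
        (auto intro!: integrand_integrable[OF i order_refl] picard_term_continuous)
    also have "(\<lambda>s. \<Sum>k<m. \<Sum>j<n. a i j s * pt k j s) = f m"
      unfolding f_def by (rule ext, subst sum.swap) (simp add: sum_distrib_left)
    finally show ?thesis by simp
  qed
  have "(\<lambda>m. \<Sum>k<Suc m. pt k i t) \<longlonglongrightarrow> ps i t"
    using LIMSEQ_Suc[OF picard_sol_pointwise[OF i, of t]] t by simp
  moreover have "(\<lambda>m. \<Sum>k<Suc m. pt k i t) \<longlonglongrightarrow> integral {0..t} (g i) + integral {0..t} (\<lambda>s. \<Sum>j<n. a i j s * ps j s)"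
    unfolding S by (intro tendsto_add tendsto_const lim)
  ultimately have "ps i t = integral {0..t} (g i) + integral {0..t} (\<lambda>s. \<Sum>j<n. a i j s * ps j s)"
    by (rule LIMSEQ_unique)
  also have "\<dots> = integral {0..t} (\<lambda>s. g i s + (\<Sum>j<n. a i j s * ps j s))"
    by (rule Henstock_Kurzweil_Integration.integral_add[symmetric, OF l2_loc_integrable[OF g_l2[OF i]]
          integrand_integrable[OF i order_refl picard_sol_continuous]])
  finally show "ps i t = integral {0..t} (\<lambda>s. g i s + (\<Sum>j<n. a i j s * ps j s))" .
qed

lemma solution_rhs_l2:
  assumes "i < n" "\<And>j b. j < n \<Longrightarrow> continuous_on {0..b} (f j)"
  shows "l2_loc (\<lambda>s. g i s + (\<Sum>j<n. a i j s * f j s))"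
  by (rule l2_loc_add[OF g_l2[OF assms(1)] integrand_l2[OF assms]])

end

section \<open>Markov parameters and the discrete-time input-output map\<close>

fun Aword :: "lss \<Rightarrow> nat list \<Rightarrow> real mat" where
  "Aword \<Sigma> [] = 1\<^sub>m (state_dim \<Sigma>)"
| "Aword \<Sigma> (q # w) = Amat \<Sigma> q * Aword \<Sigma> w"

definition markov_eq :: "lss \<Rightarrow> lss \<Rightarrow> bool" where
  "markov_eq \<Sigma> \<Sigma>' \<longleftrightarrow> (\<forall>q\<in>modes \<Sigma>. \<forall>w\<in>lists (modes \<Sigma>). \<forall>r\<in>modes \<Sigma>.
     Cmat \<Sigma> q * Aword \<Sigma> w * Bmat \<Sigma> r = Cmat \<Sigma>' q * Aword \<Sigma>' w * Bmat \<Sigma>' r)"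

lemma is_lssD:
  assumes "is_lss \<Sigma>" "q \<in> modes \<Sigma>"
  shows "Amat \<Sigma> q \<in> carrier_mat (state_dim \<Sigma>) (state_dim \<Sigma>)"
    "Bmat \<Sigma> q \<in> carrier_mat (state_dim \<Sigma>) (input_dim \<Sigma>)"
    "Cmat \<Sigma> q \<in> carrier_mat (output_dim \<Sigma>) (state_dim \<Sigma>)"
  using assms unfolding is_lss_def by auto

lemma same_typeD:
  assumes "same_type \<Sigma> \<Sigma>'"
  shows "modes \<Sigma>' = modes \<Sigma>" "input_dim \<Sigma>' = input_dim \<Sigma>" "output_dim \<Sigma>' = output_dim \<Sigma>"
  using assms unfolding same_type_def modes_def by auto

lemma Aword_carrier:
  assumes "is_lss \<Sigma>" "w \<in> lists (modes \<Sigma>)"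
  shows "Aword \<Sigma> w \<in> carrier_mat (state_dim \<Sigma>) (state_dim \<Sigma>)"
  using assms(2) by (induction w) (auto intro: mult_carrier_mat is_lssD[OF assms(1)])

lemma Aword_append:
  assumes S: "is_lss \<Sigma>" and w: "w \<in> lists (modes \<Sigma>)" "w' \<in> lists (modes \<Sigma>)"
  shows "Aword \<Sigma> (w @ w') = Aword \<Sigma> w * Aword \<Sigma> w'"
  using w(1)
proof (induction w)
  case Nil
  then show ?case using Aword_carrier[OF S w(2)] by simp
next
  case (Cons q w)
  have c: "Amat \<Sigma> q \<in> carrier_mat (state_dim \<Sigma>) (state_dim \<Sigma>)" "Aword \<Sigma> w \<in> carrier_mat (state_dim \<Sigma>) (state_dim \<Sigma>)"
    using Cons is_lssD(1)[OF S] Aword_carrier[OF S] by auto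
  have "Aword \<Sigma> ((q # w) @ w') = Amat \<Sigma> q * (Aword \<Sigma> w * Aword \<Sigma> w')" using Cons by simp
  also have "\<dots> = Amat \<Sigma> q * Aword \<Sigma> w * Aword \<Sigma> w'"
    by (rule assoc_mult_mat[symmetric, OF c Aword_carrier[OF S w(2)]])
  finally show ?case by simp
qed

lemma Aword_snoc:
  assumes S: "is_lss \<Sigma>" and w: "w \<in> lists (modes \<Sigma>)" and q: "q \<in> modes \<Sigma>"
  shows "Aword \<Sigma> (w @ [q]) = Aword \<Sigma> w * Amat \<Sigma> q"
  using Aword_append[OF S w, of "[q]"] q is_lssD(1)[OF S q] by simp

lemma CA_carrier:
  assumes "is_lss \<Sigma>" "q \<in> modes \<Sigma>" "w \<in> lists (modes \<Sigma>)"
  shows "Cmat \<Sigma> q * Aword \<Sigma> w \<in> carrier_mat (output_dim \<Sigma>) (state_dim \<Sigma>)"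
  using is_lssD(3)[OF assms(1,2)] Aword_carrier[OF assms(1,3)] by (rule mult_carrier_mat)

lemma CA_snoc:
  assumes S: "is_lss \<Sigma>" and q: "q \<in> modes \<Sigma>" and w: "w \<in> lists (modes \<Sigma>)" and r: "r \<in> modes \<Sigma>"
  shows "Cmat \<Sigma> q * Aword \<Sigma> (w @ [r]) = Cmat \<Sigma> q * Aword \<Sigma> w * Amat \<Sigma> r"
  unfolding Aword_snoc[OF S w r]
  by (rule assoc_mult_mat[symmetric, OF is_lssD(3)[OF S q] Aword_carrier[OF S w] is_lssD(1)[OF S r]])

lemma eq_mat_by_mult_vec:
  assumes "M \<in> carrier_mat p m" "N \<in> carrier_mat p m"
    and "\<And>v. v \<in> carrier_vec m \<Longrightarrow> M *\<^sub>v v = N *\<^sub>v (v :: real vec)"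
  shows "M = N"
proof (rule eq_matI)
  fix i j assume "i < dim_row N" "j < dim_col N"
  then have ij: "i < p" "j < m" using assms(2) by auto
  have "(M *\<^sub>v unit_vec m j) $ i = (N *\<^sub>v unit_vec m j) $ i" by (subst assms(3)) auto
  then show "M $$ (i, j) = N $$ (i, j)" using assms(1,2) ij by (simp add: scalar_prod_right_unit)
qed (use assms in auto)

lemma mult_mat_zero_vec: "M \<in> carrier_mat p m \<Longrightarrow> M *\<^sub>v 0\<^sub>v m = 0\<^sub>v p"
  by auto

lemma mult_vec_eq_by_rows:
  assumes M: "M \<in> carrier_mat p n" "M' \<in> carrier_mat p n'"
    and "\<And>i. i < p \<Longrightarrow> row M i \<bullet> x = row M' i \<bullet> y"
  shows "M *\<^sub>v x = M' *\<^sub>v y"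
  by (rule eq_vecI) (use assms in auto)

lemma row_eq_if_mult_vec_eq:
  assumes "M \<in> carrier_mat p n" "M' \<in> carrier_mat p n'" "i < p" "M *\<^sub>v x = M' *\<^sub>v y"
  shows "row M i \<bullet> x = row M' i \<bullet> y"
  using arg_cong[OF assms(4), of "\<lambda>v. v $ i"] assms(1-3) by simp

text \<open>\<open>X\<close> collects the pairs of states that the two systems reach under the same inputs. Taking for \<open>l\<close> and \<open>l'\<close>
  rows of \<open>C\<^sub>q A\<^sub>w\<close>, \<open>step\<close> propagates the equality of these functionals on \<open>X\<close> to longer words.\<close>

lemma markov_eq_if_reachable_pairs:
  assumes S: "is_lss \<Sigma>" "is_lss \<Sigma>'" and ty: "same_type \<Sigma> \<Sigma>'"
    and X: "\<And>x y. (x, y) \<in> X \<Longrightarrow> x \<in> carrier_vec (state_dim \<Sigma>) \<and> y \<in> carrier_vec (state_dim \<Sigma>')"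
    and zero: "(0\<^sub>v (state_dim \<Sigma>), 0\<^sub>v (state_dim \<Sigma>')) \<in> X"
    and out: "\<And>x y q. (x, y) \<in> X \<Longrightarrow> q \<in> modes \<Sigma> \<Longrightarrow> Cmat \<Sigma> q *\<^sub>v x = Cmat \<Sigma>' q *\<^sub>v y"
    and step: "\<And>l l' x y q v. l \<in> carrier_vec (state_dim \<Sigma>) \<Longrightarrow> l' \<in> carrier_vec (state_dim \<Sigma>') \<Longrightarrow>
       (\<And>x y. (x, y) \<in> X \<Longrightarrow> l \<bullet> x = l' \<bullet> y) \<Longrightarrow> (x, y) \<in> X \<Longrightarrow> q \<in> modes \<Sigma> \<Longrightarrow> v \<in> carrier_vec (input_dim \<Sigma>) \<Longrightarrow>
       l \<bullet> (Amat \<Sigma> q *\<^sub>v x + Bmat \<Sigma> q *\<^sub>v v) = l' \<bullet> (Amat \<Sigma>' q *\<^sub>v y + Bmat \<Sigma>' q *\<^sub>v v)"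
  shows "markov_eq \<Sigma> \<Sigma>'"
proof -
  note T = same_typeD[OF ty]
  note D = is_lssD[OF S(1)] and D' = is_lssD[OF S(2), unfolded T]
  note CA = CA_carrier[OF S(1)] and CA' = CA_carrier[OF S(2), unfolded T]
  have one: "Cmat \<Sigma> q * Aword \<Sigma> w *\<^sub>v (Amat \<Sigma> r *\<^sub>v x + Bmat \<Sigma> r *\<^sub>v v) =
      Cmat \<Sigma>' q * Aword \<Sigma>' w *\<^sub>v (Amat \<Sigma>' r *\<^sub>v y + Bmat \<Sigma>' r *\<^sub>v v)"
    if q: "q \<in> modes \<Sigma>" and w: "w \<in> lists (modes \<Sigma>)"
      and IH: "\<And>x y. (x, y) \<in> X \<Longrightarrow> Cmat \<Sigma> q * Aword \<Sigma> w *\<^sub>v x = Cmat \<Sigma>' q * Aword \<Sigma>' w *\<^sub>v y"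
      and xy: "(x, y) \<in> X" and r: "r \<in> modes \<Sigma>" and v: "v \<in> carrier_vec (input_dim \<Sigma>)" for q w x y r v
  proof (rule mult_vec_eq_by_rows[OF CA[OF q w] CA'[OF q w]])
    fix i assume i: "i < output_dim \<Sigma>"
    note M = CA[OF q w] and M' = CA'[OF q w]
    have rc: "row M i \<in> carrier_vec m" if "M \<in> carrier_mat (output_dim \<Sigma>) m" for m and M :: "real mat"
      using that i by auto
    show "row (Cmat \<Sigma> q * Aword \<Sigma> w) i \<bullet> (Amat \<Sigma> r *\<^sub>v x + Bmat \<Sigma> r *\<^sub>v v) =
       row (Cmat \<Sigma>' q * Aword \<Sigma>' w) i \<bullet> (Amat \<Sigma>' r *\<^sub>v y + Bmat \<Sigma>' r *\<^sub>v v)"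
      by (rule step[OF rc[OF M] rc[OF M'] row_eq_if_mult_vec_eq[OF M M' i IH] xy r v])
  qed
  have main: "Cmat \<Sigma> q * Aword \<Sigma> w *\<^sub>v x = Cmat \<Sigma>' q * Aword \<Sigma>' w *\<^sub>v y"
    if q: "q \<in> modes \<Sigma>" and w: "w \<in> lists (modes \<Sigma>)" and xy: "(x, y) \<in> X" for q w x y
    using w xy
  proof (induction w arbitrary: x y rule: rev_induct)
    case Nil
    then show ?case using out[OF Nil(2) q] D(3)[OF q] D'(3)[OF q] by simp
  next
    case (snoc r w)
    then have w: "w \<in> lists (modes \<Sigma>)" and r: "r \<in> modes \<Sigma>" by auto
    note xc = X[OF snoc.prems(2), THEN conjunct1] and yc = X[OF snoc.prems(2), THEN conjunct2]
    \<comment> \<open>With zero input the step is a pure application of \<open>Amat\<close>, which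
      lengthens the word by \<open>r\<close>.\<close>
    have z: "Bmat \<Sigma> r *\<^sub>v 0\<^sub>v (input_dim \<Sigma>) = 0\<^sub>v (state_dim \<Sigma>)" "Bmat \<Sigma>' r *\<^sub>v 0\<^sub>v (input_dim \<Sigma>) = 0\<^sub>v (state_dim \<Sigma>')"
      using D(2)[OF r] D'(2)[OF r] by auto
    have "Cmat \<Sigma> q * Aword \<Sigma> w *\<^sub>v (Amat \<Sigma> r *\<^sub>v x) = Cmat \<Sigma>' q * Aword \<Sigma>' w *\<^sub>v (Amat \<Sigma>' r *\<^sub>v y)"
      using one[OF q w snoc.IH[OF w] snoc.prems(2) r, of "0\<^sub>v (input_dim \<Sigma>)"] z
        mult_mat_vec_carrier[OF D(1)[OF r] xc] mult_mat_vec_carrier[OF D'(1)[OF r] yc] by simp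
    then show ?case
      unfolding CA_snoc[OF S(1) q w r] CA_snoc[OF S(2), unfolded T, OF q w r]
      using assoc_mult_mat_vec[OF CA[OF q w] D(1)[OF r] xc] assoc_mult_mat_vec[OF CA'[OF q w] D'(1)[OF r] yc]
      by simp
  qed
  show ?thesis unfolding markov_eq_def
  proof (intro ballI)
    fix q w r assume q: "q \<in> modes \<Sigma>" and w: "w \<in> lists (modes \<Sigma>)" and r: "r \<in> modes \<Sigma>"
    show "Cmat \<Sigma> q * Aword \<Sigma> w * Bmat \<Sigma> r = Cmat \<Sigma>' q * Aword \<Sigma>' w * Bmat \<Sigma>' r"
    proof (rule eq_mat_by_mult_vec[OF mult_carrier_mat[OF CA[OF q w] D(2)[OF r]] mult_carrier_mat[OF CA'[OF q w] D'(2)[OF r]]])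
      fix v :: "real vec" assume v: "v \<in> carrier_vec (input_dim \<Sigma>)"
      \<comment> \<open>From the pair of zero states the step is a pure application of
        \<open>Bmat\<close> and yields the Markov parameters.\<close>
      have z: "Amat \<Sigma> r *\<^sub>v 0\<^sub>v (state_dim \<Sigma>) = 0\<^sub>v (state_dim \<Sigma>)" "Amat \<Sigma>' r *\<^sub>v 0\<^sub>v (state_dim \<Sigma>') = 0\<^sub>v (state_dim \<Sigma>')"
        using D(1)[OF r] D'(1)[OF r] by auto
      show "Cmat \<Sigma> q * Aword \<Sigma> w * Bmat \<Sigma> r *\<^sub>v v = Cmat \<Sigma>' q * Aword \<Sigma>' w * Bmat \<Sigma>' r *\<^sub>v v"
        using one[OF q w main[OF q w] zero r v] z
          assoc_mult_mat_vec[OF CA[OF q w] D(2)[OF r] v] assoc_mult_mat_vec[OF CA'[OF q w] D'(2)[OF r] v]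
          mult_mat_vec_carrier[OF D(2)[OF r] v] mult_mat_vec_carrier[OF D'(2)[OF r] v] by simp
    qed
  qed
qed

lemma markov_eq_mult_vec:
  assumes S: "is_lss \<Sigma>" "is_lss \<Sigma>'" and ty: "same_type \<Sigma> \<Sigma>'" and mk: "markov_eq \<Sigma> \<Sigma>'"
    and q: "q \<in> modes \<Sigma>" "w \<in> lists (modes \<Sigma>)" "r \<in> modes \<Sigma>" and v: "v \<in> carrier_vec (input_dim \<Sigma>)"
  shows "Cmat \<Sigma> q * Aword \<Sigma> w *\<^sub>v (Bmat \<Sigma> r *\<^sub>v v) = Cmat \<Sigma>' q * Aword \<Sigma>' w *\<^sub>v (Bmat \<Sigma>' r *\<^sub>v v)"
proof -
  note T = same_typeD[OF ty]
  have "Cmat \<Sigma> q * Aword \<Sigma> w * Bmat \<Sigma> r *\<^sub>v v = Cmat \<Sigma>' q * Aword \<Sigma>' w * Bmat \<Sigma>' r *\<^sub>v v"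
    using mk q unfolding markov_eq_def by simp
  then show ?thesis
    using assoc_mult_mat_vec[OF CA_carrier[OF S(1) q(1,2)] is_lssD(2)[OF S(1) q(3)] v]
      assoc_mult_mat_vec[OF CA_carrier[OF S(2)] is_lssD(2)[OF S(2)], unfolded T, OF q v] by simp
qed

section \<open>Discrete-time trajectories\<close>

primrec dt_state :: "lss \<Rightarrow> (nat \<Rightarrow> real vec) \<Rightarrow> (nat \<Rightarrow> nat) \<Rightarrow> nat \<Rightarrow> real vec" where
  "dt_state \<Sigma> u q 0 = 0\<^sub>v (state_dim \<Sigma>)"
| "dt_state \<Sigma> u q (Suc t) = Amat \<Sigma> (q t) *\<^sub>v dt_state \<Sigma> u q t + Bmat \<Sigma> (q t) *\<^sub>v u t"

lemma dt_state_carrier: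
  assumes "is_lss \<Sigma>" "u \<in> dt_inputs (input_dim \<Sigma>)" "q \<in> dt_switchings (modes \<Sigma>)"
  shows "dt_state \<Sigma> u q t \<in> carrier_vec (state_dim \<Sigma>)"
proof (induction t)
  case (Suc t)
  have q: "q t \<in> modes \<Sigma>" using assms(3) by (simp add: dt_switchings_def)
  have u: "u t \<in> carrier_vec (input_dim \<Sigma>)" using assms(2) by (simp add: dt_inputs_def)
  show ?case unfolding dt_state.simps
    by (rule add_carrier_vec[OF mult_mat_vec_carrier[OF is_lssD(1)[OF assms(1) q] Suc]
          mult_mat_vec_carrier[OF is_lssD(2)[OF assms(1) q] u]])
qed simp

text \<open>The recursion determines the state sequence, so the definite description in
  \<open>dt_output\<close> has exactly one candidate.\<close>

lemma dt_output_eq: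
  assumes S: "is_lss \<Sigma>" and u: "u \<in> dt_inputs (input_dim \<Sigma>)" and q: "q \<in> dt_switchings (modes \<Sigma>)"
  shows "dt_output \<Sigma> (0\<^sub>v (state_dim \<Sigma>)) u q = (\<lambda>t. Cmat \<Sigma> (q t) *\<^sub>v dt_state \<Sigma> u q t)"
  unfolding dt_output_def
proof (rule the_equality)
  have "q t \<in> modes \<Sigma>" for t using q by (simp add: dt_switchings_def)
  then show "\<exists>x. dt_solution \<Sigma> (0\<^sub>v (state_dim \<Sigma>)) u q x (\<lambda>t. Cmat \<Sigma> (q t) *\<^sub>v dt_state \<Sigma> u q t)"
    using dt_state_carrier[OF S u q] is_lssD(3)[OF S]
    by (intro exI[of _ "dt_state \<Sigma> u q"]) (auto simp: dt_solution_def intro!: mult_mat_vec_carrier)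
next
  fix y assume "\<exists>x. dt_solution \<Sigma> (0\<^sub>v (state_dim \<Sigma>)) u q x y"
  then obtain x where x: "dt_solution \<Sigma> (0\<^sub>v (state_dim \<Sigma>)) u q x y" by blast
  then have "x t = dt_state \<Sigma> u q t" for t
    by (induction t) (auto simp: dt_solution_def)
  with x show "y = (\<lambda>t. Cmat \<Sigma> (q t) *\<^sub>v dt_state \<Sigma> u q t)" by (auto simp: dt_solution_def)
qed

lemma dt_state_cong:
  "(\<And>s. s < t \<Longrightarrow> u s = u' s \<and> q s = q' s) \<Longrightarrow> dt_state \<Sigma> u q t = dt_state \<Sigma> u' q' t"
  by (induction t) auto

lemma dt_inputs_fun_upd:
  assumes "u \<in> dt_inputs m" "v \<in> carrier_vec m"
  shows "u(t := v) \<in> dt_inputs m"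
proof -
  have "summable (\<lambda>s. u s \<bullet> u s)" using assms by (auto simp: dt_inputs_def)
  moreover have "finite {s. (u(t := v)) s \<bullet> (u(t := v)) s \<noteq> u s \<bullet> u s}"
    by (rule finite_subset[of _ "{t}"]) auto
  then have "eventually (\<lambda>s. (u(t := v)) s \<bullet> (u(t := v)) s = u s \<bullet> u s) sequentially"
    by (auto simp: cofinite_eq_sequentially[symmetric] eventually_cofinite)
  ultimately have "summable (\<lambda>s. (u(t := v)) s \<bullet> (u(t := v)) s)"
    by (subst summable_cong) 
  then show ?thesis using assms by (auto simp: dt_inputs_def)
qed

text \<open>The state at time \<open>t\<close> depends only on data before \<open>t\<close>, so mode
  and input at \<open>t\<close> may be reset to any \<open>r\<close> and \<open>v\<close>. The
  output at \<open>t\<close> then reads the state in an arbitrary mode, and the state at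
  \<open>Suc t\<close> realises an arbitrary step; these are the two conditions on the set of
  reachable pairs.\<close>

lemma dt_same_io_map_imp_markov_eq:
  assumes S: "is_lss \<Sigma>" "is_lss \<Sigma>'" and ty: "same_type \<Sigma> \<Sigma>'" and io: "same_io_map Discrete_Time \<Sigma> \<Sigma>'"
  shows "markov_eq \<Sigma> \<Sigma>'"
proof -
  note T = same_typeD[OF ty]
  define X where "X = {(dt_state \<Sigma> u q t, dt_state \<Sigma>' u q t) | u q t.
    u \<in> dt_inputs (input_dim \<Sigma>) \<and> q \<in> dt_switchings (modes \<Sigma>)}"
  have XI: "(dt_state \<Sigma> u q t, dt_state \<Sigma>' u q t) \<in> X"
    if "u \<in> dt_inputs (input_dim \<Sigma>)" "q \<in> dt_switchings (modes \<Sigma>)" for u q t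
    unfolding X_def using that by blast
  have q0: "1 \<in> modes \<Sigma>" using S(1) unfolding is_lss_def modes_def by simp
  show ?thesis
  proof (rule markov_eq_if_reachable_pairs[OF S ty, of X])
    fix x y assume "(x, y) \<in> X"
    then show "x \<in> carrier_vec (state_dim \<Sigma>) \<and> y \<in> carrier_vec (state_dim \<Sigma>')"
      using dt_state_carrier[OF S(1)] dt_state_carrier[OF S(2), unfolded T] unfolding X_def by blast
  next
    have "(\<lambda>t. 0\<^sub>v (input_dim \<Sigma>)) \<in> dt_inputs (input_dim \<Sigma>)" "(\<lambda>t. 1) \<in> dt_switchings (modes \<Sigma>)"
      using q0 by (auto simp: dt_inputs_def dt_switchings_def)
    then show "(0\<^sub>v (state_dim \<Sigma>), 0\<^sub>v (state_dim \<Sigma>')) \<in> X"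
      using XI[of _ _ 0] by simp
  next
    fix x y r assume "(x, y) \<in> X" and r: "r \<in> modes \<Sigma>"
    then obtain u q t where uq: "u \<in> dt_inputs (input_dim \<Sigma>)" "q \<in> dt_switchings (modes \<Sigma>)"
      and xy: "x = dt_state \<Sigma> u q t" "y = dt_state \<Sigma>' u q t" unfolding X_def by blast
    have q': "q(t := r) \<in> dt_switchings (modes \<Sigma>)" using uq(2) r by (auto simp: dt_switchings_def)
    have "dt_output \<Sigma> (0\<^sub>v (state_dim \<Sigma>)) u (q(t := r)) = dt_output \<Sigma>' (0\<^sub>v (state_dim \<Sigma>')) u (q(t := r))"
      using io uq(1) q' unfolding same_io_map_def by simp
    then have "Cmat \<Sigma> ((q(t := r)) t) *\<^sub>v dt_state \<Sigma> u (q(t := r)) t = Cmat \<Sigma>' ((q(t := r)) t) *\<^sub>v dt_state \<Sigma>' u (q(t := r)) t"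
      unfolding dt_output_eq[OF S(1) uq(1) q'] dt_output_eq[OF S(2), unfolded T, OF uq(1) q'] by meson
    moreover have "dt_state \<Sigma> u (q(t := r)) t = x" "dt_state \<Sigma>' u (q(t := r)) t = y"
      unfolding xy by (rule dt_state_cong; simp)+
    ultimately show "Cmat \<Sigma> r *\<^sub>v x = Cmat \<Sigma>' r *\<^sub>v y" by simp
  next
    fix l l' x y r and v :: "real vec"
    assume l: "\<And>x y. (x, y) \<in> X \<Longrightarrow> l \<bullet> x = l' \<bullet> y"
      and "(x, y) \<in> X" and r: "r \<in> modes \<Sigma>" and v: "v \<in> carrier_vec (input_dim \<Sigma>)"
    then obtain u q t where uq: "u \<in> dt_inputs (input_dim \<Sigma>)" "q \<in> dt_switchings (modes \<Sigma>)"
      and xy: "x = dt_state \<Sigma> u q t" "y = dt_state \<Sigma>' u q t" unfolding X_def by blast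
    have q': "q(t := r) \<in> dt_switchings (modes \<Sigma>)" using uq(2) r by (auto simp: dt_switchings_def)
    have u': "u(t := v) \<in> dt_inputs (input_dim \<Sigma>)" by (rule dt_inputs_fun_upd[OF uq(1) v])
    have "dt_state \<Sigma> (u(t := v)) (q(t := r)) t = x" "dt_state \<Sigma>' (u(t := v)) (q(t := r)) t = y"
      unfolding xy by (rule dt_state_cong; simp)+
    then have "dt_state \<Sigma> (u(t := v)) (q(t := r)) (Suc t) = Amat \<Sigma> r *\<^sub>v x + Bmat \<Sigma> r *\<^sub>v v"
      "dt_state \<Sigma>' (u(t := v)) (q(t := r)) (Suc t) = Amat \<Sigma>' r *\<^sub>v y + Bmat \<Sigma>' r *\<^sub>v v" by simp_all
    then have "(Amat \<Sigma> r *\<^sub>v x + Bmat \<Sigma> r *\<^sub>v v, Amat \<Sigma>' r *\<^sub>v y + Bmat \<Sigma>' r *\<^sub>v v) \<in> X"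
      using XI[OF u' q', of "Suc t"] by simp
    then show "l \<bullet> (Amat \<Sigma> r *\<^sub>v x + Bmat \<Sigma> r *\<^sub>v v) = l' \<bullet> (Amat \<Sigma>' r *\<^sub>v y + Bmat \<Sigma>' r *\<^sub>v v)"
      by (rule l)
  qed
qed

text \<open>Induction on time for all words at once: going back one time step appends the current
  mode to the right end of the word and splits off a Markov parameter applied to the input.\<close>

lemma dt_markov_eq_imp_same_io_map:
  assumes S: "is_lss \<Sigma>" "is_lss \<Sigma>'" and ty: "same_type \<Sigma> \<Sigma>'" and mk: "markov_eq \<Sigma> \<Sigma>'"
  shows "same_io_map Discrete_Time \<Sigma> \<Sigma>'"
proof -
  note T = same_typeD[OF ty]
  note D = is_lssD[OF S(1)] and D' = is_lssD[OF S(2), unfolded T]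
  note CA = CA_carrier[OF S(1)] and CA' = CA_carrier[OF S(2), unfolded T]
  have "dt_output \<Sigma> (0\<^sub>v (state_dim \<Sigma>)) u q = dt_output \<Sigma>' (0\<^sub>v (state_dim \<Sigma>')) u q"
    if u: "u \<in> dt_inputs (input_dim \<Sigma>)" and q: "q \<in> dt_switchings (modes \<Sigma>)" for u q
  proof -
    note sc = dt_state_carrier[OF S(1) u q] and sc' = dt_state_carrier[OF S(2), unfolded T, OF u q]
    have qm: "q t \<in> modes \<Sigma>" and um: "u t \<in> carrier_vec (input_dim \<Sigma>)" for t
      using q u by (auto simp: dt_switchings_def dt_inputs_def)
    have main: "Cmat \<Sigma> r * Aword \<Sigma> w *\<^sub>v dt_state \<Sigma> u q t = Cmat \<Sigma>' r * Aword \<Sigma>' w *\<^sub>v dt_state \<Sigma>' u q t"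
      if r: "r \<in> modes \<Sigma>" and w: "w \<in> lists (modes \<Sigma>)" for r w t
      using w
    proof (induction t arbitrary: w)
      case 0
      then show ?case using mult_mat_zero_vec[OF CA[OF r 0]] mult_mat_zero_vec[OF CA'[OF r 0]] by simp
    next
      case (Suc t)
      note w = Suc.prems
      have w': "w @ [q t] \<in> lists (modes \<Sigma>)" using w qm by simp
      have "Cmat \<Sigma> r * Aword \<Sigma> w *\<^sub>v dt_state \<Sigma> u q (Suc t) =
        Cmat \<Sigma> r * Aword \<Sigma> (w @ [q t]) *\<^sub>v dt_state \<Sigma> u q t + Cmat \<Sigma> r * Aword \<Sigma> w *\<^sub>v (Bmat \<Sigma> (q t) *\<^sub>v u t)"
        unfolding CA_snoc[OF S(1) r w qm] assoc_mult_mat_vec[OF CA[OF r w] D(1)[OF qm] sc] dt_state.simps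
        by (rule mult_add_distrib_mat_vec[OF CA[OF r w] mult_mat_vec_carrier[OF D(1)[OF qm] sc] mult_mat_vec_carrier[OF D(2)[OF qm] um]])
      moreover have "Cmat \<Sigma>' r * Aword \<Sigma>' w *\<^sub>v dt_state \<Sigma>' u q (Suc t) =
        Cmat \<Sigma>' r * Aword \<Sigma>' (w @ [q t]) *\<^sub>v dt_state \<Sigma>' u q t + Cmat \<Sigma>' r * Aword \<Sigma>' w *\<^sub>v (Bmat \<Sigma>' (q t) *\<^sub>v u t)"
        unfolding CA_snoc[OF S(2), unfolded T, OF r w qm] assoc_mult_mat_vec[OF CA'[OF r w] D'(1)[OF qm] sc'] dt_state.simps
        by (rule mult_add_distrib_mat_vec[OF CA'[OF r w] mult_mat_vec_carrier[OF D'(1)[OF qm] sc'] mult_mat_vec_carrier[OF D'(2)[OF qm] um]])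
      ultimately show ?case
        using Suc.IH[OF w'] markov_eq_mult_vec[OF S ty mk r w qm um] by simp
    qed
    have "Cmat \<Sigma> (q t) *\<^sub>v dt_state \<Sigma> u q t = Cmat \<Sigma>' (q t) *\<^sub>v dt_state \<Sigma>' u q t" for t
      using main[OF qm, of "[]" t t] D(3)[OF qm, of t] D'(3)[OF qm, of t] by simp
    then show ?thesis
      unfolding dt_output_eq[OF S(1) u q] dt_output_eq[OF S(2), unfolded T, OF u q] by simp
  qed
  then show ?thesis unfolding same_io_map_def by simp
qed

section \<open>The continuous-time input-output map\<close>

definition ct_a :: "lss \<Rightarrow> (real \<Rightarrow> nat) \<Rightarrow> nat \<Rightarrow> nat \<Rightarrow> real \<Rightarrow> real" where
  "ct_a \<Sigma> q i j t = Amat \<Sigma> (q t) $$ (i, j)"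

definition ct_g :: "lss \<Rightarrow> (real \<Rightarrow> real vec) \<Rightarrow> (real \<Rightarrow> nat) \<Rightarrow> nat \<Rightarrow> real \<Rightarrow> real" where
  "ct_g \<Sigma> u q i t = (\<Sum>j<input_dim \<Sigma>. Bmat \<Sigma> (q t) $$ (i, j) * u t $ j)"

definition ct_state :: "lss \<Rightarrow> (real \<Rightarrow> real vec) \<Rightarrow> (real \<Rightarrow> nat) \<Rightarrow> real \<Rightarrow> real vec" where
  "ct_state \<Sigma> u q t = vec (state_dim \<Sigma>) (\<lambda>i. picard_sol (state_dim \<Sigma>) (ct_a \<Sigma> q) (ct_g \<Sigma> u q) i t)"

lemma mult_mat_vec_index_sum:
  assumes "M \<in> carrier_mat p m" "v \<in> carrier_vec m" "i < p"
  shows "(M *\<^sub>v v) $ i = (\<Sum>j<m. M $$ (i, j) * v $ j)"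
  using assms by (simp add: scalar_prod_def atLeast0LessThan)

text \<open>Convergence in the discrete space \<open>nat\<close> means being eventually constant, so
  an arbitrary function of the mode respects the limit.\<close>

lemma tendsto_nat_compose:
  fixes q :: "'a \<Rightarrow> nat" and \<phi> :: "nat \<Rightarrow> 'b::topological_space"
  assumes "(q \<longlongrightarrow> l) F"
  shows "((\<lambda>t. \<phi> (q t)) \<longlongrightarrow> \<phi> l) F"
proof -
  have "eventually (\<lambda>t. q t = l) F" using assms by (simp add: tendsto_discrete)
  then have "eventually (\<lambda>t. \<phi> (q t) = \<phi> l) F" by (rule eventually_mono) simp
  then show ?thesis by (rule tendsto_eventually)
qed

text \<open>Extended by zero outside \<open>{0..b}\<close> the function is continuous off a finite
  set, namely the discontinuities of \<open>q\<close> and the two endpoints at which the extension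
  may jump. Such a function is Borel.\<close>

lemma piecewise_continuous_compose_measurable:
  fixes q :: "real \<Rightarrow> nat" and \<phi> :: "nat \<Rightarrow> real"
  assumes q: "piecewise_continuous q" and b: "0 \<le> b"
  shows "(\<lambda>t. \<phi> (q t)) \<in> borel_measurable (lebesgue_on {0..b})"
proof -
  define D where "D = {t \<in> {0..b}. \<not> continuous (at t within {0..}) q}"
  have D: "finite D" using q b unfolding piecewise_continuous_def D_def by blast
  define f where "f = (\<lambda>t. if t \<in> {0..b} then \<phi> (q t) else 0)"
  have cont: "isCont f t" if t: "t \<in> - (D \<union> {0, b})" for t
  proof (cases "t \<in> {0..b}")
    case True
    then have t': "0 < t" "t < b" using t by auto
    have "continuous (at t within {0..}) q" using t True unfolding D_def by auto
    moreover have "at t within {0..} = at t"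
      by (rule at_within_interior) (use t' in simp)
    ultimately have "(q \<longlongrightarrow> q t) (at t)" by (simp add: continuous_within)
    then have "((\<lambda>t. \<phi> (q t)) \<longlongrightarrow> \<phi> (q t)) (at t)" by (rule tendsto_nat_compose)
    moreover have "eventually (\<lambda>s. f s = \<phi> (q s)) (at t)"
    proof -
      have "eventually (\<lambda>s. s \<in> {0<..<b}) (at t)"
        by (rule eventually_at_in_open') (use t' in auto)
      then show ?thesis by (rule eventually_mono) (auto simp: f_def)
    qed
    ultimately have "(f \<longlongrightarrow> \<phi> (q t)) (at t)"
      by (subst tendsto_cong)
    then show ?thesis using True by (simp add: isCont_def f_def)
  next
    case False
    have "eventually (\<lambda>s. s \<in> - {0..b}) (at t)"
      by (rule eventually_at_in_open') (use False in auto)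
    then have "eventually (\<lambda>s. f s = 0) (at t)" by (rule eventually_mono) (auto simp: f_def)
    then have "(f \<longlongrightarrow> 0) (at t)" by (rule tendsto_eventually)
    moreover have "f t = 0" using False by (auto simp: f_def)
    ultimately show ?thesis by (simp add: isCont_def)
  qed
  have "f \<in> borel_measurable borel"
  proof (rule borel_measurable_continuous_countable_exceptions)
    show "countable (D \<union> {0, b})" using D by (simp add: countable_finite)
    show "continuous_on (- (D \<union> {0, b})) f" using cont by (intro continuous_at_imp_continuous_on ballI)
  qed
  then have "f \<in> borel_measurable lborel" by simp
  then have "f \<in> borel_measurable lebesgue" by (rule measurable_completion)
  then have "f \<in> borel_measurable (lebesgue_on {0..b})" by (rule measurable_restrict_space1)
  then show ?thesis
    by (rule measurable_cong[THEN iffD1, rotated]) (auto simp: f_def)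
qed

lemma ct_inputs_component_l2:
  assumes u: "u \<in> ct_inputs m" and j: "j < m"
  shows "l2_loc (\<lambda>t. u t $ j)"
proof (rule l2_loc_bound)
  fix b :: real assume "b \<ge> 0"
  have "(\<lambda>t. u t $ j) \<in> borel_measurable (lebesgue_on {0..})" using u j by (auto simp: ct_inputs_def)
  then show "(\<lambda>t. u t $ j) \<in> borel_measurable (lebesgue_on {0..b})"
    by (rule measurable_restrict_mono) auto
  have "integrable (lebesgue_on {0..}) (\<lambda>t. u t \<bullet> u t)" using u by (auto simp: ct_inputs_def)
  then have "(\<lambda>t. u t \<bullet> u t) integrable_on {0..}" by (rule integrable_on_lebesgue_on) auto
  then show "(\<lambda>t. u t \<bullet> u t) integrable_on {0..b}" by (rule integrable_on_subinterval) auto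
next
  fix t :: real assume "t \<ge> 0"
  then have "u t \<in> carrier_vec m" using u by (auto simp: ct_inputs_def)
  then have "u t \<bullet> u t = (\<Sum>i<m. (u t $ i)\<^sup>2)"
    by (simp add: scalar_prod_def atLeast0LessThan power2_eq_square)
  then show "(u t $ j)\<^sup>2 \<le> u t \<bullet> u t"
    using member_le_sum[of j "{..<m}" "\<lambda>i. (u t $ i)\<^sup>2"] j by simp
qed

lemma ct_switchings_compose_bounded:
  fixes \<phi> :: "nat \<Rightarrow> real"
  assumes "finite Q" "q \<in> ct_switchings Q" "t \<ge> 0"
  shows "\<bar>\<phi> (q t)\<bar> \<le> (\<Sum>r\<in>Q. \<bar>\<phi> r\<bar>)"
  by (rule member_le_sum) (use assms in \<open>auto simp: ct_switchings_def\<close>)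

lemma ct_linear_integral_equation:
  assumes u: "u \<in> ct_inputs (input_dim \<Sigma>)" and q: "q \<in> ct_switchings (modes \<Sigma>)"
  obtains K where "linear_integral_equation (state_dim \<Sigma>) (ct_a \<Sigma> q) (ct_g \<Sigma> u q) K"
proof -
  let ?n = "state_dim \<Sigma>"
  have fm: "finite (modes \<Sigma>)" by (simp add: modes_def)
  have pc: "piecewise_continuous q" using q by (simp add: ct_switchings_def)
  \<comment> \<open>A crude bound common to all entries and all modes.\<close>
  define K where "K = (\<Sum>i<?n. \<Sum>j<?n. \<Sum>r\<in>modes \<Sigma>. \<bar>Amat \<Sigma> r $$ (i, j)\<bar>)"
  have "linear_integral_equation ?n (ct_a \<Sigma> q) (ct_g \<Sigma> u q) K"
  proof
    show "K \<ge> 0" unfolding K_def by (intro sum_nonneg) auto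
    fix i j assume ij: "i < ?n" "j < ?n"
    show "ct_a \<Sigma> q i j \<in> borel_measurable (lebesgue_on {0..b})" if "b \<ge> 0" for b
      using piecewise_continuous_compose_measurable[OF pc that, of "\<lambda>r. Amat \<Sigma> r $$ (i, j)"]
      unfolding ct_a_def .
    fix t :: real assume t: "t \<ge> 0"
    have "\<bar>ct_a \<Sigma> q i j t\<bar> \<le> (\<Sum>r\<in>modes \<Sigma>. \<bar>Amat \<Sigma> r $$ (i, j)\<bar>)"
      unfolding ct_a_def using ct_switchings_compose_bounded[OF fm q t, of "\<lambda>r. Amat \<Sigma> r $$ (i, j)"] .
    also have "\<dots> \<le> (\<Sum>j<?n. \<Sum>r\<in>modes \<Sigma>. \<bar>Amat \<Sigma> r $$ (i, j)\<bar>)"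
      by (rule member_le_sum[where f = "\<lambda>j. \<Sum>r\<in>modes \<Sigma>. \<bar>Amat \<Sigma> r $$ (i, j)\<bar>"]) (use ij in \<open>auto intro!: sum_nonneg\<close>)
    also have "\<dots> \<le> K" unfolding K_def
      by (rule member_le_sum[where f = "\<lambda>i. \<Sum>j<?n. \<Sum>r\<in>modes \<Sigma>. \<bar>Amat \<Sigma> r $$ (i, j)\<bar>"]) (use ij in \<open>auto intro!: sum_nonneg\<close>)
    finally show "\<bar>ct_a \<Sigma> q i j t\<bar> \<le> K" .
  next
    fix i assume "i < ?n"
    show "l2_loc (ct_g \<Sigma> u q i)" unfolding ct_g_def
    proof (intro l2_loc_sum)
      fix j assume "j \<in> {..<input_dim \<Sigma>}"
      then have j: "j < input_dim \<Sigma>" by simp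
      show "l2_loc (\<lambda>t. Bmat \<Sigma> (q t) $$ (i, j) * u t $ j)"
        by (rule l2_loc_bounded_mult[OF ct_inputs_component_l2[OF u j]
              piecewise_continuous_compose_measurable[OF pc, where \<phi> = "\<lambda>r. Bmat \<Sigma> r $$ (i, j)"]
              ct_switchings_compose_bounded[OF fm q, where \<phi> = "\<lambda>r. Bmat \<Sigma> r $$ (i, j)"]])
    qed simp
  qed
  then show thesis by (rule that)
qed

lemma negligible_if_AE_lebesgue_on:
  assumes "AE t in lebesgue_on {0..}. P t"
  shows "\<exists>N. negligible N \<and> (\<forall>t\<in>{0..} - N. P (t :: real))"
proof -
  have "AE t in lebesgue. t \<in> {0..} \<longrightarrow> P t"
    using assms by (subst (asm) AE_restrict_space_iff) auto
  then obtain N where "{t \<in> space lebesgue. \<not> (t \<in> {0..} \<longrightarrow> P t)} \<subseteq> N" "emeasure lebesgue N = 0" "N \<in> sets lebesgue"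
    by (rule AE_E)
  then show ?thesis
    by (intro exI[of _ N]) (auto simp: negligible_iff_null_sets null_sets_def)
qed

lemma AE_lebesgue_on_if_negligible:
  assumes "negligible N" "\<And>t. t \<in> {0..} - N \<Longrightarrow> P t"
  shows "AE t in lebesgue_on {0..}. P (t :: real)"
proof -
  have "AE t in lebesgue. t \<in> {0..} \<longrightarrow> P t"
    by (rule AE_I'[of N]) (use assms in \<open>auto simp: negligible_iff_null_sets\<close>)
  then show ?thesis by (subst AE_restrict_space_iff) auto
qed

context
  fixes \<Sigma> u q
  assumes S: "is_lss \<Sigma>" and u: "u \<in> ct_inputs (input_dim \<Sigma>)" and q: "q \<in> ct_switchings (modes \<Sigma>)"
begin

lemma ct_switching_mode: "t \<ge> 0 \<Longrightarrow> q t \<in> modes \<Sigma>"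
  using q by (simp add: ct_switchings_def)

lemma ct_input_carrier: "t \<ge> 0 \<Longrightarrow> u t \<in> carrier_vec (input_dim \<Sigma>)"
  using u by (simp add: ct_inputs_def)

lemma ct_state_carrier: "ct_state \<Sigma> u q t \<in> carrier_vec (state_dim \<Sigma>)"
  by (simp add: ct_state_def)

lemma ct_g_eq:
  assumes "t \<ge> 0" "i < state_dim \<Sigma>"
  shows "ct_g \<Sigma> u q i t = (Bmat \<Sigma> (q t) *\<^sub>v u t) $ i"
  unfolding ct_g_def
  using mult_mat_vec_index_sum[OF is_lssD(2)[OF S ct_switching_mode] ct_input_carrier] assms by simp

lemma ct_rhs_eq:
  assumes t: "t \<ge> 0" and i: "i < state_dim \<Sigma>" and x: "x \<in> carrier_vec (state_dim \<Sigma>)"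
  shows "(Amat \<Sigma> (q t) *\<^sub>v x + Bmat \<Sigma> (q t) *\<^sub>v u t) $ i =
    ct_g \<Sigma> u q i t + (\<Sum>j<state_dim \<Sigma>. ct_a \<Sigma> q i j t * x $ j)"
  unfolding ct_g_eq[OF t i] ct_a_def
  using mult_mat_vec_index_sum[OF is_lssD(1)[OF S ct_switching_mode[OF t]] x i]
    carrier_matD[OF is_lssD(2)[OF S ct_switching_mode[OF t]]] i by simp

lemma ct_state_continuous: "i < state_dim \<Sigma> \<Longrightarrow> continuous_on {0..b} (\<lambda>t. ct_state \<Sigma> u q t $ i)"
  using linear_integral_equation.picard_sol_continuous[of "state_dim \<Sigma>" "ct_a \<Sigma> q" "ct_g \<Sigma> u q" _ i b]
    ct_linear_integral_equation[OF u q] by (simp add: ct_state_def) metis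

lemma ct_state_solves: "solves_integral_eq (state_dim \<Sigma>) (ct_a \<Sigma> q) (ct_g \<Sigma> u q) b (\<lambda>i t. ct_state \<Sigma> u q t $ i)"
proof -
  obtain K where K: "linear_integral_equation (state_dim \<Sigma>) (ct_a \<Sigma> q) (ct_g \<Sigma> u q) K"
    using ct_linear_integral_equation[OF u q] .
  show ?thesis
    using linear_integral_equation.picard_sol_solves[OF K, of b]
    unfolding solves_integral_eq_def ct_state_def by simp
qed

lemma ct_state_unique:
  assumes "solves_integral_eq (state_dim \<Sigma>) (ct_a \<Sigma> q) (ct_g \<Sigma> u q) b (\<lambda>i t. x t $ i)"
    and "t \<in> {0..b}" "x t \<in> carrier_vec (state_dim \<Sigma>)"
  shows "x t = ct_state \<Sigma> u q t"
proof -
  obtain K where K: "linear_integral_equation (state_dim \<Sigma>) (ct_a \<Sigma> q) (ct_g \<Sigma> u q) K"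
    using ct_linear_integral_equation[OF u q] .
  show ?thesis
    by (rule eq_vecI)
      (use linear_integral_equation.integral_eq_unique[OF K assms(1) ct_state_solves] assms(2,3) ct_state_carrier[of t] in auto)
qed

lemma ct_state_integral:
  assumes "i < state_dim \<Sigma>" "t \<ge> 0"
  shows "ct_state \<Sigma> u q t $ i = integral {0..t} (\<lambda>s. ct_g \<Sigma> u q i s + (\<Sum>j<state_dim \<Sigma>. ct_a \<Sigma> q i j s * ct_state \<Sigma> u q s $ j))"
  using ct_state_solves[of t] assms unfolding solves_integral_eq_def by simp

lemma ct_rhs_l2:
  assumes "i < state_dim \<Sigma>" "\<And>j b. j < state_dim \<Sigma> \<Longrightarrow> continuous_on {0..b} (\<lambda>t. x t $ j)"
  shows "l2_loc (\<lambda>s. ct_g \<Sigma> u q i s + (\<Sum>j<state_dim \<Sigma>. ct_a \<Sigma> q i j s * x s $ j))"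
proof -
  obtain K where K: "linear_integral_equation (state_dim \<Sigma>) (ct_a \<Sigma> q) (ct_g \<Sigma> u q) K"
    using ct_linear_integral_equation[OF u q] .
  show ?thesis
    by (rule linear_integral_equation.solution_rhs_l2[OF K assms(1), where f = "\<lambda>j t. x t $ j"]) (rule assms(2))
qed

text \<open>An absolutely continuous function is the integral of its almost-everywhere derivative,
  so any solution in the sense of \<open>ct_solution\<close> satisfies the integral equation, and
  that has only one solution.\<close>

lemma ct_solution_state:
  assumes sol: "ct_solution \<Sigma> (0\<^sub>v (state_dim \<Sigma>)) u q x y" and t: "t \<ge> 0"
  shows "x t = ct_state \<Sigma> u q t"
proof -
  have xc: "\<And>t. t \<ge> 0 \<Longrightarrow> x t \<in> carrier_vec (state_dim \<Sigma>)"
    and ac: "\<And>i. i < state_dim \<Sigma> \<Longrightarrow> absolutely_continuous_signal (\<lambda>t. x t $ i)"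
    and x0: "x 0 = 0\<^sub>v (state_dim \<Sigma>)"
    and ae: "AE t in lebesgue_on {0..}. \<forall>i<state_dim \<Sigma>.
        ((\<lambda>s. x s $ i) has_real_derivative
           (Amat \<Sigma> (q t) *\<^sub>v x t + Bmat \<Sigma> (q t) *\<^sub>v u t) $ i) (at t within {0..})"
    using sol unfolding ct_solution_def by auto
  obtain N where N: "negligible N" "\<And>t i. t \<in> {0..} - N \<Longrightarrow> i < state_dim \<Sigma> \<Longrightarrow>
      ((\<lambda>s. x s $ i) has_real_derivative
           (Amat \<Sigma> (q t) *\<^sub>v x t + Bmat \<Sigma> (q t) *\<^sub>v u t) $ i) (at t within {0..})"
    using negligible_if_AE_lebesgue_on[OF ae] by (elim exE conjE) simp
  have cont: "continuous_on {0..b} (\<lambda>t. x t $ i)" if "i < state_dim \<Sigma>" for i b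
  proof (cases "b \<ge> 0")
    case True
    then show ?thesis using absolutely_continuous_imp_continuous_on ac[OF that]
      unfolding absolutely_continuous_signal_def by blast
  qed auto
  have "solves_integral_eq (state_dim \<Sigma>) (ct_a \<Sigma> q) (ct_g \<Sigma> u q) t (\<lambda>i t. x t $ i)"
    unfolding solves_integral_eq_def
  proof (intro allI impI conjI ballI cont)
    fix i s assume i: "i < state_dim \<Sigma>" and s: "s \<in> {0..t}"
    have "x s $ i = x 0 $ i + integral {0..s} (\<lambda>s. ct_g \<Sigma> u q i s + (\<Sum>j<state_dim \<Sigma>. ct_a \<Sigma> q i j s * x s $ j))"
    proof (rule absolutely_continuous_eq_integral[OF ac[OF i] ct_rhs_l2[OF i cont] N(1)])
      fix t assume "t \<in> {0..} - N"
      then show "((\<lambda>s. x s $ i) has_real_derivative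
           ct_g \<Sigma> u q i t + (\<Sum>j<state_dim \<Sigma>. ct_a \<Sigma> q i j t * x t $ j)) (at t within {0..})"
        using N(2)[of t i] i ct_rhs_eq[of t i "x t"] xc[of t] by simp
    qed (use s in auto)
    then show "x s $ i = integral {0..s} (\<lambda>s. ct_g \<Sigma> u q i s + (\<Sum>j<state_dim \<Sigma>. ct_a \<Sigma> q i j s * x s $ j))"
      using x0 i by simp
  qed
  then show ?thesis by (rule ct_state_unique) (use t xc in auto)
qed

lemma ct_state_zero: "ct_state \<Sigma> u q 0 = 0\<^sub>v (state_dim \<Sigma>)"
  by (rule eq_vecI) (use ct_state_integral[of _ 0] ct_state_carrier[of 0] in auto)

text \<open>The state is continuous and the mode is eventually constant on either side of a point,
  so one-sided limits exist and the output is continuous wherever \<open>q\<close> is.\<close>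

lemma ct_output_component_piecewise_continuous:
  assumes i: "i < output_dim \<Sigma>"
  shows "piecewise_continuous (\<lambda>t. (restrict (\<lambda>t. Cmat \<Sigma> (q t) *\<^sub>v ct_state \<Sigma> u q t) {0..} t) $ i)" (is "piecewise_continuous ?y")
proof -
  define y where "y = (\<lambda>t. \<Sum>j<state_dim \<Sigma>. Cmat \<Sigma> (q t) $$ (i, j) * ct_state \<Sigma> u q t $ j)"
  have eq: "?y t = y t" if "t \<ge> 0" for t
    unfolding y_def using mult_mat_vec_index_sum[OF is_lssD(3)[OF S ct_switching_mode[OF that]] ct_state_carrier i] that by simp
  have xlim: "((\<lambda>t. ct_state \<Sigma> u q t $ j) \<longlongrightarrow> ct_state \<Sigma> u q t $ j) (at t within {0..})" if "j < state_dim \<Sigma>" "t \<ge> 0" for j t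
  proof -
    have "((\<lambda>t. ct_state \<Sigma> u q t $ j) \<longlongrightarrow> ct_state \<Sigma> u q t $ j) (at t within {0..t + 1})"
      using ct_state_continuous[OF that(1), of "t + 1"] that(2) unfolding continuous_on_def by auto
    moreover have "at t within {0..t + 1} = at t within {0..}"
      by (rule at_within_nhd[of _ "{..<t+1}"]) (use that in auto)
    ultimately show ?thesis by simp
  qed
  have ylim: "(y \<longlongrightarrow> (\<Sum>j<state_dim \<Sigma>. Cmat \<Sigma> l $$ (i, j) * ct_state \<Sigma> u q t $ j)) (at t within T)"
    if "(q \<longlongrightarrow> l) (at t within T)" "T \<subseteq> {0..}" "t \<ge> 0" for t l T
    unfolding y_def
    by (intro tendsto_sum tendsto_mult tendsto_nat_compose[OF that(1)] tendsto_within_subset[OF xlim that(2)])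
      (use that in auto)
  have pc: "piecewise_continuous q" using q by (simp add: ct_switchings_def)
  show ?thesis unfolding piecewise_continuous_def
  proof (intro conjI allI impI)
    fix b :: real assume b: "0 \<le> b"
    have "{t \<in> {0..b}. \<not> continuous (at t within {0..}) ?y} \<subseteq> {t \<in> {0..b}. \<not> continuous (at t within {0..}) q}"
    proof (rule ccontr)
      assume "\<not> ?thesis"
      then obtain t where t: "t \<in> {0..b}" "\<not> continuous (at t within {0..}) ?y" "continuous (at t within {0..}) q" by blast
      then have "(y \<longlongrightarrow> y t) (at t within {0..})"
        using ylim[of "q t" t "{0..}"] by (auto simp: continuous_within y_def)
      then have "(?y \<longlongrightarrow> ?y t) (at t within {0..})"
        by (rule Lim_transform_eventually[THEN tendsto_eq_rhs]) (use t eq in \<open>auto simp: eventually_at_filter\<close>)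
      then show False using t(2) by (simp add: continuous_within)
    qed
    then show "finite {t \<in> {0..b}. \<not> continuous (at t within {0..}) ?y}"
      by (rule finite_subset) (use pc b in \<open>simp add: piecewise_continuous_def\<close>)
  next
    fix t :: real assume t: "0 \<le> t"
    obtain l where "(q \<longlongrightarrow> l) (at_right t)" using pc t unfolding piecewise_continuous_def by blast
    moreover have "{t<..} \<subseteq> {0..}" using t by auto
    ultimately have "(y \<longlongrightarrow> (\<Sum>j<state_dim \<Sigma>. Cmat \<Sigma> l $$ (i, j) * ct_state \<Sigma> u q t $ j)) (at_right t)" by (rule ylim[OF _ _ t])
    moreover have "eventually (\<lambda>s. y s = ?y s) (at_right t)"
      using t eq by (auto simp: eventually_at_filter)
    ultimately show "\<exists>l. (?y \<longlongrightarrow> l) (at_right t)" by (blast intro: Lim_transform_eventually)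
  next
    fix t :: real assume t: "0 < t"
    obtain l where l: "(q \<longlongrightarrow> l) (at_left t)" using pc t unfolding piecewise_continuous_def by blast
    \<comment> \<open>Continuity of the state is available within \<open>{0..}\<close> only, so the
      left limit is taken within \<open>{0..<t}\<close>, which is the same filter for positive
      \<open>t\<close>.\<close>
    have *: "at t within {0..<t} = at_left t"
      by (rule at_within_nhd[of _ "{0<..}"]) (use t in auto)
    have "(y \<longlongrightarrow> (\<Sum>j<state_dim \<Sigma>. Cmat \<Sigma> l $$ (i, j) * ct_state \<Sigma> u q t $ j)) (at t within {0..<t})"
      by (rule ylim) (use l * t in auto)
    moreover have "eventually (\<lambda>s. y s = ?y s) (at t within {0..<t})"
      using eq by (auto simp: eventually_at_filter)
    ultimately show "\<exists>l. (?y \<longlongrightarrow> l) (at_left t)" unfolding * by (blast intro: Lim_transform_eventually)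
  qed
qed

lemma ct_solution_ct_state:
  "ct_solution \<Sigma> (0\<^sub>v (state_dim \<Sigma>)) u q (ct_state \<Sigma> u q) (\<lambda>t\<in>{0..}. Cmat \<Sigma> (q t) *\<^sub>v ct_state \<Sigma> u q t)"
  unfolding ct_solution_def
proof (intro conjI allI impI)
  define h where "h = (\<lambda>i s. ct_g \<Sigma> u q i s + (\<Sum>j<state_dim \<Sigma>. ct_a \<Sigma> q i j s * ct_state \<Sigma> u q s $ j))"
  have h: "l2_loc (h i)" if "i < state_dim \<Sigma>" for i
    unfolding h_def by (rule ct_rhs_l2[OF that ct_state_continuous])
  have st: "ct_state \<Sigma> u q t $ i = integral {0..t} (h i)" if "i < state_dim \<Sigma>" "t \<ge> 0" for i t
    unfolding h_def by (rule ct_state_integral[OF that])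
  show "\<And>t. ct_state \<Sigma> u q t \<in> carrier_vec (state_dim \<Sigma>)" by (rule ct_state_carrier)
  show "ct_state \<Sigma> u q 0 = 0\<^sub>v (state_dim \<Sigma>)" by (rule ct_state_zero)
  show "(\<lambda>t\<in>{0..}. Cmat \<Sigma> (q t) *\<^sub>v ct_state \<Sigma> u q t) \<in> {0..} \<rightarrow>\<^sub>E carrier_vec (output_dim \<Sigma>)"
    using mult_mat_vec_carrier[OF is_lssD(3)[OF S ct_switching_mode] ct_state_carrier] by auto
  show "\<And>i. i < output_dim \<Sigma> \<Longrightarrow> piecewise_continuous (\<lambda>t. (\<lambda>t\<in>{0..}. Cmat \<Sigma> (q t) *\<^sub>v ct_state \<Sigma> u q t) t $ i)"
    by (rule ct_output_component_piecewise_continuous)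
  show "\<And>t. 0 \<le> t \<Longrightarrow> (\<lambda>t\<in>{0..}. Cmat \<Sigma> (q t) *\<^sub>v ct_state \<Sigma> u q t) t = Cmat \<Sigma> (q t) *\<^sub>v ct_state \<Sigma> u q t" by simp
  fix i assume i: "i < state_dim \<Sigma>"
  have "absolutely_continuous_on_interval 0 b (\<lambda>t. ct_state \<Sigma> u q t $ i)" if b: "b \<ge> 0" for b
  proof -
    have ac: "absolutely_continuous_on_interval 0 b (\<lambda>t. integral {0..t} (h i))"
      using l2_loc_integral_absolutely_continuous[OF h[OF i]] b by (simp add: absolutely_continuous_signal_def)
    \<comment> \<open>The integral formula for the state is available at non-negative times.
      Endpoints of a division of a set inside \<open>{0..b}\<close> are non-negative, so the sums
      agree and the bound carries over.\<close>
    have eq: "(\<Sum>I\<in>\<D>. \<bar>ct_state \<Sigma> u q (Sup I) $ i - ct_state \<Sigma> u q (Inf I) $ i\<bar>) =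
        (\<Sum>I\<in>\<D>. \<bar>integral {0..Sup I} (h i) - integral {0..Inf I} (h i)\<bar>)"
      if D: "\<D> division_of T" "T \<subseteq> {0..b}" for \<D> T
    proof (rule sum.cong)
      fix I assume I: "I \<in> \<D>"
      obtain c d where cd: "I = {c..d}" "c \<le> d"
        using division_ofD(3,4)[OF D(1) I] by (metis atLeastatMost_empty_iff box_real(2))
      have "{c..d} \<subseteq> {0..b}" using division_ofD(2)[OF D(1) I] D(2) unfolding cd(1) by (rule order_trans)
      then have "c \<ge> 0" "d \<ge> 0" using cd(2) by auto
      then show "\<bar>ct_state \<Sigma> u q (Sup I) $ i - ct_state \<Sigma> u q (Inf I) $ i\<bar> = \<bar>integral {0..Sup I} (h i) - integral {0..Inf I} (h i)\<bar>"
        using cd st[OF i] by simp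
    qed simp
    show ?thesis unfolding absolutely_continuous_on_interval_def
    proof (intro allI impI)
      fix \<epsilon> :: real assume e: "\<epsilon> > 0"
      obtain \<delta> where \<delta>0: "\<delta> > 0" and \<delta>: "\<And>\<D> T. \<D> division_of T \<Longrightarrow> T \<subseteq> {0..b} \<Longrightarrow> (\<Sum>I\<in>\<D>. Sup I - Inf I) < \<delta> \<Longrightarrow>
        (\<Sum>I\<in>\<D>. \<bar>integral {0..Sup I} (h i) - integral {0..Inf I} (h i)\<bar>) < \<epsilon>"
        by (rule absolutely_continuous_on_intervalE[OF ac e]) (rule that)
      show "\<exists>\<delta>>0. \<forall>\<D> T. \<D> division_of T \<and> T \<subseteq> {0..b} \<and> (\<Sum>I\<in>\<D>. Sup I - Inf I) < \<delta> \<longrightarrow>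
         (\<Sum>I\<in>\<D>. \<bar>ct_state \<Sigma> u q (Sup I) $ i - ct_state \<Sigma> u q (Inf I) $ i\<bar>) < \<epsilon>"
      proof (intro exI[of _ \<delta>] conjI allI impI \<delta>0)
        fix \<D> T assume "\<D> division_of T \<and> T \<subseteq> {0..b} \<and> (\<Sum>I\<in>\<D>. Sup I - Inf I) < \<delta>"
        then show "(\<Sum>I\<in>\<D>. \<bar>ct_state \<Sigma> u q (Sup I) $ i - ct_state \<Sigma> u q (Inf I) $ i\<bar>) < \<epsilon>"
          using eq[of \<D> T] \<delta>[of \<D> T] by simp
      qed
    qed
  qed
  then show "absolutely_continuous_signal (\<lambda>t. ct_state \<Sigma> u q t $ i)"
    by (simp add: absolutely_continuous_signal_def)
next
  define h where "h = (\<lambda>i s. ct_g \<Sigma> u q i s + (\<Sum>j<state_dim \<Sigma>. ct_a \<Sigma> q i j s * ct_state \<Sigma> u q s $ j))"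
  have h: "l2_loc (h i)" if "i < state_dim \<Sigma>" for i
    unfolding h_def by (rule ct_rhs_l2[OF that ct_state_continuous])
  have "\<forall>i\<in>{..<state_dim \<Sigma>}. \<exists>N. negligible N \<and> (\<forall>t\<in>{0..} - N. ((\<lambda>t. integral {0..t} (h i)) has_real_derivative h i t) (at t within {0..}))"
    using l2_loc_integral_derivative_ae[OF h] by blast
  from bchoice[OF this] obtain N where N: "\<forall>i\<in>{..<state_dim \<Sigma>}. negligible (N i) \<and>
     (\<forall>t\<in>{0..} - N i. ((\<lambda>t. integral {0..t} (h i)) has_real_derivative h i t) (at t within {0..}))" by (elim exE)
  show "AE t in lebesgue_on {0..}. \<forall>i<state_dim \<Sigma>.
        ((\<lambda>s. ct_state \<Sigma> u q s $ i) has_real_derivative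
           (Amat \<Sigma> (q t) *\<^sub>v ct_state \<Sigma> u q t + Bmat \<Sigma> (q t) *\<^sub>v u t) $ i) (at t within {0..})"
  proof (rule AE_lebesgue_on_if_negligible)
    show "negligible (\<Union>i\<in>{..<state_dim \<Sigma>}. N i)" using N by (intro negligible_Union) auto
    fix t assume t: "t \<in> {0..} - (\<Union>i\<in>{..<state_dim \<Sigma>}. N i)"
    then have t0: "t \<ge> 0" by simp
    show "\<forall>i<state_dim \<Sigma>. ((\<lambda>s. ct_state \<Sigma> u q s $ i) has_real_derivative
           (Amat \<Sigma> (q t) *\<^sub>v ct_state \<Sigma> u q t + Bmat \<Sigma> (q t) *\<^sub>v u t) $ i) (at t within {0..})"
    proof (intro allI impI)
      fix i assume i: "i < state_dim \<Sigma>"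
      have "((\<lambda>t. integral {0..t} (h i)) has_real_derivative h i t) (at t within {0..})"
        using N i t by auto
      then have "((\<lambda>s. ct_state \<Sigma> u q s $ i) has_real_derivative h i t) (at t within {0..})"
        by (rule has_field_derivative_transform_within[of _ _ _ _ 1])
          (use t0 ct_state_integral[OF i] in \<open>auto simp: h_def\<close>)
      then show "((\<lambda>s. ct_state \<Sigma> u q s $ i) has_real_derivative
           (Amat \<Sigma> (q t) *\<^sub>v ct_state \<Sigma> u q t + Bmat \<Sigma> (q t) *\<^sub>v u t) $ i) (at t within {0..})"
        unfolding ct_rhs_eq[OF t0 i ct_state_carrier] h_def .
    qed
  qed
qed

text \<open>Outputs are \<open>extensional\<close> on the half-line, so uniqueness of the state at
  non-negative times makes the output unique as a function and settles the definite
  description.\<close>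

lemma ct_output_eq:
  "ct_output \<Sigma> (0\<^sub>v (state_dim \<Sigma>)) u q = (\<lambda>t\<in>{0..}. Cmat \<Sigma> (q t) *\<^sub>v ct_state \<Sigma> u q t)"
  unfolding ct_output_def
proof (rule the_equality)
  show "\<exists>x. ct_solution \<Sigma> (0\<^sub>v (state_dim \<Sigma>)) u q x (\<lambda>t\<in>{0..}. Cmat \<Sigma> (q t) *\<^sub>v ct_state \<Sigma> u q t)"
    using ct_solution_ct_state by blast
  fix y assume "\<exists>x. ct_solution \<Sigma> (0\<^sub>v (state_dim \<Sigma>)) u q x y"
  then obtain x where x: "ct_solution \<Sigma> (0\<^sub>v (state_dim \<Sigma>)) u q x y" by blast
  show "y = (\<lambda>t\<in>{0..}. Cmat \<Sigma> (q t) *\<^sub>v ct_state \<Sigma> u q t)"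
  proof (rule extensionalityI)
    show "y \<in> extensional {0..}" using x by (auto simp: ct_solution_def PiE_def)
    show "(\<lambda>t\<in>{0..}. Cmat \<Sigma> (q t) *\<^sub>v ct_state \<Sigma> u q t) \<in> extensional {0..}" by simp
    fix t :: real assume "t \<in> {0..}"
    then show "y t = (\<lambda>t\<in>{0..}. Cmat \<Sigma> (q t) *\<^sub>v ct_state \<Sigma> u q t) t"
      using x ct_solution_state[OF x, of t] by (simp add: ct_solution_def)
  qed
qed

end

section \<open>The Picard series of the output\<close>

lemma mult_mat_vec_integral:
  fixes M :: "real mat"
  assumes M: "M \<in> carrier_mat p n" and r: "r < p"
    and f: "\<And>i. i < n \<Longrightarrow> f i integrable_on {0..t}"
  shows "(M *\<^sub>v vec n (\<lambda>i. integral {0..t} (f i))) $ r = integral {0..t} (\<lambda>s. (M *\<^sub>v vec n (\<lambda>i. f i s)) $ r)"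
proof -
  have "(M *\<^sub>v vec n (\<lambda>i. integral {0..t} (f i))) $ r = (\<Sum>i<n. M $$ (r, i) * integral {0..t} (f i))"
    using mult_mat_vec_index_sum[OF M, of "vec n (\<lambda>i. integral {0..t} (f i))"] r by simp
  also have "\<dots> = (\<Sum>i<n. integral {0..t} (\<lambda>s. M $$ (r, i) * f i s))"
    by (simp only: Henstock_Kurzweil_Integration.integral_mult_right)
  also have "\<dots> = integral {0..t} (\<lambda>s. \<Sum>i<n. M $$ (r, i) * f i s)"
    by (rule Henstock_Kurzweil_Integration.integral_sum[symmetric]) (simp_all add: f integrable_on_mult_right)
  also have "(\<lambda>s. \<Sum>i<n. M $$ (r, i) * f i s) = (\<lambda>s. (M *\<^sub>v vec n (\<lambda>i. f i s)) $ r)"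
    using mult_mat_vec_index_sum[OF M, of "vec n (\<lambda>i. f i _)"] r by auto
  finally show ?thesis .
qed

definition ct_picard_vec :: "lss \<Rightarrow> (real \<Rightarrow> real vec) \<Rightarrow> (real \<Rightarrow> nat) \<Rightarrow> nat \<Rightarrow> real \<Rightarrow> real vec" where
  "ct_picard_vec \<Sigma> u q k t = vec (state_dim \<Sigma>) (\<lambda>i. picard_term (state_dim \<Sigma>) (ct_a \<Sigma> q) (ct_g \<Sigma> u q) k i t)"

context
  fixes \<Sigma> u q p and M :: "real mat"
  assumes S: "is_lss \<Sigma>" and u: "u \<in> ct_inputs (input_dim \<Sigma>)" and q: "q \<in> ct_switchings (modes \<Sigma>)"
    and M: "M \<in> carrier_mat p (state_dim \<Sigma>)"
begin

lemma mult_ct_picard_vec_0: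
  assumes "r < p"
  shows "(M *\<^sub>v ct_picard_vec \<Sigma> u q 0 t) $ r = integral {0..t} (\<lambda>s. (M *\<^sub>v (Bmat \<Sigma> (q s) *\<^sub>v u s)) $ r)"
proof -
  obtain K where K: "linear_integral_equation (state_dim \<Sigma>) (ct_a \<Sigma> q) (ct_g \<Sigma> u q) K"
    using ct_linear_integral_equation[OF u q] .
  have "(M *\<^sub>v ct_picard_vec \<Sigma> u q 0 t) $ r = integral {0..t} (\<lambda>s. (M *\<^sub>v vec (state_dim \<Sigma>) (\<lambda>i. ct_g \<Sigma> u q i s)) $ r)"
    unfolding ct_picard_vec_def picard_term.simps
    by (rule mult_mat_vec_integral[OF M assms]) (rule l2_loc_integrable[OF linear_integral_equation.g_l2[OF K]])
  also have "\<dots> = integral {0..t} (\<lambda>s. (M *\<^sub>v (Bmat \<Sigma> (q s) *\<^sub>v u s)) $ r)"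
  proof (rule integral_cong)
    fix s assume "s \<in> {0..t}"
    then have s: "s \<ge> 0" by simp
    have "vec (state_dim \<Sigma>) (\<lambda>i. ct_g \<Sigma> u q i s) = Bmat \<Sigma> (q s) *\<^sub>v u s"
      by (rule eq_vecI) (use ct_g_eq[OF S u q s] is_lssD(2)[OF S ct_switching_mode[OF S u q s]] in auto)
    then show "(M *\<^sub>v vec (state_dim \<Sigma>) (\<lambda>i. ct_g \<Sigma> u q i s)) $ r = (M *\<^sub>v (Bmat \<Sigma> (q s) *\<^sub>v u s)) $ r" by simp
  qed
  finally show ?thesis .
qed

text \<open>Pulling \<open>M\<close> under the integral moves the outermost mode matrix from the
  Picard term over to \<open>M\<close>. Started at an output matrix, this spells out words letter by
  letter.\<close>

lemma mult_ct_picard_vec_Suc: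
  assumes "r < p"
  shows "(M *\<^sub>v ct_picard_vec \<Sigma> u q (Suc k) t) $ r = integral {0..t} (\<lambda>s. (M * Amat \<Sigma> (q s) *\<^sub>v ct_picard_vec \<Sigma> u q k s) $ r)"
proof -
  let ?n = "state_dim \<Sigma>"
  let ?f = "\<lambda>i s. \<Sum>j<?n. ct_a \<Sigma> q i j s * picard_term ?n (ct_a \<Sigma> q) (ct_g \<Sigma> u q) k j s"
  obtain K where K: "linear_integral_equation (state_dim \<Sigma>) (ct_a \<Sigma> q) (ct_g \<Sigma> u q) K"
    using ct_linear_integral_equation[OF u q] .
  have "(M *\<^sub>v ct_picard_vec \<Sigma> u q (Suc k) t) $ r = integral {0..t} (\<lambda>s. (M *\<^sub>v vec ?n (\<lambda>i. ?f i s)) $ r)"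
    unfolding ct_picard_vec_def picard_term.simps
    by (rule mult_mat_vec_integral[OF M assms], rule linear_integral_equation.integrand_integrable[OF K _ order_refl])
      (auto intro: linear_integral_equation.picard_term_continuous[OF K])
  also have "\<dots> = integral {0..t} (\<lambda>s. (M * Amat \<Sigma> (q s) *\<^sub>v ct_picard_vec \<Sigma> u q k s) $ r)"
  proof (rule integral_cong)
    fix s assume "s \<in> {0..t}"
    then have s: "s \<ge> 0" by simp
    note A = is_lssD(1)[OF S ct_switching_mode[OF S u q s]]
    have c: "ct_picard_vec \<Sigma> u q k s \<in> carrier_vec ?n" by (simp add: ct_picard_vec_def)
    have "vec ?n (\<lambda>i. ?f i s) = Amat \<Sigma> (q s) *\<^sub>v ct_picard_vec \<Sigma> u q k s"
    proof (rule eq_vecI)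
      fix i assume "i < dim_vec (Amat \<Sigma> (q s) *\<^sub>v ct_picard_vec \<Sigma> u q k s)"
      then have i: "i < ?n" using A by simp
      show "vec ?n (\<lambda>i. ?f i s) $ i = (Amat \<Sigma> (q s) *\<^sub>v ct_picard_vec \<Sigma> u q k s) $ i"
        unfolding mult_mat_vec_index_sum[OF A c i] using i by (simp add: ct_a_def ct_picard_vec_def)
    qed (use A in auto)
    then show "(M *\<^sub>v vec ?n (\<lambda>i. ?f i s)) $ r = (M * Amat \<Sigma> (q s) *\<^sub>v ct_picard_vec \<Sigma> u q k s) $ r"
      using assoc_mult_mat_vec[OF M A c] by simp
  qed
  finally show ?thesis .
qed

lemma mult_ct_picard_vec_sums:
  assumes "r < p" "t \<ge> 0"
  shows "(\<lambda>k. (M *\<^sub>v ct_picard_vec \<Sigma> u q k t) $ r) sums (M *\<^sub>v ct_state \<Sigma> u q t) $ r"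
proof -
  let ?n = "state_dim \<Sigma>"
  let ?pt = "picard_term ?n (ct_a \<Sigma> q) (ct_g \<Sigma> u q)"
  obtain K where K: "linear_integral_equation (state_dim \<Sigma>) (ct_a \<Sigma> q) (ct_g \<Sigma> u q) K"
    using ct_linear_integral_equation[OF u q] .
  have "(\<lambda>k. \<Sum>i<?n. M $$ (r, i) * ?pt k i t) sums (\<Sum>i<?n. M $$ (r, i) * picard_sol ?n (ct_a \<Sigma> q) (ct_g \<Sigma> u q) i t)"
    by (intro sums_sum sums_mult)
      (use linear_integral_equation.picard_sol_pointwise[OF K _ assms(2)] in \<open>simp add: sums_def\<close>)
  moreover have "(M *\<^sub>v ct_picard_vec \<Sigma> u q k t) $ r = (\<Sum>i<?n. M $$ (r, i) * ?pt k i t)" for k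
    using mult_mat_vec_index_sum[OF M, of "ct_picard_vec \<Sigma> u q k t" r] assms by (simp add: ct_picard_vec_def)
  moreover have "(M *\<^sub>v ct_state \<Sigma> u q t) $ r = (\<Sum>i<?n. M $$ (r, i) * picard_sol ?n (ct_a \<Sigma> q) (ct_g \<Sigma> u q) i t)"
    using mult_mat_vec_index_sum[OF M, of "ct_state \<Sigma> u q t" r] assms by (simp add: ct_state_def)
  ultimately show ?thesis by simp
qed

end

text \<open>The states live in different spaces, so the outputs are compared term by term along the
  Picard series. Induction on the index of the term, for all words at once, ends at Markov
  parameters applied to the input.\<close>

lemma ct_markov_eq_imp_same_io_map:
  assumes S: "is_lss \<Sigma>" "is_lss \<Sigma>'" and ty: "same_type \<Sigma> \<Sigma>'" and mk: "markov_eq \<Sigma> \<Sigma>'"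
  shows "same_io_map Continuous_Time \<Sigma> \<Sigma>'"
proof -
  note T = same_typeD[OF ty]
  note CA = CA_carrier[OF S(1)] and CA' = CA_carrier[OF S(2), unfolded T]
  have "ct_output \<Sigma> (0\<^sub>v (state_dim \<Sigma>)) u q = ct_output \<Sigma>' (0\<^sub>v (state_dim \<Sigma>')) u q"
    if u: "u \<in> ct_inputs (input_dim \<Sigma>)" and q: "q \<in> ct_switchings (modes \<Sigma>)" for u q
  proof -
    have u': "u \<in> ct_inputs (input_dim \<Sigma>')" and q': "q \<in> ct_switchings (modes \<Sigma>')" using u q T by auto
    note qm = ct_switching_mode[OF S(1) u q] and um = ct_input_carrier[OF S(1) u q]
    have main: "(Cmat \<Sigma> r * Aword \<Sigma> w *\<^sub>v ct_picard_vec \<Sigma> u q k t) $ i = (Cmat \<Sigma>' r * Aword \<Sigma>' w *\<^sub>v ct_picard_vec \<Sigma>' u q k t) $ i"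
      if r: "r \<in> modes \<Sigma>" and w: "w \<in> lists (modes \<Sigma>)" and i: "i < output_dim \<Sigma>" for r w k t i
      using w
    proof (induction k arbitrary: w t)
      case 0
      show ?case
        unfolding mult_ct_picard_vec_0[OF S(1) u q CA[OF r 0] i] mult_ct_picard_vec_0[OF S(2) u' q' CA'[OF r 0] i]
        by (rule integral_cong) (use markov_eq_mult_vec[OF S ty mk r 0 qm um] in auto)
    next
      case (Suc k)
      note w = Suc.prems
      show ?case
        unfolding mult_ct_picard_vec_Suc[OF S(1) u q CA[OF r w] i] mult_ct_picard_vec_Suc[OF S(2) u' q' CA'[OF r w] i]
      proof (rule integral_cong)
        fix s assume "s \<in> {0..t}"
        then have qs: "q s \<in> modes \<Sigma>" using qm by simp
        have "w @ [q s] \<in> lists (modes \<Sigma>)" using w qs by simp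
        from Suc.IH[OF this, of s]
        show "(Cmat \<Sigma> r * Aword \<Sigma> w * Amat \<Sigma> (q s) *\<^sub>v ct_picard_vec \<Sigma> u q k s) $ i =
          (Cmat \<Sigma>' r * Aword \<Sigma>' w * Amat \<Sigma>' (q s) *\<^sub>v ct_picard_vec \<Sigma>' u q k s) $ i"
          unfolding CA_snoc[OF S(1) r w qs] CA_snoc[OF S(2), unfolded T, OF r w qs] .
      qed
    qed
    have "Cmat \<Sigma> (q t) *\<^sub>v ct_state \<Sigma> u q t = Cmat \<Sigma>' (q t) *\<^sub>v ct_state \<Sigma>' u q t" if t: "t \<ge> 0" for t
    proof (rule eq_vecI)
      note C = is_lssD(3)[OF S(1) qm[OF t]] and C' = is_lssD(3)[OF S(2), unfolded T, OF qm[OF t]]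
      fix i assume "i < dim_vec (Cmat \<Sigma>' (q t) *\<^sub>v ct_state \<Sigma>' u q t)"
      then have i: "i < output_dim \<Sigma>" using C' by simp
      have "(\<lambda>k. (Cmat \<Sigma> (q t) *\<^sub>v ct_picard_vec \<Sigma> u q k t) $ i) = (\<lambda>k. (Cmat \<Sigma>' (q t) *\<^sub>v ct_picard_vec \<Sigma>' u q k t) $ i)"
        using main[OF qm[OF t], of "[]" i _ t] i C C' by simp
      then show "(Cmat \<Sigma> (q t) *\<^sub>v ct_state \<Sigma> u q t) $ i = (Cmat \<Sigma>' (q t) *\<^sub>v ct_state \<Sigma>' u q t) $ i"
        using mult_ct_picard_vec_sums[OF S(1) u q C i t] mult_ct_picard_vec_sums[OF S(2) u' q' C' i t]
        by (simp add: sums_unique2)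
    qed (use is_lssD(3)[OF S(1) qm[OF t]] is_lssD(3)[OF S(2), unfolded T, OF qm[OF t]] in auto)
    then show ?thesis
      unfolding ct_output_eq[OF S(1) u q] ct_output_eq[OF S(2) u' q'] by (intro restrict_ext) simp
  qed
  then show ?thesis unfolding same_io_map_def by simp
qed

section \<open>Recovering Markov parameters from continuous-time outputs\<close>

text \<open>The input is held at \<open>v\<close> for one unit of time and cut off afterwards, which
  keeps it square-integrable.\<close>

definition extend_input :: "real \<Rightarrow> nat \<Rightarrow> real vec \<Rightarrow> (real \<Rightarrow> real vec) \<Rightarrow> real \<Rightarrow> real vec" where
  "extend_input t m v u = (\<lambda>s. if s < t then u s else if s \<le> t + 1 then v else 0\<^sub>v m)"

text \<open>The mode is \<open>r\<close> already at \<open>t\<close> itself, so the output at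
  \<open>t\<close> reads the state in mode \<open>r\<close>.\<close>

definition extend_switching :: "real \<Rightarrow> nat \<Rightarrow> (real \<Rightarrow> nat) \<Rightarrow> real \<Rightarrow> nat" where
  "extend_switching t r q = (\<lambda>s. if s < t then q s else r)"

lemma extend_input_ct_inputs:
  assumes u: "u \<in> ct_inputs m" and v: "v \<in> carrier_vec m" and t: "t \<ge> 0"
  shows "extend_input t m v u \<in> ct_inputs m"
proof -
  let ?u = "extend_input t m v u"
  have if_meas: "(\<lambda>s. if s < t then f s else if s \<le> t + 1 then c else d) \<in> borel_measurable (lebesgue_on {0..})"
    if "f \<in> borel_measurable (lebesgue_on {0..})" for f :: "real \<Rightarrow> real" and c d
  proof -
    have 1: "Measurable.pred (lebesgue_on {0..}) (\<lambda>s. s < t)" "Measurable.pred (lebesgue_on {0..}) (\<lambda>s. s \<le> t + 1)"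
      by (intro measurable_restrict_space1 measurable_completion; simp)+
    show ?thesis
      by (intro measurable_If that measurable_const 1[unfolded pred_def]) auto
  qed
  have eq: "?u s \<bullet> ?u s = (if s < t then u s \<bullet> u s else if s \<le> t + 1 then v \<bullet> v else 0)" for s
    unfolding extend_input_def by simp
  have ui: "integrable (lebesgue_on {0..}) (\<lambda>s. u s \<bullet> u s)" using u by (simp add: ct_inputs_def)
  have ind: "integrable (lebesgue_on {0..}) (\<lambda>s. v \<bullet> v * indicator {t..t+1} s)"
  proof (intro integrable_mult_right integrable_real_indicator)
    show "{t..t+1} \<in> sets (lebesgue_on {0..})" using t by (subst sets_restrict_space_iff) auto
    have "emeasure (lebesgue_on {0..}) {t..t+1} = emeasure lebesgue {t..t+1}"
      using t by (subst emeasure_restrict_space) auto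
    then show "emeasure (lebesgue_on {0..}) {t..t+1} < \<infinity>" by simp
  qed
  have vv: "w \<bullet> w \<ge> 0" for w :: "real vec" by (simp add: scalar_prod_def sum_nonneg)
  have "integrable (lebesgue_on {0..}) (\<lambda>s. ?u s \<bullet> ?u s)"
  proof (rule Bochner_Integration.integrable_bound[OF Bochner_Integration.integrable_add[OF ui ind]])
    show "(\<lambda>s. ?u s \<bullet> ?u s) \<in> borel_measurable (lebesgue_on {0..})"
      unfolding eq by (rule if_meas) (use ui in auto)
    show "AE s in lebesgue_on {0..}. norm (?u s \<bullet> ?u s) \<le> norm (u s \<bullet> u s + v \<bullet> v * indicator {t..t + 1} s)"
      unfolding eq using vv by (intro AE_I2) (auto simp: indicator_def)
  qed
  moreover have "(\<lambda>s. ?u s $ i) \<in> borel_measurable (lebesgue_on {0..})" if "i < m" for i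
  proof -
    have "(\<lambda>s. ?u s $ i) = (\<lambda>s. if s < t then u s $ i else if s \<le> t + 1 then v $ i else 0)"
      using that by (auto simp: extend_input_def)
    moreover have "(\<lambda>s. u s $ i) \<in> borel_measurable (lebesgue_on {0..})" using u that by (simp add: ct_inputs_def)
    ultimately show ?thesis using if_meas by simp
  qed
  moreover have "?u s \<in> carrier_vec m" if "s \<ge> 0" for s
    using u v that by (auto simp: ct_inputs_def extend_input_def)
  ultimately show ?thesis by (simp add: ct_inputs_def)
qed

lemma extend_switching_ct_switchings:
  assumes q: "q \<in> ct_switchings Q" and r: "r \<in> Q" and t: "t \<ge> 0"
  shows "extend_switching t r q \<in> ct_switchings Q"
proof -
  let ?q = "extend_switching t r q"
  have pc: "piecewise_continuous q" and qQ: "\<And>t. t \<ge> 0 \<Longrightarrow> q t \<in> Q" using q by (auto simp: ct_switchings_def)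
  have lt: "eventually (\<lambda>x. ?q x = q x) (at s within T)" if "s < t" for s T
  proof -
    have "eventually (\<lambda>x. x < t) (at s within T)"
      using order_tendstoD(2)[OF tendsto_ident_at that] .
    then show ?thesis by (rule eventually_mono) (simp add: extend_switching_def)
  qed
  have gt: "eventually (\<lambda>x. ?q x = r) (at s within T)" if "s > t" for s T
  proof -
    have "eventually (\<lambda>x. x > t) (at s within T)"
      using order_tendstoD(1)[OF tendsto_ident_at that] .
    then show ?thesis by (rule eventually_mono) (simp add: extend_switching_def)
  qed
  have "piecewise_continuous ?q" unfolding piecewise_continuous_def
  proof (intro conjI allI impI)
    fix b :: real assume b: "0 \<le> b"
    have "{s \<in> {0..b}. \<not> continuous (at s within {0..}) ?q} \<subseteq> insert t {s \<in> {0..b}. \<not> continuous (at s within {0..}) q}"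
    proof
      fix s assume s: "s \<in> {s \<in> {0..b}. \<not> continuous (at s within {0..}) ?q}"
      consider "s < t" | "s = t" | "s > t" by linarith
      then show "s \<in> insert t {s \<in> {0..b}. \<not> continuous (at s within {0..}) q}"
      proof cases
        case 1
        have "(?q \<longlongrightarrow> q s) (at s within {0..}) \<longleftrightarrow> (q \<longlongrightarrow> q s) (at s within {0..})"
          by (rule tendsto_cong[OF lt[OF 1]])
        then show ?thesis using s 1 by (simp add: continuous_within extend_switching_def)
      next
        case 3
        then have "(?q \<longlongrightarrow> ?q s) (at s within {0..})"
          using tendsto_eventually[OF gt[OF 3]] by (simp add: extend_switching_def)
        then show ?thesis using s by (simp add: continuous_within)
      qed simp
    qed
    then show "finite {s \<in> {0..b}. \<not> continuous (at s within {0..}) ?q}"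
      by (rule finite_subset) (use pc b in \<open>simp add: piecewise_continuous_def\<close>)
  next
    fix s :: real assume s: "0 \<le> s"
    show "\<exists>l. (?q \<longlongrightarrow> l) (at_right s)"
    proof (cases "s < t")
      case True
      obtain l where "(q \<longlongrightarrow> l) (at_right s)" using pc s unfolding piecewise_continuous_def by blast
      then show ?thesis using tendsto_cong[OF lt[OF True]] by blast
    next
      case False
      have "eventually (\<lambda>x. ?q x = r) (at_right s)"
        using False by (auto simp: eventually_at_filter extend_switching_def)
      then show ?thesis by (blast intro: tendsto_eventually)
    qed
  next
    fix s :: real assume s: "0 < s"
    show "\<exists>l. (?q \<longlongrightarrow> l) (at_left s)"
    proof (cases "s \<le> t")
      case True
      obtain l where l: "(q \<longlongrightarrow> l) (at_left s)" using pc s unfolding piecewise_continuous_def by blast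
      have "eventually (\<lambda>x. ?q x = q x) (at_left s)"
        using True by (auto simp: eventually_at_filter extend_switching_def)
      then show ?thesis using l tendsto_cong by blast
    next
      case False
      then show ?thesis using tendsto_eventually[OF gt] by (meson not_le)
    qed
  qed
  then show ?thesis using qQ r by (simp add: ct_switchings_def extend_switching_def)
qed

text \<open>On \<open>{t..t+1}\<close> this is the integrand of \<open>l \<bullet> x\<close> along
  the continued trajectory. With \<open>r\<close> and \<open>v\<close> frozen it is continuous, so
  the integral can be differentiated at \<open>t\<close> itself and not just almost
  everywhere.\<close>

definition extend_rhs :: "lss \<Rightarrow> (real \<Rightarrow> real vec) \<Rightarrow> (real \<Rightarrow> nat) \<Rightarrow> real \<Rightarrow> nat \<Rightarrow> real vec \<Rightarrow> real vec \<Rightarrow> real \<Rightarrow> real" where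
  "extend_rhs \<Sigma> u q t r v l s = l \<bullet> (Amat \<Sigma> r *\<^sub>v
      ct_state \<Sigma> (extend_input t (input_dim \<Sigma>) v u) (extend_switching t r q) s + Bmat \<Sigma> r *\<^sub>v v)"

text \<open>The right derivative of the integral at the left end of the window is
  \<open>F t\<close>, and it is 0 as well.\<close>

lemma zero_if_integrals_vanish:
  fixes F :: "real \<Rightarrow> real"
  assumes F: "continuous_on {t..t+1} F" and z: "\<And>s. s \<in> {t..t+1} \<Longrightarrow> integral {t..s} F = 0"
  shows "F t = 0"
proof -
  have "((\<lambda>s. integral {t..s} F) has_vector_derivative F t) (at t within {t..t+1})"
    by (rule integral_has_vector_derivative[OF F]) simp
  moreover have "((\<lambda>s. integral {t..s} F) has_vector_derivative 0) (at t within {t..t+1})"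
    by (rule has_vector_derivative_transform_within[OF has_vector_derivative_const, of 1]) (use z in auto)
  ultimately show ?thesis
    using vector_derivative_unique_within_closed_interval[of t "t+1" t] by simp
qed

context
  fixes \<Sigma> u q and t :: real and r and v l :: "real vec"
  assumes S: "is_lss \<Sigma>" and u: "u \<in> ct_inputs (input_dim \<Sigma>)" and q: "q \<in> ct_switchings (modes \<Sigma>)"
    and t: "t \<ge> 0" and r: "r \<in> modes \<Sigma>" and v: "v \<in> carrier_vec (input_dim \<Sigma>)" and l: "l \<in> carrier_vec (state_dim \<Sigma>)"
begin

abbreviation "er \<equiv> extend_rhs \<Sigma> u q t r v l"
abbreviation "xe \<equiv> ct_state \<Sigma> (extend_input t (input_dim \<Sigma>) v u) (extend_switching t r q)"

lemmas ue = extend_input_ct_inputs[OF u v t] and qe = extend_switching_ct_switchings[OF q r t]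

text \<open>On \<open>{0..t}\<close> the continued data differ from the old ones at most at
  \<open>t\<close>, a null set.\<close>

lemma ct_state_extend: "xe t = ct_state \<Sigma> u q t"
proof (rule ct_state_unique[OF S u q, where b = t and x = xe])
  show "solves_integral_eq (state_dim \<Sigma>) (ct_a \<Sigma> q) (ct_g \<Sigma> u q) t (\<lambda>i t. xe t $ i)"
    by (rule solves_integral_eq_spike[OF ct_state_solves[OF S ue qe], of "{t}"])
      (auto simp: ct_a_def ct_g_def extend_switching_def extend_input_def)
qed (use t ct_state_carrier[OF S ue qe] in auto)

lemma extend_rhs_eq:
  assumes "s \<in> {t..t+1}"
  shows "er s = (\<Sum>i<state_dim \<Sigma>. l $ i * (ct_g \<Sigma> (extend_input t (input_dim \<Sigma>) v u) (extend_switching t r q) i s +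
      (\<Sum>j<state_dim \<Sigma>. ct_a \<Sigma> (extend_switching t r q) i j s * xe s $ j)))"
proof -
  have s: "s \<ge> 0" "extend_switching t r q s = r" "extend_input t (input_dim \<Sigma>) v u s = v"
    using assms t by (auto simp: extend_switching_def extend_input_def)
  have c: "Amat \<Sigma> r *\<^sub>v xe s + Bmat \<Sigma> r *\<^sub>v v \<in> carrier_vec (state_dim \<Sigma>)"
    by (rule add_carrier_vec[OF mult_mat_vec_carrier[OF is_lssD(1)[OF S r] ct_state_carrier[OF S ue qe]]
          mult_mat_vec_carrier[OF is_lssD(2)[OF S r] v]])
  have "er s = (\<Sum>i<state_dim \<Sigma>. l $ i * (Amat \<Sigma> r *\<^sub>v xe s + Bmat \<Sigma> r *\<^sub>v v) $ i)"
    unfolding extend_rhs_def scalar_prod_def using carrier_vecD[OF c] by (simp only: atLeast0LessThan)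
  then show ?thesis
    using ct_rhs_eq[OF S ue qe s(1) _ ct_state_carrier[OF S ue qe]] by (simp add: s(2,3))
qed

lemma extend_rhs_continuous: "continuous_on {t..t+1} er"
proof -
  have "continuous_on {t..t+1} (\<lambda>s. \<Sum>i<state_dim \<Sigma>. l $ i * ((\<Sum>j<state_dim \<Sigma>. Amat \<Sigma> r $$ (i, j) * xe s $ j) + (Bmat \<Sigma> r *\<^sub>v v) $ i))"
    by (intro continuous_intros continuous_on_subset[OF ct_state_continuous[OF S ue qe, where b = "t + 1"]]) (use t in auto)
  moreover have "er s = (\<Sum>i<state_dim \<Sigma>. l $ i * ((\<Sum>j<state_dim \<Sigma>. Amat \<Sigma> r $$ (i, j) * xe s $ j) + (Bmat \<Sigma> r *\<^sub>v v) $ i))" for s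
  proof -
    note A = is_lssD(1)[OF S r] and B = is_lssD(2)[OF S r]
    show ?thesis
      unfolding extend_rhs_def scalar_prod_def
      using mult_mat_vec_index_sum[OF A ct_state_carrier[OF S ue qe, of s]] carrier_matD[OF A] carrier_matD[OF B]
      by (auto simp: atLeast0LessThan intro!: sum.cong)
  qed
  ultimately show ?thesis by simp
qed

lemma ct_state_extend_integral:
  assumes s: "s \<in> {t..t+1}"
  shows "l \<bullet> xe s = l \<bullet> xe t + integral {t..s} er"
proof -
  let ?ue = "extend_input t (input_dim \<Sigma>) v u" and ?qe = "extend_switching t r q"
  define h where "h = (\<lambda>i s. ct_g \<Sigma> ?ue ?qe i s + (\<Sum>j<state_dim \<Sigma>. ct_a \<Sigma> ?qe i j s * xe s $ j))"
  have h: "l2_loc (h i)" if "i < state_dim \<Sigma>" for i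
    unfolding h_def by (rule ct_rhs_l2[OF S ue qe that ct_state_continuous[OF S ue qe]])
  have lx: "l \<bullet> xe s' = (\<Sum>i<state_dim \<Sigma>. l $ i * xe s' $ i)" for s'
    unfolding scalar_prod_def using carrier_vecD[OF ct_state_carrier[OF S ue qe, of s']] by (simp only: atLeast0LessThan)
  have xi: "xe s $ i - xe t $ i = integral {t..s} (h i)" if i: "i < state_dim \<Sigma>" for i
    using ct_state_integral[OF S ue qe i, of s] ct_state_integral[OF S ue qe i, of t] integral_Ioc_diff[OF h[OF i] t, of s] s t
    by (simp add: h_def)
  have "l \<bullet> xe s - l \<bullet> xe t = (\<Sum>i<state_dim \<Sigma>. l $ i * (xe s $ i - xe t $ i))"
    unfolding lx by (simp add: sum_subtractf right_diff_distrib)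
  also have "\<dots> = (\<Sum>i<state_dim \<Sigma>. integral {t..s} (\<lambda>s. l $ i * h i s))"
    using xi by simp
  also have "\<dots> = integral {t..s} (\<lambda>s. \<Sum>i<state_dim \<Sigma>. l $ i * h i s)"
    by (rule Henstock_Kurzweil_Integration.integral_sum[symmetric])
      (auto intro!: integrable_on_mult_right l2_loc_integrable_sub[OF h t])
  also have "\<dots> = integral {t..s} er"
    by (rule integral_cong, subst extend_rhs_eq) (use s in \<open>auto simp: h_def\<close>)
  finally show ?thesis by simp
qed

end

text \<open>Functionals that agree on all reachable pairs agree along a continued trajectory, hence
  have the same right derivative at \<open>t\<close>. That derivative is the functional applied to
  an arbitrary right-hand side; it takes the place of the successor state of discrete time.\<close>

lemma ct_same_io_map_imp_markov_eq:
  assumes S: "is_lss \<Sigma>" "is_lss \<Sigma>'" and ty: "same_type \<Sigma> \<Sigma>'" and io: "same_io_map Continuous_Time \<Sigma> \<Sigma>'"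
  shows "markov_eq \<Sigma> \<Sigma>'"
proof -
  note T = same_typeD[OF ty]
  let ?m = "input_dim \<Sigma>"
  define X where "X = {(ct_state \<Sigma> u q t, ct_state \<Sigma>' u q t) | u q t.
    u \<in> ct_inputs ?m \<and> q \<in> ct_switchings (modes \<Sigma>) \<and> t \<ge> 0}"
  have XI: "(ct_state \<Sigma> u q t, ct_state \<Sigma>' u q t) \<in> X"
    if "u \<in> ct_inputs ?m" "q \<in> ct_switchings (modes \<Sigma>)" "t \<ge> 0" for u q t
    unfolding X_def using that by blast
  have XE: thesis if "(x, y) \<in> X" "\<And>u q t. u \<in> ct_inputs ?m \<Longrightarrow> q \<in> ct_switchings (modes \<Sigma>) \<Longrightarrow> t \<ge> 0 \<Longrightarrow>
      x = ct_state \<Sigma> u q t \<Longrightarrow> y = ct_state \<Sigma>' u q t \<Longrightarrow> thesis" for x y thesis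
    using that unfolding X_def by blast
  have one: "1 \<in> modes \<Sigma>" using S(1) unfolding is_lss_def modes_def by simp
  show ?thesis
  proof (rule markov_eq_if_reachable_pairs[OF S ty, of X])
    fix x y assume "(x, y) \<in> X"
    then show "x \<in> carrier_vec (state_dim \<Sigma>) \<and> y \<in> carrier_vec (state_dim \<Sigma>')"
      by (rule XE) (simp add: ct_state_def)
  next
    have u0: "(\<lambda>t. 0\<^sub>v ?m) \<in> ct_inputs ?m" and q0: "(\<lambda>t. 1) \<in> ct_switchings (modes \<Sigma>)"
      using one by (auto simp: ct_inputs_def ct_switchings_def piecewise_continuous_def)
    show "(0\<^sub>v (state_dim \<Sigma>), 0\<^sub>v (state_dim \<Sigma>')) \<in> X"
      using XI[OF u0 q0, of 0] ct_state_zero[OF S(1) u0 q0] ct_state_zero[OF S(2), unfolded T, OF u0 q0] by simp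
  next
    fix x y r assume "(x, y) \<in> X" and r: "r \<in> modes \<Sigma>"
    then obtain u q t where uq: "u \<in> ct_inputs ?m" "q \<in> ct_switchings (modes \<Sigma>)" "t \<ge> 0"
      and xy: "x = ct_state \<Sigma> u q t" "y = ct_state \<Sigma>' u q t" by (elim XE)
    let ?u = "extend_input t ?m (0\<^sub>v ?m) u" and ?q = "extend_switching t r q"
    have z: "0\<^sub>v ?m \<in> carrier_vec ?m" by simp
    note ue = extend_input_ct_inputs[OF uq(1) z uq(3)] and qe = extend_switching_ct_switchings[OF uq(2) r uq(3)]
    have "ct_output \<Sigma> (0\<^sub>v (state_dim \<Sigma>)) ?u ?q t = ct_output \<Sigma>' (0\<^sub>v (state_dim \<Sigma>')) ?u ?q t"
      using io ue qe unfolding same_io_map_def by simp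
    moreover have "?q t = r" by (simp add: extend_switching_def)
    moreover have "ct_state \<Sigma> ?u ?q t = x" "ct_state \<Sigma>' ?u ?q t = y"
      unfolding xy using ct_state_extend[OF S(1) uq r z zero_carrier_vec] ct_state_extend[OF S(2), unfolded T, OF uq r z zero_carrier_vec] by simp_all
    ultimately show "Cmat \<Sigma> r *\<^sub>v x = Cmat \<Sigma>' r *\<^sub>v y"
      unfolding ct_output_eq[OF S(1) ue qe] ct_output_eq[OF S(2), unfolded T, OF ue qe] using uq(3) by simp
  next
    fix l l' x y r and v :: "real vec"
    assume lc: "l \<in> carrier_vec (state_dim \<Sigma>)" "l' \<in> carrier_vec (state_dim \<Sigma>')"
      and l: "\<And>x y. (x, y) \<in> X \<Longrightarrow> l \<bullet> x = l' \<bullet> y"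
      and "(x, y) \<in> X" and r: "r \<in> modes \<Sigma>" and v: "v \<in> carrier_vec ?m"
    then obtain u q t where uq: "u \<in> ct_inputs ?m" "q \<in> ct_switchings (modes \<Sigma>)" "t \<ge> 0"
      and xy: "x = ct_state \<Sigma> u q t" "y = ct_state \<Sigma>' u q t" by (elim XE)
    let ?u = "extend_input t ?m v u" and ?q = "extend_switching t r q"
    note ue = extend_input_ct_inputs[OF uq(1) v uq(3)] and qe = extend_switching_ct_switchings[OF uq(2) r uq(3)]
    define F where "F = extend_rhs \<Sigma> u q t r v l"
    define F' where "F' = extend_rhs \<Sigma>' u q t r v l'"
    note i1 = ct_state_extend_integral[OF S(1) uq r v lc(1), folded F_def]
      and i2 = ct_state_extend_integral[OF S(2), unfolded T, OF uq r v lc(2), folded F'_def]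
    note c1 = extend_rhs_continuous[OF S(1) uq r v lc(1), folded F_def]
      and c2 = extend_rhs_continuous[OF S(2), unfolded T, OF uq r v lc(2), folded F'_def]
    have "F t - F' t = 0"
    proof (rule zero_if_integrals_vanish[where F = "\<lambda>s. F s - F' s"])
      show "continuous_on {t..t+1} (\<lambda>s. F s - F' s)" by (intro continuous_intros c1 c2)
      fix s assume s: "s \<in> {t..t+1}"
      have "integral {t..s} (\<lambda>s. F s - F' s) = integral {t..s} F - integral {t..s} F'"
        by (rule Henstock_Kurzweil_Integration.integral_diff; rule integrable_continuous_real)
          (use s in \<open>auto intro: continuous_on_subset[OF c1] continuous_on_subset[OF c2]\<close>)
      moreover have "s \<ge> 0" using s uq(3) by simp
      ultimately show "integral {t..s} (\<lambda>s. F s - F' s) = 0"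
        using i1[OF s] i2[OF s] l[OF XI[OF ue qe]] uq(3) by simp
    qed
    moreover have "ct_state \<Sigma> ?u ?q t = x" "ct_state \<Sigma>' ?u ?q t = y"
      unfolding xy using ct_state_extend[OF S(1) uq r v zero_carrier_vec] ct_state_extend[OF S(2), unfolded T, OF uq r v zero_carrier_vec] by simp_all
    ultimately show "l \<bullet> (Amat \<Sigma> r *\<^sub>v x + Bmat \<Sigma> r *\<^sub>v v) = l' \<bullet> (Amat \<Sigma>' r *\<^sub>v y + Bmat \<Sigma>' r *\<^sub>v v)"
      unfolding F_def F'_def extend_rhs_def T
      by simp
  qed
qed

lemma same_io_map_iff_markov_eq:
  assumes "is_lss \<Sigma>" "is_lss \<Sigma>'" "same_type \<Sigma> \<Sigma>'"
  shows "same_io_map \<tau> \<Sigma> \<Sigma>' \<longleftrightarrow> markov_eq \<Sigma> \<Sigma>'"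
  using assms dt_same_io_map_imp_markov_eq dt_markov_eq_imp_same_io_map
    ct_same_io_map_imp_markov_eq ct_markov_eq_imp_same_io_map by (cases \<tau>) blast+

section \<open>Minimal systems\<close>

text \<open>Filled up with zero rows the matrix becomes square. A unit vector lies in the kernel of
  its transpose, so the determinant vanishes.\<close>

lemma wide_matrix_kernel:
  fixes M :: "real mat"
  assumes M: "M \<in> carrier_mat n k" and nk: "n < k"
  shows "\<exists>c\<in>carrier_vec k. c \<noteq> 0\<^sub>v k \<and> M *\<^sub>v c = 0\<^sub>v n"
proof -
  define N where "N = mat k k (\<lambda>(i, j). if i < n then M $$ (i, j) else 0)"
  have N: "N \<in> carrier_mat k k" by (simp add: N_def)
  have "N\<^sup>T *\<^sub>v unit_vec k n = 0\<^sub>v k"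
    by (rule eq_vecI) (use nk in \<open>auto simp: N_def scalar_prod_right_unit\<close>)
  moreover have "unit_vec k n \<noteq> (0\<^sub>v k :: real vec)"
    using nk by (metis index_unit_vec(1) index_zero_vec(1) zero_neq_one)
  ultimately have "det (N\<^sup>T) = 0"
    by (subst det_0_iff_vec_prod_zero[of _ k]) (use N in \<open>auto intro!: exI[of _ "unit_vec k n"]\<close>)
  then have "det N = 0" using det_transpose[OF N] by simp
  then obtain c where c: "c \<in> carrier_vec k" "c \<noteq> 0\<^sub>v k" "N *\<^sub>v c = 0\<^sub>v k"
    using det_0_iff_vec_prod_zero[OF N] by blast
  have "M *\<^sub>v c = 0\<^sub>v n"
  proof (rule eq_vecI)
    fix i assume "i < dim_vec (0\<^sub>v n :: real vec)"
    then have i: "i < n" by simp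
    have "row M i = row N i" by (rule eq_vecI) (use M N i nk in \<open>auto simp: N_def\<close>)
    then have "(M *\<^sub>v c) $ i = (N *\<^sub>v c) $ i" using M N i nk by simp
    then show "(M *\<^sub>v c) $ i = 0\<^sub>v n $ i" using c(3) i nk by simp
  qed (use M in auto)
  then show ?thesis using c by blast
qed

lemma right_inverse_dim_le:
  fixes T :: "real mat"
  assumes T: "T \<in> carrier_mat k n" and U: "U \<in> carrier_mat n k" and TU: "T * U = 1\<^sub>m k"
  shows "k \<le> n"
proof (rule ccontr)
  assume "\<not> k \<le> n"
  then obtain c where c: "c \<in> carrier_vec k" "c \<noteq> 0\<^sub>v k" "U *\<^sub>v c = 0\<^sub>v n"
    using wide_matrix_kernel[OF U] by auto
  have "c = T * U *\<^sub>v c" using c TU by simp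
  also have "\<dots> = T *\<^sub>v (U *\<^sub>v c)" by (rule assoc_mult_mat_vec[OF T U c(1)])
  also have "\<dots> = 0\<^sub>v k" using c(3) mult_mat_zero_vec[OF T] by simp
  finally show False using c(2) by simp
qed

lemma scalar_prod_eq_0_imp:
  fixes v :: "real vec"
  assumes "v \<bullet> v = 0" "v \<in> carrier_vec n"
  shows "v = 0\<^sub>v n"
proof (rule eq_vecI)
  fix i assume "i < dim_vec (0\<^sub>v n :: real vec)"
  then have i: "i < n" by simp
  have "(\<Sum>j<n. (v $ j)\<^sup>2) = 0" using assms by (simp add: scalar_prod_def atLeast0LessThan power2_eq_square)
  then have "\<forall>j\<in>{..<n}. (v $ j)\<^sup>2 = 0" by (subst (asm) sum_nonneg_eq_0_iff) auto
  then show "v $ i = 0\<^sub>v n $ i" using i by simp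
qed (use assms in auto)

text \<open>At \<open>y\<close> the expansion along \<open>t\<close> and \<open>u\<close> fails to
  reproduce \<open>f\<close>. The residual of \<open>y\<close> is therefore annihilated by all
  \<open>t i\<close> but not by \<open>f\<close>, and once normalised it becomes the dual vector of
  \<open>f\<close>.\<close>

lemma biorthogonal_extend:
  fixes t u :: "nat \<Rightarrow> real vec"
  assumes F: "F \<subseteq> carrier_vec n" and t: "\<And>i. i < k \<Longrightarrow> t i \<in> F" and u: "\<And>i. i < k \<Longrightarrow> u i \<in> carrier_vec n"
    and tu: "\<And>i j. i < k \<Longrightarrow> j < k \<Longrightarrow> t i \<bullet> u j = (if i = j then 1 else 0)"
    and f: "f \<in> F" and y: "y \<in> carrier_vec n"
    and ny: "f \<bullet> y \<noteq> (\<Sum>j<k. (f \<bullet> u j) * (t j \<bullet> y))"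
  shows "\<exists>t u. (\<forall>i<Suc k. t i \<in> F \<and> u i \<in> carrier_vec n) \<and>
     (\<forall>i<Suc k. \<forall>j<Suc k. t i \<bullet> u j = (if i = j then 1 else 0))"
proof -
  have fc: "f \<in> carrier_vec n" and tc: "\<And>i. i < k \<Longrightarrow> t i \<in> carrier_vec n" using f F t by auto
  define U where "U = mat n k (\<lambda>(i, j). u j $ i)"
  define c where "c = vec k (\<lambda>j. t j \<bullet> y)"
  have U: "U \<in> carrier_mat n k" by (simp add: U_def)
  have cc: "c \<in> carrier_vec k" by (simp add: c_def)
  have prodU: "g \<bullet> (U *\<^sub>v c) = (\<Sum>j<k. (g \<bullet> u j) * (t j \<bullet> y))" if g: "g \<in> carrier_vec n" for g
  proof -
    have "g \<bullet> (U *\<^sub>v c) = (U\<^sup>T *\<^sub>v g) \<bullet> c"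
      by (rule transpose_vec_mult_scalar[OF U cc g, symmetric])
    also have "\<dots> = (\<Sum>j<k. (U\<^sup>T *\<^sub>v g) $ j * (t j \<bullet> y))"
      by (simp add: scalar_prod_def c_def atLeast0LessThan)
    also have "\<dots> = (\<Sum>j<k. (g \<bullet> u j) * (t j \<bullet> y))"
    proof (rule sum.cong)
      fix j assume "j \<in> {..<k}"
      then have j: "j < k" by simp
      have "col U j = u j" by (rule eq_vecI) (use j u[OF j] in \<open>auto simp: U_def\<close>)
      then have "(U\<^sup>T *\<^sub>v g) $ j = u j \<bullet> g" using U j by simp
      also have "\<dots> = g \<bullet> u j" by (rule comm_scalar_prod[OF u[OF j] g])
      finally show "(U\<^sup>T *\<^sub>v g) $ j * (t j \<bullet> y) = (g \<bullet> u j) * (t j \<bullet> y)" by simp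
    qed simp
    finally show ?thesis .
  qed
  define x0 where "x0 = y - U *\<^sub>v c"
  have Uc: "U *\<^sub>v c \<in> carrier_vec n" using U cc by (rule mult_mat_vec_carrier)
  have x0: "x0 \<in> carrier_vec n" unfolding x0_def using y Uc by simp
  have gx0: "g \<bullet> x0 = g \<bullet> y - (\<Sum>j<k. (g \<bullet> u j) * (t j \<bullet> y))" if "g \<in> carrier_vec n" for g
    unfolding x0_def using prodU[OF that] scalar_prod_minus_distrib[OF that y Uc] by simp
  have fx0: "f \<bullet> x0 \<noteq> 0" using ny gx0[OF fc] by simp
  have tx0: "t i \<bullet> x0 = 0" if i: "i < k" for i
  proof -
    have "(\<Sum>j<k. (t i \<bullet> u j) * (t j \<bullet> y)) = (\<Sum>j<k. if i = j then t j \<bullet> y else 0)"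
      by (rule sum.cong) (use tu[OF i] in auto)
    also have "\<dots> = t i \<bullet> y" using i by simp
    finally show ?thesis using gx0[OF tc[OF i]] by simp
  qed
  define x where "x = (1 / (f \<bullet> x0)) \<cdot>\<^sub>v x0"
  have xc: "x \<in> carrier_vec n" using x0 by (simp add: x_def)
  have fx: "f \<bullet> x = 1" using fx0 scalar_prod_smult_distrib[OF fc x0] by (simp add: x_def)
  have tx: "t i \<bullet> x = 0" if "i < k" for i
    using tx0[OF that] scalar_prod_smult_distrib[OF tc[OF that] x0] by (simp add: x_def)
  define t' where "t' = (\<lambda>i. if i < k then t i else f)"
  \<comment> \<open>The old dual vectors are corrected along \<open>x\<close> so that
    \<open>f\<close> annihilates them. Their products with the \<open>t i\<close> are unchanged,
    because every \<open>t i\<close> annihilates \<open>x\<close>.\<close>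
  define u' where "u' = (\<lambda>j. if j < k then u j - (f \<bullet> u j) \<cdot>\<^sub>v x else x)"
  have gu: "g \<bullet> (u j - (f \<bullet> u j) \<cdot>\<^sub>v x) = g \<bullet> u j - (f \<bullet> u j) * (g \<bullet> x)" if "g \<in> carrier_vec n" "j < k" for g j
    using scalar_prod_minus_distrib[OF that(1) u[OF that(2)], of "(f \<bullet> u j) \<cdot>\<^sub>v x"]
      scalar_prod_smult_distrib[OF that(1) xc] xc by simp
  show ?thesis
  proof (rule exI[of _ t'], rule exI[of _ u'], intro conjI allI impI)
    fix i assume "i < Suc k"
    show "t' i \<in> F" using t f by (simp add: t'_def)
    show "u' i \<in> carrier_vec n" using u xc by (simp add: u'_def)
    fix j assume "j < Suc k"
    then show "t' i \<bullet> u' j = (if i = j then 1 else 0)"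
      using \<open>i < Suc k\<close> gu tc tu tx fx fc by (auto simp: t'_def u'_def less_Suc_eq)
  qed
qed

text \<open>A maximal biorthogonal family serves as a basis of the span of \<open>F\<close> chosen inside \<open>F\<close>; \<open>U * T\<close> acts
  from the right as the identity on row vectors in \<open>F\<close>.\<close>

lemma biorthogonal_selection:
  assumes F: "F \<subseteq> carrier_vec n"
  obtains k T U where "T \<in> carrier_mat k n" "U \<in> carrier_mat n k" "T * U = 1\<^sub>m k"
    "\<And>i. i < k \<Longrightarrow> row T i \<in> (F :: real vec set)"
    "\<forall>p M. M \<in> carrier_mat p n \<and> (\<forall>i<p. row M i \<in> F) \<longrightarrow> M * U * T = M"
proof -
  define P where "P = (\<lambda>k::nat. \<exists>t u. (\<forall>i<k. t i \<in> F \<and> u i \<in> carrier_vec n) \<and>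
     (\<forall>i<k. \<forall>j<k. t i \<bullet> u j = (if i = j then 1 else 0)))"
  define Tm where "Tm = (\<lambda>(k::nat) (t :: nat \<Rightarrow> real vec). mat k n (\<lambda>(i, j). t i $ j))"
  define Um where "Um = (\<lambda>(k::nat) (u :: nat \<Rightarrow> real vec). mat n k (\<lambda>(i, j). u j $ i))"
  have row: "row (Tm k t) i = t i" if "i < k" "t i \<in> carrier_vec n" for k i t
    by (rule eq_vecI) (use that in \<open>auto simp: Tm_def\<close>)
  have col: "col (Um k u) i = u i" if "i < k" "u i \<in> carrier_vec n" for k i u
    by (rule eq_vecI) (use that in \<open>auto simp: Um_def\<close>)
  have carr: "Tm k t \<in> carrier_mat k n" "Um k u \<in> carrier_mat n k" for k t u by (simp_all add: Tm_def Um_def)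
  have TU: "Tm k t * Um k u = 1\<^sub>m k" if "\<forall>i<k. t i \<in> F \<and> u i \<in> carrier_vec n"
    "\<forall>i<k. \<forall>j<k. t i \<bullet> u j = (if i = j then 1 else 0)" for k t u
  proof (rule eq_matI)
    fix i j assume "i < dim_row (1\<^sub>m k :: real mat)" "j < dim_col (1\<^sub>m k :: real mat)"
    then have ij: "i < k" "j < k" by auto
    have "(Tm k t * Um k u) $$ (i, j) = row (Tm k t) i \<bullet> col (Um k u) j" using ij carr[of k t] carr(2)[of k u] by simp
    also have "\<dots> = t i \<bullet> u j" using row[of i k t] col[of j k u] ij that F by auto
    finally show "(Tm k t * Um k u) $$ (i, j) = 1\<^sub>m k $$ (i, j)" using that ij by simp
  qed (use carrier_matD[OF carr(1)[of k t]] carrier_matD[OF carr(2)[of k u]] in simp_all)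
  have bound: "k \<le> n" if Pk: "P k" for k
  proof -
    obtain t u where "\<forall>i<k. t i \<in> F \<and> u i \<in> carrier_vec n" "\<forall>i<k. \<forall>j<k. t i \<bullet> u j = (if i = j then 1 else 0)"
      using Pk unfolding P_def by blast
    then show ?thesis using right_inverse_dim_le[OF carr(1) carr(2) TU] by simp
  qed
  have P0: "P 0" by (simp add: P_def)
  \<comment> \<open>Biorthogonality gives \<open>Tm\<close> a right inverse, which bounds the size
    of a family by \<open>n\<close>; so a largest one exists.\<close>
  define k where "k = (GREATEST k. P k)"
  have Pk: "P k" unfolding k_def by (rule GreatestI_nat[where P = P and b = n, OF P0 bound])
  have max: "j \<le> k" if "P j" for j unfolding k_def by (rule Greatest_le_nat[where P = P and b = n, OF that bound])
  obtain t u where tu: "\<forall>i<k. t i \<in> F \<and> u i \<in> carrier_vec n" "\<forall>i<k. \<forall>j<k. t i \<bullet> u j = (if i = j then 1 else 0)"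
    using Pk unfolding P_def by blast
  define T where "T = Tm k t"
  define U where "U = Um k u"
  have T: "T \<in> carrier_mat k n" and U: "U \<in> carrier_mat n k" using carr by (simp_all add: T_def U_def)
  \<comment> \<open>A member of \<open>F\<close> that is not reproduced could be added to the
    family, against maximality.\<close>
  have expand: "f \<bullet> y = (\<Sum>j<k. (f \<bullet> u j) * (t j \<bullet> y))" if f: "f \<in> F" and y: "y \<in> carrier_vec n" for f y
  proof (rule ccontr)
    assume ny: "f \<bullet> y \<noteq> (\<Sum>j<k. (f \<bullet> u j) * (t j \<bullet> y))"
    have "P (Suc k)" unfolding P_def
      by (rule biorthogonal_extend[where t = t and u = u and k = k, OF F _ _ _ f y ny]) (use tu in simp_all)
    then show False using max[of "Suc k"] by simp
  qed
  have rep: "M * U * T = M" if M: "M \<in> carrier_mat p n" and rows: "\<And>i. i < p \<Longrightarrow> row M i \<in> F" for p M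
  proof (rule eq_mat_by_mult_vec)
    show "M * U * T \<in> carrier_mat p n" "M \<in> carrier_mat p n" using M U T by auto
    fix v :: "real vec" assume v: "v \<in> carrier_vec n"
    have Tv: "T *\<^sub>v v \<in> carrier_vec k" using T v by simp
    have UTv: "U *\<^sub>v (T *\<^sub>v v) \<in> carrier_vec n" using U Tv by simp
    have "M * U * T *\<^sub>v v = M *\<^sub>v (U *\<^sub>v (T *\<^sub>v v))"
      using assoc_mult_mat_vec[OF mult_carrier_mat[OF M U] T v] assoc_mult_mat_vec[OF M U Tv] by simp
    also have "\<dots> = M *\<^sub>v v"
    proof (rule mult_vec_eq_by_rows[OF M M])
      fix i assume i: "i < p"
      have rc: "row M i \<in> carrier_vec n" using rows[OF i] F by auto
      have tt: "t j \<bullet> (U *\<^sub>v (T *\<^sub>v v)) = t j \<bullet> v" if j: "j < k" for j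
      proof -
        have "T *\<^sub>v (U *\<^sub>v (T *\<^sub>v v)) = T *\<^sub>v v"
          using assoc_mult_mat_vec[OF T U Tv] TU[OF tu] Tv by (simp add: T_def U_def)
        then have "row T j \<bullet> (U *\<^sub>v (T *\<^sub>v v)) = row T j \<bullet> v"
          by (rule row_eq_if_mult_vec_eq[OF T T j])
        moreover have "row T j = t j" unfolding T_def by (rule row[OF j]) (use tu j F in auto)
        ultimately show ?thesis by simp
      qed
      show "row M i \<bullet> (U *\<^sub>v (T *\<^sub>v v)) = row M i \<bullet> v"
        unfolding expand[OF rows[OF i] UTv] expand[OF rows[OF i] v] by (rule sum.cong) (simp_all add: tt)
    qed
    finally show "M * U * T *\<^sub>v v = M *\<^sub>v v" .
  qed
  show thesis
  proof (rule that[OF T U])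
    show "\<forall>p M. M \<in> carrier_mat p n \<and> (\<forall>i<p. row M i \<in> F) \<longrightarrow> M * U * T = M"
      using rep by blast
    show "T * U = 1\<^sub>m k" unfolding T_def U_def by (rule TU[OF tu])
    show "\<And>i. i < k \<Longrightarrow> row T i \<in> F" using row[of _ k t] tu F by (auto simp: T_def)
  qed
qed

section \<open>Morphisms of systems, observable quotient and reachable restriction\<close>

text \<open>A morphism from \<open>\<Sigma>\<close> to \<open>\<Sigma>'\<close>: the equations of an
  isomorphism for a rectangular matrix. Inclusions of invariant subspaces and projections onto
  quotients are both of this kind.\<close>

definition intertwines :: "real mat \<Rightarrow> lss \<Rightarrow> lss \<Rightarrow> bool" where
  "intertwines X \<Sigma> \<Sigma>' \<longleftrightarrow> same_type \<Sigma> \<Sigma>' \<and> X \<in> carrier_mat (state_dim \<Sigma>') (state_dim \<Sigma>) \<and>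
     (\<forall>q\<in>modes \<Sigma>. Amat \<Sigma>' q * X = X * Amat \<Sigma> q \<and> Bmat \<Sigma>' q = X * Bmat \<Sigma> q \<and> Cmat \<Sigma>' q * X = Cmat \<Sigma> q)"

lemma intertwines_Aword:
  assumes S: "is_lss \<Sigma>" "is_lss \<Sigma>'" and X: "intertwines X \<Sigma> \<Sigma>'" and w: "w \<in> lists (modes \<Sigma>)"
  shows "Aword \<Sigma>' w * X = X * Aword \<Sigma> w"
proof -
  have T: "same_type \<Sigma> \<Sigma>'" and Xc: "X \<in> carrier_mat (state_dim \<Sigma>') (state_dim \<Sigma>)"
    using X unfolding intertwines_def by auto
  note T = same_typeD[OF T]
  show ?thesis using w
  proof (induction w)
    case (Cons q w)
    then have q: "q \<in> modes \<Sigma>" and w: "w \<in> lists (modes \<Sigma>)" by auto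
    note c = is_lssD(1)[OF S(1) q] is_lssD(1)[OF S(2), unfolded T, OF q]
      Aword_carrier[OF S(1) w] Aword_carrier[OF S(2), unfolded T, OF w]
    have "Aword \<Sigma>' (q # w) * X = Amat \<Sigma>' q * (X * Aword \<Sigma> w)"
      using assoc_mult_mat[OF c(2) c(4) Xc] Cons by simp
    also have "\<dots> = X * Amat \<Sigma> q * Aword \<Sigma> w"
      using assoc_mult_mat[OF c(2) Xc c(3)] X q unfolding intertwines_def by simp
    also have "\<dots> = X * Aword \<Sigma> (q # w)" using assoc_mult_mat[OF Xc c(1) c(3)] by simp
    finally show ?case .
  qed (use Xc in simp)
qed

lemma intertwines_imp_markov_eq:
  assumes S: "is_lss \<Sigma>" "is_lss \<Sigma>'" and X: "intertwines X \<Sigma> \<Sigma>'"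
  shows "markov_eq \<Sigma> \<Sigma>'"
  unfolding markov_eq_def
proof (intro ballI)
  have T: "same_type \<Sigma> \<Sigma>'" and Xc: "X \<in> carrier_mat (state_dim \<Sigma>') (state_dim \<Sigma>)"
    using X unfolding intertwines_def by auto
  note T = same_typeD[OF T]
  fix q w r assume q: "q \<in> modes \<Sigma>" and w: "w \<in> lists (modes \<Sigma>)" and r: "r \<in> modes \<Sigma>"
  note c = is_lssD(3)[OF S(1) q] is_lssD(3)[OF S(2), unfolded T, OF q]
    Aword_carrier[OF S(1) w] Aword_carrier[OF S(2), unfolded T, OF w] is_lssD(2)[OF S(1) r]
  have "Cmat \<Sigma>' q * Aword \<Sigma>' w * Bmat \<Sigma>' r = Cmat \<Sigma>' q * Aword \<Sigma>' w * X * Bmat \<Sigma> r"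
    using X r assoc_mult_mat[OF mult_carrier_mat[OF c(2) c(4)] Xc c(5)] unfolding intertwines_def by simp
  also have "Cmat \<Sigma>' q * Aword \<Sigma>' w * X = Cmat \<Sigma>' q * (X * Aword \<Sigma> w)"
    using assoc_mult_mat[OF c(2) c(4) Xc] intertwines_Aword[OF S X w] by simp
  also have "\<dots> = Cmat \<Sigma> q * Aword \<Sigma> w"
    using X q assoc_mult_mat[OF c(2) Xc c(3)] unfolding intertwines_def by simp
  finally show "Cmat \<Sigma> q * Aword \<Sigma> w * Bmat \<Sigma> r = Cmat \<Sigma>' q * Aword \<Sigma>' w * Bmat \<Sigma>' r" by simp
qed

text \<open>Compression along a pair with \<open>L * V\<close> equal to the identity. It is the
  restriction to the range of \<open>V\<close> when that range is invariant and contains the columns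
  of the input matrices, and the quotient by the kernel of \<open>L\<close> when that kernel is
  invariant and unobserved.\<close>

definition transform_lss :: "nat \<Rightarrow> real mat \<Rightarrow> real mat \<Rightarrow> lss \<Rightarrow> lss" where
  "transform_lss k L V \<Sigma> = \<Sigma>\<lparr>state_dim := k, Amat := \<lambda>q. L * Amat \<Sigma> q * V, Bmat := \<lambda>q. L * Bmat \<Sigma> q, Cmat := \<lambda>q. Cmat \<Sigma> q * V\<rparr>"

lemma transform_lss_simps [simp]:
  "state_dim (transform_lss k L V \<Sigma>) = k" "modes (transform_lss k L V \<Sigma>) = modes \<Sigma>"
  "input_dim (transform_lss k L V \<Sigma>) = input_dim \<Sigma>" "output_dim (transform_lss k L V \<Sigma>) = output_dim \<Sigma>"
  "Amat (transform_lss k L V \<Sigma>) q = L * Amat \<Sigma> q * V" "Bmat (transform_lss k L V \<Sigma>) q = L * Bmat \<Sigma> q"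
  "Cmat (transform_lss k L V \<Sigma>) q = Cmat \<Sigma> q * V"
  "same_type \<Sigma> (transform_lss k L V \<Sigma>)" "same_type (transform_lss k L V \<Sigma>) \<Sigma>"
  by (simp_all add: transform_lss_def modes_def same_type_def)

lemma is_lss_transform:
  assumes "is_lss \<Sigma>" "L \<in> carrier_mat k (state_dim \<Sigma>)" "V \<in> carrier_mat (state_dim \<Sigma>) k"
  shows "is_lss (transform_lss k L V \<Sigma>)"
  using assms is_lssD[OF assms(1)] unfolding is_lss_def
  by (auto simp: transform_lss_def modes_def intro!: mult_carrier_mat)

definition obs_rows :: "lss \<Rightarrow> real vec set" where
  "obs_rows \<Sigma> = {row (Cmat \<Sigma> q * Aword \<Sigma> w) i | q w i. q \<in> modes \<Sigma> \<and> w \<in> lists (modes \<Sigma>) \<and> i < output_dim \<Sigma>}"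

definition reach_cols :: "lss \<Rightarrow> real vec set" where
  "reach_cols \<Sigma> = {col (Aword \<Sigma> w * Bmat \<Sigma> r) j | w r j. r \<in> modes \<Sigma> \<and> w \<in> lists (modes \<Sigma>) \<and> j < input_dim \<Sigma>}"

lemma obs_rowsI:
  "q \<in> modes \<Sigma> \<Longrightarrow> w \<in> lists (modes \<Sigma>) \<Longrightarrow> i < output_dim \<Sigma> \<Longrightarrow> row (Cmat \<Sigma> q * Aword \<Sigma> w) i \<in> obs_rows \<Sigma>"
  unfolding obs_rows_def by blast

lemma reach_colsI:
  "r \<in> modes \<Sigma> \<Longrightarrow> w \<in> lists (modes \<Sigma>) \<Longrightarrow> j < input_dim \<Sigma> \<Longrightarrow> col (Aword \<Sigma> w * Bmat \<Sigma> r) j \<in> reach_cols \<Sigma>"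
  unfolding reach_cols_def by blast

lemma AB_carrier:
  assumes "is_lss \<Sigma>" "w \<in> lists (modes \<Sigma>)" "r \<in> modes \<Sigma>"
  shows "Aword \<Sigma> w * Bmat \<Sigma> r \<in> carrier_mat (state_dim \<Sigma>) (input_dim \<Sigma>)"
  using Aword_carrier[OF assms(1,2)] is_lssD(2)[OF assms(1,3)] by (rule mult_carrier_mat)

lemma row_mult_right:
  fixes M :: "real mat"
  assumes "M \<in> carrier_mat p n" "N \<in> carrier_mat n m" "i < p"
  shows "row (M * N) i = N\<^sup>T *\<^sub>v row M i"
proof (rule eq_vecI)
  fix j assume "j < dim_vec (N\<^sup>T *\<^sub>v row M i)"
  then have j: "j < m" using assms by simp
  have "row M i \<bullet> col N j = col N j \<bullet> row M i"
    by (rule comm_scalar_prod[of _ n]) (use assms j in auto)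
  then show "row (M * N) i $ j = (N\<^sup>T *\<^sub>v row M i) $ j" using assms j by simp
qed (use assms in auto)

text \<open>The rows of all matrices \<open>Cmat \<Sigma> q * Aword \<Sigma> w\<close> are permuted
  among themselves, not necessarily injectively, by right multiplication with a mode matrix, as the
  word grows at its end. So \<open>U * T\<close> fixes the rows of
  \<open>T * Amat \<Sigma> q\<close>, and this is the intertwining equation.\<close>

lemma observable_quotient:
  assumes S: "is_lss \<Sigma>"
  obtains k T U where "T \<in> carrier_mat k (state_dim \<Sigma>)" "U \<in> carrier_mat (state_dim \<Sigma>) k" "T * U = 1\<^sub>m k"
    "\<And>i. i < k \<Longrightarrow> row T i \<in> obs_rows \<Sigma>" "intertwines T \<Sigma> (transform_lss k T U \<Sigma>)"
proof -
  let ?n = "state_dim \<Sigma>"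
  have F: "obs_rows \<Sigma> \<subseteq> carrier_vec ?n"
    unfolding obs_rows_def using CA_carrier[OF S] by fastforce
  obtain k T U where T: "T \<in> carrier_mat k ?n" and U: "U \<in> carrier_mat ?n k" and TU: "T * U = 1\<^sub>m k"
    and rows: "\<And>i. i < k \<Longrightarrow> row T i \<in> obs_rows \<Sigma>"
    and rep0: "\<forall>p M. M \<in> carrier_mat p ?n \<and> (\<forall>i<p. row M i \<in> obs_rows \<Sigma>) \<longrightarrow> M * U * T = M"
    by (rule biorthogonal_selection[OF F]) (rule that)
  have rep: "M * U * T = M" if "M \<in> carrier_mat p ?n" "\<And>i. i < p \<Longrightarrow> row M i \<in> obs_rows \<Sigma>" for p M
    using rep0 that by blast
  have "intertwines T \<Sigma> (transform_lss k T U \<Sigma>)" unfolding intertwines_def transform_lss_simps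
  proof (intro conjI ballI T refl)
    show "same_type \<Sigma> (transform_lss k T U \<Sigma>)" by simp
    fix q assume q: "q \<in> modes \<Sigma>"
    note A = is_lssD(1)[OF S q] and C = is_lssD(3)[OF S q]
    show "T * Amat \<Sigma> q * U * T = T * Amat \<Sigma> q"
    proof (rule rep[OF mult_carrier_mat[OF T A]])
      fix i assume i: "i < k"
      obtain q' w j where qw: "row T i = row (Cmat \<Sigma> q' * Aword \<Sigma> w) j" "q' \<in> modes \<Sigma>" "w \<in> lists (modes \<Sigma>)" "j < output_dim \<Sigma>"
        using rows[OF i] unfolding obs_rows_def by blast
      have "row (T * Amat \<Sigma> q) i = row (Cmat \<Sigma> q' * Aword \<Sigma> (w @ [q])) j"
        unfolding CA_snoc[OF S qw(2,3) q] row_mult_right[OF T A i] row_mult_right[OF CA_carrier[OF S qw(2,3)] A qw(4)] qw(1) ..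
      moreover have "w @ [q] \<in> lists (modes \<Sigma>)" using qw q by simp
      ultimately show "row (T * Amat \<Sigma> q) i \<in> obs_rows \<Sigma>" using obs_rowsI[OF qw(2) _ qw(4), of "w @ [q]"] by simp
    qed
    show "Cmat \<Sigma> q * U * T = Cmat \<Sigma> q"
    proof (rule rep[OF C])
      fix i assume "i < output_dim \<Sigma>"
      moreover have "Cmat \<Sigma> q * Aword \<Sigma> [] = Cmat \<Sigma> q" using C by simp
      moreover have "[] \<in> lists (modes \<Sigma>)" by simp
      ultimately show "row (Cmat \<Sigma> q) i \<in> obs_rows \<Sigma>" using obs_rowsI[OF q, of "[]" i] by simp
    qed
  qed
  then show thesis by (intro that[OF T U TU] rows)
qed

text \<open>The same selection for columns, carried out on transposes; here the word grows at its
  front. The last clause lifts reachable columns to the restricted system, which is needed when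
  preimages are sought there.\<close>

lemma reachable_restriction:
  assumes S: "is_lss \<Sigma>"
  obtains k V L where "V \<in> carrier_mat (state_dim \<Sigma>) k" "L \<in> carrier_mat k (state_dim \<Sigma>)" "L * V = 1\<^sub>m k"
    "\<And>j. j < k \<Longrightarrow> col V j \<in> reach_cols \<Sigma>" "intertwines V (transform_lss k L V \<Sigma>) \<Sigma>"
    "\<And>w r. w \<in> lists (modes \<Sigma>) \<Longrightarrow> r \<in> modes \<Sigma> \<Longrightarrow> V * (L * (Aword \<Sigma> w * Bmat \<Sigma> r)) = Aword \<Sigma> w * Bmat \<Sigma> r"
proof -
  let ?n = "state_dim \<Sigma>"
  have G: "reach_cols \<Sigma> \<subseteq> carrier_vec ?n"
    unfolding reach_cols_def using AB_carrier[OF S] by fastforce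
  obtain k T U where T: "T \<in> carrier_mat k ?n" and U: "U \<in> carrier_mat ?n k" and TU: "T * U = 1\<^sub>m k"
    and rows: "\<And>i. i < k \<Longrightarrow> row T i \<in> reach_cols \<Sigma>"
    and rep0: "\<forall>p M. M \<in> carrier_mat p ?n \<and> (\<forall>i<p. row M i \<in> reach_cols \<Sigma>) \<longrightarrow> M * U * T = M"
    by (rule biorthogonal_selection[OF G]) (rule that)
  have rep: "M * U * T = M" if "M \<in> carrier_mat p ?n" "\<And>i. i < p \<Longrightarrow> row M i \<in> reach_cols \<Sigma>" for p M
    using rep0 that by blast
  define V where "V = T\<^sup>T"
  define L where "L = U\<^sup>T"
  have V: "V \<in> carrier_mat ?n k" and L: "L \<in> carrier_mat k ?n" using T U by (simp_all add: V_def L_def)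
  have LV: "L * V = 1\<^sub>m k" using transpose_mult[OF T U] TU by (simp add: V_def L_def)
  have cols: "col V j \<in> reach_cols \<Sigma>" if "j < k" for j using rows[OF that] T that by (simp add: V_def)
  have VL: "V * (L * M) = M" if M: "M \<in> carrier_mat ?n p" and c: "\<And>j. j < p \<Longrightarrow> col M j \<in> reach_cols \<Sigma>" for M p
  proof -
    have "M\<^sup>T * U * T = M\<^sup>T" by (rule rep[of _ p]) (use M c in auto)
    then have "(M\<^sup>T * U * T)\<^sup>T = M" by simp
    moreover have "(M\<^sup>T * U * T)\<^sup>T = V * (L * M)"
      using transpose_mult[of "M\<^sup>T * U" p k T ?n] transpose_mult[of "M\<^sup>T" p ?n U k] M U T by (simp add: V_def L_def)
    ultimately show ?thesis by simp
  qed
  have "intertwines V (transform_lss k L V \<Sigma>) \<Sigma>" unfolding intertwines_def transform_lss_simps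
  proof (intro conjI ballI V)
    fix q assume q: "q \<in> modes \<Sigma>"
    note A = is_lssD(1)[OF S q] and B = is_lssD(2)[OF S q]
    have "V * (L * (Amat \<Sigma> q * V)) = Amat \<Sigma> q * V"
    proof (rule VL[OF mult_carrier_mat[OF A V]])
      fix j assume j: "j < k"
      obtain w r i where wr: "col V j = col (Aword \<Sigma> w * Bmat \<Sigma> r) i" "r \<in> modes \<Sigma>" "w \<in> lists (modes \<Sigma>)" "i < input_dim \<Sigma>"
        using cols[OF j] unfolding reach_cols_def by blast
      note Bc = is_lssD(2)[OF S wr(2)] and Aw = Aword_carrier[OF S wr(3)]
      have "col (Amat \<Sigma> q * V) j = Amat \<Sigma> q *\<^sub>v col V j" by (rule col_mult2[OF A V j])
      also have "\<dots> = col (Amat \<Sigma> q * (Aword \<Sigma> w * Bmat \<Sigma> r)) i"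
        unfolding wr(1) by (rule col_mult2[OF A AB_carrier[OF S wr(3,2)] wr(4), symmetric])
      also have "Amat \<Sigma> q * (Aword \<Sigma> w * Bmat \<Sigma> r) = Aword \<Sigma> (q # w) * Bmat \<Sigma> r"
        using assoc_mult_mat[OF A Aw Bc] by simp
      finally have "col (Amat \<Sigma> q * V) j = col (Aword \<Sigma> (q # w) * Bmat \<Sigma> r) i" .
      moreover have "q # w \<in> lists (modes \<Sigma>)" using wr q by simp
      ultimately show "col (Amat \<Sigma> q * V) j \<in> reach_cols \<Sigma>" using reach_colsI[OF wr(2) _ wr(4), of "q # w"] by simp
    qed
    then show "Amat \<Sigma> q * V = V * (L * Amat \<Sigma> q * V)" using assoc_mult_mat[OF L A V] by simp
    have "V * (L * Bmat \<Sigma> q) = Bmat \<Sigma> q"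
    proof (rule VL[OF B])
      fix j assume "j < input_dim \<Sigma>"
      moreover have "Aword \<Sigma> [] * Bmat \<Sigma> q = Bmat \<Sigma> q" using B by simp
      moreover have "[] \<in> lists (modes \<Sigma>)" by simp
      ultimately show "col (Bmat \<Sigma> q) j \<in> reach_cols \<Sigma>" using reach_colsI[OF q, of "[]" j] by simp
    qed
    then show "Bmat \<Sigma> q = V * (L * Bmat \<Sigma> q)" by simp
  qed simp_all
  note tw = this
  have "V * (L * (Aword \<Sigma> w * Bmat \<Sigma> r)) = Aword \<Sigma> w * Bmat \<Sigma> r" if "w \<in> lists (modes \<Sigma>)" "r \<in> modes \<Sigma>" for w r
    by (rule VL[OF AB_carrier[OF S that]]) (use that reach_colsI in simp)
  then show thesis by (intro that[OF V L LV] cols tw)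
qed

section \<open>Consequences of minimality\<close>

definition markov_minimal :: "lss \<Rightarrow> bool" where
  "markov_minimal \<Sigma> \<longleftrightarrow> (\<forall>\<Sigma>'. is_lss \<Sigma>' \<and> same_type \<Sigma>' \<Sigma> \<and> markov_eq \<Sigma>' \<Sigma> \<longrightarrow> state_dim \<Sigma> \<le> state_dim \<Sigma>')"

lemma lss_minimal_iff:
  assumes "is_lss \<Sigma>"
  shows "lss_minimal \<tau> \<Sigma> \<longleftrightarrow> markov_minimal \<Sigma>"
proof -
  have "is_lss \<Sigma>' \<and> same_type \<Sigma>' \<Sigma> \<and> same_io_map \<tau> \<Sigma>' \<Sigma> \<longleftrightarrow>
      is_lss \<Sigma>' \<and> same_type \<Sigma>' \<Sigma> \<and> markov_eq \<Sigma>' \<Sigma>" for \<Sigma>'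
    using same_io_map_iff_markov_eq[OF _ assms, of \<Sigma>' \<tau>] by metis
  then show ?thesis unfolding lss_minimal_def markov_minimal_def lss_equivalent_def by (simp only:)
qed

lemma same_type_sym: "same_type \<Sigma> \<Sigma>' \<Longrightarrow> same_type \<Sigma>' \<Sigma>"
  by (simp add: same_type_def)

lemma markov_eq_sym:
  assumes ty: "same_type \<Sigma> \<Sigma>'" and mk: "markov_eq \<Sigma> \<Sigma>'"
  shows "markov_eq \<Sigma>' \<Sigma>"
  unfolding markov_eq_def same_typeD(1)[OF ty]
proof (intro ballI)
  fix q w r assume "q \<in> modes \<Sigma>" "w \<in> lists (modes \<Sigma>)" "r \<in> modes \<Sigma>"
  then show "Cmat \<Sigma>' q * Aword \<Sigma>' w * Bmat \<Sigma>' r = Cmat \<Sigma> q * Aword \<Sigma> w * Bmat \<Sigma> r"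
    by (rule mk[unfolded markov_eq_def, THEN bspec, THEN bspec, THEN bspec, symmetric])
qed

text \<open>The observable quotient is an equivalent system of no larger dimension, so minimality
  makes \<open>T\<close> square and invertible. A state with zero output after every word is
  annihilated by all rows of \<open>T\<close>.\<close>

lemma minimal_observable:
  assumes S: "is_lss \<Sigma>" and min: "markov_minimal \<Sigma>" and x: "x \<in> carrier_vec (state_dim \<Sigma>)"
    and zero: "\<And>q w. q \<in> modes \<Sigma> \<Longrightarrow> w \<in> lists (modes \<Sigma>) \<Longrightarrow> Cmat \<Sigma> q * Aword \<Sigma> w *\<^sub>v x = 0\<^sub>v (output_dim \<Sigma>)"
  shows "x = 0\<^sub>v (state_dim \<Sigma>)"
proof -
  let ?n = "state_dim \<Sigma>"
  obtain k T U where T: "T \<in> carrier_mat k ?n" and U: "U \<in> carrier_mat ?n k" and TU: "T * U = 1\<^sub>m k"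
    and rows: "\<And>i. i < k \<Longrightarrow> row T i \<in> obs_rows \<Sigma>" and tw: "intertwines T \<Sigma> (transform_lss k T U \<Sigma>)"
    by (rule observable_quotient[OF S]) (rule that)
  have S': "is_lss (transform_lss k T U \<Sigma>)" by (rule is_lss_transform[OF S T U])
  have mk: "markov_eq (transform_lss k T U \<Sigma>) \<Sigma>"
    by (rule markov_eq_sym[OF transform_lss_simps(8) intertwines_imp_markov_eq[OF S S' tw]])
  have "?n \<le> state_dim (transform_lss k T U \<Sigma>)"
    by (rule min[unfolded markov_minimal_def, THEN spec, THEN mp]) (intro conjI S' mk transform_lss_simps(9))
  then have k: "k = ?n" using right_inverse_dim_le[OF T U TU] by simp
  have UT: "U * T = 1\<^sub>m ?n" by (rule mat_mult_left_right_inverse[OF T[unfolded k] U[unfolded k] TU[unfolded k]])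
  have "T *\<^sub>v x = 0\<^sub>v k"
  proof (rule eq_vecI)
    fix i assume "i < dim_vec (0\<^sub>v k :: real vec)"
    then have i: "i < k" by simp
    obtain q w j where qw: "row T i = row (Cmat \<Sigma> q * Aword \<Sigma> w) j" "q \<in> modes \<Sigma>" "w \<in> lists (modes \<Sigma>)" "j < output_dim \<Sigma>"
      using rows[OF i] unfolding obs_rows_def by blast
    have "(T *\<^sub>v x) $ i = row T i \<bullet> x" by (rule index_mult_mat_vec) (use T i in simp)
    also have "\<dots> = (Cmat \<Sigma> q * Aword \<Sigma> w *\<^sub>v x) $ j"
      unfolding qw(1) by (rule index_mult_mat_vec[symmetric]) (use carrier_matD[OF CA_carrier[OF S qw(2,3)]] qw(4) in simp)
    also have "\<dots> = 0" unfolding zero[OF qw(2,3)] by (rule index_zero_vec(1)[OF qw(4)])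
    finally show "(T *\<^sub>v x) $ i = 0\<^sub>v k $ i" using i by simp
  qed (use T in auto)
  then have z: "U *\<^sub>v (T *\<^sub>v x) = 0\<^sub>v ?n" using mult_mat_zero_vec[OF U] by (simp only:)
  have "x = U * T *\<^sub>v x" unfolding UT using x by simp
  also have "\<dots> = 0\<^sub>v ?n" unfolding assoc_mult_mat_vec[OF U T x] by (rule z)
  finally show ?thesis .
qed

lemma CA_AB:
  assumes S: "is_lss \<Sigma>" and q: "q \<in> modes \<Sigma>" and w: "w \<in> lists (modes \<Sigma>)" "w' \<in> lists (modes \<Sigma>)" and r: "r \<in> modes \<Sigma>"
  shows "Cmat \<Sigma> q * Aword \<Sigma> w * (Aword \<Sigma> w' * Bmat \<Sigma> r) = Cmat \<Sigma> q * Aword \<Sigma> (w @ w') * Bmat \<Sigma> r"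
proof -
  note C = is_lssD(3)[OF S q] and A = Aword_carrier[OF S w(1)] and A' = Aword_carrier[OF S w(2)] and B = is_lssD(2)[OF S r]
  have "Cmat \<Sigma> q * Aword \<Sigma> w * (Aword \<Sigma> w' * Bmat \<Sigma> r) = Cmat \<Sigma> q * Aword \<Sigma> w * Aword \<Sigma> w' * Bmat \<Sigma> r"
    by (rule assoc_mult_mat[OF CA_carrier[OF S q w(1)] A' B, symmetric])
  also have "Cmat \<Sigma> q * Aword \<Sigma> w * Aword \<Sigma> w' = Cmat \<Sigma> q * Aword \<Sigma> (w @ w')"
    unfolding Aword_append[OF S w] by (rule assoc_mult_mat[OF C A A'])
  finally show ?thesis .
qed

text \<open>Observability as a left cancellation rule: identities in the minimal system are verified
  through their effect on outputs.\<close>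

lemma minimal_observable_cancel:
  assumes S: "is_lss \<Sigma>" and min: "markov_minimal \<Sigma>"
    and M: "M \<in> carrier_mat (state_dim \<Sigma>) p" and N: "N \<in> carrier_mat (state_dim \<Sigma>) p"
    and eq: "\<And>q w. q \<in> modes \<Sigma> \<Longrightarrow> w \<in> lists (modes \<Sigma>) \<Longrightarrow> Cmat \<Sigma> q * Aword \<Sigma> w * M = Cmat \<Sigma> q * Aword \<Sigma> w * N"
  shows "M = N"
proof (rule eq_mat_by_mult_vec[OF M N])
  fix v :: "real vec" assume v: "v \<in> carrier_vec p"
  note Mv = mult_mat_vec_carrier[OF M v] and Nv = mult_mat_vec_carrier[OF N v]
  have "M *\<^sub>v v - N *\<^sub>v v = 0\<^sub>v (state_dim \<Sigma>)"
  proof (rule minimal_observable[OF S min])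
    show "M *\<^sub>v v - N *\<^sub>v v \<in> carrier_vec (state_dim \<Sigma>)" using Mv Nv by (rule minus_carrier_vec)
    fix q w assume qw: "q \<in> modes \<Sigma>" "w \<in> lists (modes \<Sigma>)"
    note CA = CA_carrier[OF S qw]
    have "Cmat \<Sigma> q * Aword \<Sigma> w *\<^sub>v (M *\<^sub>v v - N *\<^sub>v v) = Cmat \<Sigma> q * Aword \<Sigma> w *\<^sub>v (M *\<^sub>v v) - Cmat \<Sigma> q * Aword \<Sigma> w *\<^sub>v (N *\<^sub>v v)"
      by (rule mult_minus_distrib_mat_vec[OF CA Mv Nv])
    also have "Cmat \<Sigma> q * Aword \<Sigma> w *\<^sub>v (M *\<^sub>v v) = Cmat \<Sigma> q * Aword \<Sigma> w *\<^sub>v (N *\<^sub>v v)"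
      unfolding assoc_mult_mat_vec[OF CA M v, symmetric] assoc_mult_mat_vec[OF CA N v, symmetric] eq[OF qw] ..
    also have "Cmat \<Sigma> q * Aword \<Sigma> w *\<^sub>v (N *\<^sub>v v) - Cmat \<Sigma> q * Aword \<Sigma> w *\<^sub>v (N *\<^sub>v v) = 0\<^sub>v (output_dim \<Sigma>)"
      by (rule minus_cancel_vec[OF mult_mat_vec_carrier[OF CA Nv]])
    finally show "Cmat \<Sigma> q * Aword \<Sigma> w *\<^sub>v (M *\<^sub>v v - N *\<^sub>v v) = 0\<^sub>v (output_dim \<Sigma>)" .
  qed
  then have "(M *\<^sub>v v - N *\<^sub>v v) $ i = 0" if "i < state_dim \<Sigma>" for i using that by simp
  then show "M *\<^sub>v v = N *\<^sub>v v"
    by (intro eq_vecI) (use M N in auto)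
qed

text \<open>The reachable restriction is an equivalent system, so for a minimal one the inclusion
  \<open>V\<close> is square and invertible.\<close>

lemma minimal_reachable:
  assumes S: "is_lss \<Sigma>" and min: "markov_minimal \<Sigma>"
  obtains V L where "V \<in> carrier_mat (state_dim \<Sigma>) (state_dim \<Sigma>)" "L \<in> carrier_mat (state_dim \<Sigma>) (state_dim \<Sigma>)"
    "V * L = 1\<^sub>m (state_dim \<Sigma>)" "\<And>j. j < state_dim \<Sigma> \<Longrightarrow> col V j \<in> reach_cols \<Sigma>"
proof -
  let ?n = "state_dim \<Sigma>"
  obtain k V L where V: "V \<in> carrier_mat ?n k" and L: "L \<in> carrier_mat k ?n" and LV: "L * V = 1\<^sub>m k"
    and cols: "\<And>j. j < k \<Longrightarrow> col V j \<in> reach_cols \<Sigma>" and tw: "intertwines V (transform_lss k L V \<Sigma>) \<Sigma>"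
    by (rule reachable_restriction[OF S]) (rule that)
  have S': "is_lss (transform_lss k L V \<Sigma>)" by (rule is_lss_transform[OF S L V])
  have mk: "markov_eq (transform_lss k L V \<Sigma>) \<Sigma>" by (rule intertwines_imp_markov_eq[OF S' S tw])
  have "?n \<le> state_dim (transform_lss k L V \<Sigma>)"
    by (rule min[unfolded markov_minimal_def, THEN spec, THEN mp]) (intro conjI S' mk transform_lss_simps(9))
  then have k: "k = ?n" using right_inverse_dim_le[OF L V LV] by simp
  have VL: "V * L = 1\<^sub>m ?n" by (rule mat_mult_left_right_inverse[OF L[unfolded k] V[unfolded k] LV[unfolded k]])
  show thesis by (rule that[OF V[unfolded k] L[unfolded k] VL cols[unfolded k]])
qed

text \<open>\<open>T\<close> sends each basis column \<open>A\<^sub>w B\<^sub>s e\<^sub>i\<close> of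
  the reachable space to the column of the minimal system with the same word, mode and input index.
  Prescribed on a basis, it is well defined; that it respects the dynamics follows from equality of
  Markov parameters together with cancellation in the minimal system. Its surjectivity comes from
  reachability there.\<close>

lemma minimal_quotient:
  assumes S: "is_lss \<Sigma>" "is_lss \<Sigma>m" and ty: "same_type \<Sigma> \<Sigma>m" and mk: "markov_eq \<Sigma> \<Sigma>m" and min: "markov_minimal \<Sigma>m"
  obtains r V L T U where "V \<in> carrier_mat (state_dim \<Sigma>) r" "L \<in> carrier_mat r (state_dim \<Sigma>)" "L * V = 1\<^sub>m r"
    "T \<in> carrier_mat (state_dim \<Sigma>m) r" "U \<in> carrier_mat r (state_dim \<Sigma>m)" "T * U = 1\<^sub>m (state_dim \<Sigma>m)"
    "intertwines V (transform_lss r L V \<Sigma>) \<Sigma>" "intertwines T (transform_lss r L V \<Sigma>) \<Sigma>m"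
proof -
  let ?n = "state_dim \<Sigma>" and ?k = "state_dim \<Sigma>m"
  note Ty = same_typeD[OF ty]
  note D = is_lssD[OF S(1)] and D' = is_lssD[OF S(2), unfolded Ty]
  note Aw = Aword_carrier[OF S(1)] and Aw' = Aword_carrier[OF S(2), unfolded Ty]
  note CA = CA_carrier[OF S(1)] and CA' = CA_carrier[OF S(2), unfolded Ty]
  note AB = AB_carrier[OF S(1)] and AB' = AB_carrier[OF S(2), unfolded Ty]
  have mk': "Cmat \<Sigma> q * Aword \<Sigma> w * Bmat \<Sigma> r = Cmat \<Sigma>m q * Aword \<Sigma>m w * Bmat \<Sigma>m r"
    if "q \<in> modes \<Sigma>" "w \<in> lists (modes \<Sigma>)" "r \<in> modes \<Sigma>" for q w r
    by (rule mk[unfolded markov_eq_def, THEN bspec, THEN bspec, THEN bspec, OF that])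
  obtain r V L where V: "V \<in> carrier_mat ?n r" and L: "L \<in> carrier_mat r ?n" and LV: "L * V = 1\<^sub>m r"
    and cols: "\<And>j. j < r \<Longrightarrow> col V j \<in> reach_cols \<Sigma>" and twV: "intertwines V (transform_lss r L V \<Sigma>) \<Sigma>"
    and VLAB: "\<And>w s. w \<in> lists (modes \<Sigma>) \<Longrightarrow> s \<in> modes \<Sigma> \<Longrightarrow> V * (L * (Aword \<Sigma> w * Bmat \<Sigma> s)) = Aword \<Sigma> w * Bmat \<Sigma> s"
    by (rule reachable_restriction[OF S(1)]) (rule that)
  define P where "P = (\<lambda>j w s i. col V j = col (Aword \<Sigma> w * Bmat \<Sigma> s) i \<and> s \<in> modes \<Sigma> \<and> w \<in> lists (modes \<Sigma>) \<and> i < input_dim \<Sigma>)"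
  have "\<exists>w s i. P j w s i" if "j < r" for j
    using cols[OF that] unfolding reach_cols_def P_def by blast
  then obtain w s i where P: "\<And>j. j < r \<Longrightarrow> P j (w j) (s j) (i j)" by metis
  define T where "T = mat ?k r (\<lambda>(a, j). col (Aword \<Sigma>m (w j) * Bmat \<Sigma>m (s j)) (i j) $ a)"
  have T: "T \<in> carrier_mat ?k r" by (simp add: T_def)
  have colT: "col T j = col (Aword \<Sigma>m (w j) * Bmat \<Sigma>m (s j)) (i j)" if j: "j < r" for j
  proof -
    have "Aword \<Sigma>m (w j) * Bmat \<Sigma>m (s j) \<in> carrier_mat ?k (input_dim \<Sigma>)"
      using P[OF j] unfolding P_def by (intro AB') auto
    then have "dim_row (Aword \<Sigma>m (w j) * Bmat \<Sigma>m (s j)) = ?k" by (rule carrier_matD(1))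
    then show ?thesis using j by (intro eq_vecI) (simp_all add: T_def)
  qed
  \<comment> \<open>The basic relation: after every word, a state and its image under
    \<open>T\<close> give the same output. Columnwise it is an equality of Markov parameters for the
    concatenated word.\<close>
  have key: "Cmat \<Sigma>m q * Aword \<Sigma>m v * T = Cmat \<Sigma> q * Aword \<Sigma> v * V"
    if q: "q \<in> modes \<Sigma>" and v: "v \<in> lists (modes \<Sigma>)" for q v
  proof (rule mat_col_eqI)
    fix j assume "j < dim_col (Cmat \<Sigma> q * Aword \<Sigma> v * V)"
    then have j: "j < r" using V by simp
    have Pj: "col V j = col (Aword \<Sigma> (w j) * Bmat \<Sigma> (s j)) (i j)" "s j \<in> modes \<Sigma>" "w j \<in> lists (modes \<Sigma>)" "i j < input_dim \<Sigma>"
      using P[OF j] unfolding P_def by auto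
    have vw: "v @ w j \<in> lists (modes \<Sigma>)" using v Pj(3) by (simp only: append_in_lists_conv)
    have "col (Cmat \<Sigma>m q * Aword \<Sigma>m v * T) j = Cmat \<Sigma>m q * Aword \<Sigma>m v *\<^sub>v col T j"
      by (rule col_mult2[OF CA'[OF q v] T j])
    also have "\<dots> = col (Cmat \<Sigma>m q * Aword \<Sigma>m v * (Aword \<Sigma>m (w j) * Bmat \<Sigma>m (s j))) (i j)"
      unfolding colT[OF j] by (rule col_mult2[OF CA'[OF q v] AB'[OF Pj(3,2)] Pj(4), symmetric])
    also have "Cmat \<Sigma>m q * Aword \<Sigma>m v * (Aword \<Sigma>m (w j) * Bmat \<Sigma>m (s j)) = Cmat \<Sigma> q * Aword \<Sigma> v * (Aword \<Sigma> (w j) * Bmat \<Sigma> (s j))"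
      unfolding CA_AB[OF S(1) q v Pj(3,2)] CA_AB[OF S(2), unfolded Ty, OF q v Pj(3,2)] by (rule mk'[OF q vw Pj(2), symmetric])
    also have "col (Cmat \<Sigma> q * Aword \<Sigma> v * (Aword \<Sigma> (w j) * Bmat \<Sigma> (s j))) (i j) = Cmat \<Sigma> q * Aword \<Sigma> v *\<^sub>v col V j"
      unfolding Pj(1) by (rule col_mult2[OF CA[OF q v] AB[OF Pj(3,2)] Pj(4)])
    also have "\<dots> = col (Cmat \<Sigma> q * Aword \<Sigma> v * V) j" by (rule col_mult2[OF CA[OF q v] V j, symmetric])
    finally show "col (Cmat \<Sigma>m q * Aword \<Sigma>m v * T) j = col (Cmat \<Sigma> q * Aword \<Sigma> v * V) j" .
  qed (use carrier_matD[OF CA[OF q v]] carrier_matD[OF CA'[OF q v]] carrier_matD[OF V] carrier_matD[OF T] in \<open>simp_all only: index_mult_mat\<close>)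
  have keyX: "Cmat \<Sigma>m q * Aword \<Sigma>m v * (T * X) = Cmat \<Sigma> q * Aword \<Sigma> v * (V * X)"
    if q: "q \<in> modes \<Sigma>" and v: "v \<in> lists (modes \<Sigma>)" and X: "X \<in> carrier_mat r p" for q v X p
    unfolding assoc_mult_mat[OF CA'[OF q v] T X, symmetric] assoc_mult_mat[OF CA[OF q v] V X, symmetric] key[OF q v] ..
  have cancel: "M = N" if "M \<in> carrier_mat ?k p" "N \<in> carrier_mat ?k p"
    "\<And>q v. q \<in> modes \<Sigma> \<Longrightarrow> v \<in> lists (modes \<Sigma>) \<Longrightarrow> Cmat \<Sigma>m q * Aword \<Sigma>m v * M = Cmat \<Sigma>m q * Aword \<Sigma>m v * N" for M N p
    by (rule minimal_observable_cancel[OF S(2) min that(1,2), unfolded Ty]) (rule that(3))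
  have twVD: "Amat \<Sigma> q * V = V * (L * Amat \<Sigma> q * V)" "Bmat \<Sigma> q = V * (L * Bmat \<Sigma> q)" if "q \<in> modes \<Sigma>" for q
    using twV that unfolding intertwines_def transform_lss_simps by auto
  have twT: "intertwines T (transform_lss r L V \<Sigma>) \<Sigma>m" unfolding intertwines_def transform_lss_simps
  proof (intro conjI ballI T)
    show "same_type (transform_lss r L V \<Sigma>) \<Sigma>m" using ty by (simp add: same_type_def transform_lss_def)
    fix q assume q: "q \<in> modes \<Sigma>"
    note LA = mult_carrier_mat[OF L D(1)[OF q]]
    note LAV = mult_carrier_mat[OF LA V]
    note LB = mult_carrier_mat[OF L D(2)[OF q]]
    show "Amat \<Sigma>m q * T = T * (L * Amat \<Sigma> q * V)"
    proof (rule cancel[OF mult_carrier_mat[OF D'(1)[OF q] T] mult_carrier_mat[OF T LAV]])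
      fix q' v assume q': "q' \<in> modes \<Sigma>" and v: "v \<in> lists (modes \<Sigma>)"
      have vq: "v @ [q] \<in> lists (modes \<Sigma>)" using v q by simp
      have "Cmat \<Sigma>m q' * Aword \<Sigma>m v * (Amat \<Sigma>m q * T) = Cmat \<Sigma>m q' * Aword \<Sigma>m (v @ [q]) * T"
        unfolding CA_snoc[OF S(2), unfolded Ty, OF q' v q] by (rule assoc_mult_mat[OF CA'[OF q' v] D'(1)[OF q] T, symmetric])
      also have "\<dots> = Cmat \<Sigma> q' * Aword \<Sigma> (v @ [q]) * V" by (rule key[OF q' vq])
      also have "\<dots> = Cmat \<Sigma> q' * Aword \<Sigma> v * (Amat \<Sigma> q * V)"
        unfolding CA_snoc[OF S(1) q' v q] by (rule assoc_mult_mat[OF CA[OF q' v] D(1)[OF q] V])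
      also have "\<dots> = Cmat \<Sigma>m q' * Aword \<Sigma>m v * (T * (L * Amat \<Sigma> q * V))"
        unfolding keyX[OF q' v LAV] twVD(1)[OF q, symmetric] ..
      finally show "Cmat \<Sigma>m q' * Aword \<Sigma>m v * (Amat \<Sigma>m q * T) = Cmat \<Sigma>m q' * Aword \<Sigma>m v * (T * (L * Amat \<Sigma> q * V))" .
    qed
    show "Bmat \<Sigma>m q = T * (L * Bmat \<Sigma> q)"
    proof (rule cancel[OF D'(2)[OF q] mult_carrier_mat[OF T LB]])
      fix q' v assume q': "q' \<in> modes \<Sigma>" and v: "v \<in> lists (modes \<Sigma>)"
      show "Cmat \<Sigma>m q' * Aword \<Sigma>m v * Bmat \<Sigma>m q = Cmat \<Sigma>m q' * Aword \<Sigma>m v * (T * (L * Bmat \<Sigma> q))"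
        unfolding keyX[OF q' v LB] twVD(2)[OF q, symmetric] by (rule mk'[OF q' v q, symmetric])
    qed
    have "Cmat \<Sigma>m q * Aword \<Sigma>m [] = Cmat \<Sigma>m q" "Cmat \<Sigma> q * Aword \<Sigma> [] = Cmat \<Sigma> q"
      using D(3)[OF q] D'(3)[OF q] by simp_all
    then show "Cmat \<Sigma>m q * T = Cmat \<Sigma> q * V" using key[OF q, of "[]"] by simp
  qed
  obtain Vm Lm where Vm: "Vm \<in> carrier_mat ?k ?k" and Lm: "Lm \<in> carrier_mat ?k ?k" and VLm: "Vm * Lm = 1\<^sub>m ?k"
    and colm: "\<And>j. j < ?k \<Longrightarrow> col Vm j \<in> reach_cols \<Sigma>m"
    by (rule minimal_reachable[OF S(2) min]) (rule that)
  \<comment> \<open>The columns of the invertible matrix \<open>Vm\<close> are reachable, hence have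
    preimages under \<open>T\<close>. Collected into \<open>W\<close> these give the right inverse
    \<open>W * Lm\<close>.\<close>
  have "\<forall>j\<in>{..<?k}. \<exists>x. x \<in> carrier_vec r \<and> T *\<^sub>v x = col Vm j"
  proof
    fix j assume "j \<in> {..<?k}"
    then have j: "j < ?k" by simp
    obtain v t a where vt: "col Vm j = col (Aword \<Sigma>m v * Bmat \<Sigma>m t) a" "t \<in> modes \<Sigma>" "v \<in> lists (modes \<Sigma>)" "a < input_dim \<Sigma>"
      using colm[OF j] unfolding reach_cols_def Ty by blast
    note LAB = mult_carrier_mat[OF L AB[OF vt(3,2)]]
    have "T * (L * (Aword \<Sigma> v * Bmat \<Sigma> t)) = Aword \<Sigma>m v * Bmat \<Sigma>m t"
    proof (rule cancel[OF mult_carrier_mat[OF T LAB] AB'[OF vt(3,2)]])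
      fix q' v' assume q': "q' \<in> modes \<Sigma>" and v': "v' \<in> lists (modes \<Sigma>)"
      have vv: "v' @ v \<in> lists (modes \<Sigma>)" using v' vt(3) by (simp only: append_in_lists_conv)
      show "Cmat \<Sigma>m q' * Aword \<Sigma>m v' * (T * (L * (Aword \<Sigma> v * Bmat \<Sigma> t))) = Cmat \<Sigma>m q' * Aword \<Sigma>m v' * (Aword \<Sigma>m v * Bmat \<Sigma>m t)"
        unfolding keyX[OF q' v' LAB] VLAB[OF vt(3,2)] CA_AB[OF S(1) q' v' vt(3,2)] CA_AB[OF S(2), unfolded Ty, OF q' v' vt(3,2)]
        by (rule mk'[OF q' vv vt(2)])
    qed
    then have "T *\<^sub>v col (L * (Aword \<Sigma> v * Bmat \<Sigma> t)) a = col Vm j"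
      unfolding vt(1) by (subst col_mult2[OF T LAB vt(4), symmetric]) simp
    moreover have "col (L * (Aword \<Sigma> v * Bmat \<Sigma> t)) a \<in> carrier_vec r" by (rule col_carrier_vec[OF vt(4) LAB])
    ultimately show "\<exists>x. x \<in> carrier_vec r \<and> T *\<^sub>v x = col Vm j" by blast
  qed
  from bchoice[OF this] obtain x where x: "\<forall>j\<in>{..<?k}. x j \<in> carrier_vec r \<and> T *\<^sub>v x j = col Vm j" by (elim exE)
  define W where "W = mat r ?k (\<lambda>(a, j). x j $ a)"
  have W: "W \<in> carrier_mat r ?k" by (simp add: W_def)
  have TW: "T * W = Vm"
  proof (rule mat_col_eqI)
    fix j assume "j < dim_col Vm"
    then have j: "j < ?k" using Vm by simp
    have "x j \<in> carrier_vec r" using x j by simp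
    then have "dim_vec (x j) = r" by simp
    then have "col W j = x j" using j by (intro eq_vecI) (simp_all add: W_def)
    then show "col (T * W) j = col Vm j" using col_mult2[OF T W j] x j by simp
  qed (use T W Vm in auto)
  have "T * (W * Lm) = 1\<^sub>m ?k" using assoc_mult_mat[OF T W Lm] TW VLm by simp
  then show thesis by (rule that[OF V L LV T mult_carrier_mat[OF W Lm] _ twV twT])
qed

section \<open>Dissipation inequalities\<close>

lemma form_transpose_mult:
  fixes X Y :: "real mat"
  assumes "X \<in> carrier_mat k a" "Y \<in> carrier_mat k b" "x \<in> carrier_vec a" "y \<in> carrier_vec b"
  shows "x \<bullet> (X\<^sup>T * Y *\<^sub>v y) = (X *\<^sub>v x) \<bullet> (Y *\<^sub>v y)"
proof -
  have Xt: "X\<^sup>T \<in> carrier_mat a k" and Yy: "Y *\<^sub>v y \<in> carrier_vec k" using assms by auto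
  have "x \<bullet> (X\<^sup>T * Y *\<^sub>v y) = x \<bullet> (X\<^sup>T *\<^sub>v (Y *\<^sub>v y))"
    unfolding assoc_mult_mat_vec[OF Xt assms(2,4)] ..
  also have "\<dots> = (X\<^sup>T\<^sup>T *\<^sub>v x) \<bullet> (Y *\<^sub>v y)"
    by (rule transpose_vec_mult_scalar[OF Xt Yy assms(3), symmetric])
  finally show ?thesis by simp
qed

lemma form_congruence:
  fixes X P Y :: "real mat"
  assumes "X \<in> carrier_mat n a" "P \<in> carrier_mat n n" "Y \<in> carrier_mat n b" "x \<in> carrier_vec a" "y \<in> carrier_vec b"
  shows "x \<bullet> (X\<^sup>T * P * Y *\<^sub>v y) = (X *\<^sub>v x) \<bullet> (P *\<^sub>v (Y *\<^sub>v y))"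
proof -
  have Xt: "X\<^sup>T \<in> carrier_mat a n" using assms by auto
  show ?thesis
    unfolding assoc_mult_mat[OF Xt assms(2,3)] form_transpose_mult[OF assms(1) mult_carrier_mat[OF assms(2,3)] assms(4,5)]
      assoc_mult_mat_vec[OF assms(2,3,5)] ..
qed

lemma form_add:
  fixes M N :: "real mat"
  assumes "M \<in> carrier_mat a b" "N \<in> carrier_mat a b" "x \<in> carrier_vec a" "y \<in> carrier_vec b"
  shows "x \<bullet> ((M + N) *\<^sub>v y) = x \<bullet> (M *\<^sub>v y) + x \<bullet> (N *\<^sub>v y)"
  unfolding add_mult_distrib_mat_vec[OF assms(1,2,4)]
  by (rule scalar_prod_add_distrib[OF assms(3) mult_mat_vec_carrier[OF assms(1,4)] mult_mat_vec_carrier[OF assms(2,4)]])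

lemma form_minus:
  fixes M N :: "real mat"
  assumes "M \<in> carrier_mat a b" "N \<in> carrier_mat a b" "x \<in> carrier_vec a" "y \<in> carrier_vec b"
  shows "x \<bullet> ((M - N) *\<^sub>v y) = x \<bullet> (M *\<^sub>v y) - x \<bullet> (N *\<^sub>v y)"
  unfolding minus_mult_distrib_mat_vec[OF assms(1,2,4)]
  by (rule scalar_prod_minus_distrib[OF assms(3) mult_mat_vec_carrier[OF assms(1,4)] mult_mat_vec_carrier[OF assms(2,4)]])

lemma symmetric_form_commute:
  fixes P :: "real mat"
  assumes "P \<in> carrier_mat n n" "P\<^sup>T = P" "x \<in> carrier_vec n" "y \<in> carrier_vec n"
  shows "x \<bullet> (P *\<^sub>v y) = y \<bullet> (P *\<^sub>v x)"
proof -
  have "x \<bullet> (P *\<^sub>v y) = (P\<^sup>T *\<^sub>v x) \<bullet> y" by (rule transpose_vec_mult_scalar[OF assms(1,4,3), symmetric])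
  also have "\<dots> = y \<bullet> (P *\<^sub>v x)"
    unfolding assms(2) by (rule comm_scalar_prod[OF mult_mat_vec_carrier[OF assms(1,3)] assms(4)])
  finally show ?thesis .
qed

lemma transpose_congruence:
  fixes P :: "real mat"
  assumes "X \<in> carrier_mat n a" "P \<in> carrier_mat n n" "P\<^sup>T = P" "Y \<in> carrier_mat n b"
  shows "(X\<^sup>T * P * Y)\<^sup>T = Y\<^sup>T * P * X"
proof -
  have Xt: "X\<^sup>T \<in> carrier_mat a n" and Yt: "Y\<^sup>T \<in> carrier_mat b n" using assms by auto
  have "(X\<^sup>T * P * Y)\<^sup>T = Y\<^sup>T * (X\<^sup>T * P)\<^sup>T" by (rule transpose_mult[OF mult_carrier_mat[OF Xt assms(2)] assms(4)])
  also have "(X\<^sup>T * P)\<^sup>T = P * X" unfolding transpose_mult[OF Xt assms(2)] assms(3) by simp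
  finally show ?thesis using assoc_mult_mat[OF Yt assms(2,1)] by simp
qed

lemma transpose_gram:
  fixes C :: "real mat"
  assumes "C \<in> carrier_mat p n"
  shows "(C\<^sup>T * C)\<^sup>T = C\<^sup>T * C"
  using transpose_mult[of "C\<^sup>T" n p C n] assms by simp

text \<open>The change of the storage function \<open>x \<bullet> (P *\<^sub>v x)\<close>, for
  symmetric \<open>P\<close>: its time derivative when \<open>x\<close> moves with velocity
  \<open>z\<close>, or its increment when \<open>z\<close> is the successor of \<open>x\<close>. All
  the matrix inequalities are conditions on this expression.\<close>

definition lyap :: "time_axis \<Rightarrow> real mat \<Rightarrow> real vec \<Rightarrow> real vec \<Rightarrow> real" where
  "lyap \<tau> P x z = (case \<tau> of Continuous_Time \<Rightarrow> 2 * (x \<bullet> (P *\<^sub>v z))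
     | Discrete_Time \<Rightarrow> z \<bullet> (P *\<^sub>v z) - x \<bullet> (P *\<^sub>v x))"

lemma pos_defD:
  assumes "pos_def n P"
  shows "P \<in> carrier_mat n n" "P\<^sup>T = P" "\<And>v. v \<in> carrier_vec n \<Longrightarrow> v \<noteq> 0\<^sub>v n \<Longrightarrow> v \<bullet> (P *\<^sub>v v) > 0"
  using assms unfolding pos_def_def by auto

lemma pos_def_nonneg:
  assumes "pos_def n P" "v \<in> carrier_vec n"
  shows "v \<bullet> (P *\<^sub>v v) \<ge> 0"
proof (cases "v = 0\<^sub>v n")
  case True
  then show ?thesis using mult_mat_zero_vec[OF pos_defD(1)[OF assms(1)]] by simp
next
  case False
  then show ?thesis using pos_defD(3)[OF assms(1,2)] by simp
qed

context
  fixes n :: nat and A P :: "real mat"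
  assumes A: "A \<in> carrier_mat n n" and P: "P \<in> carrier_mat n n" and sym: "P\<^sup>T = P"
begin

lemma At: "A\<^sup>T \<in> carrier_mat n n" using A by simp

lemma ct_lyap_carrier: "A\<^sup>T * P + P * A \<in> carrier_mat n n"
  by (rule add_carrier_mat[OF mult_carrier_mat[OF P A]])

lemma dt_lyap_carrier: "A\<^sup>T * P * A \<in> carrier_mat n n"
  by (rule mult_carrier_mat[OF mult_carrier_mat[OF At P] A])

lemma ct_lyap_sym: "(A\<^sup>T * P + P * A)\<^sup>T = A\<^sup>T * P + P * A"
proof -
  have "(A\<^sup>T * P + P * A)\<^sup>T = (A\<^sup>T * P)\<^sup>T + (P * A)\<^sup>T"
    by (rule transpose_add[OF mult_carrier_mat[OF At P] mult_carrier_mat[OF P A]])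
  also have "\<dots> = P * A + A\<^sup>T * P" unfolding transpose_mult[OF At P] transpose_mult[OF P A] sym by simp
  also have "\<dots> = A\<^sup>T * P + P * A" by (rule comm_add_mat[OF mult_carrier_mat[OF P A] mult_carrier_mat[OF At P]])
  finally show ?thesis .
qed

lemma dt_lyap_sym: "(A\<^sup>T * P * A)\<^sup>T = A\<^sup>T * P * A"
  by (rule transpose_congruence[OF A P sym A])

lemma ct_lyap_form:
  assumes x: "x \<in> carrier_vec n"
  shows "x \<bullet> ((A\<^sup>T * P + P * A) *\<^sub>v x) = lyap Continuous_Time P x (A *\<^sub>v x)"
proof -
  note Ax = mult_mat_vec_carrier[OF A x]
  have "x \<bullet> ((A\<^sup>T * P + P * A) *\<^sub>v x) = x \<bullet> (A\<^sup>T * P *\<^sub>v x) + x \<bullet> (P * A *\<^sub>v x)"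
    by (rule form_add[OF mult_carrier_mat[OF At P] mult_carrier_mat[OF P A] x x])
  also have "x \<bullet> (A\<^sup>T * P *\<^sub>v x) = (A *\<^sub>v x) \<bullet> (P *\<^sub>v x)" by (rule form_transpose_mult[OF A P x x])
  also have "\<dots> = x \<bullet> (P *\<^sub>v (A *\<^sub>v x))" by (rule symmetric_form_commute[OF P sym Ax x])
  also have "x \<bullet> (P * A *\<^sub>v x) = x \<bullet> (P *\<^sub>v (A *\<^sub>v x))" unfolding assoc_mult_mat_vec[OF P A x] ..
  finally show ?thesis by (simp add: lyap_def)
qed

lemma dt_lyap_form:
  assumes x: "x \<in> carrier_vec n"
  shows "x \<bullet> (A\<^sup>T * P * A *\<^sub>v x) - x \<bullet> (P *\<^sub>v x) = lyap Discrete_Time P x (A *\<^sub>v x)"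
  unfolding form_congruence[OF A P A x x] by (simp add: lyap_def)

end

text \<open>Symmetry of the matrix in the inequality is inherited from \<open>P\<close>, so only the
  sign of its quadratic form remains, and the two time axes share one formulation.\<close>

lemma stability_set_iff:
  assumes S: "is_lss \<Sigma>"
  shows "P \<in> stability_set \<tau> \<Sigma> \<longleftrightarrow> pos_def (state_dim \<Sigma>) P \<and>
    (\<forall>q\<in>modes \<Sigma>. \<forall>x\<in>carrier_vec (state_dim \<Sigma>). x \<noteq> 0\<^sub>v (state_dim \<Sigma>) \<longrightarrow> lyap \<tau> P x (Amat \<Sigma> q *\<^sub>v x) < 0)"
proof (cases "pos_def (state_dim \<Sigma>) P")
  case True
  note P = pos_defD(1,2)[OF True]
  have "neg_def (state_dim \<Sigma>) (case \<tau> of Continuous_Time \<Rightarrow> A\<^sup>T * P + P * A | Discrete_Time \<Rightarrow> A\<^sup>T * P * A - P) \<longleftrightarrow>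
    (\<forall>x\<in>carrier_vec (state_dim \<Sigma>). x \<noteq> 0\<^sub>v (state_dim \<Sigma>) \<longrightarrow> lyap \<tau> P x (A *\<^sub>v x) < 0)"
    if A: "A \<in> carrier_mat (state_dim \<Sigma>) (state_dim \<Sigma>)" for A
  proof (cases \<tau>)
    case Continuous_Time
    show ?thesis unfolding Continuous_Time time_axis.case neg_def_def
      using ct_lyap_carrier[OF A P] ct_lyap_sym[OF A P] ct_lyap_form[OF A P] by simp
  next
    case Discrete_Time
    have c: "A\<^sup>T * P * A - P \<in> carrier_mat (state_dim \<Sigma>) (state_dim \<Sigma>)"
      by (rule minus_carrier_mat[OF P(1)])
    have s: "(A\<^sup>T * P * A - P)\<^sup>T = A\<^sup>T * P * A - P"
      unfolding transpose_minus[OF dt_lyap_carrier[OF A P] P(1)] dt_lyap_sym[OF A P] P(2) ..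
    have f: "x \<bullet> ((A\<^sup>T * P * A - P) *\<^sub>v x) = lyap Discrete_Time P x (A *\<^sub>v x)" if "x \<in> carrier_vec (state_dim \<Sigma>)" for x
      unfolding form_minus[OF dt_lyap_carrier[OF A P] P(1) that that] by (rule dt_lyap_form[OF A P that])
    show ?thesis unfolding Discrete_Time time_axis.case neg_def_def using c s f by simp
  qed
  then show ?thesis using is_lssD(1)[OF S] True unfolding stability_set_def Let_def by simp
qed (simp add: stability_set_def)

lemma obs_grammians_iff:
  assumes S: "is_lss \<Sigma>"
  shows "P \<in> obs_grammians \<tau> \<Sigma> \<longleftrightarrow> pos_def (state_dim \<Sigma>) P \<and>
    (\<forall>q\<in>modes \<Sigma>. \<forall>x\<in>carrier_vec (state_dim \<Sigma>). lyap \<tau> P x (Amat \<Sigma> q *\<^sub>v x) + (Cmat \<Sigma> q *\<^sub>v x) \<bullet> (Cmat \<Sigma> q *\<^sub>v x) \<le> 0)"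
proof (cases "pos_def (state_dim \<Sigma>) P")
  case True
  let ?n = "state_dim \<Sigma>"
  note P = pos_defD(1,2)[OF True]
  have "neg_semidef ?n (case \<tau> of Continuous_Time \<Rightarrow> A\<^sup>T * P + P * A + C\<^sup>T * C | Discrete_Time \<Rightarrow> A\<^sup>T * P * A + C\<^sup>T * C - P) \<longleftrightarrow>
    (\<forall>x\<in>carrier_vec ?n. lyap \<tau> P x (A *\<^sub>v x) + (C *\<^sub>v x) \<bullet> (C *\<^sub>v x) \<le> 0)"
    if A: "A \<in> carrier_mat ?n ?n" and C: "C \<in> carrier_mat (output_dim \<Sigma>) ?n" for A C
  proof -
    have CC: "C\<^sup>T * C \<in> carrier_mat ?n ?n" using C by simp
    note CCs = transpose_gram[OF C] and CCf = form_transpose_mult[OF C C]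
    show ?thesis
    proof (cases \<tau>)
      case Continuous_Time
      note K = ct_lyap_carrier[OF A P]
      have c: "A\<^sup>T * P + P * A + C\<^sup>T * C \<in> carrier_mat ?n ?n" by (rule add_carrier_mat[OF CC])
      have s: "(A\<^sup>T * P + P * A + C\<^sup>T * C)\<^sup>T = A\<^sup>T * P + P * A + C\<^sup>T * C"
        unfolding transpose_add[OF K CC] ct_lyap_sym[OF A P] CCs ..
      have f: "x \<bullet> ((A\<^sup>T * P + P * A + C\<^sup>T * C) *\<^sub>v x) = lyap Continuous_Time P x (A *\<^sub>v x) + (C *\<^sub>v x) \<bullet> (C *\<^sub>v x)"
        if "x \<in> carrier_vec ?n" for x
        unfolding form_add[OF K CC that that] ct_lyap_form[OF A P that] CCf[OF that that] ..
      show ?thesis unfolding Continuous_Time time_axis.case neg_semidef_def using c s f by simp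
    next
      case Discrete_Time
      note K = dt_lyap_carrier[OF A P]
      note KC = add_carrier_mat[OF CC, of "A\<^sup>T * P * A"]
      have c: "A\<^sup>T * P * A + C\<^sup>T * C - P \<in> carrier_mat ?n ?n" by (rule minus_carrier_mat[OF P(1)])
      have s: "(A\<^sup>T * P * A + C\<^sup>T * C - P)\<^sup>T = A\<^sup>T * P * A + C\<^sup>T * C - P"
        unfolding transpose_minus[OF KC P(1)] transpose_add[OF K CC] dt_lyap_sym[OF A P] CCs P(2) ..
      have f: "x \<bullet> ((A\<^sup>T * P * A + C\<^sup>T * C - P) *\<^sub>v x) = lyap Discrete_Time P x (A *\<^sub>v x) + (C *\<^sub>v x) \<bullet> (C *\<^sub>v x)"
        if "x \<in> carrier_vec ?n" for x
        unfolding form_minus[OF KC P(1) that that] form_add[OF K CC that that] CCf[OF that that] dt_lyap_form[OF A P that, symmetric] by simp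
      show ?thesis unfolding Discrete_Time time_axis.case neg_semidef_def using c s f by simp
    qed
  qed
  then show ?thesis using is_lssD(1,3)[OF S] True unfolding obs_grammians_def Let_def by simp
qed (simp add: obs_grammians_def)

lemma form_block:
  fixes K11 K12 K21 K22 :: "real mat"
  assumes "K11 \<in> carrier_mat n n" "K12 \<in> carrier_mat n m" "K21 \<in> carrier_mat m n" "K22 \<in> carrier_mat m m"
    and x: "x \<in> carrier_vec n" and u: "u \<in> carrier_vec m"
  shows "(x @\<^sub>v u) \<bullet> (four_block_mat K11 K12 K21 K22 *\<^sub>v (x @\<^sub>v u)) =
    x \<bullet> (K11 *\<^sub>v x) + x \<bullet> (K12 *\<^sub>v u) + u \<bullet> (K21 *\<^sub>v x) + u \<bullet> (K22 *\<^sub>v u)"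
proof -
  note c = mult_mat_vec_carrier[OF assms(1) x] mult_mat_vec_carrier[OF assms(2) u]
    mult_mat_vec_carrier[OF assms(3) x] mult_mat_vec_carrier[OF assms(4) u]
  show ?thesis
    unfolding four_block_mat_mult_vec[OF assms] scalar_prod_append[OF x u add_carrier_vec[OF c(1,2)] add_carrier_vec[OF c(3,4)]]
      scalar_prod_add_distrib[OF x c(1,2)] scalar_prod_add_distrib[OF u c(3,4)] by simp
qed

lemma neg_def_block_iff:
  assumes K: "K11 \<in> carrier_mat n n" "K12 \<in> carrier_mat n m" "K21 \<in> carrier_mat m n" "K22 \<in> carrier_mat m m"
    and sym: "K11\<^sup>T = K11" "K12\<^sup>T = K21" "K21\<^sup>T = K12" "K22\<^sup>T = K22"
  shows "neg_def (n + m) (four_block_mat K11 K12 K21 K22) \<longleftrightarrow>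
    (\<forall>x\<in>carrier_vec n. \<forall>u\<in>carrier_vec m. x \<noteq> 0\<^sub>v n \<or> u \<noteq> 0\<^sub>v m \<longrightarrow>
      x \<bullet> (K11 *\<^sub>v x) + x \<bullet> (K12 *\<^sub>v u) + u \<bullet> (K21 *\<^sub>v x) + u \<bullet> (K22 *\<^sub>v u) < 0)" (is "?l = ?r")
proof -
  have c: "four_block_mat K11 K12 K21 K22 \<in> carrier_mat (n + m) (n + m)" by (rule four_block_carrier_mat[OF K(1,4)])
  have s: "(four_block_mat K11 K12 K21 K22)\<^sup>T = four_block_mat K11 K12 K21 K22"
    unfolding transpose_four_block_mat[OF K] sym ..
  have z: "0\<^sub>v (n + m) = (0\<^sub>v n @\<^sub>v 0\<^sub>v m :: real vec)" by (rule eq_vecI) auto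
  have eqz: "x @\<^sub>v u = 0\<^sub>v (n + m) \<longleftrightarrow> x = 0\<^sub>v n \<and> u = 0\<^sub>v m" if "x \<in> carrier_vec n" "u \<in> carrier_vec m" for x u :: "real vec"
    unfolding z using append_vec_eq[OF that(1), of "0\<^sub>v n"] by simp
  have "?l \<longleftrightarrow> (\<forall>v\<in>carrier_vec (n + m). v \<noteq> 0\<^sub>v (n + m) \<longrightarrow> v \<bullet> (four_block_mat K11 K12 K21 K22 *\<^sub>v v) < 0)"
    unfolding neg_def_def using c s by blast
  also have "\<dots> \<longleftrightarrow> (\<forall>x\<in>carrier_vec n. \<forall>u\<in>carrier_vec m. x @\<^sub>v u \<noteq> 0\<^sub>v (n + m) \<longrightarrow>
      (x @\<^sub>v u) \<bullet> (four_block_mat K11 K12 K21 K22 *\<^sub>v (x @\<^sub>v u)) < 0)"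
  proof (intro iffI ballI impI)
    fix v :: "real vec" assume H: "\<forall>x\<in>carrier_vec n. \<forall>u\<in>carrier_vec m. x @\<^sub>v u \<noteq> 0\<^sub>v (n + m) \<longrightarrow>
      (x @\<^sub>v u) \<bullet> (four_block_mat K11 K12 K21 K22 *\<^sub>v (x @\<^sub>v u)) < 0" and v: "v \<in> carrier_vec (n + m)" "v \<noteq> 0\<^sub>v (n + m)"
    have e: "v = vec_first v n @\<^sub>v vec_last v m" using vec_first_last_append[OF v(1)] by simp
    show "v \<bullet> (four_block_mat K11 K12 K21 K22 *\<^sub>v v) < 0"
      using H[rule_format, of "vec_first v n" "vec_last v m"] v(2) unfolding e[symmetric] by simp
  qed simp
  also have "\<dots> \<longleftrightarrow> ?r"
    by (intro ball_cong refl) (simp add: eqz form_block[OF K])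
  finally show ?thesis .
qed

text \<open>Evaluated at the stacked vector of \<open>x\<close> and \<open>u\<close>, the block
  inequality is a strict dissipation inequality whose supply rate is
  \<open>\<gamma>\<^sup>2 * (u \<bullet> u)\<close> minus the squared norm of the output.\<close>

lemma gain_set_iff:
  assumes S: "is_lss \<Sigma>"
  shows "P \<in> gain_set \<tau> \<gamma> \<Sigma> \<longleftrightarrow> pos_def (state_dim \<Sigma>) P \<and>
    (\<forall>q\<in>modes \<Sigma>. \<forall>x\<in>carrier_vec (state_dim \<Sigma>). \<forall>u\<in>carrier_vec (input_dim \<Sigma>). x \<noteq> 0\<^sub>v (state_dim \<Sigma>) \<or> u \<noteq> 0\<^sub>v (input_dim \<Sigma>) \<longrightarrow>
      lyap \<tau> P x (Amat \<Sigma> q *\<^sub>v x + Bmat \<Sigma> q *\<^sub>v u) + (Cmat \<Sigma> q *\<^sub>v x) \<bullet> (Cmat \<Sigma> q *\<^sub>v x) - \<gamma>\<^sup>2 * (u \<bullet> u) < 0)"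
proof (cases "pos_def (state_dim \<Sigma>) P")
  case True
  let ?n = "state_dim \<Sigma>" and ?m = "input_dim \<Sigma>"
  note P = pos_defD(1,2)[OF True]
  define G :: "real mat" where "G = \<gamma>\<^sup>2 \<cdot>\<^sub>m 1\<^sub>m ?m"
  have G: "G \<in> carrier_mat ?m ?m" "G\<^sup>T = G" by (auto simp: G_def)
  have Gf: "u \<bullet> (G *\<^sub>v u) = \<gamma>\<^sup>2 * (u \<bullet> u)" if u: "u \<in> carrier_vec ?m" for u
  proof -
    have "G *\<^sub>v u = \<gamma>\<^sup>2 \<cdot>\<^sub>v u" by (rule eq_vecI) (use u in \<open>auto simp: G_def\<close>)
    then show ?thesis using u by simp
  qed
  have "neg_def (?n + ?m) (case \<tau> of
             Continuous_Time \<Rightarrow> four_block_mat (A\<^sup>T * P + P * A + C\<^sup>T * C) (P * B) (B\<^sup>T * P) (- G)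
           | Discrete_Time \<Rightarrow> four_block_mat (A\<^sup>T * P * A + C\<^sup>T * C - P) (A\<^sup>T * P * B) (B\<^sup>T * P * A) (B\<^sup>T * P * B - G)) \<longleftrightarrow>
    (\<forall>x\<in>carrier_vec ?n. \<forall>u\<in>carrier_vec ?m. x \<noteq> 0\<^sub>v ?n \<or> u \<noteq> 0\<^sub>v ?m \<longrightarrow>
      lyap \<tau> P x (A *\<^sub>v x + B *\<^sub>v u) + (C *\<^sub>v x) \<bullet> (C *\<^sub>v x) - \<gamma>\<^sup>2 * (u \<bullet> u) < 0)"
    if A: "A \<in> carrier_mat ?n ?n" and B: "B \<in> carrier_mat ?n ?m" and C: "C \<in> carrier_mat (output_dim \<Sigma>) ?n" for A B C
  proof -
    have CC: "C\<^sup>T * C \<in> carrier_mat ?n ?n" using C by simp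
    have Bt: "B\<^sup>T \<in> carrier_mat ?m ?n" and At: "A\<^sup>T \<in> carrier_mat ?n ?n" using A B by auto
    note CCs = transpose_gram[OF C] and CCf = form_transpose_mult[OF C C]
    show ?thesis
    proof (cases \<tau>)
      case Continuous_Time
      note K = ct_lyap_carrier[OF A P]
      have c: "A\<^sup>T * P + P * A + C\<^sup>T * C \<in> carrier_mat ?n ?n" by (rule add_carrier_mat[OF CC])
      have s: "(A\<^sup>T * P + P * A + C\<^sup>T * C)\<^sup>T = A\<^sup>T * P + P * A + C\<^sup>T * C"
        unfolding transpose_add[OF K CC] ct_lyap_sym[OF A P] CCs ..
      have G': "- G \<in> carrier_mat ?m ?m" "(- G)\<^sup>T = - G" using G by (auto simp: transpose_uminus)
      have s12: "(P * B)\<^sup>T = B\<^sup>T * P" unfolding transpose_mult[OF P(1) B] P(2) ..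
      have s21: "(B\<^sup>T * P)\<^sup>T = P * B" unfolding transpose_mult[OF Bt P(1)] P(2) by simp
      have f: "x \<bullet> ((A\<^sup>T * P + P * A + C\<^sup>T * C) *\<^sub>v x) + x \<bullet> (P * B *\<^sub>v u) + u \<bullet> (B\<^sup>T * P *\<^sub>v x) + u \<bullet> (- G *\<^sub>v u) =
          lyap \<tau> P x (A *\<^sub>v x + B *\<^sub>v u) + (C *\<^sub>v x) \<bullet> (C *\<^sub>v x) - \<gamma>\<^sup>2 * (u \<bullet> u)"
        if x: "x \<in> carrier_vec ?n" and u: "u \<in> carrier_vec ?m" for x u
      proof -
        note Ax = mult_mat_vec_carrier[OF A x] and Bu = mult_mat_vec_carrier[OF B u]
        have "- G *\<^sub>v u = - (G *\<^sub>v u)" using G(1) u by auto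
        then have g: "u \<bullet> (- G *\<^sub>v u) = - (\<gamma>\<^sup>2 * (u \<bullet> u))"
          unfolding Gf[OF u, symmetric]
          using scalar_prod_uminus_right[of u "G *\<^sub>v u"] carrier_vecD[OF mult_mat_vec_carrier[OF G(1) u]] carrier_vecD[OF u] by (simp only:)
        have "x \<bullet> (P *\<^sub>v (A *\<^sub>v x + B *\<^sub>v u)) = x \<bullet> (P *\<^sub>v (A *\<^sub>v x)) + x \<bullet> (P *\<^sub>v (B *\<^sub>v u))"
          unfolding mult_add_distrib_mat_vec[OF P(1) Ax Bu]
          by (rule scalar_prod_add_distrib[OF x mult_mat_vec_carrier[OF P(1) Ax] mult_mat_vec_carrier[OF P(1) Bu]])
        moreover have "u \<bullet> (B\<^sup>T * P *\<^sub>v x) = x \<bullet> (P *\<^sub>v (B *\<^sub>v u))"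
          unfolding form_transpose_mult[OF B P(1) u x] by (rule symmetric_form_commute[OF P Bu x])
        moreover have "x \<bullet> (P * B *\<^sub>v u) = x \<bullet> (P *\<^sub>v (B *\<^sub>v u))" unfolding assoc_mult_mat_vec[OF P(1) B u] ..
        ultimately show ?thesis
          unfolding form_add[OF K CC x x] ct_lyap_form[OF A P x] CCf[OF x x] g Continuous_Time lyap_def by simp
      qed
      show ?thesis unfolding Continuous_Time time_axis.case
          neg_def_block_iff[OF c mult_carrier_mat[OF P(1) B] mult_carrier_mat[OF Bt P(1)] G'(1) s s12 s21 G'(2)]
        by (intro ball_cong refl) (simp only: f[unfolded Continuous_Time])
    next
      case Discrete_Time
      note K = dt_lyap_carrier[OF A P]
      note KC = add_carrier_mat[OF CC, of "A\<^sup>T * P * A"]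
      have c: "A\<^sup>T * P * A + C\<^sup>T * C - P \<in> carrier_mat ?n ?n" by (rule minus_carrier_mat[OF P(1)])
      have s: "(A\<^sup>T * P * A + C\<^sup>T * C - P)\<^sup>T = A\<^sup>T * P * A + C\<^sup>T * C - P"
        unfolding transpose_minus[OF KC P(1)] transpose_add[OF K CC] dt_lyap_sym[OF A P] CCs P(2) ..
      note K22 = mult_carrier_mat[OF mult_carrier_mat[OF Bt P(1)] B]
      have c22: "B\<^sup>T * P * B - G \<in> carrier_mat ?m ?m" by (rule minus_carrier_mat[OF G(1)])
      have s22: "(B\<^sup>T * P * B - G)\<^sup>T = B\<^sup>T * P * B - G"
        unfolding transpose_minus[OF K22 G(1)] transpose_congruence[OF B P B] G(2) ..
      have f: "x \<bullet> ((A\<^sup>T * P * A + C\<^sup>T * C - P) *\<^sub>v x) + x \<bullet> (A\<^sup>T * P * B *\<^sub>v u) + u \<bullet> (B\<^sup>T * P * A *\<^sub>v x) + u \<bullet> ((B\<^sup>T * P * B - G) *\<^sub>v u) =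
          lyap \<tau> P x (A *\<^sub>v x + B *\<^sub>v u) + (C *\<^sub>v x) \<bullet> (C *\<^sub>v x) - \<gamma>\<^sup>2 * (u \<bullet> u)"
        if x: "x \<in> carrier_vec ?n" and u: "u \<in> carrier_vec ?m" for x u
      proof -
        note Ax = mult_mat_vec_carrier[OF A x] and Bu = mult_mat_vec_carrier[OF B u]
        note PAx = mult_mat_vec_carrier[OF P(1) Ax] and PBu = mult_mat_vec_carrier[OF P(1) Bu]
        have "(A *\<^sub>v x + B *\<^sub>v u) \<bullet> (P *\<^sub>v (A *\<^sub>v x + B *\<^sub>v u)) =
           (A *\<^sub>v x) \<bullet> (P *\<^sub>v (A *\<^sub>v x)) + (A *\<^sub>v x) \<bullet> (P *\<^sub>v (B *\<^sub>v u)) + ((B *\<^sub>v u) \<bullet> (P *\<^sub>v (A *\<^sub>v x)) + (B *\<^sub>v u) \<bullet> (P *\<^sub>v (B *\<^sub>v u)))"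
          unfolding mult_add_distrib_mat_vec[OF P(1) Ax Bu] add_scalar_prod_distrib[OF Ax Bu add_carrier_vec[OF PAx PBu]]
            scalar_prod_add_distrib[OF Ax PAx PBu] scalar_prod_add_distrib[OF Bu PAx PBu] ..
        then show ?thesis
          unfolding form_minus[OF KC P(1) x x] form_add[OF K CC x x] CCf[OF x x] form_minus[OF K22 G(1) u u] Gf[OF u]
            form_congruence[OF A P(1) A x x] form_congruence[OF A P(1) B x u] form_congruence[OF B P(1) A u x] form_congruence[OF B P(1) B u u]
            Discrete_Time lyap_def by simp
      qed
      show ?thesis unfolding Discrete_Time time_axis.case
          neg_def_block_iff[OF c mult_carrier_mat[OF mult_carrier_mat[OF At P(1)] B] mult_carrier_mat[OF mult_carrier_mat[OF Bt P(1)] A] c22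
            s transpose_congruence[OF A P B] transpose_congruence[OF B P A] s22]
        by (intro ball_cong refl) (simp only: f[unfolded Discrete_Time])
    qed
  qed
  then show ?thesis using is_lssD[OF S] True unfolding gain_set_def Let_def G_def by simp
qed (simp add: gain_set_def)

lemma left_invertible_nonzero:
  fixes U :: "real mat"
  assumes U: "U \<in> carrier_mat n k" and L: "L \<in> carrier_mat k n" "L * U = 1\<^sub>m k"
    and v: "v \<in> carrier_vec k" "v \<noteq> 0\<^sub>v k"
  shows "U *\<^sub>v v \<noteq> 0\<^sub>v n"
proof
  assume z: "U *\<^sub>v v = 0\<^sub>v n"
  have "v = L * U *\<^sub>v v" unfolding L(2) using v(1) by simp
  also have "\<dots> = 0\<^sub>v k" unfolding assoc_mult_mat_vec[OF L(1) U v(1)] z by (rule mult_mat_zero_vec[OF L(1)])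
  finally show False using v(2) by simp
qed

lemma pos_def_congruence:
  assumes P: "pos_def n P" and U: "U \<in> carrier_mat n k" and L: "L \<in> carrier_mat k n" "L * U = 1\<^sub>m k"
  shows "pos_def k (U\<^sup>T * P * U)"
  unfolding pos_def_def
proof (intro conjI ballI impI)
  note Pc = pos_defD(1,2)[OF P]
  show "U\<^sup>T * P * U \<in> carrier_mat k k" using U Pc(1) by simp
  show "(U\<^sup>T * P * U)\<^sup>T = U\<^sup>T * P * U" by (rule transpose_congruence[OF U Pc U])
  fix v :: "real vec" assume v: "v \<in> carrier_vec k" "v \<noteq> 0\<^sub>v k"
  show "v \<bullet> (U\<^sup>T * P * U *\<^sub>v v) > 0"
    unfolding form_congruence[OF U Pc(1) U v(1) v(1)]
    by (rule pos_defD(3)[OF P mult_mat_vec_carrier[OF U v(1)] left_invertible_nonzero[OF U L v]])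
qed

text \<open>The discrete-time case uses that \<open>U z'\<close> is the \<open>P\<close>-orthogonal projection of \<open>z\<close> onto the range of \<open>U\<close>.\<close>

lemma lyap_projection:
  assumes P: "pos_def n P" and U: "U \<in> carrier_mat n k" and z: "z \<in> carrier_vec n" and z': "z' \<in> carrier_vec k" and v: "v \<in> carrier_vec k"
    and eq: "U\<^sup>T *\<^sub>v (P *\<^sub>v z) = U\<^sup>T * P * U *\<^sub>v z'"
  shows "lyap \<tau> (U\<^sup>T * P * U) v z' \<le> lyap \<tau> P (U *\<^sub>v v) z"
proof -
  note Pc = pos_defD(1,2)[OF P]
  have Ut: "U\<^sup>T \<in> carrier_mat k n" using U by simp
  note Pz = mult_mat_vec_carrier[OF Pc(1) z]
  \<comment> \<open>The hypothesis in weak form: \<open>z\<close> and \<open>U *\<^sub>v z'\<close>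
    have the same \<open>P\<close>-products with the range of \<open>U\<close>.\<close>
  have cross: "w \<bullet> (U\<^sup>T * P * U *\<^sub>v z') = (U *\<^sub>v w) \<bullet> (P *\<^sub>v z)" if w: "w \<in> carrier_vec k" for w
  proof -
    have "w \<bullet> (U\<^sup>T *\<^sub>v (P *\<^sub>v z)) = (U\<^sup>T\<^sup>T *\<^sub>v w) \<bullet> (P *\<^sub>v z)"
      by (rule transpose_vec_mult_scalar[OF Ut Pz w, symmetric])
    then show ?thesis unfolding eq by simp
  qed
  show ?thesis
  proof (cases \<tau>)
    case Continuous_Time
    then show ?thesis unfolding lyap_def using cross[OF v] by simp
  next
    case Discrete_Time
    note Uz = mult_mat_vec_carrier[OF U z']
    note PUz = mult_mat_vec_carrier[OF Pc(1) Uz]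
    define e where "e = z - U *\<^sub>v z'"
    have e: "e \<in> carrier_vec n" unfolding e_def by (rule minus_carrier_vec[OF z Uz])
    have "e \<bullet> (P *\<^sub>v e) = z \<bullet> (P *\<^sub>v z) - z \<bullet> (P *\<^sub>v (U *\<^sub>v z')) - ((U *\<^sub>v z') \<bullet> (P *\<^sub>v z) - (U *\<^sub>v z') \<bullet> (P *\<^sub>v (U *\<^sub>v z')))"
      unfolding e_def mult_minus_distrib_mat_vec[OF Pc(1) z Uz] minus_scalar_prod_distrib[OF z Uz minus_carrier_vec[OF Pz PUz]]
        scalar_prod_minus_distrib[OF z Pz PUz] scalar_prod_minus_distrib[OF Uz Pz PUz] ..
    also have "z \<bullet> (P *\<^sub>v (U *\<^sub>v z')) = (U *\<^sub>v z') \<bullet> (P *\<^sub>v z)" by (rule symmetric_form_commute[OF Pc z Uz])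
    also have "(U *\<^sub>v z') \<bullet> (P *\<^sub>v z) = z' \<bullet> (U\<^sup>T * P * U *\<^sub>v z')" by (rule cross[OF z', symmetric])
    also have "(U *\<^sub>v z') \<bullet> (P *\<^sub>v (U *\<^sub>v z')) = z' \<bullet> (U\<^sup>T * P * U *\<^sub>v z')"
      by (rule form_congruence[OF U Pc(1) U z' z', symmetric])
    finally have "z' \<bullet> (U\<^sup>T * P * U *\<^sub>v z') \<le> z \<bullet> (P *\<^sub>v z)" using pos_def_nonneg[OF P e] by simp
    then show ?thesis
      unfolding lyap_def Discrete_Time time_axis.case form_congruence[OF U Pc(1) U v v] by simp
  qed
qed

section \<open>Interlacing for pencils of quadratic forms\<close>

text \<open>An eigenvalue exists over the complex numbers. With \<open>a\<close> and
  \<open>b\<close> the real and imaginary parts of an eigenvector, symmetry of \<open>S\<close>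
  makes the imaginary part of the eigenvalue times \<open>a \<bullet> a + b \<bullet> b\<close>
  vanish, so \<open>a\<close> or \<open>b\<close> is a real eigenvector.\<close>

lemma symmetric_eigenvector:
  fixes S :: "real mat"
  assumes S: "S \<in> carrier_mat n n" and sym: "S\<^sup>T = S" and n: "n > 0"
  obtains v \<mu> where "v \<in> carrier_vec n" "v \<noteq> 0\<^sub>v n" "S *\<^sub>v v = \<mu> \<cdot>\<^sub>v v"
proof -
  define C where "C = map_mat complex_of_real S"
  have C: "C \<in> carrier_mat n n" using S by (simp add: C_def)
  have "degree (char_poly C) = n" using degree_monic_char_poly[OF C] by simp
  then have "\<not> constant (poly (char_poly C))" using n by (simp add: constant_degree)
  then obtain z where "poly (char_poly C) z = 0" using fundamental_theorem_of_algebra by blast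
  then have "eigenvalue C z" using eigenvalue_root_char_poly[OF C] by simp
  then obtain w where w: "w \<in> carrier_vec n" "w \<noteq> 0\<^sub>v n" "C *\<^sub>v w = z \<cdot>\<^sub>v w"
    unfolding eigenvalue_def eigenvector_def using C by auto
  define a where "a = map_vec Re w"
  define b where "b = map_vec Im w"
  have ab: "a \<in> carrier_vec n" "b \<in> carrier_vec n" using w(1) by (simp_all add: a_def b_def)
  have comp: "(\<Sum>j<n. complex_of_real (S $$ (i, j)) * w $ j) = z * w $ i" if i: "i < n" for i
  proof -
    have "(\<Sum>j<n. complex_of_real (S $$ (i, j)) * w $ j) = (\<Sum>j<n. C $$ (i, j) * w $ j)"
      by (rule sum.cong) (use i S in \<open>simp_all add: C_def\<close>)
    also have "\<dots> = (C *\<^sub>v w) $ i"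
      by (simp add: scalar_prod_def atLeast0LessThan carrier_matD[OF C] carrier_vecD[OF w(1)] i)
    also have "\<dots> = z * w $ i" unfolding w(3) using w(1) i by simp
    finally show ?thesis .
  qed
  have Sa: "S *\<^sub>v a = Re z \<cdot>\<^sub>v a - Im z \<cdot>\<^sub>v b"
  proof (rule eq_vecI)
    fix i assume "i < dim_vec (Re z \<cdot>\<^sub>v a - Im z \<cdot>\<^sub>v b)"
    then have i: "i < n" using ab by simp
    have "(S *\<^sub>v a) $ i = (\<Sum>j<n. S $$ (i, j) * Re (w $ j))"
      using mult_mat_vec_index_sum[OF S ab(1) i] w(1) by (simp add: a_def)
    also have "\<dots> = Re (\<Sum>j<n. complex_of_real (S $$ (i, j)) * w $ j)" by simp
    also have "\<dots> = Re z * Re (w $ i) - Im z * Im (w $ i)" unfolding comp[OF i] by simp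
    finally show "(S *\<^sub>v a) $ i = (Re z \<cdot>\<^sub>v a - Im z \<cdot>\<^sub>v b) $ i" using i w(1) by (simp add: a_def b_def)
  qed (use S ab in auto)
  have Sb: "S *\<^sub>v b = Re z \<cdot>\<^sub>v b + Im z \<cdot>\<^sub>v a"
  proof (rule eq_vecI)
    fix i assume "i < dim_vec (Re z \<cdot>\<^sub>v b + Im z \<cdot>\<^sub>v a)"
    then have i: "i < n" using ab by simp
    have "(S *\<^sub>v b) $ i = (\<Sum>j<n. S $$ (i, j) * Im (w $ j))"
      using mult_mat_vec_index_sum[OF S ab(2) i] w(1) by (simp add: b_def)
    also have "\<dots> = Im (\<Sum>j<n. complex_of_real (S $$ (i, j)) * w $ j)" by simp
    also have "\<dots> = Re z * Im (w $ i) + Im z * Re (w $ i)" unfolding comp[OF i] by simp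
    finally show "(S *\<^sub>v b) $ i = (Re z \<cdot>\<^sub>v b + Im z \<cdot>\<^sub>v a) $ i" using i w(1) by (simp add: a_def b_def)
  qed (use S ab in auto)
  have nn: "v \<bullet> v \<ge> 0" for v :: "real vec" by (simp add: scalar_prod_def sum_nonneg)
  have "a \<bullet> (S *\<^sub>v b) = b \<bullet> (S *\<^sub>v a)" by (rule symmetric_form_commute[OF S sym ab])
  moreover have "a \<bullet> (S *\<^sub>v b) = Re z * (a \<bullet> b) + Im z * (a \<bullet> a)"
    unfolding Sb using ab by (simp add: scalar_prod_add_distrib[of _ n])
  moreover have "b \<bullet> (S *\<^sub>v a) = Re z * (a \<bullet> b) - Im z * (b \<bullet> b)"
    unfolding Sa using ab comm_scalar_prod[OF ab(2,1)] by (simp add: scalar_prod_minus_distrib[of _ n])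
  ultimately have "Im z * (a \<bullet> a + b \<bullet> b) = 0" by (simp add: distrib_left)
  moreover have "a \<bullet> a + b \<bullet> b \<noteq> 0"
  proof
    assume "a \<bullet> a + b \<bullet> b = 0"
    then have "a \<bullet> a = 0" "b \<bullet> b = 0" using nn[of a] nn[of b] by auto
    then have "a = 0\<^sub>v n" "b = 0\<^sub>v n" using scalar_prod_eq_0_imp ab by auto
    then have z: "a $ i = 0" "b $ i = 0" if "i < n" for i using that by simp_all
    have "w = 0\<^sub>v n"
    proof (rule eq_vecI)
      fix i assume "i < dim_vec (0\<^sub>v n :: complex vec)"
      then have i: "i < n" by simp
      then show "w $ i = 0\<^sub>v n $ i" using z[OF i] w(1) by (simp add: a_def b_def complex_eq_iff)
    qed (use w(1) in simp)
    then show False using w(2) by simp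
  qed
  ultimately have Im: "Im z = 0" by simp
  have "Re z \<cdot>\<^sub>v a - Im z \<cdot>\<^sub>v b = Re z \<cdot>\<^sub>v a" "Re z \<cdot>\<^sub>v b + Im z \<cdot>\<^sub>v a = Re z \<cdot>\<^sub>v b"
    unfolding Im by (rule eq_vecI; use ab in simp)+
  then have ev: "S *\<^sub>v a = Re z \<cdot>\<^sub>v a" "S *\<^sub>v b = Re z \<cdot>\<^sub>v b" using Sa Sb by simp_all
  have "a \<noteq> 0\<^sub>v n \<or> b \<noteq> 0\<^sub>v n" using \<open>a \<bullet> a + b \<bullet> b \<noteq> 0\<close> by auto
  then show thesis using that ev ab by blast
qed

text \<open>The reflection in the hyperplane orthogonal to \<open>v - e\<close> swaps the two unit
  vectors \<open>v\<close> and \<open>e\<close>. Being symmetric and its own inverse, it is a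
  convenient orthogonal matrix with first column \<open>v\<close>.\<close>

lemma householder:
  fixes v :: "real vec"
  assumes v: "v \<in> carrier_vec n" and unit: "v \<bullet> v = 1" and n: "n > 0"
  obtains H where "H \<in> carrier_mat n n" "H\<^sup>T = H" "H * H = 1\<^sub>m n" "H *\<^sub>v unit_vec n 0 = v"
proof -
  define e where "e = (unit_vec n 0 :: real vec)"
  have e: "e \<in> carrier_vec n" by (simp add: e_def)
  have ee: "e \<bullet> e = 1" using n by (simp add: e_def)
  define u where "u = v - e"
  have u: "u \<in> carrier_vec n" unfolding u_def by (rule minus_carrier_vec[OF v e])
  show thesis
  proof (cases "u = 0\<^sub>v n")
    case True
    have "v = e"
    proof (rule eq_vecI)
      fix i assume "i < dim_vec e"
      then show "v $ i = e $ i" using arg_cong[OF True, of "\<lambda>x. x $ i"] v e by (simp add: u_def)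
    qed (use v e in simp)
    then show ?thesis by (intro that[of "1\<^sub>m n"]) (simp_all add: e_def)
  next
    case False
    have uu: "u \<bullet> u \<noteq> 0" using scalar_prod_eq_0_imp[OF _ u] False by blast
    define c where "c = 2 / (u \<bullet> u)"
    have cu: "c * (u \<bullet> u) = 2" using uu by (simp add: c_def)
    define H where "H = mat n n (\<lambda>(i, j). (if i = j then 1 else 0) - c * u $ i * u $ j)"
    have H: "H \<in> carrier_mat n n" by (simp add: H_def)
    have Hx: "H *\<^sub>v x = x - (c * (u \<bullet> x)) \<cdot>\<^sub>v u" if x: "x \<in> carrier_vec n" for x
    proof (rule eq_vecI)
      fix i assume "i < dim_vec (x - (c * (u \<bullet> x)) \<cdot>\<^sub>v u)"
      then have i: "i < n" using u by simp
      have "(H *\<^sub>v x) $ i = (\<Sum>j<n. ((if i = j then 1 else 0) - c * u $ i * u $ j) * x $ j)"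
        using mult_mat_vec_index_sum[OF H x i] i by (simp add: H_def)
      also have "\<dots> = (\<Sum>j<n. (if i = j then x $ j else 0) - c * u $ i * (u $ j * x $ j))"
        by (rule sum.cong) (auto simp: algebra_simps)
      also have "\<dots> = x $ i - c * u $ i * (\<Sum>j<n. u $ j * x $ j)"
        using i by (simp add: sum_subtractf sum_distrib_left)
      also have "(\<Sum>j<n. u $ j * x $ j) = u \<bullet> x" using x by (simp add: scalar_prod_def atLeast0LessThan)
      finally show "(H *\<^sub>v x) $ i = (x - (c * (u \<bullet> x)) \<cdot>\<^sub>v u) $ i" using i u x by simp
    qed (use H u in simp)
    have HH: "H *\<^sub>v (H *\<^sub>v x) = x" if x: "x \<in> carrier_vec n" for x
    proof -
      have y: "x - (c * (u \<bullet> x)) \<cdot>\<^sub>v u \<in> carrier_vec n" using x u by simp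
      have "u \<bullet> (x - (c * (u \<bullet> x)) \<cdot>\<^sub>v u) = u \<bullet> x - c * (u \<bullet> x) * (u \<bullet> u)"
        using scalar_prod_minus_distrib[OF u x, of "(c * (u \<bullet> x)) \<cdot>\<^sub>v u"] u by simp
      also have "\<dots> = u \<bullet> x - (u \<bullet> x) * (c * (u \<bullet> u))" by simp
      also have "\<dots> = - (u \<bullet> x)" unfolding cu by simp
      finally have ux: "u \<bullet> (x - (c * (u \<bullet> x)) \<cdot>\<^sub>v u) = - (u \<bullet> x)" .
      show ?thesis unfolding Hx[OF x] Hx[OF y] ux by (rule eq_vecI) (use u x in auto)
    qed
    have "H * H = 1\<^sub>m n"
    proof (rule eq_mat_by_mult_vec[OF mult_carrier_mat[OF H H] one_carrier_mat])
      fix x :: "real vec" assume x: "x \<in> carrier_vec n"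
      show "H * H *\<^sub>v x = 1\<^sub>m n *\<^sub>v x" unfolding assoc_mult_mat_vec[OF H H x] HH[OF x] using x by simp
    qed
    moreover have "H\<^sup>T = H" by (rule eq_matI) (auto simp: H_def)
    moreover have "H *\<^sub>v e = v"
    proof -
      have "u \<bullet> e = v \<bullet> e - 1" unfolding u_def using minus_scalar_prod_distrib[OF v e e] ee by simp
      moreover have "u \<bullet> u = 2 - 2 * (v \<bullet> e)"
        unfolding u_def using minus_scalar_prod_distrib[OF v e u[unfolded u_def]] scalar_prod_minus_distrib[OF v v e]
          scalar_prod_minus_distrib[OF e v e] comm_scalar_prod[OF e v] ee unit by simp
      ultimately have "c * (u \<bullet> e) = -1" using uu by (simp add: c_def field_simps)
      then show ?thesis unfolding Hx[OF e] by (intro eq_vecI) (use v e in \<open>auto simp: u_def\<close>)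
    qed
    ultimately show ?thesis using that H unfolding e_def by blast
  qed
qed

text \<open>Deflation: a reflection moves an eigenvector to the first unit vector, which clears the
  first column; symmetry clears the first row, and induction treats the remaining block.\<close>

lemma symmetric_orthonormal_eigenvectors:
  fixes S :: "real mat"
  assumes "S \<in> carrier_mat n n" "S\<^sup>T = S"
  shows "\<exists>x d. \<forall>i<n. x i \<in> carrier_vec n \<and> S *\<^sub>v x i = d i \<cdot>\<^sub>v x i \<and> (\<forall>j<n. x i \<bullet> x j = (if i = j then 1 else 0))"
  using assms
proof (induction n arbitrary: S)
  case (Suc m)
  note S = Suc.prems
  let ?n = "Suc m"
  obtain v0 \<mu> where v0: "v0 \<in> carrier_vec ?n" "v0 \<noteq> 0\<^sub>v ?n" "S *\<^sub>v v0 = \<mu> \<cdot>\<^sub>v v0"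
    using symmetric_eigenvector[OF S] by blast
  have pos: "v0 \<bullet> v0 > 0"
  proof -
    have "v0 \<bullet> v0 \<noteq> 0" using scalar_prod_eq_0_imp[OF _ v0(1)] v0(2) by blast
    moreover have "v0 \<bullet> v0 \<ge> 0" by (simp add: scalar_prod_def sum_nonneg)
    ultimately show ?thesis by simp
  qed
  define v where "v = (1 / sqrt (v0 \<bullet> v0)) \<cdot>\<^sub>v v0"
  have v: "v \<in> carrier_vec ?n" using v0(1) by (simp add: v_def)
  have vv: "v \<bullet> v = 1" unfolding v_def using v0(1) pos by (simp add: real_sqrt_mult[symmetric])
  have Sv: "S *\<^sub>v v = \<mu> \<cdot>\<^sub>v v"
    unfolding v_def mult_mat_vec[OF S(1) v0(1)] v0(3) by (simp add: smult_smult_assoc mult.commute)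
  obtain H where H: "H \<in> carrier_mat ?n ?n" "H\<^sup>T = H" "H * H = 1\<^sub>m ?n" "H *\<^sub>v unit_vec ?n 0 = v"
    by (rule householder[OF v vv]) simp_all
  have HH: "H *\<^sub>v (H *\<^sub>v x) = x" if x: "x \<in> carrier_vec ?n" for x
    unfolding assoc_mult_mat_vec[OF H(1) H(1) x, symmetric] H(3) using x by simp
  have Hiso: "(H *\<^sub>v x) \<bullet> (H *\<^sub>v y) = x \<bullet> y" if x: "x \<in> carrier_vec ?n" and y: "y \<in> carrier_vec ?n" for x y
    using form_transpose_mult[OF H(1) H(1) x y] y unfolding H(2,3) by simp
  define S' where "S' = H * S * H"
  have S': "S' \<in> carrier_mat ?n ?n" unfolding S'_def by (rule mult_carrier_mat[OF mult_carrier_mat[OF H(1) S(1)] H(1)])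
  have S'x: "S' *\<^sub>v x = H *\<^sub>v (S *\<^sub>v (H *\<^sub>v x))" if x: "x \<in> carrier_vec ?n" for x
    unfolding S'_def assoc_mult_mat_vec[OF mult_carrier_mat[OF H(1) S(1)] H(1) x]
      assoc_mult_mat_vec[OF H(1) S(1) mult_mat_vec_carrier[OF H(1) x]] ..
  have S'sym: "S'\<^sup>T = S'" using transpose_congruence[OF H(1) S H(1)] unfolding H(2) S'_def .
  have e: "unit_vec ?n 0 \<in> carrier_vec ?n" by simp
  have He: "H *\<^sub>v v = unit_vec ?n 0" using HH[OF e] unfolding H(4) .
  have S'e: "S' *\<^sub>v unit_vec ?n 0 = \<mu> \<cdot>\<^sub>v unit_vec ?n 0"
    unfolding S'x[OF e] H(4) Sv mult_mat_vec[OF H(1) v] He ..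
  have col0: "S' $$ (i, 0) = (if i = 0 then \<mu> else 0)" if i: "i < ?n" for i
  proof -
    have "(S' *\<^sub>v unit_vec ?n 0) $ i = S' $$ (i, 0)" using S' i by (simp add: scalar_prod_right_unit)
    then show ?thesis unfolding S'e using i by (cases "i = 0") simp_all
  qed
  have row0: "S' $$ (0, j) = (if j = 0 then \<mu> else 0)" if j: "j < ?n" for j
  proof -
    have "S' $$ (0, j) = S'\<^sup>T $$ (j, 0)" using S' j by simp
    then show ?thesis unfolding S'sym col0[OF j] .
  qed
  define S1 where "S1 = mat m m (\<lambda>(i, j). S' $$ (Suc i, Suc j))"
  have S1: "S1 \<in> carrier_mat m m" by (simp add: S1_def)
  have S1sym: "S1\<^sup>T = S1"
  proof (rule eq_matI)
    fix i j assume "i < dim_row S1" "j < dim_col S1"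
    then have ij: "i < m" "j < m" by (simp_all add: S1_def)
    have "S' $$ (Suc j, Suc i) = S'\<^sup>T $$ (Suc i, Suc j)" using S' ij by simp
    then show "S1\<^sup>T $$ (i, j) = S1 $$ (i, j)" using ij unfolding S'sym by (simp add: S1_def)
  qed (simp_all add: S1_def)
  obtain y d where yd: "\<And>i. i < m \<Longrightarrow> y i \<in> carrier_vec m" "\<And>i. i < m \<Longrightarrow> S1 *\<^sub>v y i = d i \<cdot>\<^sub>v y i"
    "\<And>i j. i < m \<Longrightarrow> j < m \<Longrightarrow> y i \<bullet> y j = (if i = j then 1 else 0)"
    using Suc.IH[OF S1 S1sym] by blast
  have S'y: "S' *\<^sub>v vCons 0 z = vCons 0 (S1 *\<^sub>v z)" if z: "z \<in> carrier_vec m" for z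
  proof (rule eq_vecI)
    have zc: "vCons 0 z \<in> carrier_vec ?n" using z by simp
    fix i assume "i < dim_vec (vCons 0 (S1 *\<^sub>v z))"
    then have i: "i < ?n" using S1 by simp
    have "(S' *\<^sub>v vCons 0 z) $ i = (\<Sum>j<?n. S' $$ (i, j) * vCons 0 z $ j)"
      by (rule mult_mat_vec_index_sum[OF S' zc i])
    also have "\<dots> = (\<Sum>j<m. S' $$ (i, Suc j) * z $ j)" by (subst sum.lessThan_Suc_shift) simp
    also have "\<dots> = vCons 0 (S1 *\<^sub>v z) $ i"
    proof (cases i)
      case 0
      then show ?thesis using row0 by simp
    next
      case (Suc k)
      then have k: "k < m" using i by simp
      show ?thesis unfolding Suc vec_index_vCons_Suc mult_mat_vec_index_sum[OF S1 z k] using k by (simp add: S1_def)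
    qed
    finally show "(S' *\<^sub>v vCons 0 z) $ i = vCons 0 (S1 *\<^sub>v z) $ i" .
  qed (use S' S1 in simp)
  define w where "w = (\<lambda>i. case i of 0 \<Rightarrow> unit_vec ?n 0 | Suc i \<Rightarrow> vCons 0 (y i))"
  define dd where "dd = (\<lambda>i. case i of 0 \<Rightarrow> \<mu> | Suc i \<Rightarrow> d i)"
  have w: "w i \<in> carrier_vec ?n" if "i < ?n" for i
    using that yd(1) by (cases i) (auto simp: w_def)
  have S'w: "S' *\<^sub>v w i = dd i \<cdot>\<^sub>v w i" if "i < ?n" for i
  proof (cases i)
    case 0
    then show ?thesis using S'e by (simp add: w_def dd_def)
  next
    case (Suc k)
    then have k: "k < m" using that by simp
    have "vCons 0 (d k \<cdot>\<^sub>v y k) = d k \<cdot>\<^sub>v vCons 0 (y k)"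
    proof (rule eq_vecI)
      fix a assume "a < dim_vec (d k \<cdot>\<^sub>v vCons 0 (y k))"
      then show "vCons 0 (d k \<cdot>\<^sub>v y k) $ a = (d k \<cdot>\<^sub>v vCons 0 (y k)) $ a" by (cases a) simp_all
    qed simp
    then show ?thesis using S'y[OF yd(1)[OF k]] yd(2)[OF k] by (simp add: w_def dd_def Suc)
  qed
  have ww: "w i \<bullet> w j = (if i = j then 1 else 0)" if "i < ?n" "j < ?n" for i j
  proof -
    have eq: "unit_vec ?n 0 \<bullet> vCons 0 z = (0 :: real)" "vCons 0 z \<bullet> unit_vec ?n 0 = (0 :: real)" if "z \<in> carrier_vec m" for z
      using that by (simp_all add: scalar_prod_left_unit scalar_prod_right_unit)
    show ?thesis
      using that yd(1,3) eq by (cases i; cases j) (simp_all add: w_def)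
  qed
  have "S *\<^sub>v (H *\<^sub>v w i) = dd i \<cdot>\<^sub>v (H *\<^sub>v w i)" if i: "i < ?n" for i
  proof -
    note c = mult_mat_vec_carrier[OF H(1) w[OF i]]
    have "S *\<^sub>v (H *\<^sub>v w i) = H *\<^sub>v (S' *\<^sub>v w i)"
      unfolding S'x[OF w[OF i]] by (rule HH[OF mult_mat_vec_carrier[OF S(1) c], symmetric])
    then show ?thesis unfolding S'w[OF i] mult_mat_vec[OF H(1) w[OF i]] .
  qed
  then show ?case
    by (intro exI[of _ "\<lambda>i. H *\<^sub>v w i"] exI[of _ dd] allI impI conjI)
      (use mult_mat_vec_carrier[OF H(1) w] Hiso[OF w w] ww in simp_all)
qed simp

lemma pos_def_inverse:
  assumes P: "pos_def n P"
  obtains Q where "pos_def n Q" "P * Q = 1\<^sub>m n" "Q * P = 1\<^sub>m n"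
proof -
  note Pc = pos_defD(1,2)[OF P]
  have "det P \<noteq> 0"
  proof
    assume "det P = 0"
    then obtain v where v: "v \<in> carrier_vec n" "v \<noteq> 0\<^sub>v n" "P *\<^sub>v v = 0\<^sub>v n"
      using det_0_iff_vec_prod_zero[OF Pc(1)] by blast
    have "v \<bullet> (P *\<^sub>v v) = 0" unfolding v(3) using v(1) by simp
    then show False using pos_defD(3)[OF P v(1,2)] by simp
  qed
  then have U: "P \<in> Units (ring_mat TYPE(real) n ())" by (rule det_non_zero_imp_unit[OF Pc(1)])
  obtain Q where "mat_inverse P = Some Q"
    using mat_inverse(1)[OF Pc(1), where b = "()"] U by (cases "mat_inverse P") auto
  from mat_inverse(2)[OF Pc(1) this]
  have Q: "Q \<in> carrier_mat n n" "P * Q = 1\<^sub>m n" "Q * P = 1\<^sub>m n" by blast+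
  have QT: "Q\<^sup>T \<in> carrier_mat n n" using Q(1) by simp
  have QTP: "Q\<^sup>T * P = 1\<^sub>m n"
    using transpose_mult[OF Pc(1) Q(1)] unfolding Q(2) Pc(2) transpose_one by (rule sym)
  have a1: "Q\<^sup>T * P * Q = Q" unfolding QTP by (rule left_mult_one_mat[OF Q(1)])
  have a2: "Q\<^sup>T * P * Q = Q\<^sup>T" unfolding assoc_mult_mat[OF QT Pc(1) Q(1)] Q(2) by (rule right_mult_one_mat[OF QT])
  have sym: "Q\<^sup>T = Q" by (rule trans[OF a2[symmetric] a1])
  have "pos_def n Q" unfolding pos_def_def
  proof (intro conjI ballI impI Q(1) sym)
    fix v :: "real vec" assume v: "v \<in> carrier_vec n" "v \<noteq> 0\<^sub>v n"
    note Qv = mult_mat_vec_carrier[OF Q(1) v(1)]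
    have PQv: "P *\<^sub>v (Q *\<^sub>v v) = v" unfolding assoc_mult_mat_vec[OF Pc(1) Q(1) v(1), symmetric] Q(2) using v(1) by simp
    have "Q *\<^sub>v v \<noteq> 0\<^sub>v n"
    proof
      assume "Q *\<^sub>v v = 0\<^sub>v n"
      then show False using PQv v(2) mult_mat_zero_vec[OF Pc(1)] by (simp only:)
    qed
    then have "(Q *\<^sub>v v) \<bullet> (P *\<^sub>v (Q *\<^sub>v v)) > 0" by (rule pos_defD(3)[OF P Qv])
    then show "v \<bullet> (Q *\<^sub>v v) > 0" unfolding PQv comm_scalar_prod[OF Qv v(1)] .
  qed
  then show thesis by (rule that[OF _ Q(2,3)])
qed

definition diag_of :: "nat \<Rightarrow> (nat \<Rightarrow> real) \<Rightarrow> real mat" where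
  "diag_of n d = mat n n (\<lambda>(i, j). if i = j then d i else 0)"

lemma diag_of_carrier [simp]: "diag_of n d \<in> carrier_mat n n"
  by (simp add: diag_of_def)

lemma diag_of_form:
  assumes c: "c \<in> carrier_vec n"
  shows "c \<bullet> (diag_of n d *\<^sub>v c) = (\<Sum>i<n. d i * (c $ i)\<^sup>2)"
proof -
  have "(diag_of n d *\<^sub>v c) $ i = d i * c $ i" if i: "i < n" for i
  proof -
    have "(diag_of n d *\<^sub>v c) $ i = (\<Sum>j<n. diag_of n d $$ (i, j) * c $ j)"
      by (rule mult_mat_vec_index_sum[OF diag_of_carrier c i])
    also have "\<dots> = (\<Sum>j<n. if i = j then d j * c $ j else 0)"
      by (rule sum.cong) (use i in \<open>auto simp: diag_of_def\<close>)
    finally show ?thesis using i by simp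
  qed
  then have "c \<bullet> (diag_of n d *\<^sub>v c) = (\<Sum>i<n. c $ i * (d i * c $ i))"
    unfolding scalar_prod_def by (simp add: diag_of_def atLeast0LessThan)
  also have "\<dots> = (\<Sum>i<n. d i * (c $ i)\<^sup>2)" by (rule sum.cong) (simp_all add: power2_eq_square)
  finally show ?thesis .
qed

lemma matrix_of_family:
  fixes x :: "nat \<Rightarrow> real vec"
  assumes x: "\<And>i. i < n \<Longrightarrow> x i \<in> carrier_vec n" and P: "P \<in> carrier_mat n n"
    and f: "\<And>i j. i < n \<Longrightarrow> j < n \<Longrightarrow> x i \<bullet> (P *\<^sub>v x j) = (if i = j then d i else 0)"
  shows "(mat n n (\<lambda>(a, j). x j $ a))\<^sup>T * P * mat n n (\<lambda>(a, j). x j $ a) = diag_of n d" (is "?X\<^sup>T * P * ?X = _")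
proof (rule eq_matI)
  have X: "?X \<in> carrier_mat n n" and Xt: "?X\<^sup>T \<in> carrier_mat n n" by auto
  have col: "col ?X j = x j" if j: "j < n" for j
    using carrier_vecD[OF x[OF j]] j by (intro eq_vecI) simp_all
  fix i j assume "i < dim_row (diag_of n d)" "j < dim_col (diag_of n d)"
  then have ij: "i < n" "j < n" by (simp_all add: diag_of_def)
  have "(?X\<^sup>T * P * ?X) $$ (i, j) = (?X\<^sup>T * (P * ?X)) $$ (i, j)" unfolding assoc_mult_mat[OF Xt P X] ..
  also have "\<dots> = row (?X\<^sup>T) i \<bullet> col (P * ?X) j"
    by (rule index_mult_mat(1)) (use ij X P in simp_all)
  also have "\<dots> = x i \<bullet> (P *\<^sub>v x j)"
  proof -
    have "row (?X\<^sup>T) i = x i" unfolding col[OF ij(1), symmetric] by (rule row_transpose) (use ij in simp)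
    then show ?thesis unfolding col_mult2[OF P X ij(2)] col[OF ij(2)] by (simp only:)
  qed
  also have "\<dots> = diag_of n d $$ (i, j)" using f[OF ij] ij by (simp add: diag_of_def)
  finally show "(?X\<^sup>T * P * ?X) $$ (i, j) = diag_of n d $$ (i, j)" .
qed (use P in \<open>simp_all add: diag_of_def\<close>)

lemma decreasing_rearrangement:
  fixes d :: "nat \<Rightarrow> real"
  obtains \<pi> where "bij_betw \<pi> {..<n} {..<n}" "\<And>i j. i \<le> j \<Longrightarrow> j < n \<Longrightarrow> d (\<pi> j) \<le> d (\<pi> i)"
proof -
  define xs where "xs = sort_key (\<lambda>i. - d i) [0..<n]"
  have len: "length xs = n" by (simp add: xs_def)
  have dist: "distinct xs" by (simp add: xs_def)
  have set: "set xs = {..<n}" by (auto simp: xs_def)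
  have bij: "bij_betw ((!) xs) {..<n} {..<n}"
    by (rule bij_betw_nth[OF dist]) (simp_all add: len set)
  have "d (xs ! j) \<le> d (xs ! i)" if "i \<le> j" "j < n" for i j
  proof -
    have "sorted (map (\<lambda>i. - d i) xs)" unfolding xs_def by (rule sorted_sort_key)
    then have "map (\<lambda>i. - d i) xs ! i \<le> map (\<lambda>i. - d i) xs ! j"
      by (rule sorted_nth_mono) (use that len in auto)
    then show ?thesis using that len by simp
  qed
  then show thesis by (rule that[OF bij])
qed

text \<open>Eigenvectors of \<open>Q\<close>, divided by the square roots of their eigenvalues, turn
  \<open>Q\<close> into the identity. An orthonormal eigenbasis of the transformed \<open>P\<close>
  preserves that identity and makes \<open>P\<close> diagonal; it is listed by decreasing
  eigenvalue.\<close>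

lemma simultaneous_diagonalization:
  assumes Q: "pos_def n Q" and P: "P \<in> carrier_mat n n" "P\<^sup>T = P"
  obtains X d where "X \<in> carrier_mat n n" "X\<^sup>T * Q * X = 1\<^sub>m n" "X\<^sup>T * P * X = diag_of n d"
    "\<And>i j. i \<le> j \<Longrightarrow> j < n \<Longrightarrow> d j \<le> d i"
proof -
  note Qc = pos_defD(1,2)[OF Q]
  obtain x c where xc: "\<And>i. i < n \<Longrightarrow> x i \<in> carrier_vec n" "\<And>i. i < n \<Longrightarrow> Q *\<^sub>v x i = c i \<cdot>\<^sub>v x i"
    "\<And>i j. i < n \<Longrightarrow> j < n \<Longrightarrow> x i \<bullet> x j = (if i = j then 1 else 0)"
    using symmetric_orthonormal_eigenvectors[OF Qc] by blast
  have cpos: "c i > 0" if i: "i < n" for i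
  proof -
    have "x i \<noteq> 0\<^sub>v n"
    proof
      assume z: "x i = 0\<^sub>v n"
      show False using xc(3)[OF i i] unfolding z by simp
    qed
    then have "x i \<bullet> (Q *\<^sub>v x i) > 0" by (rule pos_defD(3)[OF Q xc(1)[OF i]])
    then show ?thesis unfolding xc(2)[OF i] using xc(1)[OF i] xc(3)[OF i i] by simp
  qed
  define y where "y = (\<lambda>i. (1 / sqrt (c i)) \<cdot>\<^sub>v x i)"
  have y: "y i \<in> carrier_vec n" if "i < n" for i using xc(1)[OF that] by (simp add: y_def)
  have yQy: "y i \<bullet> (Q *\<^sub>v y j) = (if i = j then 1 else 0)" if ij: "i < n" "j < n" for i j
  proof -
    have "y i \<bullet> (Q *\<^sub>v y j) = 1 / sqrt (c i) * (1 / sqrt (c j) * (c j * (x i \<bullet> x j)))"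
      unfolding y_def mult_mat_vec[OF Qc(1) xc(1)[OF ij(2)]] xc(2)[OF ij(2)]
      using xc(1)[OF ij(1)] xc(1)[OF ij(2)] by simp
    then show ?thesis using xc(3)[OF ij] cpos[OF ij(1)] by (auto simp: field_simps real_sqrt_mult_self)
  qed
  define Y where "Y = mat n n (\<lambda>(a, j). y j $ a)"
  have Y: "Y \<in> carrier_mat n n" by (simp add: Y_def)
  have one: "diag_of n (\<lambda>i. 1) = 1\<^sub>m n" by (rule eq_matI) (simp_all add: diag_of_def)
  have YQY: "Y\<^sup>T * Q * Y = 1\<^sub>m n"
    unfolding Y_def one[symmetric] by (rule matrix_of_family[OF y Qc(1) yQy])
  define S where "S = Y\<^sup>T * P * Y"
  have S: "S \<in> carrier_mat n n" unfolding S_def using Y P by simp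
  have Ss: "S\<^sup>T = S" unfolding S_def by (rule transpose_congruence[OF Y P Y])
  obtain z e where ze: "\<And>i. i < n \<Longrightarrow> z i \<in> carrier_vec n" "\<And>i. i < n \<Longrightarrow> S *\<^sub>v z i = e i \<cdot>\<^sub>v z i"
    "\<And>i j. i < n \<Longrightarrow> j < n \<Longrightarrow> z i \<bullet> z j = (if i = j then 1 else 0)"
    using symmetric_orthonormal_eigenvectors[OF S Ss] by blast
  obtain \<pi> where \<pi>: "bij_betw \<pi> {..<n} {..<n}" "\<And>i j. i \<le> j \<Longrightarrow> j < n \<Longrightarrow> e (\<pi> j) \<le> e (\<pi> i)"
    by (rule decreasing_rearrangement[of n e]) (rule that)
  have \<pi>n: "\<pi> i < n" if "i < n" for i using bij_betwE[OF \<pi>(1)] that by simp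
  have \<pi>i: "\<pi> i = \<pi> j \<longleftrightarrow> i = j" if "i < n" "j < n" for i j
    using bij_betw_imp_inj_on[OF \<pi>(1)] that by (auto simp: inj_on_def)
  define w where "w = (\<lambda>i. Y *\<^sub>v z (\<pi> i))"
  have w: "w i \<in> carrier_vec n" if "i < n" for i
    unfolding w_def by (rule mult_mat_vec_carrier[OF Y ze(1)[OF \<pi>n[OF that]]])
  have wQw: "w i \<bullet> (Q *\<^sub>v w j) = (if i = j then 1 else 0)" if ij: "i < n" "j < n" for i j
  proof -
    have "w i \<bullet> (Q *\<^sub>v w j) = z (\<pi> i) \<bullet> (Y\<^sup>T * Q * Y *\<^sub>v z (\<pi> j))"
      unfolding w_def by (rule form_congruence[OF Y Qc(1) Y ze(1)[OF \<pi>n[OF ij(1)]] ze(1)[OF \<pi>n[OF ij(2)]], symmetric])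
    also have "\<dots> = z (\<pi> i) \<bullet> z (\<pi> j)" unfolding YQY using ze(1)[OF \<pi>n[OF ij(2)]] by simp
    finally show ?thesis using ze(3)[OF \<pi>n[OF ij(1)] \<pi>n[OF ij(2)]] \<pi>i[OF ij] by simp
  qed
  have wPw: "w i \<bullet> (P *\<^sub>v w j) = (if i = j then e (\<pi> i) else 0)" if ij: "i < n" "j < n" for i j
  proof -
    have "w i \<bullet> (P *\<^sub>v w j) = z (\<pi> i) \<bullet> (S *\<^sub>v z (\<pi> j))"
      unfolding w_def S_def by (rule form_congruence[OF Y P(1) Y ze(1)[OF \<pi>n[OF ij(1)]] ze(1)[OF \<pi>n[OF ij(2)]], symmetric])
    also have "\<dots> = e (\<pi> j) * (z (\<pi> i) \<bullet> z (\<pi> j))"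
      unfolding ze(2)[OF \<pi>n[OF ij(2)]] using ze(1)[OF \<pi>n[OF ij(1)]] ze(1)[OF \<pi>n[OF ij(2)]] by simp
    finally show ?thesis using ze(3)[OF \<pi>n[OF ij(1)] \<pi>n[OF ij(2)]] \<pi>i[OF ij] by simp
  qed
  define X where "X = mat n n (\<lambda>(a, j). w j $ a)"
  have "X\<^sup>T * Q * X = 1\<^sub>m n" unfolding X_def one[symmetric] by (rule matrix_of_family[OF w Qc(1) wQw])
  note XQX = this
  have XPX: "X\<^sup>T * P * X = diag_of n (\<lambda>i. e (\<pi> i))" unfolding X_def by (rule matrix_of_family[OF w P(1) wPw])
  have X: "X \<in> carrier_mat n n" by (simp add: X_def)
  show thesis by (rule that[OF X XQX XPX \<pi>(2)])
qed

text \<open>Since \<open>X\<close> normalises \<open>Q\<close>, its inverse is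
  \<open>R = X * X\<^sup>T\<close>, and \<open>P * R\<close> equals
  \<open>Q * X * diag_of n d * X\<^sup>T\<close>, where \<open>Q * X\<close> and
  \<open>X\<^sup>T\<close> are inverse to each other. So the eigenvalues of \<open>P * R\<close> are
  those of \<open>P\<close> relative to \<open>Q\<close>. The index is shifted because
  \<open>singular_value\<close> counts from 1.\<close>

lemma singular_value_diag:
  assumes P: "P \<in> carrier_mat n n" and Q: "Q \<in> carrier_mat n n" and R: "R \<in> carrier_mat n n" "Q * R = 1\<^sub>m n" "R * Q = 1\<^sub>m n"
    and X: "X \<in> carrier_mat n n" "X\<^sup>T * Q * X = 1\<^sub>m n" "X\<^sup>T * P * X = diag_of n d"
    and d: "\<And>i j. i \<le> j \<Longrightarrow> j < n \<Longrightarrow> d j \<le> d i" and i: "i < n"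
  shows "singular_value P R (Suc i) = d i"
proof -
  have Xt: "X\<^sup>T \<in> carrier_mat n n" using X(1) by simp
  note XtQ = mult_carrier_mat[OF Xt Q] and QX = mult_carrier_mat[OF Q X(1)] and PX = mult_carrier_mat[OF P X(1)]
  have 1: "X\<^sup>T * (Q * X) = 1\<^sub>m n" using X(2) unfolding assoc_mult_mat[OF Xt Q X(1)] .
  have 2: "Q * X * X\<^sup>T = 1\<^sub>m n" by (rule mat_mult_left_right_inverse[OF Xt QX 1])
  have "R = X * X\<^sup>T"
  proof -
    have "Q * (X * X\<^sup>T) = 1\<^sub>m n" using 2 unfolding assoc_mult_mat[OF Q X(1) Xt] .
    then have "R * (Q * (X * X\<^sup>T)) = R" by (simp only: right_mult_one_mat[OF R(1)])
    moreover have "R * (Q * (X * X\<^sup>T)) = X * X\<^sup>T"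
      unfolding assoc_mult_mat[OF R(1) Q mult_carrier_mat[OF X(1) Xt], symmetric] R(3)
      by (rule left_mult_one_mat[OF mult_carrier_mat[OF X(1) Xt]])
    ultimately show ?thesis by simp
  qed
  then have "P * R = P * X * X\<^sup>T" unfolding assoc_mult_mat[OF P X(1) Xt] by (simp only:)
  also have "P * X = Q * X * X\<^sup>T * (P * X)" unfolding 2 by (rule left_mult_one_mat[OF PX, symmetric])
  also have "\<dots> = Q * X * diag_of n d"
    unfolding assoc_mult_mat[OF QX Xt PX] X(3)[symmetric] assoc_mult_mat[OF Xt P X(1)] ..
  finally have PR: "P * R = Q * X * diag_of n d * X\<^sup>T" .
  have "similar_mat_wit (P * R) (diag_of n d) (Q * X) (X\<^sup>T)"
    by (rule similar_mat_witI[OF 2 1 PR mult_carrier_mat[OF P R(1)] diag_of_carrier QX Xt])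
  then have "similar_mat (P * R) (diag_of n d)" unfolding similar_mat_def by (intro exI)
  then have "char_poly (P * R) = char_poly (diag_of n d)" by (rule char_poly_similar)
  also have "\<dots> = (\<Prod>a\<leftarrow>diag_mat (diag_of n d). [:- a, 1:])"
    by (rule char_poly_upper_triangular[OF diag_of_carrier]) (auto simp: diag_of_def upper_triangular_def)
  also have "diag_mat (diag_of n d) = map d [0..<n]" by (simp add: diag_mat_def diag_of_def)
  finally have cp: "char_poly (P * R) = (\<Prod>a\<leftarrow>map d [0..<n]. [:- a, 1:])" .
  have proots: "proots (\<Prod>a\<leftarrow>xs. [:- a, 1:]) = mset xs" for xs :: "real list"
  proof (induction xs)
    case (Cons a xs)
    have "(\<Prod>a\<leftarrow>xs. [:- a, 1:]) \<noteq> 0" by (auto simp: prod_list_zero_iff)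
    then show ?case using Cons by (simp add: proots_mult del: mult_pCons_left)
  qed simp
  have "sorted (rev (map d [0..<n]))"
    unfolding sorted_rev_iff_nth_mono using d by simp
  then have "sort (map d [0..<n]) = rev (map d [0..<n])"
    by (intro properties_for_sort) simp_all
  then have "rev (sorted_list_of_multiset (proots (char_poly (P * R)))) = map d [0..<n]"
    unfolding cp proots sorted_list_of_multiset_mset by simp
  then show ?thesis unfolding singular_value_def using i by simp
qed

section \<open>Dimension counts for interlacing\<close>

text \<open>The submatrix with rows \<open>J\<close> and columns \<open>I\<close> has more columns
  than rows, so it has a kernel vector, which is extended by zero outside \<open>I\<close>. The
  bijections \<open>f\<close> and \<open>g\<close> number the two index sets.\<close>

lemma wide_support_kernel:
  fixes M :: "real mat"
  assumes M: "M \<in> carrier_mat n k" and J: "J \<subseteq> {..<n}" and I: "I \<subseteq> {..<k}" and card: "card J < card I"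
  obtains c where "c \<in> carrier_vec k" "c \<noteq> 0\<^sub>v k" "\<And>i. i < k \<Longrightarrow> i \<notin> I \<Longrightarrow> c $ i = 0"
    "\<And>j. j \<in> J \<Longrightarrow> (M *\<^sub>v c) $ j = 0"
proof -
  have fin: "finite I" "finite J" using I J finite_subset by auto
  obtain f where f: "bij_betw f {..<card I} I" using ex_bij_betw_nat_finite[OF fin(1)] by (auto simp: atLeast0LessThan)
  obtain g where g: "bij_betw g {..<card J} J" using ex_bij_betw_nat_finite[OF fin(2)] by (auto simp: atLeast0LessThan)
  have fI: "f a \<in> I" if "a < card I" for a using bij_betwE[OF f] that by simp
  have gJ: "g a \<in> J" if "a < card J" for a using bij_betwE[OF g] that by simp
  define N where "N = mat (card J) (card I) (\<lambda>(a, b). M $$ (g a, f b))"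
  have N: "N \<in> carrier_mat (card J) (card I)" by (simp add: N_def)
  obtain b where b: "b \<in> carrier_vec (card I)" "b \<noteq> 0\<^sub>v (card I)" "N *\<^sub>v b = 0\<^sub>v (card J)"
    using wide_matrix_kernel[OF N card] by blast
  define c where "c = vec k (\<lambda>i. if i \<in> I then b $ (the_inv_into {..<card I} f i) else 0)"
  have c: "c \<in> carrier_vec k" by (simp add: c_def)
  have cf: "c $ f a = b $ a" if a: "a < card I" for a
  proof -
    have "f a < k" using fI[OF a] I by auto
    moreover have "the_inv_into {..<card I} f (f a) = a"
      by (rule the_inv_into_f_f[OF bij_betw_imp_inj_on[OF f]]) (use a in simp)
    ultimately show ?thesis using fI[OF a] by (simp add: c_def)
  qed
  have "c \<noteq> 0\<^sub>v k"
  proof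
    assume z: "c = 0\<^sub>v k"
    have "b = 0\<^sub>v (card I)"
    proof (rule eq_vecI)
      fix a assume "a < dim_vec (0\<^sub>v (card I) :: real vec)"
      then have a: "a < card I" by simp
      have "f a < k" using fI[OF a] I by auto
      then show "b $ a = 0\<^sub>v (card I) $ a" using cf[OF a] z a by simp
    qed (use b in simp)
    then show False using b(2) by simp
  qed
  moreover have "(M *\<^sub>v c) $ j = 0" if j: "j \<in> J" for j
  proof -
    have jn: "j < n" using j J by auto
    obtain a where a: "a < card J" "j = g a" using bij_betw_imp_surj_on[OF g] j by auto
    have "(M *\<^sub>v c) $ j = (\<Sum>i<k. M $$ (j, i) * c $ i)" by (rule mult_mat_vec_index_sum[OF M c jn])
    also have "\<dots> = (\<Sum>i\<in>I. M $$ (j, i) * c $ i)"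
      by (rule sum.mono_neutral_right) (use I in \<open>auto simp: c_def\<close>)
    also have "\<dots> = (\<Sum>t<card I. M $$ (j, f t) * c $ f t)"
      using sum.reindex_bij_betw[OF f, of "\<lambda>i. M $$ (j, i) * c $ i"] by simp
    also have "\<dots> = (\<Sum>t<card I. N $$ (a, t) * b $ t)"
      by (rule sum.cong) (use a cf in \<open>simp_all add: N_def\<close>)
    also have "\<dots> = (N *\<^sub>v b) $ a" by (rule mult_mat_vec_index_sum[OF N b(1) a(1), symmetric])
    finally show ?thesis unfolding b(3) using a(1) by simp
  qed
  moreover have "c $ i = 0" if "i < k" "i \<notin> I" for i using that by (simp add: c_def)
  ultimately show thesis using that[OF c] by blast
qed

lemma sum_square_pos:
  assumes "c \<in> carrier_vec k" "c \<noteq> 0\<^sub>v k"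
  shows "(\<Sum>i<k. (c $ i :: real)\<^sup>2) > 0"
proof -
  have "c \<bullet> c \<noteq> 0" using scalar_prod_eq_0_imp[OF _ assms(1)] assms(2) by blast
  moreover have "c \<bullet> c = (\<Sum>i<k. (c $ i)\<^sup>2)"
    using assms(1) by (simp add: scalar_prod_def atLeast0LessThan power2_eq_square)
  moreover have "(\<Sum>i<k. (c $ i)\<^sup>2) \<ge> 0" by (rule sum_nonneg) simp
  ultimately show ?thesis by linarith
qed

text \<open>Among the vectors supported on the \<open>i + 1\<close> largest values of
  \<open>e\<close>, one has an image whose first \<open>i\<close> coordinates vanish. Its
  \<open>e\<close>-form is at least \<open>e i\<close> times its squared norm, while the
  \<open>d\<close>-form of the image is at most \<open>d i\<close> times the squared norm of the
  image.\<close>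

lemma diagonal_interlacing_upper:
  fixes Z :: "real mat"
  assumes Z: "Z \<in> carrier_mat n k"
    and d: "\<And>i j. i \<le> j \<Longrightarrow> j < n \<Longrightarrow> d j \<le> d i" and e: "\<And>i j. i \<le> j \<Longrightarrow> j < k \<Longrightarrow> e j \<le> e i"
    and dpos: "\<And>i. i < n \<Longrightarrow> d i \<ge> 0"
    and form: "\<And>c. c \<in> carrier_vec k \<Longrightarrow> (\<Sum>i<k. e i * (c $ i)\<^sup>2) \<le> (\<Sum>j<n. d j * ((Z *\<^sub>v c) $ j)\<^sup>2)"
    and norm: "\<And>c. c \<in> carrier_vec k \<Longrightarrow> (\<Sum>j<n. ((Z *\<^sub>v c) $ j)\<^sup>2) \<le> (\<Sum>i<k. (c $ i)\<^sup>2)"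
    and i: "i < k" "i < n"
  shows "e i \<le> d i"
proof -
  obtain c where c: "c \<in> carrier_vec k" "c \<noteq> 0\<^sub>v k" "\<And>a. a < k \<Longrightarrow> a \<notin> {..i} \<Longrightarrow> c $ a = 0"
    "\<And>j. j \<in> {..<i} \<Longrightarrow> (Z *\<^sub>v c) $ j = 0"
    by (rule wide_support_kernel[OF Z, of "{..<i}" "{..i}"]) (use i in auto)
  have "e i * (\<Sum>a<k. (c $ a)\<^sup>2) = (\<Sum>a<k. e i * (c $ a)\<^sup>2)" by (rule sum_distrib_left)
  also have "\<dots> \<le> (\<Sum>a<k. e a * (c $ a)\<^sup>2)"
  proof (rule sum_mono)
    fix a assume "a \<in> {..<k}"
    then have a: "a < k" by simp
    show "e i * (c $ a)\<^sup>2 \<le> e a * (c $ a)\<^sup>2"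
      using c(3)[OF a] e[of a i] i by (cases "a \<le> i") (auto intro: mult_right_mono)
  qed
  also have "\<dots> \<le> (\<Sum>j<n. d j * ((Z *\<^sub>v c) $ j)\<^sup>2)" by (rule form[OF c(1)])
  also have "\<dots> \<le> (\<Sum>j<n. d i * ((Z *\<^sub>v c) $ j)\<^sup>2)"
  proof (rule sum_mono)
    fix j assume "j \<in> {..<n}"
    then have j: "j < n" by simp
    show "d j * ((Z *\<^sub>v c) $ j)\<^sup>2 \<le> d i * ((Z *\<^sub>v c) $ j)\<^sup>2"
      using c(4)[of j] d[of i j] j by (cases "j < i") (auto intro: mult_right_mono)
  qed
  also have "\<dots> = d i * (\<Sum>j<n. ((Z *\<^sub>v c) $ j)\<^sup>2)" by (rule sum_distrib_left[symmetric])
  also have "\<dots> \<le> d i * (\<Sum>a<k. (c $ a)\<^sup>2)" by (rule mult_left_mono[OF norm[OF c(1)] dpos[OF i(2)]])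
  finally show ?thesis using sum_square_pos[OF c(1,2)] by simp
qed

text \<open>The mirror image: \<open>c\<close> is supported on the \<open>k - i\<close> smallest
  values of \<open>e\<close>, and the \<open>k - i - 1\<close> coordinates of its image beyond
  \<open>n - k + i\<close> vanish. Being one condition short of the number of free coordinates is
  what fixes the shift \<open>n - k\<close>.\<close>

lemma diagonal_interlacing_lower:
  fixes Z :: "real mat"
  assumes Z: "Z \<in> carrier_mat n k"
    and d: "\<And>i j. i \<le> j \<Longrightarrow> j < n \<Longrightarrow> d j \<le> d i" and e: "\<And>i j. i \<le> j \<Longrightarrow> j < k \<Longrightarrow> e j \<le> e i"
    and dpos: "\<And>i. i < n \<Longrightarrow> d i \<ge> 0"
    and form: "\<And>c. c \<in> carrier_vec k \<Longrightarrow> (\<Sum>j<n. d j * ((Z *\<^sub>v c) $ j)\<^sup>2) \<le> (\<Sum>i<k. e i * (c $ i)\<^sup>2)"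
    and norm: "\<And>c. c \<in> carrier_vec k \<Longrightarrow> (\<Sum>i<k. (c $ i)\<^sup>2) \<le> (\<Sum>j<n. ((Z *\<^sub>v c) $ j)\<^sup>2)"
    and i: "i < k" and kn: "k \<le> n"
  shows "d (n - k + i) \<le> e i"
proof -
  let ?m = "n - k + i"
  have m: "?m < n" using i kn by simp
  obtain c where c: "c \<in> carrier_vec k" "c \<noteq> 0\<^sub>v k" "\<And>a. a < k \<Longrightarrow> a \<notin> {i..<k} \<Longrightarrow> c $ a = 0"
    "\<And>j. j \<in> {?m<..<n} \<Longrightarrow> (Z *\<^sub>v c) $ j = 0"
    by (rule wide_support_kernel[OF Z, of "{?m<..<n}" "{i..<k}"]) (use i kn in auto)
  have "d ?m * (\<Sum>a<k. (c $ a)\<^sup>2) \<le> d ?m * (\<Sum>j<n. ((Z *\<^sub>v c) $ j)\<^sup>2)"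
    by (rule mult_left_mono[OF norm[OF c(1)] dpos[OF m]])
  also have "\<dots> = (\<Sum>j<n. d ?m * ((Z *\<^sub>v c) $ j)\<^sup>2)" by (rule sum_distrib_left)
  also have "\<dots> \<le> (\<Sum>j<n. d j * ((Z *\<^sub>v c) $ j)\<^sup>2)"
  proof (rule sum_mono)
    fix j assume "j \<in> {..<n}"
    then have j: "j < n" by simp
    show "d ?m * ((Z *\<^sub>v c) $ j)\<^sup>2 \<le> d j * ((Z *\<^sub>v c) $ j)\<^sup>2"
      using c(4)[of j] d[of j ?m] j m by (cases "j \<le> ?m") (auto intro: mult_right_mono)
  qed
  also have "\<dots> \<le> (\<Sum>a<k. e a * (c $ a)\<^sup>2)" by (rule form[OF c(1)])
  also have "\<dots> \<le> (\<Sum>a<k. e i * (c $ a)\<^sup>2)"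
  proof (rule sum_mono)
    fix a assume "a \<in> {..<k}"
    then have a: "a < k" by simp
    show "e a * (c $ a)\<^sup>2 \<le> e i * (c $ a)\<^sup>2"
      using c(3)[OF a] e[of i a] a by (cases "i \<le> a") (auto intro: mult_right_mono)
  qed
  also have "\<dots> = e i * (\<Sum>a<k. (c $ a)\<^sup>2)" by (rule sum_distrib_left[symmetric])
  finally show ?thesis using sum_square_pos[OF c(1,2)] by simp
qed

lemma pencil_interlacing:
  assumes P: "pos_def n P" and Q: "pos_def n Q" and R: "R \<in> carrier_mat n n" "Q * R = 1\<^sub>m n" "R * Q = 1\<^sub>m n"
    and P': "pos_def k P'" and Q': "pos_def k Q'" and R': "R' \<in> carrier_mat k k" "Q' * R' = 1\<^sub>m k" "R' * Q' = 1\<^sub>m k"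
    and Z: "Z \<in> carrier_mat n k"
  shows pencil_interlacing_upper: "(\<And>c. c \<in> carrier_vec k \<Longrightarrow> c \<bullet> (P' *\<^sub>v c) \<le> (Z *\<^sub>v c) \<bullet> (P *\<^sub>v (Z *\<^sub>v c))) \<Longrightarrow>
      (\<And>c. c \<in> carrier_vec k \<Longrightarrow> (Z *\<^sub>v c) \<bullet> (Q *\<^sub>v (Z *\<^sub>v c)) \<le> c \<bullet> (Q' *\<^sub>v c)) \<Longrightarrow> i < k \<Longrightarrow> i < n \<Longrightarrow>
      singular_value P' R' (Suc i) \<le> singular_value P R (Suc i)"
    and pencil_interlacing_lower: "(\<And>c. c \<in> carrier_vec k \<Longrightarrow> (Z *\<^sub>v c) \<bullet> (P *\<^sub>v (Z *\<^sub>v c)) \<le> c \<bullet> (P' *\<^sub>v c)) \<Longrightarrow>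
      (\<And>c. c \<in> carrier_vec k \<Longrightarrow> c \<bullet> (Q' *\<^sub>v c) \<le> (Z *\<^sub>v c) \<bullet> (Q *\<^sub>v (Z *\<^sub>v c))) \<Longrightarrow> i < k \<Longrightarrow> k \<le> n \<Longrightarrow>
      singular_value P R (Suc (n - k + i)) \<le> singular_value P' R' (Suc i)"
proof -
  note Pc = pos_defD(1,2)[OF P] and Qc = pos_defD(1,2)[OF Q] and Pc' = pos_defD(1,2)[OF P'] and Qc' = pos_defD(1,2)[OF Q']
  obtain X d where X: "X \<in> carrier_mat n n" "X\<^sup>T * Q * X = 1\<^sub>m n" "X\<^sup>T * P * X = diag_of n d"
    and d: "\<And>i j. i \<le> j \<Longrightarrow> j < n \<Longrightarrow> d j \<le> d i"
    by (rule simultaneous_diagonalization[OF Q Pc]) (rule that)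
  obtain Y e where Y: "Y \<in> carrier_mat k k" "Y\<^sup>T * Q' * Y = 1\<^sub>m k" "Y\<^sup>T * P' * Y = diag_of k e"
    and e: "\<And>i j. i \<le> j \<Longrightarrow> j < k \<Longrightarrow> e j \<le> e i"
    by (rule simultaneous_diagonalization[OF Q' Pc']) (rule that)
  have svd: "singular_value P R (Suc i) = d i" if "i < n" for i
    by (rule singular_value_diag[OF Pc(1) Qc(1) R X d that])
  have sve: "singular_value P' R' (Suc i) = e i" if "i < k" for i
    by (rule singular_value_diag[OF Pc'(1) Qc'(1) R' Y e that])
  have Xt: "X\<^sup>T \<in> carrier_mat n n" using X(1) by simp
  note XtQ = mult_carrier_mat[OF Xt Qc(1)]
  have XXtQ: "X * (X\<^sup>T * Q) = 1\<^sub>m n" by (rule mat_mult_left_right_inverse[OF XtQ X(1,2)])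
  \<comment> \<open>\<open>X\<^sup>T * Q\<close> is the inverse of \<open>X\<close>, so
    \<open>W\<close> is the map \<open>Z\<close> written in the coordinates that diagonalise both
    pencils.\<close>
  define W where "W = X\<^sup>T * Q * (Z * Y)"
  note ZY = mult_carrier_mat[OF Z Y(1)]
  have W: "W \<in> carrier_mat n k" unfolding W_def by (rule mult_carrier_mat[OF XtQ ZY])
  have XW: "X *\<^sub>v (W *\<^sub>v c) = Z *\<^sub>v (Y *\<^sub>v c)" if c: "c \<in> carrier_vec k" for c
  proof -
    have "X * W = Z * Y" unfolding W_def assoc_mult_mat[OF X(1) XtQ ZY, symmetric] XXtQ by (rule left_mult_one_mat[OF ZY])
    then show ?thesis
      unfolding assoc_mult_mat_vec[OF X(1) W c, symmetric] assoc_mult_mat_vec[OF Z Y(1) c, symmetric] by simp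
  qed
  have one: "1\<^sub>m m = diag_of m (\<lambda>i. 1)" for m by (rule eq_matI) (simp_all add: diag_of_def)
  have formP: "(\<Sum>j<n. d j * (v $ j)\<^sup>2) = (X *\<^sub>v v) \<bullet> (P *\<^sub>v (X *\<^sub>v v))"
    and formQ: "(\<Sum>j<n. (v $ j)\<^sup>2) = (X *\<^sub>v v) \<bullet> (Q *\<^sub>v (X *\<^sub>v v))" if v: "v \<in> carrier_vec n" for v
    using form_congruence[OF X(1) Pc(1) X(1) v v] form_congruence[OF X(1) Qc(1) X(1) v v]
      diag_of_form[OF v] unfolding X(2,3) one by simp_all
  have formP': "(\<Sum>j<k. e j * (v $ j)\<^sup>2) = (Y *\<^sub>v v) \<bullet> (P' *\<^sub>v (Y *\<^sub>v v))"
    and formQ': "(\<Sum>j<k. (v $ j)\<^sup>2) = (Y *\<^sub>v v) \<bullet> (Q' *\<^sub>v (Y *\<^sub>v v))" if v: "v \<in> carrier_vec k" for v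
    using form_congruence[OF Y(1) Pc'(1) Y(1) v v] form_congruence[OF Y(1) Qc'(1) Y(1) v v]
      diag_of_form[OF v] unfolding Y(2,3) one by simp_all
  \<comment> \<open>A diagonal value is the value of the form \<open>P\<close> at a column of
    \<open>X\<close>.\<close>
  have dpos: "d i \<ge> 0" if i: "i < n" for i
  proof -
    have u: "unit_vec n i \<in> carrier_vec n" by simp
    have "(\<Sum>j<n. d j * (unit_vec n i $ j)\<^sup>2) = (\<Sum>j<n. if j = i then d j else 0)"
      by (rule sum.cong) (use i in auto)
    also have "\<dots> = d i" using i by simp
    finally show ?thesis using formP[OF u] pos_def_nonneg[OF P mult_mat_vec_carrier[OF X(1) u]] by simp
  qed
  note Wc = mult_mat_vec_carrier[OF W] and Yc = mult_mat_vec_carrier[OF Y(1)]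
  {
    assume H: "\<And>c. c \<in> carrier_vec k \<Longrightarrow> c \<bullet> (P' *\<^sub>v c) \<le> (Z *\<^sub>v c) \<bullet> (P *\<^sub>v (Z *\<^sub>v c))"
      "\<And>c. c \<in> carrier_vec k \<Longrightarrow> (Z *\<^sub>v c) \<bullet> (Q *\<^sub>v (Z *\<^sub>v c)) \<le> c \<bullet> (Q' *\<^sub>v c)" and i: "i < k" "i < n"
    have "e i \<le> d i"
    proof (rule diagonal_interlacing_upper[OF W d e dpos _ _ i])
      fix c :: "real vec" assume c: "c \<in> carrier_vec k"
      show "(\<Sum>i<k. e i * (c $ i)\<^sup>2) \<le> (\<Sum>j<n. d j * ((W *\<^sub>v c) $ j)\<^sup>2)"
        unfolding formP[OF Wc[OF c]] formP'[OF c] XW[OF c] by (rule H(1)[OF Yc[OF c]])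
      show "(\<Sum>j<n. ((W *\<^sub>v c) $ j)\<^sup>2) \<le> (\<Sum>i<k. (c $ i)\<^sup>2)"
        unfolding formQ[OF Wc[OF c]] formQ'[OF c] XW[OF c] by (rule H(2)[OF Yc[OF c]])
    qed
    then show "singular_value P' R' (Suc i) \<le> singular_value P R (Suc i)" unfolding svd[OF i(2)] sve[OF i(1)] .
  next
    assume H: "\<And>c. c \<in> carrier_vec k \<Longrightarrow> (Z *\<^sub>v c) \<bullet> (P *\<^sub>v (Z *\<^sub>v c)) \<le> c \<bullet> (P' *\<^sub>v c)"
      "\<And>c. c \<in> carrier_vec k \<Longrightarrow> c \<bullet> (Q' *\<^sub>v c) \<le> (Z *\<^sub>v c) \<bullet> (Q *\<^sub>v (Z *\<^sub>v c))" and i: "i < k" "k \<le> n"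
    have m: "n - k + i < n" using i by simp
    have "d (n - k + i) \<le> e i"
    proof (rule diagonal_interlacing_lower[OF W d e dpos _ _ i])
      fix c :: "real vec" assume c: "c \<in> carrier_vec k"
      show "(\<Sum>j<n. d j * ((W *\<^sub>v c) $ j)\<^sup>2) \<le> (\<Sum>i<k. e i * (c $ i)\<^sup>2)"
        unfolding formP[OF Wc[OF c]] formP'[OF c] XW[OF c] by (rule H(1)[OF Yc[OF c]])
      show "(\<Sum>i<k. (c $ i)\<^sup>2) \<le> (\<Sum>j<n. ((W *\<^sub>v c) $ j)\<^sup>2)"
        unfolding formQ[OF Wc[OF c]] formQ'[OF c] XW[OF c] by (rule H(2)[OF Yc[OF c]])
    qed
    then show "singular_value P R (Suc (n - k + i)) \<le> singular_value P' R' (Suc i)" unfolding svd[OF m] sve[OF i(1)] .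
  }
qed

section \<open>Congruence and duality\<close>

lemma projected_vector_eq:
  fixes U P A B A' B' :: "real mat"
  assumes U: "U \<in> carrier_mat n k" and P: "P \<in> carrier_mat n n" and A: "A \<in> carrier_mat n n" and B: "B \<in> carrier_mat n m"
    and A': "A' \<in> carrier_mat k k" and B': "B' \<in> carrier_mat k m"
    and eqA: "U\<^sup>T * P * (A * U) = U\<^sup>T * P * U * A'" and eqB: "U\<^sup>T * P * B = U\<^sup>T * P * U * B'"
    and x: "x \<in> carrier_vec k" and u: "u \<in> carrier_vec m"
  shows "U\<^sup>T *\<^sub>v (P *\<^sub>v (A *\<^sub>v (U *\<^sub>v x) + B *\<^sub>v u)) = U\<^sup>T * P * U *\<^sub>v (A' *\<^sub>v x + B' *\<^sub>v u)"
proof -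
  have Ut: "U\<^sup>T \<in> carrier_mat k n" using U by simp
  note UtP = mult_carrier_mat[OF Ut P]
  note UtPU = mult_carrier_mat[OF UtP U]
  note Ux = mult_mat_vec_carrier[OF U x]
  note AUx = mult_mat_vec_carrier[OF A Ux] and Bu = mult_mat_vec_carrier[OF B u]
  have "U\<^sup>T *\<^sub>v (P *\<^sub>v (A *\<^sub>v (U *\<^sub>v x) + B *\<^sub>v u)) = U\<^sup>T * P *\<^sub>v (A *\<^sub>v (U *\<^sub>v x) + B *\<^sub>v u)"
    by (rule assoc_mult_mat_vec[OF Ut P add_carrier_vec[OF AUx Bu], symmetric])
  also have "\<dots> = U\<^sup>T * P *\<^sub>v (A *\<^sub>v (U *\<^sub>v x)) + U\<^sup>T * P *\<^sub>v (B *\<^sub>v u)"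
    by (rule mult_add_distrib_mat_vec[OF UtP AUx Bu])
  also have "U\<^sup>T * P *\<^sub>v (A *\<^sub>v (U *\<^sub>v x)) = U\<^sup>T * P * U *\<^sub>v (A' *\<^sub>v x)"
    unfolding assoc_mult_mat_vec[OF A U x, symmetric] assoc_mult_mat_vec[OF UtP mult_carrier_mat[OF A U] x, symmetric] eqA
    by (rule assoc_mult_mat_vec[OF UtPU A' x])
  also have "U\<^sup>T * P *\<^sub>v (B *\<^sub>v u) = U\<^sup>T * P * U *\<^sub>v (B' *\<^sub>v u)"
    unfolding assoc_mult_mat_vec[OF UtP B u, symmetric] eqB by (rule assoc_mult_mat_vec[OF UtPU B' u])
  also have "U\<^sup>T * P * U *\<^sub>v (A' *\<^sub>v x) + U\<^sup>T * P * U *\<^sub>v (B' *\<^sub>v u) = U\<^sup>T * P * U *\<^sub>v (A' *\<^sub>v x + B' *\<^sub>v u)"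
    by (rule mult_add_distrib_mat_vec[OF UtPU mult_mat_vec_carrier[OF A' x] mult_mat_vec_carrier[OF B' u], symmetric])
  finally show ?thesis .
qed

lemma symbol_set_pos_def: "P \<in> symbol_set \<tau> K \<Sigma> \<Longrightarrow> pos_def (state_dim \<Sigma>) P"
  by (cases K) (auto simp: stability_set_def obs_grammians_def ctrl_grammians_def gain_set_def)

text \<open>The projection estimate for zero input, the form in which it serves stability matrices
  and observability grammians.\<close>

lemma lyap_projection_autonomous:
  assumes P: "pos_def n P" and U: "U \<in> carrier_mat n k" and A: "A \<in> carrier_mat n n" and A': "A' \<in> carrier_mat k k"
    and eqA: "U\<^sup>T * P * (A * U) = U\<^sup>T * P * U * A'" and x: "x \<in> carrier_vec k"
  shows "lyap \<tau> (U\<^sup>T * P * U) x (A' *\<^sub>v x) \<le> lyap \<tau> P (U *\<^sub>v x) (A *\<^sub>v (U *\<^sub>v x))"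
proof (rule lyap_projection[OF P U _ _ x])
  note Pc = pos_defD(1)[OF P]
  have Ut: "U\<^sup>T \<in> carrier_mat k n" using U by simp
  note UtP = mult_carrier_mat[OF Ut Pc]
  note Ux = mult_mat_vec_carrier[OF U x]
  note AUx = mult_mat_vec_carrier[OF A Ux]
  show "A *\<^sub>v (U *\<^sub>v x) \<in> carrier_vec n" "A' *\<^sub>v x \<in> carrier_vec k"
    using AUx mult_mat_vec_carrier[OF A' x] by auto
  have "U\<^sup>T *\<^sub>v (P *\<^sub>v (A *\<^sub>v (U *\<^sub>v x))) = U\<^sup>T * P *\<^sub>v (A *\<^sub>v (U *\<^sub>v x))"
    by (rule assoc_mult_mat_vec[OF Ut Pc AUx, symmetric])
  also have "\<dots> = U\<^sup>T * P * U *\<^sub>v (A' *\<^sub>v x)"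
    unfolding assoc_mult_mat_vec[OF A U x, symmetric] assoc_mult_mat_vec[OF UtP mult_carrier_mat[OF A U] x, symmetric] eqA
    by (rule assoc_mult_mat_vec[OF mult_carrier_mat[OF UtP U] A' x])
  finally show "U\<^sup>T *\<^sub>v (P *\<^sub>v (A *\<^sub>v (U *\<^sub>v x))) = U\<^sup>T * P * U *\<^sub>v (A' *\<^sub>v x)" .
qed

lemma obs_grammians_projection:
  assumes S: "is_lss \<Sigma>" "is_lss \<Sigma>'" and ty: "same_type \<Sigma> \<Sigma>'" and P: "P \<in> obs_grammians \<tau> \<Sigma>"
    and U: "U \<in> carrier_mat (state_dim \<Sigma>) (state_dim \<Sigma>')" and L: "L \<in> carrier_mat (state_dim \<Sigma>') (state_dim \<Sigma>)" "L * U = 1\<^sub>m (state_dim \<Sigma>')"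
    and eqA: "\<And>q. q \<in> modes \<Sigma> \<Longrightarrow> U\<^sup>T * P * (Amat \<Sigma> q * U) = U\<^sup>T * P * U * Amat \<Sigma>' q"
    and eqC: "\<And>q. q \<in> modes \<Sigma> \<Longrightarrow> Cmat \<Sigma> q * U = Cmat \<Sigma>' q"
  shows "U\<^sup>T * P * U \<in> obs_grammians \<tau> \<Sigma>'"
  unfolding obs_grammians_iff[OF S(2)]
proof (intro conjI ballI)
  note T = same_typeD[OF ty]
  have Pd: "pos_def (state_dim \<Sigma>) P" and ineq: "\<And>q x. q \<in> modes \<Sigma> \<Longrightarrow> x \<in> carrier_vec (state_dim \<Sigma>) \<Longrightarrow>
      lyap \<tau> P x (Amat \<Sigma> q *\<^sub>v x) + (Cmat \<Sigma> q *\<^sub>v x) \<bullet> (Cmat \<Sigma> q *\<^sub>v x) \<le> 0"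
    using P unfolding obs_grammians_iff[OF S(1)] by auto
  show "pos_def (state_dim \<Sigma>') (U\<^sup>T * P * U)" by (rule pos_def_congruence[OF Pd U L])
  fix q and x :: "real vec" assume "q \<in> modes \<Sigma>'" and x: "x \<in> carrier_vec (state_dim \<Sigma>')"
  then have q: "q \<in> modes \<Sigma>" using T by simp
  have Cx: "Cmat \<Sigma> q *\<^sub>v (U *\<^sub>v x) = Cmat \<Sigma>' q *\<^sub>v x"
    unfolding assoc_mult_mat_vec[OF is_lssD(3)[OF S(1) q] U x, symmetric] eqC[OF q] ..
  show "lyap \<tau> (U\<^sup>T * P * U) x (Amat \<Sigma>' q *\<^sub>v x) + (Cmat \<Sigma>' q *\<^sub>v x) \<bullet> (Cmat \<Sigma>' q *\<^sub>v x) \<le> 0"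
    using ineq[OF q mult_mat_vec_carrier[OF U x]]
      lyap_projection_autonomous[OF Pd U is_lssD(1)[OF S(1) q] is_lssD(1)[OF S(2), unfolded T, OF q] eqA[OF q] x, of \<tau>]
    unfolding Cx by linarith
qed

text \<open>The equations for \<open>Amat\<close> and \<open>Bmat\<close> say that the right-hand
  side of \<open>\<Sigma>'\<close>, embedded by \<open>U\<close>, is the \<open>P\<close>-orthogonal
  projection of the right-hand side of \<open>\<Sigma>\<close> at embedded states. Projection does
  not raise the change of storage, the outputs agree, and injectivity of \<open>U\<close> preserves
  strictness.\<close>

lemma symbol_set_projection:
  assumes K: "K \<noteq> Sym_C" and S: "is_lss \<Sigma>" "is_lss \<Sigma>'" and ty: "same_type \<Sigma> \<Sigma>'" and P: "P \<in> symbol_set \<tau> K \<Sigma>"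
    and U: "U \<in> carrier_mat (state_dim \<Sigma>) (state_dim \<Sigma>')" and L: "L \<in> carrier_mat (state_dim \<Sigma>') (state_dim \<Sigma>)" "L * U = 1\<^sub>m (state_dim \<Sigma>')"
    and eqA: "\<And>q. q \<in> modes \<Sigma> \<Longrightarrow> U\<^sup>T * P * (Amat \<Sigma> q * U) = U\<^sup>T * P * U * Amat \<Sigma>' q"
    and eqB: "\<And>q. q \<in> modes \<Sigma> \<Longrightarrow> U\<^sup>T * P * Bmat \<Sigma> q = U\<^sup>T * P * U * Bmat \<Sigma>' q"
    and eqC: "\<And>q. q \<in> modes \<Sigma> \<Longrightarrow> Cmat \<Sigma> q * U = Cmat \<Sigma>' q"
  shows "U\<^sup>T * P * U \<in> symbol_set \<tau> K \<Sigma>'"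
proof (cases K)
  case Sym_S
  note T = same_typeD[OF ty]
  have P': "P \<in> stability_set \<tau> \<Sigma>" using P Sym_S by simp
  have Pd: "pos_def (state_dim \<Sigma>) P" and ineq: "\<And>q x. q \<in> modes \<Sigma> \<Longrightarrow> x \<in> carrier_vec (state_dim \<Sigma>) \<Longrightarrow> x \<noteq> 0\<^sub>v (state_dim \<Sigma>) \<Longrightarrow>
      lyap \<tau> P x (Amat \<Sigma> q *\<^sub>v x) < 0"
    using P' unfolding stability_set_iff[OF S(1)] by auto
  show ?thesis unfolding Sym_S symbol_set.simps stability_set_iff[OF S(2)]
  proof (intro conjI ballI impI)
    show "pos_def (state_dim \<Sigma>') (U\<^sup>T * P * U)" by (rule pos_def_congruence[OF Pd U L])
    fix q and x :: "real vec" assume "q \<in> modes \<Sigma>'" and x: "x \<in> carrier_vec (state_dim \<Sigma>')" "x \<noteq> 0\<^sub>v (state_dim \<Sigma>')"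
    then have q: "q \<in> modes \<Sigma>" using T by simp
    show "lyap \<tau> (U\<^sup>T * P * U) x (Amat \<Sigma>' q *\<^sub>v x) < 0"
      using ineq[OF q mult_mat_vec_carrier[OF U x(1)] left_invertible_nonzero[OF U L x]]
        lyap_projection_autonomous[OF Pd U is_lssD(1)[OF S(1) q] is_lssD(1)[OF S(2), unfolded T, OF q] eqA[OF q] x(1), of \<tau>]
      by linarith
  qed
next
  case Sym_O
  then show ?thesis using obs_grammians_projection[OF S ty _ U L eqA eqC] P by simp
next
  case (Sym_G \<gamma>)
  note T = same_typeD[OF ty]
  have P': "P \<in> gain_set \<tau> \<gamma> \<Sigma>" using P Sym_G by simp
  have Pd: "pos_def (state_dim \<Sigma>) P" and ineq: "\<And>q x u. q \<in> modes \<Sigma> \<Longrightarrow> x \<in> carrier_vec (state_dim \<Sigma>) \<Longrightarrow> u \<in> carrier_vec (input_dim \<Sigma>) \<Longrightarrow>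
      x \<noteq> 0\<^sub>v (state_dim \<Sigma>) \<or> u \<noteq> 0\<^sub>v (input_dim \<Sigma>) \<Longrightarrow>
      lyap \<tau> P x (Amat \<Sigma> q *\<^sub>v x + Bmat \<Sigma> q *\<^sub>v u) + (Cmat \<Sigma> q *\<^sub>v x) \<bullet> (Cmat \<Sigma> q *\<^sub>v x) - \<gamma>\<^sup>2 * (u \<bullet> u) < 0"
    using P' unfolding gain_set_iff[OF S(1)] by auto
  note Pc = pos_defD(1)[OF Pd]
  show ?thesis unfolding Sym_G symbol_set.simps gain_set_iff[OF S(2)] T
  proof (intro conjI ballI impI)
    show "pos_def (state_dim \<Sigma>') (U\<^sup>T * P * U)" by (rule pos_def_congruence[OF Pd U L])
    fix q and x u :: "real vec" assume q: "q \<in> modes \<Sigma>" and x: "x \<in> carrier_vec (state_dim \<Sigma>')" and u: "u \<in> carrier_vec (input_dim \<Sigma>)"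
      and ne: "x \<noteq> 0\<^sub>v (state_dim \<Sigma>') \<or> u \<noteq> 0\<^sub>v (input_dim \<Sigma>)"
    note D = is_lssD[OF S(1) q] and D' = is_lssD[OF S(2), unfolded T, OF q]
    note Ux = mult_mat_vec_carrier[OF U x]
    have ne': "U *\<^sub>v x \<noteq> 0\<^sub>v (state_dim \<Sigma>) \<or> u \<noteq> 0\<^sub>v (input_dim \<Sigma>)"
      using ne left_invertible_nonzero[OF U L x] by blast
    have Cx: "Cmat \<Sigma> q *\<^sub>v (U *\<^sub>v x) = Cmat \<Sigma>' q *\<^sub>v x"
      unfolding assoc_mult_mat_vec[OF D(3) U x, symmetric] eqC[OF q] ..
    have le: "lyap \<tau> (U\<^sup>T * P * U) x (Amat \<Sigma>' q *\<^sub>v x + Bmat \<Sigma>' q *\<^sub>v u) \<le> lyap \<tau> P (U *\<^sub>v x) (Amat \<Sigma> q *\<^sub>v (U *\<^sub>v x) + Bmat \<Sigma> q *\<^sub>v u)"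
      by (rule lyap_projection[OF Pd U
            add_carrier_vec[OF mult_mat_vec_carrier[OF D(1) Ux] mult_mat_vec_carrier[OF D(2) u]]
            add_carrier_vec[OF mult_mat_vec_carrier[OF D'(1) x] mult_mat_vec_carrier[OF D'(2) u]] x
            projected_vector_eq[OF U Pc D(1,2) D'(1,2) eqA[OF q] eqB[OF q] x u]])
    show "lyap \<tau> (U\<^sup>T * P * U) x (Amat \<Sigma>' q *\<^sub>v x + Bmat \<Sigma>' q *\<^sub>v u) + (Cmat \<Sigma>' q *\<^sub>v x) \<bullet> (Cmat \<Sigma>' q *\<^sub>v x) - \<gamma>\<^sup>2 * (u \<bullet> u) < 0"
      using ineq[OF q Ux u ne'] le unfolding Cx by linarith
  qed
qed (use K in simp)

section \<open>Dual systems and isomorphisms\<close>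

definition dual_lss :: "lss \<Rightarrow> lss" where
  "dual_lss \<Sigma> = \<Sigma>\<lparr>input_dim := output_dim \<Sigma>, output_dim := input_dim \<Sigma>,
     Amat := \<lambda>q. (Amat \<Sigma> q)\<^sup>T, Bmat := \<lambda>q. (Cmat \<Sigma> q)\<^sup>T, Cmat := \<lambda>q. (Bmat \<Sigma> q)\<^sup>T\<rparr>"

lemma dual_lss_simps [simp]:
  "state_dim (dual_lss \<Sigma>) = state_dim \<Sigma>" "modes (dual_lss \<Sigma>) = modes \<Sigma>"
  "input_dim (dual_lss \<Sigma>) = output_dim \<Sigma>" "output_dim (dual_lss \<Sigma>) = input_dim \<Sigma>"
  "Amat (dual_lss \<Sigma>) q = (Amat \<Sigma> q)\<^sup>T" "Bmat (dual_lss \<Sigma>) q = (Cmat \<Sigma> q)\<^sup>T" "Cmat (dual_lss \<Sigma>) q = (Bmat \<Sigma> q)\<^sup>T"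
  by (simp_all add: dual_lss_def modes_def)

lemma is_lss_dual: "is_lss \<Sigma> \<Longrightarrow> is_lss (dual_lss \<Sigma>)"
  unfolding is_lss_def by (simp add: dual_lss_def modes_def)

lemma same_type_dual: "same_type \<Sigma> \<Sigma>' \<Longrightarrow> same_type (dual_lss \<Sigma>) (dual_lss \<Sigma>')"
  unfolding same_type_def by (simp add: dual_lss_def)

lemma ctrl_grammians_dual: "ctrl_grammians \<tau> \<Sigma> = obs_grammians \<tau> (dual_lss \<Sigma>)"
  unfolding ctrl_grammians_def obs_grammians_def Let_def dual_lss_simps transpose_transpose ..

lemma intertwines_dual:
  assumes S: "is_lss \<Sigma>" "is_lss \<Sigma>'" and X: "intertwines X \<Sigma> \<Sigma>'"
  shows "intertwines (X\<^sup>T) (dual_lss \<Sigma>') (dual_lss \<Sigma>)"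
proof -
  have ty: "same_type \<Sigma> \<Sigma>'" and Xc: "X \<in> carrier_mat (state_dim \<Sigma>') (state_dim \<Sigma>)"
    using X unfolding intertwines_def by auto
  note T = same_typeD[OF ty]
  show ?thesis unfolding intertwines_def dual_lss_simps T
  proof (intro conjI ballI)
    show "same_type (dual_lss \<Sigma>') (dual_lss \<Sigma>)" by (rule same_type_dual[OF same_type_sym[OF ty]])
    show "X\<^sup>T \<in> carrier_mat (state_dim \<Sigma>) (state_dim \<Sigma>')" using Xc by simp
    fix q assume q: "q \<in> modes \<Sigma>"
    note D = is_lssD[OF S(1) q] and D' = is_lssD[OF S(2), unfolded T, OF q]
    have e: "Amat \<Sigma>' q * X = X * Amat \<Sigma> q" "Bmat \<Sigma>' q = X * Bmat \<Sigma> q" "Cmat \<Sigma>' q * X = Cmat \<Sigma> q"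
      using X q unfolding intertwines_def by auto
    show "(Amat \<Sigma> q)\<^sup>T * X\<^sup>T = X\<^sup>T * (Amat \<Sigma>' q)\<^sup>T"
      unfolding transpose_mult[OF Xc D(1), symmetric] transpose_mult[OF D'(1) Xc, symmetric] e(1) ..
    show "(Cmat \<Sigma> q)\<^sup>T = X\<^sup>T * (Cmat \<Sigma>' q)\<^sup>T"
      unfolding transpose_mult[OF D'(3) Xc, symmetric] e(3) ..
    show "(Bmat \<Sigma> q)\<^sup>T * X\<^sup>T = (Bmat \<Sigma>' q)\<^sup>T"
      unfolding transpose_mult[OF Xc D(2), symmetric] e(2) ..
  qed
qed

text \<open>Along an injective morphism the right-hand side at an embedded state already lies in the
  range of \<open>X\<close>, so it is its own projection.\<close>

lemma symbol_set_congruence: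
  assumes K: "K \<noteq> Sym_C" and S: "is_lss \<Sigma>" "is_lss \<Sigma>'" and X: "intertwines X \<Sigma>' \<Sigma>"
    and L: "L \<in> carrier_mat (state_dim \<Sigma>') (state_dim \<Sigma>)" "L * X = 1\<^sub>m (state_dim \<Sigma>')" and P: "P \<in> symbol_set \<tau> K \<Sigma>"
  shows "X\<^sup>T * P * X \<in> symbol_set \<tau> K \<Sigma>'"
proof -
  have ty: "same_type \<Sigma>' \<Sigma>" and Xc: "X \<in> carrier_mat (state_dim \<Sigma>) (state_dim \<Sigma>')"
    using X unfolding intertwines_def by auto
  note T = same_typeD[OF ty]
  note Pc = pos_defD(1)[OF symbol_set_pos_def[OF P]]
  have Xt: "X\<^sup>T \<in> carrier_mat (state_dim \<Sigma>') (state_dim \<Sigma>)" using Xc by simp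
  note XtP = mult_carrier_mat[OF Xt Pc]
  show ?thesis
  proof (rule symbol_set_projection[OF K S same_type_sym[OF ty] P Xc L])
    fix q assume "q \<in> modes \<Sigma>"
    then have q: "q \<in> modes \<Sigma>'" using T by simp
    note D = is_lssD[OF S(2) q]
    have e: "Amat \<Sigma> q * X = X * Amat \<Sigma>' q" "Bmat \<Sigma> q = X * Bmat \<Sigma>' q" "Cmat \<Sigma> q * X = Cmat \<Sigma>' q"
      using X q unfolding intertwines_def by auto
    show "X\<^sup>T * P * (Amat \<Sigma> q * X) = X\<^sup>T * P * X * Amat \<Sigma>' q"
      unfolding e(1) by (rule assoc_mult_mat[OF XtP Xc D(1), symmetric])
    show "X\<^sup>T * P * Bmat \<Sigma> q = X\<^sup>T * P * X * Bmat \<Sigma>' q"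
      unfolding e(2) by (rule assoc_mult_mat[OF XtP Xc D(2), symmetric])
    show "Cmat \<Sigma> q * X = Cmat \<Sigma>' q" by (rule e(3))
  qed
qed

lemma symbol_set_congruence_iff:
  assumes K: "K \<noteq> Sym_C" and S: "is_lss \<Sigma>" "is_lss \<Sigma>'" and X: "intertwines X \<Sigma>' \<Sigma>" and Y: "intertwines Y \<Sigma> \<Sigma>'"
    and YX: "Y * X = 1\<^sub>m (state_dim \<Sigma>')" and XY: "X * Y = 1\<^sub>m (state_dim \<Sigma>)"
    and P: "P \<in> carrier_mat (state_dim \<Sigma>) (state_dim \<Sigma>)"
  shows "P \<in> symbol_set \<tau> K \<Sigma> \<longleftrightarrow> X\<^sup>T * P * X \<in> symbol_set \<tau> K \<Sigma>'"
proof
  have Xc: "X \<in> carrier_mat (state_dim \<Sigma>) (state_dim \<Sigma>')" and Yc: "Y \<in> carrier_mat (state_dim \<Sigma>') (state_dim \<Sigma>)"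
    using X Y unfolding intertwines_def by auto
  show "X\<^sup>T * P * X \<in> symbol_set \<tau> K \<Sigma>'" if "P \<in> symbol_set \<tau> K \<Sigma>"
    by (rule symbol_set_congruence[OF K S X Yc YX that])
  show "P \<in> symbol_set \<tau> K \<Sigma>" if H: "X\<^sup>T * P * X \<in> symbol_set \<tau> K \<Sigma>'"
  proof -
    have Xt: "X\<^sup>T \<in> carrier_mat (state_dim \<Sigma>') (state_dim \<Sigma>)" and Yt: "Y\<^sup>T \<in> carrier_mat (state_dim \<Sigma>) (state_dim \<Sigma>')"
      using Xc Yc by auto
    note PX = mult_carrier_mat[OF P Xc] and XtP = mult_carrier_mat[OF Xt P]
    have t: "Y\<^sup>T * X\<^sup>T = 1\<^sub>m (state_dim \<Sigma>)" unfolding transpose_mult[OF Xc Yc, symmetric] XY by simp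
    have "Y\<^sup>T * (X\<^sup>T * P * X) * Y = Y\<^sup>T * (X\<^sup>T * P * X * Y)"
      by (rule assoc_mult_mat[OF Yt mult_carrier_mat[OF XtP Xc] Yc])
    also have "X\<^sup>T * P * X * Y = X\<^sup>T * P"
      unfolding assoc_mult_mat[OF XtP Xc Yc] XY by (rule right_mult_one_mat[OF XtP])
    also have "Y\<^sup>T * (X\<^sup>T * P) = P"
      unfolding assoc_mult_mat[OF Yt Xt P, symmetric] t by (rule left_mult_one_mat[OF P])
    finally have "Y\<^sup>T * (X\<^sup>T * P * X) * Y = P" .
    then show ?thesis using symbol_set_congruence[OF K S(2,1) Y Xc XY H] by simp
  qed
qed

text \<open>Forms are pulled back against the direction of a morphism. For forms on states the
  morphism from \<open>\<Sigma>'\<close> to \<open>\<Sigma>\<close> is the inverse of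
  \<open>X\<close>. Controllability grammians are forms on dual states, and since duality reverses
  arrows the morphism is there \<open>X\<^sup>T\<close>. This is the origin of the two cases of
  \<open>congruence_factor\<close>.\<close>

lemma isomorphism_congruence:
  assumes S: "is_lss \<Sigma>" "is_lss \<Sigma>'" and iso: "lss_isomorphism X \<Sigma> \<Sigma>'"
  shows "congruence_factor K X \<in> carrier_mat (state_dim \<Sigma>) (state_dim \<Sigma>)" (is ?carrier)
    and "invertible_mat (congruence_factor K X)" (is ?inv)
    and "pos_def (state_dim \<Sigma>) P \<Longrightarrow> P \<in> symbol_set \<tau> K \<Sigma> \<longleftrightarrow>
      (congruence_factor K X)\<^sup>T * P * congruence_factor K X \<in> symbol_set \<tau> K \<Sigma>'" (is "_ \<Longrightarrow> ?iff")
proof -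
  let ?n = "state_dim \<Sigma>"
  have ty: "same_type \<Sigma> \<Sigma>'" and dim: "state_dim \<Sigma>' = ?n" and Xc: "X \<in> carrier_mat ?n ?n" and inv: "invertible_mat X"
    and e: "\<And>q. q \<in> modes \<Sigma> \<Longrightarrow> Amat \<Sigma>' q * X = X * Amat \<Sigma> q \<and> Bmat \<Sigma>' q = X * Bmat \<Sigma> q \<and> Cmat \<Sigma>' q * X = Cmat \<Sigma> q"
    using iso unfolding lss_isomorphism_def by auto
  note T = same_typeD[OF ty]
  have X: "intertwines X \<Sigma> \<Sigma>'" unfolding intertwines_def dim using ty Xc e by blast
  obtain B where B: "inverts_mat X B" "inverts_mat B X" using inv unfolding invertible_mat_def by blast
  have XB: "X * B = 1\<^sub>m ?n" using B(1) Xc unfolding inverts_mat_def by simp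
  have BX: "B * X = 1\<^sub>m (dim_row B)" using B(2) unfolding inverts_mat_def .
  have Bc: "B \<in> carrier_mat ?n ?n"
    using arg_cong[OF XB, of dim_col] arg_cong[OF BX, of dim_col] Xc by auto
  \<comment> \<open>\<open>congruence_factor\<close> refers to \<open>mat_inverse\<close>; the
    abstract inverse \<open>B\<close> serves to show that \<open>mat_inverse X\<close>
    succeeds.\<close>
  have "X \<in> Units (ring_mat TYPE(real) ?n ())"
    unfolding Units_def ring_mat_def using Xc Bc XB BX by auto
  then obtain Y where mi: "mat_inverse X = Some Y"
    using mat_inverse(1)[OF Xc, where b = "()"] by (cases "mat_inverse X") auto
  from mat_inverse(2)[OF Xc mi] have XY: "X * Y = 1\<^sub>m ?n" and YX: "Y * X = 1\<^sub>m ?n" and Yc: "Y \<in> carrier_mat ?n ?n" by blast+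
  have Y: "intertwines Y \<Sigma>' \<Sigma>" unfolding intertwines_def dim T
  proof (intro conjI ballI Yc same_type_sym[OF ty])
    fix q assume q: "q \<in> modes \<Sigma>"
    note D = is_lssD[OF S(1) q] and D' = is_lssD[OF S(2), unfolded T dim, OF q]
    have "Y * (Amat \<Sigma>' q * X) * Y = Y * (X * Amat \<Sigma> q) * Y" using e[OF q] by simp
    moreover have "Y * (Amat \<Sigma>' q * X) * Y = Y * Amat \<Sigma>' q"
      unfolding assoc_mult_mat[OF Yc mult_carrier_mat[OF D'(1) Xc] Yc] assoc_mult_mat[OF D'(1) Xc Yc] XY
        right_mult_one_mat[OF D'(1)] ..
    moreover have "Y * (X * Amat \<Sigma> q) * Y = Amat \<Sigma> q * Y"
      unfolding assoc_mult_mat[OF Yc Xc D(1), symmetric] YX left_mult_one_mat[OF D(1)] ..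
    ultimately show "Amat \<Sigma> q * Y = Y * Amat \<Sigma>' q" by simp
    have "Y * Bmat \<Sigma>' q = Y * (X * Bmat \<Sigma> q)" using e[OF q] by simp
    also have "\<dots> = Bmat \<Sigma> q" unfolding assoc_mult_mat[OF Yc Xc D(2), symmetric] YX by (rule left_mult_one_mat[OF D(2)])
    finally show "Bmat \<Sigma> q = Y * Bmat \<Sigma>' q" by simp
    have "Cmat \<Sigma> q * Y = Cmat \<Sigma>' q * X * Y" using e[OF q] by simp
    also have "\<dots> = Cmat \<Sigma>' q" unfolding assoc_mult_mat[OF D'(3) Xc Yc] XY by (rule right_mult_one_mat[OF D'(3)])
    finally show "Cmat \<Sigma> q * Y = Cmat \<Sigma>' q" .
  qed
  have invI: "invertible_mat M" if "M \<in> carrier_mat ?n ?n" "N \<in> carrier_mat ?n ?n" "M * N = 1\<^sub>m ?n" "N * M = 1\<^sub>m ?n" for M N :: "real mat"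
    unfolding invertible_mat_def inverts_mat_def using that by (auto intro!: exI[of _ N])
  show ?carrier ?inv "pos_def ?n P \<Longrightarrow> ?iff"
  proof -
    show ?carrier using Xc Yc mi by (cases K) auto
    show ?inv
    proof (cases "K = Sym_C")
      case True
      have "X\<^sup>T * Y\<^sup>T = 1\<^sub>m ?n" "Y\<^sup>T * X\<^sup>T = 1\<^sub>m ?n"
        unfolding transpose_mult[OF Yc Xc, symmetric] transpose_mult[OF Xc Yc, symmetric] XY YX by simp_all
      then show ?thesis unfolding True congruence_factor.simps
        by (intro invI[of "X\<^sup>T" "Y\<^sup>T"]) (use Xc Yc in simp_all)
    next
      case False
      then have "congruence_factor K X = Y" using mi by (cases K) auto
      then show ?thesis using invI[OF Yc Xc YX XY] by simp
    qed
    assume P: "pos_def ?n P"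
    note Pc = pos_defD(1)[OF P]
    show ?iff
    proof (cases "K = Sym_C")
      case True
      have t: "X\<^sup>T * Y\<^sup>T = 1\<^sub>m ?n" "Y\<^sup>T * X\<^sup>T = 1\<^sub>m ?n"
        unfolding transpose_mult[OF Yc Xc, symmetric] transpose_mult[OF Xc Yc, symmetric] XY YX by simp_all
      show ?thesis
        unfolding True congruence_factor.simps symbol_set.simps ctrl_grammians_dual
        by (rule symbol_set_congruence_iff[of Sym_O, unfolded symbol_set.simps, OF _ is_lss_dual[OF S(1)] is_lss_dual[OF S(2)]
              intertwines_dual[OF S X] intertwines_dual[OF S(2,1) Y]]) (use t dim Pc in simp_all)
    next
      case False
      then have c: "congruence_factor K X = Y" using mi by (cases K) auto
      show ?thesis unfolding c
        by (rule symbol_set_congruence_iff[OF False S Y X]) (use XY YX dim Pc in simp_all)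
    qed
  qed
qed

section \<open>Minimising a form along the fibres of a surjection\<close>

text \<open>The Lagrange conditions for minimising the form \<open>R\<close> on the fibre of
  \<open>T\<close> over \<open>z\<close> give the minimiser \<open>N *\<^sub>v z\<close> with
  \<open>N = Q * (T\<^sup>T * W)\<close>, where \<open>Q\<close> is the inverse of \<open>R\<close>
  and \<open>W\<close> that of \<open>T * Q * T\<^sup>T\<close>. The minimal value is the form
  \<open>W\<close> at \<open>z\<close>.\<close>

lemma quotient_form:
  fixes R T :: "real mat"
  assumes R: "pos_def r R" and T: "T \<in> carrier_mat k r" and U: "U \<in> carrier_mat r k" "T * U = 1\<^sub>m k"
  obtains N W where "N \<in> carrier_mat r k" "T * N = 1\<^sub>m k" "pos_def k W" "N\<^sup>T * R = W * T" "N\<^sup>T * R * N = W"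
proof -
  note Rc = pos_defD(1,2)[OF R]
  obtain Q where Q: "pos_def r Q" "R * Q = 1\<^sub>m r" "Q * R = 1\<^sub>m r" by (rule pos_def_inverse[OF R]) (rule that)
  note Qc = pos_defD(1,2)[OF Q(1)]
  have Tt: "T\<^sup>T \<in> carrier_mat r k" and Ut: "U\<^sup>T \<in> carrier_mat k r" using T U by auto
  have UT: "U\<^sup>T * T\<^sup>T = 1\<^sub>m k" unfolding transpose_mult[OF T U(1), symmetric] U(2) by simp
  have G: "pos_def k (T * Q * T\<^sup>T)" using pos_def_congruence[OF Q(1) Tt Ut UT] by simp
  obtain W where W: "pos_def k W" "T * Q * T\<^sup>T * W = 1\<^sub>m k" "W * (T * Q * T\<^sup>T) = 1\<^sub>m k"
    by (rule pos_def_inverse[OF G]) (rule that)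
  note Wc = pos_defD(1,2)[OF W(1)]
  note TtW = mult_carrier_mat[OF Tt Wc(1)]
  define N where "N = Q * (T\<^sup>T * W)"
  have N: "N \<in> carrier_mat r k" unfolding N_def by (rule mult_carrier_mat[OF Qc(1) TtW])
  have TN: "T * N = 1\<^sub>m k"
    using W(2) unfolding N_def assoc_mult_mat[OF mult_carrier_mat[OF T Qc(1)] Tt Wc(1)] assoc_mult_mat[OF T Qc(1) TtW] .
  have "N\<^sup>T = W * T * Q"
    unfolding N_def transpose_mult[OF Qc(1) TtW] transpose_mult[OF Tt Wc(1)] Qc(2) Wc(2) transpose_transpose ..
  then have NR: "N\<^sup>T * R = W * T"
    using assoc_mult_mat[OF mult_carrier_mat[OF Wc(1) T] Qc(1) Rc(1)] right_mult_one_mat[OF mult_carrier_mat[OF Wc(1) T]]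
    unfolding Q(3) by (simp only:)
  have NRN: "N\<^sup>T * R * N = W"
    unfolding NR assoc_mult_mat[OF Wc(1) T N] TN by (rule right_mult_one_mat[OF Wc(1)])
  show thesis by (rule that[OF N TN W(1) NR NRN])
qed

text \<open>The difference of \<open>x\<close> and the minimiser of its fibre is
  \<open>R\<close>-orthogonal to the minimiser, and the form is non-negative at that
  difference.\<close>

lemma quotient_form_le:
  fixes R T N W :: "real mat"
  assumes R: "pos_def r R" and T: "T \<in> carrier_mat k r" and N: "N \<in> carrier_mat r k"
    and W: "W \<in> carrier_mat k k" and NR: "N\<^sup>T * R = W * T" and NRN: "N\<^sup>T * R * N = W" and x: "x \<in> carrier_vec r"
  shows "(T *\<^sub>v x) \<bullet> (W *\<^sub>v (T *\<^sub>v x)) \<le> x \<bullet> (R *\<^sub>v x)"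
proof -
  note Rc = pos_defD(1,2)[OF R]
  have Nt: "N\<^sup>T \<in> carrier_mat k r" using N by simp
  note Tx = mult_mat_vec_carrier[OF T x]
  note y = mult_mat_vec_carrier[OF N Tx]
  note Rx = mult_mat_vec_carrier[OF Rc(1) x] and Ry = mult_mat_vec_carrier[OF Rc(1) y]
  have yRx: "(N *\<^sub>v (T *\<^sub>v x)) \<bullet> (R *\<^sub>v x) = (T *\<^sub>v x) \<bullet> (W *\<^sub>v (T *\<^sub>v x))"
    using form_transpose_mult[OF N Rc(1) Tx x] unfolding NR assoc_mult_mat_vec[OF W T x] by simp
  have yRy: "(N *\<^sub>v (T *\<^sub>v x)) \<bullet> (R *\<^sub>v (N *\<^sub>v (T *\<^sub>v x))) = (T *\<^sub>v x) \<bullet> (W *\<^sub>v (T *\<^sub>v x))"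
    using form_congruence[OF N Rc(1) N Tx Tx] unfolding NRN by simp
  define e where "e = x - N *\<^sub>v (T *\<^sub>v x)"
  have e: "e \<in> carrier_vec r" unfolding e_def by (rule minus_carrier_vec[OF x y])
  have "e \<bullet> (R *\<^sub>v e) = x \<bullet> (R *\<^sub>v x) - x \<bullet> (R *\<^sub>v (N *\<^sub>v (T *\<^sub>v x))) -
      ((N *\<^sub>v (T *\<^sub>v x)) \<bullet> (R *\<^sub>v x) - (N *\<^sub>v (T *\<^sub>v x)) \<bullet> (R *\<^sub>v (N *\<^sub>v (T *\<^sub>v x))))"
    unfolding e_def mult_minus_distrib_mat_vec[OF Rc(1) x y] minus_scalar_prod_distrib[OF x y minus_carrier_vec[OF Rx Ry]]
      scalar_prod_minus_distrib[OF x Rx Ry] scalar_prod_minus_distrib[OF y Rx Ry] ..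
  also have "x \<bullet> (R *\<^sub>v (N *\<^sub>v (T *\<^sub>v x))) = (N *\<^sub>v (T *\<^sub>v x)) \<bullet> (R *\<^sub>v x)" by (rule symmetric_form_commute[OF Rc x y])
  finally show ?thesis using pos_def_nonneg[OF R e] unfolding yRx yRy by linarith
qed

section \<open>Reduction to a minimal system\<close>

text \<open>Two morphisms leave the reachable part of \<open>\<Sigma>\<close>: the inclusion
  \<open>V\<close> into \<open>\<Sigma>\<close> and the surjection \<open>T\<close> onto
  \<open>\<Sigma>m\<close>. \<open>L\<close> and \<open>U\<close> witness injectivity of the one and
  surjectivity of the other.\<close>

locale reduction =
  fixes \<Sigma> \<Sigma>m :: lss and r :: nat and V L T U :: "real mat"
  assumes S: "is_lss \<Sigma>" "is_lss \<Sigma>m" and ty: "same_type \<Sigma> \<Sigma>m"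
    and V: "V \<in> carrier_mat (state_dim \<Sigma>) r" and L: "L \<in> carrier_mat r (state_dim \<Sigma>)" and LV: "L * V = 1\<^sub>m r"
    and T: "T \<in> carrier_mat (state_dim \<Sigma>m) r" and U: "U \<in> carrier_mat r (state_dim \<Sigma>m)" and TU: "T * U = 1\<^sub>m (state_dim \<Sigma>m)"
    and twV: "intertwines V (transform_lss r L V \<Sigma>) \<Sigma>" and twT: "intertwines T (transform_lss r L V \<Sigma>) \<Sigma>m"
begin

abbreviation "n \<equiv> state_dim \<Sigma>"
abbreviation "k \<equiv> state_dim \<Sigma>m"

definition "Ar q = L * Amat \<Sigma> q * V"
definition "Br q = L * Bmat \<Sigma> q"

lemmas Ty = same_typeD[OF ty]
lemmas D = is_lssD[OF S(1)]
lemmas D' = is_lssD[OF S(2), unfolded Ty]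

lemma dims: "k \<le> r" "r \<le> n"
  using right_inverse_dim_le[OF T U TU] right_inverse_dim_le[OF L V LV] by auto

lemma Ar: "q \<in> modes \<Sigma> \<Longrightarrow> Ar q \<in> carrier_mat r r"
  unfolding Ar_def by (rule mult_carrier_mat[OF mult_carrier_mat[OF L D(1)] V])

lemma Br: "q \<in> modes \<Sigma> \<Longrightarrow> Br q \<in> carrier_mat r (input_dim \<Sigma>)"
  unfolding Br_def by (rule mult_carrier_mat[OF L D(2)])

lemma restriction:
  assumes "q \<in> modes \<Sigma>"
  shows "Amat \<Sigma> q * V = V * Ar q" "Bmat \<Sigma> q = V * Br q"
  using twV assms unfolding intertwines_def transform_lss_simps Ar_def Br_def by auto

lemma quotient:
  assumes "q \<in> modes \<Sigma>"
  shows "Amat \<Sigma>m q * T = T * Ar q" "Bmat \<Sigma>m q = T * Br q" "Cmat \<Sigma>m q * T = Cmat \<Sigma> q * V"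
  using twT assms unfolding intertwines_def transform_lss_simps Ar_def Br_def by auto

lemma Vt: "V\<^sup>T \<in> carrier_mat r n" and Tt: "T\<^sup>T \<in> carrier_mat r k" and Ut: "U\<^sup>T \<in> carrier_mat k r" and Lt: "L\<^sup>T \<in> carrier_mat n r"
  using V T U L by auto

lemma VtLt: "V\<^sup>T * L\<^sup>T = 1\<^sub>m r"
  unfolding transpose_mult[OF L V, symmetric] LV by simp

lemma UtTt: "U\<^sup>T * T\<^sup>T = 1\<^sub>m k"
  unfolding transpose_mult[OF T U, symmetric] TU by simp

text \<open>\<open>W\<close> at \<open>z\<close> is the minimum of the form \<open>R\<close> over the reachable states that \<open>T\<close> maps to \<open>z\<close>;
  \<open>V * N\<close> selects the minimiser.\<close>

lemma symbol_reduction: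
  assumes R: "pos_def n R"
  obtains N W where "N \<in> carrier_mat r k" "T * N = 1\<^sub>m k" "pos_def k W"
    "N\<^sup>T * (V\<^sup>T * R * V) = W * T" "N\<^sup>T * (V\<^sup>T * R * V) * N = W" "(V * N)\<^sup>T * R * (V * N) = W"
    "\<And>\<tau> K. K \<noteq> Sym_C \<Longrightarrow> R \<in> symbol_set \<tau> K \<Sigma> \<Longrightarrow> W \<in> symbol_set \<tau> K \<Sigma>m"
proof -
  note Rc = pos_defD(1,2)[OF R]
  have Rr: "pos_def r (V\<^sup>T * R * V)" by (rule pos_def_congruence[OF R V L LV])
  obtain N W where N: "N \<in> carrier_mat r k" and TN: "T * N = 1\<^sub>m k" and W: "pos_def k W"
    and NR: "N\<^sup>T * (V\<^sup>T * R * V) = W * T" and NRN: "N\<^sup>T * (V\<^sup>T * R * V) * N = W"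
    by (rule quotient_form[OF Rr T U TU]) (rule that)
  note Wc = pos_defD(1,2)[OF W]
  have Nt: "N\<^sup>T \<in> carrier_mat k r" using N by simp
  note VtR = mult_carrier_mat[OF Vt Rc(1)]
  define X where "X = V * N"
  have X: "X \<in> carrier_mat n k" unfolding X_def by (rule mult_carrier_mat[OF V N])
  have XR: "X\<^sup>T * R = N\<^sup>T * (V\<^sup>T * R)"
    unfolding X_def transpose_mult[OF V N] by (rule assoc_mult_mat[OF Nt Vt Rc(1)])
  have XtR: "X\<^sup>T * R \<in> carrier_mat k n" unfolding XR by (rule mult_carrier_mat[OF Nt VtR])
  \<comment> \<open>Paired with reachable states, the vectors of the range of \<open>X\<close> see
    them only through \<open>T\<close>. This identity carries \<open>Amat\<close> and
    \<open>Bmat\<close> from \<open>\<Sigma>\<close> over to \<open>\<Sigma>m\<close>.\<close>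
  have XRV: "X\<^sup>T * R * V = W * T"
    unfolding XR assoc_mult_mat[OF Nt VtR V] by (rule NR)
  have XRX: "X\<^sup>T * R * X = W"
    unfolding X_def[THEN arg_cong[of _ _ "\<lambda>Z. X\<^sup>T * R * Z"]] assoc_mult_mat[OF XtR V N, symmetric] XRV assoc_mult_mat[OF Wc(1) T N] TN
    by (rule right_mult_one_mat[OF Wc(1)])
  \<comment> \<open>\<open>T * L\<close> is a left inverse of \<open>X\<close>, so nonzero states
    stay nonzero under the embedding.\<close>
  have LX: "T * L * X = 1\<^sub>m k"
  proof -
    have "T * L * X = T * (L * (V * N))" unfolding X_def by (rule assoc_mult_mat[OF T L mult_carrier_mat[OF V N]])
    also have "L * (V * N) = N" unfolding assoc_mult_mat[OF L V N, symmetric] LV by (rule left_mult_one_mat[OF N])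
    finally show ?thesis unfolding TN .
  qed
  have red: "W \<in> symbol_set \<tau> K \<Sigma>m" if K: "K \<noteq> Sym_C" and RK: "R \<in> symbol_set \<tau> K \<Sigma>" for \<tau> K
  proof -
    have "X\<^sup>T * R * X \<in> symbol_set \<tau> K \<Sigma>m"
    proof (rule symbol_set_projection[OF K S ty RK X mult_carrier_mat[OF T L] LX])
      fix q assume q: "q \<in> modes \<Sigma>"
      note ArN = mult_carrier_mat[OF Ar[OF q] N]
      have "Amat \<Sigma> q * X = V * (Ar q * N)"
        unfolding X_def assoc_mult_mat[OF D(1)[OF q] V N, symmetric] restriction(1)[OF q] by (rule assoc_mult_mat[OF V Ar[OF q] N])
      then have "X\<^sup>T * R * (Amat \<Sigma> q * X) = X\<^sup>T * R * V * (Ar q * N)"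
        by (simp only: assoc_mult_mat[OF XtR V ArN])
      also have "\<dots> = W * (T * (Ar q * N))" unfolding XRV by (rule assoc_mult_mat[OF Wc(1) T ArN])
      also have "T * (Ar q * N) = Amat \<Sigma>m q * (T * N)"
        unfolding assoc_mult_mat[OF T Ar[OF q] N, symmetric] quotient(1)[OF q, symmetric] by (rule assoc_mult_mat[OF D'(1)[OF q] T N])
      also have "\<dots> = Amat \<Sigma>m q" unfolding TN by (rule right_mult_one_mat[OF D'(1)[OF q]])
      finally show "X\<^sup>T * R * (Amat \<Sigma> q * X) = X\<^sup>T * R * X * Amat \<Sigma>m q" unfolding XRX .
      have "X\<^sup>T * R * Bmat \<Sigma> q = X\<^sup>T * R * V * Br q"
        unfolding restriction(2)[OF q] by (rule assoc_mult_mat[OF XtR V Br[OF q], symmetric])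
      also have "\<dots> = W * Bmat \<Sigma>m q" unfolding XRV quotient(2)[OF q] by (rule assoc_mult_mat[OF Wc(1) T Br[OF q]])
      finally show "X\<^sup>T * R * Bmat \<Sigma> q = X\<^sup>T * R * X * Bmat \<Sigma>m q" unfolding XRX .
      have "Cmat \<Sigma> q * X = Cmat \<Sigma>m q * T * N"
        unfolding X_def quotient(3)[OF q] by (rule assoc_mult_mat[OF D(3)[OF q] V N, symmetric])
      also have "\<dots> = Cmat \<Sigma>m q" unfolding assoc_mult_mat[OF D'(3)[OF q] T N] TN by (rule right_mult_one_mat[OF D'(3)[OF q]])
      finally show "Cmat \<Sigma> q * X = Cmat \<Sigma>m q" .
    qed
    then show ?thesis unfolding XRX .
  qed
  show thesis by (rule that[OF N TN W NR NRN XRX[unfolded X_def] red])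
qed

text \<open>On dual states \<open>V\<^sup>T\<close> is a surjection and \<open>T\<^sup>T\<close> an
  injection, so the two operations change places: \<open>P\<close> is minimised along the fibres of
  \<open>V\<^sup>T\<close>, which gives \<open>M\<close>, and \<open>M\<close> is restricted along
  \<open>T\<^sup>T\<close>. \<open>Z\<close> is the composite embedding of dual states.\<close>

lemma ctrl_reduction:
  assumes P: "pos_def n P"
  obtains Z M where "Z \<in> carrier_mat n k" "V\<^sup>T * Z = T\<^sup>T" "M \<in> carrier_mat r r" "P * Z = V * (M * T\<^sup>T)"
    "pos_def k (Z\<^sup>T * P * Z)" "T * (M * T\<^sup>T) = Z\<^sup>T * P * Z"
    "\<And>\<tau>. P \<in> ctrl_grammians \<tau> \<Sigma> \<Longrightarrow> Z\<^sup>T * P * Z \<in> ctrl_grammians \<tau> \<Sigma>m"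
proof -
  note Pc = pos_defD(1,2)[OF P]
  obtain N M where N: "N \<in> carrier_mat n r" and VN: "V\<^sup>T * N = 1\<^sub>m r" and M: "pos_def r M"
    and NP: "N\<^sup>T * P = M * V\<^sup>T" and NPN: "N\<^sup>T * P * N = M"
    by (rule quotient_form[OF P Vt Lt VtLt]) (rule that)
  note Mc = pos_defD(1,2)[OF M]
  note MTt = mult_carrier_mat[OF Mc(1) Tt]
  note MVt = mult_carrier_mat[OF Mc(1) Vt]
  have Nt: "N\<^sup>T \<in> carrier_mat r n" using N by simp
  define Z where "Z = N * T\<^sup>T"
  have Z: "Z \<in> carrier_mat n k" unfolding Z_def by (rule mult_carrier_mat[OF N Tt])
  have Zt: "Z\<^sup>T = T * N\<^sup>T" unfolding Z_def transpose_mult[OF N Tt] by simp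
  have VZ: "V\<^sup>T * Z = T\<^sup>T" unfolding Z_def assoc_mult_mat[OF Vt N Tt, symmetric] VN by (rule left_mult_one_mat[OF Tt])
  have PN: "P * N = V * M"
  proof -
    have "P * N = (N\<^sup>T * P)\<^sup>T" unfolding transpose_mult[OF Nt Pc(1)] Pc(2) by simp
    also have "\<dots> = V * M" unfolding NP transpose_mult[OF Mc(1) Vt] Mc(2) by simp
    finally show ?thesis .
  qed
  \<comment> \<open>\<open>P\<close> maps the range of \<open>Z\<close> into the reachable states.
    The upper bound on the singular values rests on this.\<close>
  have PZ: "P * Z = V * (M * T\<^sup>T)"
    unfolding Z_def assoc_mult_mat[OF Pc(1) N Tt, symmetric] PN by (rule assoc_mult_mat[OF V Mc(1) Tt])
  have ZtP: "Z\<^sup>T * P = T * (M * V\<^sup>T)" unfolding Zt assoc_mult_mat[OF T Nt Pc(1)] NP ..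
  have ZPX: "Z\<^sup>T * P * X = T * (M * (V\<^sup>T * X))" if X: "X \<in> carrier_mat n a" for X a
    unfolding ZtP assoc_mult_mat[OF T MVt X] assoc_mult_mat[OF Mc(1) Vt X] ..
  have ZPZ: "Z\<^sup>T * P * Z = T * (M * T\<^sup>T)" unfolding ZPX[OF Z] VZ ..
  have UVZ: "U\<^sup>T * V\<^sup>T * Z = 1\<^sub>m k" unfolding assoc_mult_mat[OF Ut Vt Z] VZ by (rule UtTt)
  have pd: "pos_def k (Z\<^sup>T * P * Z)" by (rule pos_def_congruence[OF P Z mult_carrier_mat[OF Ut Vt] UVZ])
  have red: "Z\<^sup>T * P * Z \<in> ctrl_grammians \<tau> \<Sigma>m" if C: "P \<in> ctrl_grammians \<tau> \<Sigma>" for \<tau>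
    unfolding ctrl_grammians_dual
  proof (rule obs_grammians_projection[OF is_lss_dual[OF S(1)] is_lss_dual[OF S(2)] same_type_dual[OF ty] C[unfolded ctrl_grammians_dual]],
      unfold dual_lss_simps)
    show "Z \<in> carrier_mat n k" "U\<^sup>T * V\<^sup>T \<in> carrier_mat k n" "U\<^sup>T * V\<^sup>T * Z = 1\<^sub>m k"
      by (rule Z, rule mult_carrier_mat[OF Ut Vt], rule UVZ)
    fix q assume q: "q \<in> modes \<Sigma>"
    have At: "(Amat \<Sigma> q)\<^sup>T \<in> carrier_mat n n" and Art: "(Ar q)\<^sup>T \<in> carrier_mat r r" and Amt: "(Amat \<Sigma>m q)\<^sup>T \<in> carrier_mat k k"
      and Bt: "(Bmat \<Sigma> q)\<^sup>T \<in> carrier_mat (input_dim \<Sigma>) n" and Brt: "(Br q)\<^sup>T \<in> carrier_mat (input_dim \<Sigma>) r"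
      using D(1,2)[OF q] Ar[OF q] D'(1)[OF q] Br[OF q] by auto
    have VA: "V\<^sup>T * (Amat \<Sigma> q)\<^sup>T = (Ar q)\<^sup>T * V\<^sup>T"
      unfolding transpose_mult[OF D(1)[OF q] V, symmetric] transpose_mult[OF V Ar[OF q], symmetric] restriction(1)[OF q] ..
    have TA: "(Ar q)\<^sup>T * T\<^sup>T = T\<^sup>T * (Amat \<Sigma>m q)\<^sup>T"
      unfolding transpose_mult[OF D'(1)[OF q] T, symmetric] transpose_mult[OF T Ar[OF q], symmetric] quotient(1)[OF q] ..
    have VAZ: "V\<^sup>T * ((Amat \<Sigma> q)\<^sup>T * Z) = T\<^sup>T * (Amat \<Sigma>m q)\<^sup>T"
      unfolding assoc_mult_mat[OF Vt At Z, symmetric] VA assoc_mult_mat[OF Art Vt Z] VZ by (rule TA)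
    show "Z\<^sup>T * P * ((Amat \<Sigma> q)\<^sup>T * Z) = Z\<^sup>T * P * Z * (Amat \<Sigma>m q)\<^sup>T"
      unfolding ZPX[OF mult_carrier_mat[OF At Z]] VAZ ZPZ assoc_mult_mat[OF T MTt Amt] assoc_mult_mat[OF Mc(1) Tt Amt] ..
    have "(Bmat \<Sigma> q)\<^sup>T * Z = (Br q)\<^sup>T * (V\<^sup>T * Z)"
      unfolding restriction(2)[OF q] transpose_mult[OF V Br[OF q]] by (rule assoc_mult_mat[OF Brt Vt Z])
    also have "\<dots> = (Bmat \<Sigma>m q)\<^sup>T" unfolding VZ quotient(2)[OF q] by (rule transpose_mult[OF T Br[OF q], symmetric])
    finally show "(Bmat \<Sigma> q)\<^sup>T * Z = (Bmat \<Sigma>m q)\<^sup>T" .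
  qed
  show thesis by (rule that[OF Z VZ Mc(1) PZ pd ZPZ[symmetric] red])
qed

text \<open>The product in the other order is the transpose.\<close>

lemma singular_value_commute:
  assumes "pos_def m P" "pos_def m R"
  shows "singular_value P R = singular_value R P"
proof -
  note Pc = pos_defD(1,2)[OF assms(1)] and Rc = pos_defD(1,2)[OF assms(2)]
  have "(P * R)\<^sup>T = R * P" unfolding transpose_mult[OF Pc(1) Rc(1)] Pc(2) Rc(2) ..
  then have "char_poly (R * P) = char_poly (P * R)"
    using char_poly_transpose_mat[OF mult_carrier_mat[OF Pc(1) Rc(1)]] by simp
  then show ?thesis unfolding singular_value_def by (intro ext) simp
qed

text \<open>Each bound compares two pencils along one map. The lower one uses \<open>P\<close> and
  the inverse of \<open>R\<close> along \<open>Z\<close>: the reduced form \<open>Pm\<close> is the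
  pullback of \<open>P\<close>, and the inverse of \<open>W\<close> is at most the pullback of the
  inverse of \<open>R\<close>. The upper one uses \<open>R\<close> and the inverse of
  \<open>P\<close> along a map \<open>Y\<close>: the inverse of \<open>P\<close> pulls back exactly
  to that of \<open>Pm\<close>, and \<open>W\<close> is at most the pullback of
  \<open>R\<close>.\<close>

lemma grammian_reduction:
  assumes P: "P \<in> ctrl_grammians \<tau> \<Sigma>" and R: "R \<in> obs_grammians \<tau> \<Sigma>"
  shows "\<exists>Pm\<in>ctrl_grammians \<tau> \<Sigma>m. \<exists>Rm\<in>obs_grammians \<tau> \<Sigma>m. \<forall>j<k.
    singular_value P R (Suc (n - k + j)) \<le> singular_value Pm Rm (Suc j) \<and> singular_value Pm Rm (Suc j) \<le> singular_value P R (Suc j)"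
proof -
  have Pp: "pos_def n P" using P by (simp add: ctrl_grammians_def)
  have Rp: "pos_def n R" using R by (simp add: obs_grammians_def)
  note Pc = pos_defD(1,2)[OF Pp] and Rc = pos_defD(1,2)[OF Rp]
  obtain N W where N: "N \<in> carrier_mat r k" and TN: "T * N = 1\<^sub>m k" and W: "pos_def k W"
    and NR: "N\<^sup>T * (V\<^sup>T * R * V) = W * T" and NRN: "N\<^sup>T * (V\<^sup>T * R * V) * N = W" and VNW: "(V * N)\<^sup>T * R * (V * N) = W"
    and redR: "\<And>\<tau> K. K \<noteq> Sym_C \<Longrightarrow> R \<in> symbol_set \<tau> K \<Sigma> \<Longrightarrow> W \<in> symbol_set \<tau> K \<Sigma>m"
    by (rule symbol_reduction[OF Rp]) (rule that)
  obtain Z M where Z: "Z \<in> carrier_mat n k" and VZ: "V\<^sup>T * Z = T\<^sup>T" and M: "M \<in> carrier_mat r r" and PZ: "P * Z = V * (M * T\<^sup>T)"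
    and Pm: "pos_def k (Z\<^sup>T * P * Z)" and TMT: "T * (M * T\<^sup>T) = Z\<^sup>T * P * Z"
    and redP: "\<And>\<tau>. P \<in> ctrl_grammians \<tau> \<Sigma> \<Longrightarrow> Z\<^sup>T * P * Z \<in> ctrl_grammians \<tau> \<Sigma>m"
    by (rule ctrl_reduction[OF Pp]) (rule that)
  define Pm where "Pm = Z\<^sup>T * P * Z"
  note Pm = Pm[folded Pm_def] and TMT = TMT[folded Pm_def] and redP = redP[folded Pm_def]
  note Wc = pos_defD(1,2)[OF W] and Pmc = pos_defD(1,2)[OF Pm]
  obtain Pi where Pi: "pos_def n Pi" "P * Pi = 1\<^sub>m n" "Pi * P = 1\<^sub>m n" by (rule pos_def_inverse[OF Pp]) (rule that)
  obtain Ri where Ri: "pos_def n Ri" "R * Ri = 1\<^sub>m n" "Ri * R = 1\<^sub>m n" by (rule pos_def_inverse[OF Rp]) (rule that)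
  obtain Wi where Wi: "pos_def k Wi" "W * Wi = 1\<^sub>m k" "Wi * W = 1\<^sub>m k" by (rule pos_def_inverse[OF W]) (rule that)
  obtain Pmi where Pmi: "pos_def k Pmi" "Pm * Pmi = 1\<^sub>m k" "Pmi * Pm = 1\<^sub>m k" by (rule pos_def_inverse[OF Pm]) (rule that)
  note Pic = pos_defD(1,2)[OF Pi(1)] and Ric = pos_defD(1,2)[OF Ri(1)] and Wic = pos_defD(1,2)[OF Wi(1)] and Pmic = pos_defD(1,2)[OF Pmi(1)]
  have kn: "k \<le> n" using dims by simp
  have lower: "singular_value P R (Suc (n - k + j)) \<le> singular_value Pm W (Suc j)" if j: "j < k" for j
  proof (rule pencil_interlacing_lower[OF Pp Ri(1) Rc(1) Ri(3,2) Pm Wi(1) Wc(1) Wi(3,2) Z _ _ j kn])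
    fix c :: "real vec" assume c: "c \<in> carrier_vec k"
    show "(Z *\<^sub>v c) \<bullet> (P *\<^sub>v (Z *\<^sub>v c)) \<le> c \<bullet> (Pm *\<^sub>v c)"
      unfolding Pm_def form_congruence[OF Z Pc(1) Z c c] ..
    define b where "b = Wi *\<^sub>v c"
    have b: "b \<in> carrier_vec k" unfolding b_def by (rule mult_mat_vec_carrier[OF Wic(1) c])
    have Wb: "W *\<^sub>v b = c" unfolding b_def assoc_mult_mat_vec[OF Wc(1) Wic(1) c, symmetric] Wi(2) using c by simp
    note Zc = mult_mat_vec_carrier[OF Z c] and Nb = mult_mat_vec_carrier[OF N b]
    note VNb = mult_mat_vec_carrier[OF V Nb]
    have Vx: "V * N *\<^sub>v b = V *\<^sub>v (N *\<^sub>v b)" by (rule assoc_mult_mat_vec[OF V N b])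
    have 1: "(V *\<^sub>v (N *\<^sub>v b)) \<bullet> (R *\<^sub>v (V *\<^sub>v (N *\<^sub>v b))) = c \<bullet> b"
      using form_congruence[OF mult_carrier_mat[OF V N] Rc(1) mult_carrier_mat[OF V N] b b] comm_scalar_prod[OF b c]
      unfolding VNW Vx Wb by simp
    have 2: "(V *\<^sub>v (N *\<^sub>v b)) \<bullet> (Z *\<^sub>v c) = c \<bullet> b"
    proof -
      have "(V *\<^sub>v (N *\<^sub>v b)) \<bullet> (Z *\<^sub>v c) = (N *\<^sub>v b) \<bullet> (V\<^sup>T * Z *\<^sub>v c)" by (rule form_transpose_mult[OF V Z Nb c, symmetric])
      also have "\<dots> = (T\<^sup>T\<^sup>T *\<^sub>v (N *\<^sub>v b)) \<bullet> c" unfolding VZ by (rule transpose_vec_mult_scalar[OF Tt c Nb, symmetric])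
      also have "T\<^sup>T\<^sup>T *\<^sub>v (N *\<^sub>v b) = b"
        unfolding transpose_transpose assoc_mult_mat_vec[OF T N b, symmetric] TN using b by simp
      finally show ?thesis using comm_scalar_prod[OF b c] by simp
    qed
    \<comment> \<open>A test vector for completing the square: its \<open>Ri\<close>-form and its
      \<open>Ri\<close>-product with \<open>Z *\<^sub>v c\<close> both equal
      \<open>c \<bullet> b\<close>, so non-negativity of the \<open>Ri\<close>-form at
      \<open>Z *\<^sub>v c - y\<close> is the desired inequality.\<close>
    define y where "y = R *\<^sub>v (V *\<^sub>v (N *\<^sub>v b))"
    have y: "y \<in> carrier_vec n" unfolding y_def by (rule mult_mat_vec_carrier[OF Rc(1) VNb])
    have Riy: "Ri *\<^sub>v y = V *\<^sub>v (N *\<^sub>v b)" unfolding y_def assoc_mult_mat_vec[OF Ric(1) Rc(1) VNb, symmetric] Ri(3) using VNb by simp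
    note RiZ = mult_mat_vec_carrier[OF Ric(1) Zc] and Riyc = mult_mat_vec_carrier[OF Ric(1) y]
    have "0 \<le> (Z *\<^sub>v c - y) \<bullet> (Ri *\<^sub>v (Z *\<^sub>v c - y))" by (rule pos_def_nonneg[OF Ri(1) minus_carrier_vec[OF Zc y]])
    also have "\<dots> = (Z *\<^sub>v c) \<bullet> (Ri *\<^sub>v (Z *\<^sub>v c)) - (Z *\<^sub>v c) \<bullet> (Ri *\<^sub>v y) - (y \<bullet> (Ri *\<^sub>v (Z *\<^sub>v c)) - y \<bullet> (Ri *\<^sub>v y))"
      unfolding mult_minus_distrib_mat_vec[OF Ric(1) Zc y] minus_scalar_prod_distrib[OF Zc y minus_carrier_vec[OF RiZ Riyc]]
        scalar_prod_minus_distrib[OF Zc RiZ Riyc] scalar_prod_minus_distrib[OF y RiZ Riyc] ..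
    also have "y \<bullet> (Ri *\<^sub>v (Z *\<^sub>v c)) = (Z *\<^sub>v c) \<bullet> (Ri *\<^sub>v y)" by (rule symmetric_form_commute[OF Ric y Zc])
    also have "(Z *\<^sub>v c) \<bullet> (Ri *\<^sub>v y) = c \<bullet> b" unfolding Riy comm_scalar_prod[OF Zc VNb] by (rule 2)
    also have "y \<bullet> (Ri *\<^sub>v y) = c \<bullet> b" unfolding Riy comm_scalar_prod[OF y VNb] unfolding y_def by (rule 1)
    finally show "c \<bullet> (Wi *\<^sub>v c) \<le> (Z *\<^sub>v c) \<bullet> (Ri *\<^sub>v (Z *\<^sub>v c))" unfolding b_def by linarith
  qed
  have upper: "singular_value Pm W (Suc j) \<le> singular_value P R (Suc j)" if j: "j < k" for j
  proof -
    \<comment> \<open>\<open>Y\<close> equals \<open>P * Z * Pmi\<close>. Written this way its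
      values are visibly reachable states, and \<open>T\<close> maps their coordinates back to the
      argument.\<close>
    define Y where "Y = V * (M * T\<^sup>T * Pmi)"
    note MT = mult_carrier_mat[OF M Tt]
    note MTP = mult_carrier_mat[OF MT Pmic(1)]
    have Y: "Y \<in> carrier_mat n k" unfolding Y_def by (rule mult_carrier_mat[OF V MTP])
    have "singular_value W Pm (Suc j) \<le> singular_value R P (Suc j)"
    proof (rule pencil_interlacing_upper[OF Rp Pi(1) Pc(1) Pi(3,2) W Pmi(1) Pmc(1) Pmi(3,2) Y _ _ j])
      show "j < n" using j kn by simp
      fix c :: "real vec" assume c: "c \<in> carrier_vec k"
      define b where "b = Pmi *\<^sub>v c"
      have b: "b \<in> carrier_vec k" unfolding b_def by (rule mult_mat_vec_carrier[OF Pmic(1) c])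
      have Pb: "Pm *\<^sub>v b = c" unfolding b_def assoc_mult_mat_vec[OF Pmc(1) Pmic(1) c, symmetric] Pmi(2) using c by simp
      define x where "x = M * T\<^sup>T *\<^sub>v b"
      have x: "x \<in> carrier_vec r" unfolding x_def by (rule mult_mat_vec_carrier[OF MT b])
      have Yc: "Y *\<^sub>v c = V *\<^sub>v x"
        unfolding Y_def x_def b_def assoc_mult_mat_vec[OF V MTP c] assoc_mult_mat_vec[OF MT Pmic(1) c] ..
      have Tx: "T *\<^sub>v x = c" unfolding x_def assoc_mult_mat_vec[OF T MT b, symmetric] TMT by (rule Pb)
      have Rr: "pos_def r (V\<^sup>T * R * V)" by (rule pos_def_congruence[OF Rp V L LV])
      have "(T *\<^sub>v x) \<bullet> (W *\<^sub>v (T *\<^sub>v x)) \<le> x \<bullet> (V\<^sup>T * R * V *\<^sub>v x)" by (rule quotient_form_le[OF Rr T N Wc(1) NR NRN x])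
      then show "c \<bullet> (W *\<^sub>v c) \<le> (Y *\<^sub>v c) \<bullet> (R *\<^sub>v (Y *\<^sub>v c))"
        unfolding Tx Yc form_congruence[OF V Rc(1) V x x] .
      note Zb = mult_mat_vec_carrier[OF Z b]
      note PZb = mult_mat_vec_carrier[OF Pc(1) Zb]
      have YP: "Y *\<^sub>v c = P *\<^sub>v (Z *\<^sub>v b)"
        unfolding Yc x_def assoc_mult_mat_vec[OF V MT b, symmetric] PZ[symmetric] by (rule assoc_mult_mat_vec[OF Pc(1) Z b])
      have "Pi *\<^sub>v (Y *\<^sub>v c) = Z *\<^sub>v b"
        unfolding YP assoc_mult_mat_vec[OF Pic(1) Pc(1) Zb, symmetric] Pi(3) using Zb by simp
      then have "(Y *\<^sub>v c) \<bullet> (Pi *\<^sub>v (Y *\<^sub>v c)) = (Z *\<^sub>v b) \<bullet> (P *\<^sub>v (Z *\<^sub>v b))"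
        unfolding YP using comm_scalar_prod[OF PZb Zb] by simp
      also have "\<dots> = b \<bullet> (Pm *\<^sub>v b)" unfolding Pm_def form_congruence[OF Z Pc(1) Z b b] ..
      also have "\<dots> = c \<bullet> (Pmi *\<^sub>v c)" unfolding Pb comm_scalar_prod[OF b c] unfolding b_def ..
      finally show "(Y *\<^sub>v c) \<bullet> (Pi *\<^sub>v (Y *\<^sub>v c)) \<le> c \<bullet> (Pmi *\<^sub>v c)" by simp
    qed
    then show ?thesis unfolding singular_value_commute[OF Pm W] singular_value_commute[OF Pp Rp] .
  qed
  have "Pm \<in> ctrl_grammians \<tau> \<Sigma>m" by (rule redP[OF P])
  moreover have "W \<in> obs_grammians \<tau> \<Sigma>m" using redR[of Sym_O \<tau>] R by simp
  ultimately show ?thesis using lower upper by blast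
qed

lemma symbol_set_reduction:
  assumes "symbol_set \<tau> K \<Sigma> \<noteq> {}"
  shows "symbol_set \<tau> K \<Sigma>m \<noteq> {}"
proof -
  obtain R where R: "R \<in> symbol_set \<tau> K \<Sigma>" using assms by blast
  note Rp = symbol_set_pos_def[OF R]
  show ?thesis
  proof (cases "K = Sym_C")
    case True
    obtain Z where "\<And>\<tau>. R \<in> ctrl_grammians \<tau> \<Sigma> \<Longrightarrow> Z\<^sup>T * R * Z \<in> ctrl_grammians \<tau> \<Sigma>m"
      by (rule ctrl_reduction[OF Rp]) (rule that)
    then have "Z\<^sup>T * R * Z \<in> ctrl_grammians \<tau> \<Sigma>m" using R True by simp
    then show ?thesis unfolding True symbol_set.simps by blast
  next
    case False
    obtain W where "\<And>\<tau> K. K \<noteq> Sym_C \<Longrightarrow> R \<in> symbol_set \<tau> K \<Sigma> \<Longrightarrow> W \<in> symbol_set \<tau> K \<Sigma>m"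
      by (rule symbol_reduction[OF Rp]) (rule that)
    then have "W \<in> symbol_set \<tau> K \<Sigma>m" using False R by blast
    then show ?thesis by blast
  qed
qed

text \<open>\<open>r\<close> lies between the two dimensions, so equality makes \<open>V\<close> and
  \<open>T\<close> square and hence invertible. The two arrows out of the reachable part then
  compose to a single map.\<close>

lemma isomorphism_if_same_dim:
  assumes kn: "k = n"
  shows "lss_isomorphism (T * L) \<Sigma> \<Sigma>m"
proof -
  have rn: "r = n" using dims kn by simp
  have TL: "T * L \<in> carrier_mat n n" using mult_carrier_mat[OF T L] unfolding kn .
  have VL: "V * L = 1\<^sub>m n" by (rule mat_mult_left_right_inverse[OF L[unfolded rn] V[unfolded rn] LV[unfolded rn]])
  have VU: "V * U \<in> carrier_mat n n" using mult_carrier_mat[OF V U] unfolding kn .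
  have i1: "T * L * (V * U) = 1\<^sub>m n"
  proof -
    have "T * L * (V * U) = T * (L * (V * U))" by (rule assoc_mult_mat[OF T L mult_carrier_mat[OF V U]])
    also have "L * (V * U) = U" unfolding assoc_mult_mat[OF L V U, symmetric] LV by (rule left_mult_one_mat[OF U])
    finally show ?thesis unfolding TU kn .
  qed
  have i2: "V * U * (T * L) = 1\<^sub>m n" by (rule mat_mult_left_right_inverse[OF TL VU i1])
  have "inverts_mat (T * L) (V * U)" "inverts_mat (V * U) (T * L)"
    unfolding inverts_mat_def i1 i2 carrier_matD(1)[OF TL] carrier_matD(1)[OF VU] by simp_all
  moreover have "square_mat (T * L)" using carrier_matD[OF TL] by (simp only: square_mat.simps)
  ultimately have inv: "invertible_mat (T * L)" unfolding invertible_mat_def by blast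
  show ?thesis unfolding lss_isomorphism_def
  proof (intro conjI ballI ty kn[symmetric] TL inv)
    fix q assume q: "q \<in> modes \<Sigma>"
    note LA = mult_carrier_mat[OF L D(1)[OF q]]
    have ArL: "Ar q * L = L * Amat \<Sigma> q"
      unfolding Ar_def assoc_mult_mat[OF LA V L] VL by (rule right_mult_one_mat[OF LA])
    have "Amat \<Sigma>m q * (T * L) = T * (Ar q * L)"
      unfolding assoc_mult_mat[OF D'(1)[OF q] T L, symmetric] quotient(1)[OF q] by (rule assoc_mult_mat[OF T Ar[OF q] L])
    also have "\<dots> = T * L * Amat \<Sigma> q" unfolding ArL by (rule assoc_mult_mat[OF T L D(1)[OF q], symmetric])
    finally show "Amat \<Sigma>m q * (T * L) = T * L * Amat \<Sigma> q" .
    show "Bmat \<Sigma>m q = T * L * Bmat \<Sigma> q"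
      unfolding quotient(2)[OF q] Br_def by (rule assoc_mult_mat[OF T L D(2)[OF q], symmetric])
    show "Cmat \<Sigma>m q * (T * L) = Cmat \<Sigma> q"
      unfolding assoc_mult_mat[OF D'(3)[OF q] T L, symmetric] quotient(3)[OF q] assoc_mult_mat[OF D(3)[OF q] V L] VL
      by (rule right_mult_one_mat[OF D(3)[OF q]])
  qed
qed

end

lemma reduction_exists:
  assumes S: "is_lss \<Sigma>" "is_lss \<Sigma>m" and min: "lss_minimal \<tau> \<Sigma>m" and eq: "lss_equivalent \<tau> \<Sigma>m \<Sigma>"
  obtains r V L T U where "reduction \<Sigma> \<Sigma>m r V L T U"
proof -
  have ty: "same_type \<Sigma>m \<Sigma>" and io: "same_io_map \<tau> \<Sigma>m \<Sigma>" using eq unfolding lss_equivalent_def by auto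
  have "markov_eq \<Sigma>m \<Sigma>" using io same_io_map_iff_markov_eq[OF S(2,1) ty] by blast
  then have mk: "markov_eq \<Sigma> \<Sigma>m" by (rule markov_eq_sym[OF ty])
  have mm: "markov_minimal \<Sigma>m" using min lss_minimal_iff[OF S(2)] by blast
  obtain r V L T U where "V \<in> carrier_mat (state_dim \<Sigma>) r" "L \<in> carrier_mat r (state_dim \<Sigma>)" "L * V = 1\<^sub>m r"
    "T \<in> carrier_mat (state_dim \<Sigma>m) r" "U \<in> carrier_mat r (state_dim \<Sigma>m)" "T * U = 1\<^sub>m (state_dim \<Sigma>m)"
    "intertwines V (transform_lss r L V \<Sigma>) \<Sigma>" "intertwines T (transform_lss r L V \<Sigma>) \<Sigma>m"
    by (rule minimal_quotient[OF S same_type_sym[OF ty] mk mm]) (rule that)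
  then have "reduction \<Sigma> \<Sigma>m r V L T U" by (intro reduction.intro S same_type_sym[OF ty])
  then show thesis by (rule that)
qed

text \<open>Each system competes in the minimality of the other, so their dimensions agree and the
  reduction of one to the other is invertible.\<close>

lemma minimal_equivalent_isomorphic:
  assumes S: "is_lss \<Sigma>" "is_lss \<Sigma>'" and min: "lss_minimal \<tau> \<Sigma>" "lss_minimal \<tau> \<Sigma>'" and eq: "lss_equivalent \<tau> \<Sigma> \<Sigma>'"
  obtains X where "lss_isomorphism X \<Sigma> \<Sigma>'"
proof -
  have ty: "same_type \<Sigma> \<Sigma>'" using eq unfolding lss_equivalent_def by simp
  \<comment> \<open>\<open>same_io_map\<close> quantifies over the inputs of its first argument;
    symmetry is read off from the Markov parameters.\<close>
  have "same_io_map \<tau> \<Sigma>' \<Sigma>"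
    using eq markov_eq_sym[OF ty] same_io_map_iff_markov_eq[OF S ty] same_io_map_iff_markov_eq[OF S(2,1) same_type_sym[OF ty]]
    unfolding lss_equivalent_def by blast
  then have eq': "lss_equivalent \<tau> \<Sigma>' \<Sigma>" unfolding lss_equivalent_def using same_type_sym[OF ty] by simp
  have dim: "state_dim \<Sigma>' = state_dim \<Sigma>"
    using min S eq eq' unfolding lss_minimal_def by (meson order_antisym)
  obtain r V L T U where "reduction \<Sigma> \<Sigma>' r V L T U" by (rule reduction_exists[OF S min(2) eq']) (rule that)
  then have "lss_isomorphism (T * L) \<Sigma> \<Sigma>'" by (rule reduction.isomorphism_if_same_dim[OF _ dim])
  then show thesis by (rule that)
qed

theorem theorem3:
  fixes \<tau> :: time_axis and K :: set_symbol
  assumes "valid_symbol K"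
  shows
    "(\<forall>\<Sigma> \<Sigma>m.
        is_lss \<Sigma> \<and> symbol_set \<tau> K \<Sigma> \<noteq> {} \<and>
        is_lss \<Sigma>m \<and> lss_minimal \<tau> \<Sigma>m \<and> lss_equivalent \<tau> \<Sigma>m \<Sigma> \<longrightarrow>
        symbol_set \<tau> K \<Sigma>m \<noteq> {}) \<and>
     (\<forall>\<Sigma> \<Sigma>m P R.
        is_lss \<Sigma> \<and> P \<in> ctrl_grammians \<tau> \<Sigma> \<and> R \<in> obs_grammians \<tau> \<Sigma> \<and>
        is_lss \<Sigma>m \<and> lss_minimal \<tau> \<Sigma>m \<and> lss_equivalent \<tau> \<Sigma>m \<Sigma> \<longrightarrow>
        (\<exists>Pm\<in>ctrl_grammians \<tau> \<Sigma>m. \<exists>Rm\<in>obs_grammians \<tau> \<Sigma>m.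
           let n = state_dim \<Sigma>; k = state_dim \<Sigma>m in
             \<forall>i\<in>{1..k}.
               singular_value P R (n - k + i) \<le> singular_value Pm Rm i \<and>
               singular_value Pm Rm i \<le> singular_value P R i)) \<and>
     (\<forall>\<Sigma>1 \<Sigma>2 S.
        is_lss \<Sigma>1 \<and> is_lss \<Sigma>2 \<and> lss_isomorphism S \<Sigma>1 \<Sigma>2 \<longrightarrow>
        (let M = congruence_factor K S in
           M \<in> carrier_mat (state_dim \<Sigma>1) (state_dim \<Sigma>1) \<and>
           (\<forall>P. pos_def (state_dim \<Sigma>1) P \<longrightarrow>
              (P \<in> symbol_set \<tau> K \<Sigma>1 \<longleftrightarrow> M\<^sup>T * P * M \<in> symbol_set \<tau> K \<Sigma>2)))) \<and>
     (\<forall>\<Sigma>1 \<Sigma>2.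
        is_lss \<Sigma>1 \<and> is_lss \<Sigma>2 \<and> lss_minimal \<tau> \<Sigma>1 \<and> lss_minimal \<tau> \<Sigma>2 \<and>
        lss_equivalent \<tau> \<Sigma>1 \<Sigma>2 \<longrightarrow>
        (\<exists>M\<in>carrier_mat (state_dim \<Sigma>1) (state_dim \<Sigma>1).
           invertible_mat M \<and>
           (\<forall>P. pos_def (state_dim \<Sigma>1) P \<longrightarrow>
              (P \<in> symbol_set \<tau> K \<Sigma>1 \<longleftrightarrow> M\<^sup>T * P * M \<in> symbol_set \<tau> K \<Sigma>2))))"
proof (intro conjI allI impI)
  fix \<Sigma> \<Sigma>m
  assume H: "is_lss \<Sigma> \<and> symbol_set \<tau> K \<Sigma> \<noteq> {} \<and> is_lss \<Sigma>m \<and> lss_minimal \<tau> \<Sigma>m \<and> lss_equivalent \<tau> \<Sigma>m \<Sigma>"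
  then have h: "is_lss \<Sigma>" "is_lss \<Sigma>m" "lss_minimal \<tau> \<Sigma>m" "lss_equivalent \<tau> \<Sigma>m \<Sigma>"
    and ne: "symbol_set \<tau> K \<Sigma> \<noteq> {}" by auto
  obtain r V L T U where red: "reduction \<Sigma> \<Sigma>m r V L T U" by (rule reduction_exists[OF h]) (rule that)
  show "symbol_set \<tau> K \<Sigma>m \<noteq> {}" by (rule reduction.symbol_set_reduction[OF red ne])
next
  fix \<Sigma> \<Sigma>m P R
  assume H: "is_lss \<Sigma> \<and> P \<in> ctrl_grammians \<tau> \<Sigma> \<and> R \<in> obs_grammians \<tau> \<Sigma> \<and>
        is_lss \<Sigma>m \<and> lss_minimal \<tau> \<Sigma>m \<and> lss_equivalent \<tau> \<Sigma>m \<Sigma>"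
  then have h: "is_lss \<Sigma>" "is_lss \<Sigma>m" "lss_minimal \<tau> \<Sigma>m" "lss_equivalent \<tau> \<Sigma>m \<Sigma>"
    and PR: "P \<in> ctrl_grammians \<tau> \<Sigma>" "R \<in> obs_grammians \<tau> \<Sigma>" by auto
  obtain r V L T U where red: "reduction \<Sigma> \<Sigma>m r V L T U" by (rule reduction_exists[OF h]) (rule that)
  obtain Pm Rm where PRm: "Pm \<in> ctrl_grammians \<tau> \<Sigma>m" "Rm \<in> obs_grammians \<tau> \<Sigma>m"
    and le: "\<And>j. j < state_dim \<Sigma>m \<Longrightarrow>
      singular_value P R (Suc (state_dim \<Sigma> - state_dim \<Sigma>m + j)) \<le> singular_value Pm Rm (Suc j) \<and>
      singular_value Pm Rm (Suc j) \<le> singular_value P R (Suc j)"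
    using reduction.grammian_reduction[OF red PR] by blast
  \<comment> \<open>The reduction indexes by \<open>j = i - 1\<close>, so
    \<open>Suc (n - k + j)\<close> is \<open>n - k + i\<close>.\<close>
  have "singular_value P R (state_dim \<Sigma> - state_dim \<Sigma>m + i) \<le> singular_value Pm Rm i \<and>
      singular_value Pm Rm i \<le> singular_value P R i" if "i \<in> {1..state_dim \<Sigma>m}" for i
    using le[of "i - 1"] that by (cases i) auto
  then show "\<exists>Pm\<in>ctrl_grammians \<tau> \<Sigma>m. \<exists>Rm\<in>obs_grammians \<tau> \<Sigma>m.
           let n = state_dim \<Sigma>; k = state_dim \<Sigma>m in
             \<forall>i\<in>{1..k}.
               singular_value P R (n - k + i) \<le> singular_value Pm Rm i \<and>
               singular_value Pm Rm i \<le> singular_value P R i"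
    unfolding Let_def using PRm by blast
next
  fix \<Sigma>1 \<Sigma>2 S
  assume "is_lss \<Sigma>1 \<and> is_lss \<Sigma>2 \<and> lss_isomorphism S \<Sigma>1 \<Sigma>2"
  then have H: "is_lss \<Sigma>1" "is_lss \<Sigma>2" "lss_isomorphism S \<Sigma>1 \<Sigma>2" by auto
  show "let M = congruence_factor K S in
           M \<in> carrier_mat (state_dim \<Sigma>1) (state_dim \<Sigma>1) \<and>
           (\<forall>P. pos_def (state_dim \<Sigma>1) P \<longrightarrow>
              (P \<in> symbol_set \<tau> K \<Sigma>1 \<longleftrightarrow> M\<^sup>T * P * M \<in> symbol_set \<tau> K \<Sigma>2))"
    unfolding Let_def using isomorphism_congruence(1,3)[OF H] by blast
next
  fix \<Sigma>1 \<Sigma>2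
  assume "is_lss \<Sigma>1 \<and> is_lss \<Sigma>2 \<and> lss_minimal \<tau> \<Sigma>1 \<and> lss_minimal \<tau> \<Sigma>2 \<and> lss_equivalent \<tau> \<Sigma>1 \<Sigma>2"
  then have S: "is_lss \<Sigma>1" "is_lss \<Sigma>2" and mn: "lss_minimal \<tau> \<Sigma>1" "lss_minimal \<tau> \<Sigma>2" "lss_equivalent \<tau> \<Sigma>1 \<Sigma>2" by auto
  obtain X where X: "lss_isomorphism X \<Sigma>1 \<Sigma>2" by (rule minimal_equivalent_isomorphic[OF S mn]) (rule that)
  show "\<exists>M\<in>carrier_mat (state_dim \<Sigma>1) (state_dim \<Sigma>1).
           invertible_mat M \<and>
           (\<forall>P. pos_def (state_dim \<Sigma>1) P \<longrightarrow>
              (P \<in> symbol_set \<tau> K \<Sigma>1 \<longleftrightarrow> M\<^sup>T * P * M \<in> symbol_set \<tau> K \<Sigma>2))"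
    using isomorphism_congruence[OF S X] by blast
qed

end
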